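(* Let $X$ be an $S$-scheme. For $n\ge 1$, the isomorphism $\nu_n:\Omega^{(n)}_{X/S}\to\underline{\Psi}^{(n)}_{X/S}$, $db_1\tilde\wedge\cdots\tilde\wedge db_n\mapsto\prod_{i=1}^n d^{0,i}b_i$, induces an isomorphism $$\Omega^n_{X/S}\ \xrightarrow{\ \sim\ }\ \underline{\Psi}^n_{X/S},\qquad db_1\wedge\cdots\wedge db_n\mapsto\prod_{i=1}^n d^{0,i}b_i,$$ between $n$-forms and strong combinatorial $n$-forms on $X/S$, and this isomorphism is compatible with the multiplicative structure (the exterior product of forms corresponding to the product $*$ of combinatorial forms).
   Context: All constructions are Zariski local on $X$ and $S$, and $X/S$ is taken to be separated; $\mathcal{O}_X^{\otimes n+1}$ is the tensor power over $\mathcal{O}_S$ (i.e. $\mathcal{O}_{X^{n+1}}$). For $0\le r,s\le n$, $J_{rs}\subset\mathcal{O}_X^{\otimes n+1}$ is the ideal generated by the elements $d^{r,s}b:=$ (tensor with $b$ in position $s+1$, $1$ elsewhere) $-$ (tensor with $b$ in position $r+1$, $1$ elsewhere), $b\in\mathcal{O}_X$. Put $J^{(2)}_{0n}:=\sum_{r<s}J_{rs}^2$ and $J^{<2>}_{0n}:=J^{(2)}_{0n}+J_n$, where $J_n$ is the ideal generated by all products $d^{0,r}b\,d^{0,s}b$ for all pairs $r,s$ and all $b\in\mathcal{O}_X$. Weak side: $\Psi^{(n)}_{X/S}$ is the ideal $\bigcap_{r<s}\tilde J_{rs}$ of $\mathcal{O}_X^{\otimes n+1}/J^{(2)}_{0n}$,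 with $\tilde J_{rs}$ the image of $J_{rs}$; $\Omega^{(n)}_{X/S}$ is the quotient of $(\Omega^1_{X/S})^{\otimes n}$ by the sums of a pure tensor and the tensor obtained from it by exchanging two of its factors, the class of $\omega_1\otimes\cdots\otimes\omega_n$ being denoted $\omega_1\tilde\wedge\cdots\tilde\wedge\omega_n$. Strong side: $\Psi^n_{X/S}$, the module of strong combinatorial $n$-forms, is the ideal $\prod_{i=1}^n\tilde J_{0i}$ of $\mathcal{O}_X^{\otimes n+1}/J^{<2>}_{0n}$, where now $\tilde J_{rs}$ is the image of $J_{rs}$ in $\mathcal{O}_X^{\otimes n+1}/J^{<2>}_{0n}$; $\Omega^n_{X/S}=\wedge^n\Omega^1_{X/S}$. The sheaves $\underline\Psi$ on the small étale site of $X$ are $\underline{\Psi}^{(n)}_{X/S}(U)=\Psi^{(n)}_{U/S}$ and $\underline{\Psi}^{n}_{X/S}(U)=\Psi^{n}_{U/S}$. Multiplicative structure: viewing combinatorial forms as functions $f(x_0,\dots,x_m)$, $g(x_0,\dots,x_n)$ on the closed subschemes $\Delta^m_{X/S}=\mathrm{Spec}(\mathcal{O}_X^{\otimes m+1}/J^{<2>}_{0m})$, $\Delta^n_{X/S}$ of $X^{m+1}$, $X^{n+1}$, their product is $(f*g)(x_0,\dots,x_{m+n}):=f(x_0,\dots,x_m)\,g(x_m,\dots,x_{m+n})$. *)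

theory Defs
  imports "HOL-Algebra.Ideal_Product" "HOL-Algebra.QuotRing" "HOL-Algebra.Module" "HOL-Analysis.Abstract_Topology" "HOL-Analysis.Function_Topology"
begin

section \<open>Modules, algebras, tensor powers\<close>

text \<open>An algebra over a ring \<open>R\<close> is a record of type \<open>module\<close> (compare the locale \<open>algebra\<close> of the
  library). For records that are only used as modules the fields \<open>mult\<close> and \<open>one\<close> are irrelevant.\<close>

definition free_module :: "('a, 'm) ring_scheme \<Rightarrow> 's set \<Rightarrow> ('a, 's \<Rightarrow> 'a) module" where
  "free_module R S =
     \<lparr>carrier = {f. (\<forall>s\<in>S. f s \<in> carrier R) \<and> (\<forall>s. s \<notin> S \<longrightarrow> f s = \<zero>\<^bsub>R\<^esub>) \<and> finite {s. f s \<noteq> \<zero>\<^bsub>R\<^esub>}},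
      monoid.mult = undefined, one = undefined,
      ring.zero = (\<lambda>s. \<zero>\<^bsub>R\<^esub>), add = (\<lambda>f g s. f s \<oplus>\<^bsub>R\<^esub> g s),
      smult = (\<lambda>a f s. a \<otimes>\<^bsub>R\<^esub> f s)\<rparr>"

definition delta :: "('a, 'm) ring_scheme \<Rightarrow> 's \<Rightarrow> 's \<Rightarrow> 'a" where
  "delta R s = (\<lambda>t. if t = s then \<one>\<^bsub>R\<^esub> else \<zero>\<^bsub>R\<^esub>)"

definition monoid_algebra ::
  "('a, 'm) ring_scheme \<Rightarrow> ('s, 'k) monoid_scheme \<Rightarrow> ('a, 's \<Rightarrow> 'a) module" where
  "monoid_algebra R G = (free_module R (carrier G))
     \<lparr>monoid.mult := (\<lambda>f g z. \<Oplus>\<^bsub>R\<^esub>p \<in> {(x, y). f x \<noteq> \<zero>\<^bsub>R\<^esub> \<and> g y \<noteq> \<zero>\<^bsub>R\<^esub> \<and> x \<otimes>\<^bsub>G\<^esub> y = z}.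
                          f (fst p) \<otimes>\<^bsub>R\<^esub> g (snd p)),
      one := delta R \<one>\<^bsub>G\<^esub>\<rparr>"

text \<open>Semilinear extension to a free module over \<open>R\<close> of a map \<open>v\<close> defined on the basis,
  along a map \<open>a\<close> of coefficient rings.\<close>

definition lin_ext :: "('a, 'm) ring_scheme \<Rightarrow> ('c, 'd, 'k) module_scheme \<Rightarrow> ('a \<Rightarrow> 'c) \<Rightarrow> ('s \<Rightarrow> 'd) \<Rightarrow>
    ('s \<Rightarrow> 'a) \<Rightarrow> 'd" where
  "lin_ext R P a v f = (\<Oplus>\<^bsub>P\<^esub>s \<in> {s. f s \<noteq> \<zero>\<^bsub>R\<^esub>}. a (f s) \<odot>\<^bsub>P\<^esub> v s)"

definition submodule_gen ::
  "('a, 'm) ring_scheme \<Rightarrow> ('a, 'b, 'k) module_scheme \<Rightarrow> 'b set \<Rightarrow> 'b set" where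
  "submodule_gen R M S = \<Inter>{N. submodule N R M \<and> S \<subseteq> N}"

text \<open>Quotient by a submodule \<open>N\<close>; if \<open>M\<close> is an algebra and \<open>N\<close> an ideal this is the quotient algebra.\<close>

definition quot_module :: "('a, 'b, 'k) module_scheme \<Rightarrow> 'b set \<Rightarrow> ('a, 'b set) module" where
  "quot_module M N = ring.extend (M Quot N) (module.fields (\<lambda>a X. \<Union>x\<in>X. N +>\<^bsub>M\<^esub> (a \<odot>\<^bsub>M\<^esub> x)))"

text \<open>The map out of a quotient that is induced by a map \<open>h\<close> into \<open>P\<close>, respectively into the quotient
  of \<open>P\<close> by \<open>N\<close>. As in the library, it is given by its common value on a coset.\<close>

definition coset_lift :: "('b \<Rightarrow> 'c) \<Rightarrow> 'b set \<Rightarrow> 'c" where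
  "coset_lift h X = the_elem (h ` X)"

definition coset_map :: "('c, 'k) ring_scheme \<Rightarrow> 'c set \<Rightarrow> ('b \<Rightarrow> 'c) \<Rightarrow> 'b set \<Rightarrow> 'c set" where
  "coset_map P N h = coset_lift (\<lambda>x. N +>\<^bsub>P\<^esub> h x)"

definition tuple_monoid :: "('b, 'k) monoid_scheme \<Rightarrow> nat \<Rightarrow> (nat \<Rightarrow> 'b) monoid" where
  "tuple_monoid M n =
     \<lparr>carrier = {..<n} \<rightarrow>\<^sub>E carrier M, monoid.mult = (\<lambda>x y. \<lambda>i\<in>{..<n}. x i \<otimes>\<^bsub>M\<^esub> y i),
      one = (\<lambda>i\<in>{..<n}. \<one>\<^bsub>M\<^esub>)\<rparr>"

text \<open>The tensor power of \<open>n\<close> factors of \<open>M\<close> over \<open>R\<close>: the free module on \<open>n\<close>-tuples modulo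
  multilinearity. The free module carries the product of the monoid algebra (componentwise product of
  tuples); if \<open>M\<close> is a commutative algebra, the relations span an ideal for it, and the tensor power is
  obtained with its algebra structure. If \<open>M\<close> is only a module, that product is to be ignored.\<close>

definition tensor_free :: "('a, 'm) ring_scheme \<Rightarrow> ('a, 'b, 'k) module_scheme \<Rightarrow> nat \<Rightarrow>
    ('a, (nat \<Rightarrow> 'b) \<Rightarrow> 'a) module" where
  "tensor_free R M n = monoid_algebra R (tuple_monoid M n)"

definition tensor_rel :: "('a, 'm) ring_scheme \<Rightarrow> ('a, 'b, 'k) module_scheme \<Rightarrow> nat \<Rightarrow>
    ((nat \<Rightarrow> 'b) \<Rightarrow> 'a) set" where
  "tensor_rel R M n = submodule_gen R (tensor_free R M n)
     ({delta R (x(i := y \<oplus>\<^bsub>M\<^esub> z)) \<ominus>\<^bsub>tensor_free R M n\<^esub>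
         (delta R (x(i := y)) \<oplus>\<^bsub>tensor_free R M n\<^esub> delta R (x(i := z))) | x i y z.
         x \<in> {..<n} \<rightarrow>\<^sub>E carrier M \<and> i < n \<and> y \<in> carrier M \<and> z \<in> carrier M} \<union>
      {delta R (x(i := a \<odot>\<^bsub>M\<^esub> y)) \<ominus>\<^bsub>tensor_free R M n\<^esub>
         (a \<odot>\<^bsub>tensor_free R M n\<^esub> delta R (x(i := y))) | x i a y.
         x \<in> {..<n} \<rightarrow>\<^sub>E carrier M \<and> i < n \<and> a \<in> carrier R \<and> y \<in> carrier M})"

definition tensor_power :: "('a, 'm) ring_scheme \<Rightarrow> ('a, 'b, 'k) module_scheme \<Rightarrow> nat \<Rightarrow>
    ('a, ((nat \<Rightarrow> 'b) \<Rightarrow> 'a) set) module" where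
  "tensor_power R M n = quot_module (tensor_free R M n) (tensor_rel R M n)"

definition pure_tensor :: "('a, 'm) ring_scheme \<Rightarrow> ('a, 'b, 'k) module_scheme \<Rightarrow> nat \<Rightarrow>
    (nat \<Rightarrow> 'b) \<Rightarrow> ((nat \<Rightarrow> 'b) \<Rightarrow> 'a) set" where
  "pure_tensor R M n x = tensor_rel R M n +>\<^bsub>tensor_free R M n\<^esub> delta R x"

text \<open>The map from the \<open>n\<close>-th tensor power over \<open>R\<close> to that of \<open>M'\<close> over \<open>R'\<close> given by a ring homomorphism
  \<open>a\<close> from \<open>R\<close> to \<open>R'\<close> and an \<open>a\<close>-semilinear map \<open>u\<close> into \<open>M'\<close>.\<close>

definition tensor_map :: "('a, 'm) ring_scheme \<Rightarrow> ('c, 'm') ring_scheme \<Rightarrow> ('c, 'd, 'k) module_scheme \<Rightarrow>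
    nat \<Rightarrow> ('a \<Rightarrow> 'c) \<Rightarrow> ('b \<Rightarrow> 'd) \<Rightarrow> ((nat \<Rightarrow> 'b) \<Rightarrow> 'a) set \<Rightarrow> ((nat \<Rightarrow> 'd) \<Rightarrow> 'c) set" where
  "tensor_map R R' M' n a u =
     coset_lift (lin_ext R (tensor_power R' M' n) a (\<lambda>x. pure_tensor R' M' n (\<lambda>i\<in>{..<n}. u (x i))))"

text \<open>A ring homomorphism \<open>\<phi>\<close> into \<open>B\<close>, viewed as an algebra.\<close>

definition hom_algebra :: "('a \<Rightarrow> 'b) \<Rightarrow> 'b ring \<Rightarrow> ('a, 'b) module" where
  "hom_algebra \<phi> B = ring.extend B (module.fields (\<lambda>a b. \<phi> a \<otimes>\<^bsub>B\<^esub> b))"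

definition module_iso :: "('a, 'm) ring_scheme \<Rightarrow> ('a, 'b, 'k) module_scheme \<Rightarrow>
    ('a, 'c, 'l) module_scheme \<Rightarrow> ('b \<Rightarrow> 'c) set" where
  "module_iso R M N = {h. bij_betw h (carrier M) (carrier N) \<and>
     (\<forall>x\<in>carrier M. \<forall>y\<in>carrier M. h (x \<oplus>\<^bsub>M\<^esub> y) = h x \<oplus>\<^bsub>N\<^esub> h y) \<and>
     (\<forall>a\<in>carrier R. \<forall>x\<in>carrier M. h (a \<odot>\<^bsub>M\<^esub> x) = a \<odot>\<^bsub>N\<^esub> h x)}"


section \<open>Differential forms of an algebra\<close>

type_synonym 'b kaehler_elt = "('b \<Rightarrow> 'b) set"
type_synonym 'b form_elt = "((nat \<Rightarrow> 'b kaehler_elt) \<Rightarrow> 'b) set set"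

text \<open>Throughout, \<open>B\<close> is an algebra over \<open>R\<close>.\<close>

definition kaehler_rel :: "('a, 'm) ring_scheme \<Rightarrow> ('a, 'b) module \<Rightarrow> ('b \<Rightarrow> 'b) set" where
  "kaehler_rel R B = (let F = free_module B (carrier B) in submodule_gen B F
     ({delta B (b \<oplus>\<^bsub>B\<^esub> c) \<ominus>\<^bsub>F\<^esub> (delta B b \<oplus>\<^bsub>F\<^esub> delta B c) | b c. b \<in> carrier B \<and> c \<in> carrier B} \<union>
      {delta B (b \<otimes>\<^bsub>B\<^esub> c) \<ominus>\<^bsub>F\<^esub> (b \<odot>\<^bsub>F\<^esub> delta B c \<oplus>\<^bsub>F\<^esub> c \<odot>\<^bsub>F\<^esub> delta B b) | b c.
         b \<in> carrier B \<and> c \<in> carrier B} \<union>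
      {delta B (r \<odot>\<^bsub>B\<^esub> \<one>\<^bsub>B\<^esub>) | r. r \<in> carrier R}))"

definition kaehler :: "('a, 'm) ring_scheme \<Rightarrow> ('a, 'b) module \<Rightarrow> ('b, 'b kaehler_elt) module" where
  "kaehler R B = quot_module (free_module B (carrier B)) (kaehler_rel R B)"

definition kaehler_d :: "('a, 'm) ring_scheme \<Rightarrow> ('a, 'b) module \<Rightarrow> 'b \<Rightarrow> 'b kaehler_elt" where
  "kaehler_d R B b = kaehler_rel R B +>\<^bsub>free_module B (carrier B)\<^esub> delta B b"

definition kaehler_map :: "('a, 'b) module \<Rightarrow> ('c, 'm) ring_scheme \<Rightarrow> ('c, 'd) module \<Rightarrow>
    ('b \<Rightarrow> 'd) \<Rightarrow> 'b kaehler_elt \<Rightarrow> 'd kaehler_elt" where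
  "kaehler_map B R' B' \<beta> =
     coset_lift (lin_ext B (kaehler R' B') \<beta> (\<lambda>b. kaehler_d R' B' (\<beta> b)))"

text \<open>The quotient of the \<open>n\<close>-th tensor power of the differentials by the sums of a pure tensor and the one
  obtained by exchanging two factors (weak forms), respectively the exterior power (strong forms).
  The factors of a tensor are numbered from \<open>0\<close>.\<close>

definition omega_weak_rel :: "('a, 'm) ring_scheme \<Rightarrow> ('a, 'b) module \<Rightarrow> nat \<Rightarrow>
    ((nat \<Rightarrow> 'b kaehler_elt) \<Rightarrow> 'b) set set" where
  "omega_weak_rel R B n = submodule_gen B (tensor_power B (kaehler R B) n)
     {pure_tensor B (kaehler R B) n x \<oplus>\<^bsub>tensor_power B (kaehler R B) n\<^esub>
        pure_tensor B (kaehler R B) n (x(i := x j, j := x i)) | x i j.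
        x \<in> {..<n} \<rightarrow>\<^sub>E carrier (kaehler R B) \<and> i < n \<and> j < n \<and> i \<noteq> j}"

definition omega_strong_rel :: "('a, 'm) ring_scheme \<Rightarrow> ('a, 'b) module \<Rightarrow> nat \<Rightarrow>
    ((nat \<Rightarrow> 'b kaehler_elt) \<Rightarrow> 'b) set set" where
  "omega_strong_rel R B n = submodule_gen B (tensor_power B (kaehler R B) n)
     {pure_tensor B (kaehler R B) n x | x.
        x \<in> {..<n} \<rightarrow>\<^sub>E carrier (kaehler R B) \<and> (\<exists>i<n. \<exists>j<n. i \<noteq> j \<and> x i = x j)}"

definition omega_weak :: "nat \<Rightarrow> 'a ring \<Rightarrow> ('a, 'b) module \<Rightarrow> ('b, 'b form_elt) module" where
  "omega_weak n R B = quot_module (tensor_power B (kaehler R B) n) (omega_weak_rel R B n)"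

definition omega_strong :: "nat \<Rightarrow> 'a ring \<Rightarrow> ('a, 'b) module \<Rightarrow> ('b, 'b form_elt) module" where
  "omega_strong n R B = quot_module (tensor_power B (kaehler R B) n) (omega_strong_rel R B n)"

text \<open>The class of the tensor of a family of differentials: a weak, respectively the usual, wedge product.\<close>

definition wedge_weak :: "nat \<Rightarrow> 'a ring \<Rightarrow> ('a, 'b) module \<Rightarrow> (nat \<Rightarrow> 'b kaehler_elt) \<Rightarrow> 'b form_elt" where
  "wedge_weak n R B x = omega_weak_rel R B n +>\<^bsub>tensor_power B (kaehler R B) n\<^esub>
     pure_tensor B (kaehler R B) n x"

definition wedge_strong :: "nat \<Rightarrow> 'a ring \<Rightarrow> ('a, 'b) module \<Rightarrow> (nat \<Rightarrow> 'b kaehler_elt) \<Rightarrow> 'b form_elt" where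
  "wedge_strong n R B x = omega_strong_rel R B n +>\<^bsub>tensor_power B (kaehler R B) n\<^esub>
     pure_tensor B (kaehler R B) n x"

text \<open>The maps on forms given by a commutative square of rings, with \<open>\<alpha>\<close> from \<open>R\<close> to \<open>R'\<close> and \<open>\<beta>\<close> from \<open>B\<close>
  to \<open>B'\<close>. (The argument \<open>\<alpha>\<close> is not needed here, but it is for combinatorial forms.)\<close>

definition omega_weak_map :: "nat \<Rightarrow> 'a ring \<Rightarrow> ('a, 'b) module \<Rightarrow> 'a ring \<Rightarrow> ('a, 'c) module \<Rightarrow>
    ('a \<Rightarrow> 'a) \<Rightarrow> ('b \<Rightarrow> 'c) \<Rightarrow> 'b form_elt \<Rightarrow> 'c form_elt" where
  "omega_weak_map n R B R' B' \<alpha> \<beta> =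
     coset_map (tensor_power B' (kaehler R' B') n) (omega_weak_rel R' B' n)
       (tensor_map B B' (kaehler R' B') n \<beta> (kaehler_map B R' B' \<beta>))"

definition omega_strong_map :: "nat \<Rightarrow> 'a ring \<Rightarrow> ('a, 'b) module \<Rightarrow> 'a ring \<Rightarrow> ('a, 'c) module \<Rightarrow>
    ('a \<Rightarrow> 'a) \<Rightarrow> ('b \<Rightarrow> 'c) \<Rightarrow> 'b form_elt \<Rightarrow> 'c form_elt" where
  "omega_strong_map n R B R' B' \<alpha> \<beta> =
     coset_map (tensor_power B' (kaehler R' B') n) (omega_strong_rel R' B' n)
       (tensor_map B B' (kaehler R' B') n \<beta> (kaehler_map B R' B' \<beta>))"

definition omega_proj :: "nat \<Rightarrow> 'a ring \<Rightarrow> ('a, 'b) module \<Rightarrow> 'b form_elt \<Rightarrow> 'b form_elt" where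
  "omega_proj n R B =
     coset_map (tensor_power B (kaehler R B) n) (omega_strong_rel R B n) (\<lambda>t. t)"

text \<open>The exterior product of an \<open>m\<close>-form and an \<open>n\<close>-form: juxtaposition of tuples, extended bilinearly.
  The union of a form, as a set of sets, is the set of its representatives in the free module on tuples.\<close>

definition ext_prod :: "'a ring \<Rightarrow> ('a, 'b) module \<Rightarrow> nat \<Rightarrow> nat \<Rightarrow>
    'b form_elt \<Rightarrow> 'b form_elt \<Rightarrow> 'b form_elt" where
  "ext_prod R B m n \<omega> \<eta> = the_elem
     ((\<lambda>(u, v). lin_ext B (omega_strong (m + n) R B) (\<lambda>b. b)
        (\<lambda>x. lin_ext B (omega_strong (m + n) R B) (\<lambda>b. b)
          (\<lambda>y. wedge_strong (m + n) R B (\<lambda>i\<in>{..<m + n}. if i < m then x i else y (i - m))) v) u)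
      ` (\<Union>\<omega> \<times> \<Union>\<eta>))"


section \<open>Combinatorial differential forms of an algebra\<close>

type_synonym ('a, 'b) comb_elt = "((nat \<Rightarrow> 'b) \<Rightarrow> 'a) set set"

text \<open>The functions on \<open>X\<^sup>n\<^sup>+\<^sup>1\<close>, the coordinates being numbered from \<open>0\<close> to \<open>n\<close>.\<close>

definition fun_ring :: "nat \<Rightarrow> 'a ring \<Rightarrow> ('a, 'b) module \<Rightarrow> ('a, ((nat \<Rightarrow> 'b) \<Rightarrow> 'a) set) module" where
  "fun_ring n R B = tensor_power R B (Suc n)"

definition coord :: "nat \<Rightarrow> 'a ring \<Rightarrow> ('a, 'b) module \<Rightarrow> nat \<Rightarrow> 'b \<Rightarrow> ((nat \<Rightarrow> 'b) \<Rightarrow> 'a) set" where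
  "coord n R B r b = pure_tensor R B (Suc n) (\<lambda>i\<in>{..<Suc n}. if i = r then b else \<one>\<^bsub>B\<^esub>)"

definition diff :: "nat \<Rightarrow> 'a ring \<Rightarrow> ('a, 'b) module \<Rightarrow> nat \<Rightarrow> nat \<Rightarrow> 'b \<Rightarrow> ((nat \<Rightarrow> 'b) \<Rightarrow> 'a) set" where
  "diff n R B r s b = coord n R B s b \<ominus>\<^bsub>fun_ring n R B\<^esub> coord n R B r b"

definition J_ideal :: "nat \<Rightarrow> 'a ring \<Rightarrow> ('a, 'b) module \<Rightarrow> nat \<Rightarrow> nat \<Rightarrow> ((nat \<Rightarrow> 'b) \<Rightarrow> 'a) set set" where
  "J_ideal n R B r s = Idl\<^bsub>fun_ring n R B\<^esub> {diff n R B r s b | b. b \<in> carrier B}"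

definition J_weak :: "nat \<Rightarrow> 'a ring \<Rightarrow> ('a, 'b) module \<Rightarrow> ((nat \<Rightarrow> 'b) \<Rightarrow> 'a) set set" where
  "J_weak n R B = Idl\<^bsub>fun_ring n R B\<^esub>
     (\<Union>{J_ideal n R B r s \<cdot>\<^bsub>fun_ring n R B\<^esub> J_ideal n R B r s | r s. r < s \<and> s \<le> n})"

definition J_alt :: "nat \<Rightarrow> 'a ring \<Rightarrow> ('a, 'b) module \<Rightarrow> ((nat \<Rightarrow> 'b) \<Rightarrow> 'a) set set" where
  "J_alt n R B = Idl\<^bsub>fun_ring n R B\<^esub>
     {diff n R B 0 r b \<otimes>\<^bsub>fun_ring n R B\<^esub> diff n R B 0 s b | r s b. r \<le> n \<and> s \<le> n \<and> b \<in> carrier B}"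

definition J_strong :: "nat \<Rightarrow> 'a ring \<Rightarrow> ('a, 'b) module \<Rightarrow> ((nat \<Rightarrow> 'b) \<Rightarrow> 'a) set set" where
  "J_strong n R B = J_weak n R B <+>\<^bsub>fun_ring n R B\<^esub> J_alt n R B"

definition image_ideal :: "('b, 'm) ring_scheme \<Rightarrow> 'b set \<Rightarrow> 'b set \<Rightarrow> 'b set set" where
  "image_ideal T J I = (\<lambda>t. J +>\<^bsub>T\<^esub> t) ` I"

text \<open>Combinatorial forms are modules over \<open>B\<close> through the coordinate \<open>0\<close> (on them, all coordinates give
  the same action).\<close>

definition comb_module :: "nat \<Rightarrow> 'a ring \<Rightarrow> ('a, 'b) module \<Rightarrow> ((nat \<Rightarrow> 'b) \<Rightarrow> 'a) set set \<Rightarrow>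
    ('a, 'b) comb_elt set \<Rightarrow> ('b, ('a, 'b) comb_elt) module" where
  "comb_module n R B J \<Psi> = ring.extend ((fun_ring n R B Quot J)\<lparr>carrier := \<Psi>\<rparr>)
     (module.fields (\<lambda>b X. (J +>\<^bsub>fun_ring n R B\<^esub> coord n R B 0 b) \<otimes>\<^bsub>fun_ring n R B Quot J\<^esub> X))"

definition psi_weak :: "nat \<Rightarrow> 'a ring \<Rightarrow> ('a, 'b) module \<Rightarrow> ('b, ('a, 'b) comb_elt) module" where
  "psi_weak n R B = comb_module n R B (J_weak n R B)
     (\<Inter>{image_ideal (fun_ring n R B) (J_weak n R B) (J_ideal n R B r s) | r s. r < s \<and> s \<le> n})"

definition psi_strong :: "nat \<Rightarrow> 'a ring \<Rightarrow> ('a, 'b) module \<Rightarrow> ('b, ('a, 'b) comb_elt) module" where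
  "psi_strong n R B = comb_module n R B (J_strong n R B)
     (finprod (ideals_set (fun_ring n R B Quot J_strong n R B))
        (\<lambda>i. image_ideal (fun_ring n R B) (J_strong n R B) (J_ideal n R B 0 i)) {1..n})"

definition diff_prod_weak :: "nat \<Rightarrow> 'a ring \<Rightarrow> ('a, 'b) module \<Rightarrow> (nat \<Rightarrow> 'b) \<Rightarrow> ('a, 'b) comb_elt" where
  "diff_prod_weak n R B b =
     J_weak n R B +>\<^bsub>fun_ring n R B\<^esub> (\<Otimes>\<^bsub>fun_ring n R B\<^esub>i\<in>{1..n}. diff n R B 0 i (b i))"

definition diff_prod_strong :: "nat \<Rightarrow> 'a ring \<Rightarrow> ('a, 'b) module \<Rightarrow> (nat \<Rightarrow> 'b) \<Rightarrow> ('a, 'b) comb_elt" where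
  "diff_prod_strong n R B b =
     J_strong n R B +>\<^bsub>fun_ring n R B\<^esub> (\<Otimes>\<^bsub>fun_ring n R B\<^esub>i\<in>{1..n}. diff n R B 0 i (b i))"

definition psi_weak_map :: "nat \<Rightarrow> 'a ring \<Rightarrow> ('a, 'b) module \<Rightarrow> 'a ring \<Rightarrow> ('a, 'c) module \<Rightarrow>
    ('a \<Rightarrow> 'a) \<Rightarrow> ('b \<Rightarrow> 'c) \<Rightarrow> ('a, 'b) comb_elt \<Rightarrow> ('a, 'c) comb_elt" where
  "psi_weak_map n R B R' B' \<alpha> \<beta> =
     coset_map (fun_ring n R' B') (J_weak n R' B') (tensor_map R R' B' (Suc n) \<alpha> \<beta>)"

definition psi_strong_map :: "nat \<Rightarrow> 'a ring \<Rightarrow> ('a, 'b) module \<Rightarrow> 'a ring \<Rightarrow> ('a, 'c) module \<Rightarrow>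
    ('a \<Rightarrow> 'a) \<Rightarrow> ('b \<Rightarrow> 'c) \<Rightarrow> ('a, 'b) comb_elt \<Rightarrow> ('a, 'c) comb_elt" where
  "psi_strong_map n R B R' B' \<alpha> \<beta> =
     coset_map (fun_ring n R' B') (J_strong n R' B') (tensor_map R R' B' (Suc n) \<alpha> \<beta>)"

definition psi_proj :: "nat \<Rightarrow> 'a ring \<Rightarrow> ('a, 'b) module \<Rightarrow> ('a, 'b) comb_elt \<Rightarrow> ('a, 'b) comb_elt" where
  "psi_proj n R B = coset_map (fun_ring n R B) (J_strong n R B) (\<lambda>t. t)"

text \<open>Pullback of functions along the map from \<open>X\<^sup>k\<^sup>+\<^sup>1\<close> to \<open>X\<^sup>m\<^sup>+\<^sup>1\<close> that sends \<open>(x\<^sub>0, \<dots>, x\<^sub>k)\<close> to the tuple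
  whose \<open>j\<close>-th entry is the \<open>\<sigma> j\<close>-th entry of the given one.\<close>

definition coord_pull :: "nat \<Rightarrow> nat \<Rightarrow> 'a ring \<Rightarrow> ('a, 'b) module \<Rightarrow> (nat \<Rightarrow> nat) \<Rightarrow>
    ((nat \<Rightarrow> 'b) \<Rightarrow> 'a) set \<Rightarrow> ((nat \<Rightarrow> 'b) \<Rightarrow> 'a) set" where
  "coord_pull m k R B \<sigma> = coset_lift (lin_ext R (fun_ring k R B) (\<lambda>a. a)
     (\<lambda>x. pure_tensor R B (Suc k) (\<lambda>i\<in>{..<Suc k}. \<Otimes>\<^bsub>B\<^esub>j\<in>{j. j \<le> m \<and> \<sigma> j = i}. x j)))"

text \<open>The product \<open>f (x\<^sub>0, \<dots>, x\<^sub>m) \<cdot> g (x\<^sub>m, \<dots>, x\<^sub>m\<^sub>+\<^sub>n)\<close>.\<close>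

definition star_prod :: "'a ring \<Rightarrow> ('a, 'b) module \<Rightarrow> nat \<Rightarrow> nat \<Rightarrow>
    ('a, 'b) comb_elt \<Rightarrow> ('a, 'b) comb_elt \<Rightarrow> ('a, 'b) comb_elt" where
  "star_prod R B m n f g =
     coset_map (fun_ring (m + n) R B) (J_strong (m + n) R B) (coord_pull m (m + n) R B (\<lambda>j. j)) f
     \<otimes>\<^bsub>fun_ring (m + n) R B Quot J_strong (m + n) R B\<^esub>
     coset_map (fun_ring (m + n) R B) (J_strong (m + n) R B) (coord_pull n (m + n) R B (\<lambda>j. m + j)) g"


section \<open>Schemes\<close>

record ('p, 'r) ringed_space =
  pts :: "'p topology"
  sec :: "'p set \<Rightarrow> 'r ring"
  res :: "'p set \<Rightarrow> 'p set \<Rightarrow> 'r \<Rightarrow> 'r"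

definition is_ringed_space :: "('p, 'r) ringed_space \<Rightarrow> bool" where
  "is_ringed_space X \<longleftrightarrow>
     (\<forall>U. openin (pts X) U \<longrightarrow> cring (sec X U)) \<and>
     (\<forall>U V. openin (pts X) U \<and> openin (pts X) V \<and> V \<subseteq> U \<longrightarrow>
        res X U V \<in> ring_hom (sec X U) (sec X V)) \<and>
     (\<forall>U. openin (pts X) U \<longrightarrow> (\<forall>s\<in>carrier (sec X U). res X U U s = s)) \<and>
     (\<forall>U V W. openin (pts X) U \<and> openin (pts X) V \<and> openin (pts X) W \<and> V \<subseteq> U \<and> W \<subseteq> V \<longrightarrow>
        (\<forall>s\<in>carrier (sec X U). res X V W (res X U V s) = res X U W s)) \<and>
     (\<forall>C t. (\<forall>V\<in>C. openin (pts X) V \<and> t V \<in> carrier (sec X V)) \<and>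
        (\<forall>V\<in>C. \<forall>V'\<in>C. res X V (V \<inter> V') (t V) = res X V' (V \<inter> V') (t V')) \<longrightarrow>
        (\<exists>!s. s \<in> carrier (sec X (\<Union>C)) \<and> (\<forall>V\<in>C. res X (\<Union>C) V s = t V)))"

record ('p, 'q, 'r, 's) space_map =
  base :: "'p \<Rightarrow> 'q"
  comor :: "'q set \<Rightarrow> 's \<Rightarrow> 'r"

definition preim :: "('p, 'r) ringed_space \<Rightarrow> ('p, 'q, 'r, 's) space_map \<Rightarrow> 'q set \<Rightarrow> 'p set" where
  "preim X f W = {x \<in> topspace (pts X). base f x \<in> W}"

definition ringed_map ::
  "('p, 'r) ringed_space \<Rightarrow> ('q, 's) ringed_space \<Rightarrow> ('p, 'q, 'r, 's) space_map \<Rightarrow> bool" where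
  "ringed_map X Y f \<longleftrightarrow> continuous_map (pts X) (pts Y) (base f) \<and>
     (\<forall>W. openin (pts Y) W \<longrightarrow> comor f W \<in> ring_hom (sec Y W) (sec X (preim X f W))) \<and>
     (\<forall>W W'. openin (pts Y) W \<and> openin (pts Y) W' \<and> W' \<subseteq> W \<longrightarrow>
        (\<forall>s\<in>carrier (sec Y W). res X (preim X f W) (preim X f W') (comor f W s) = comor f W' (res Y W W' s)))"

definition ringed_iso :: "('p, 'r) ringed_space \<Rightarrow> ('q, 's) ringed_space \<Rightarrow> bool" where
  "ringed_iso X Y \<longleftrightarrow> (\<exists>f. ringed_map X Y f \<and> homeomorphic_map (pts X) (pts Y) (base f) \<and>
     (\<forall>W. openin (pts Y) W \<longrightarrow> comor f W \<in> ring_iso (sec Y W) (sec X (preim X f W))))"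

text \<open>Elements of the localization of \<open>A\<close> at a prime ideal \<open>P\<close> are classes of pairs (numerator,
  denominator).\<close>

definition fraction :: "'a ring \<Rightarrow> 'a set \<Rightarrow> 'a \<Rightarrow> 'a \<Rightarrow> ('a \<times> 'a) set" where
  "fraction A P a f = {(b, g). b \<in> carrier A \<and> g \<in> carrier A - P \<and>
     (\<exists>t\<in>carrier A - P. t \<otimes>\<^bsub>A\<^esub> (g \<otimes>\<^bsub>A\<^esub> a) = t \<otimes>\<^bsub>A\<^esub> (f \<otimes>\<^bsub>A\<^esub> b))}"

definition localization :: "'a ring \<Rightarrow> 'a set \<Rightarrow> (('a \<times> 'a) set) ring" where
  "localization A P =
     \<lparr>carrier = {fraction A P a f | a f. a \<in> carrier A \<and> f \<in> carrier A - P},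
      monoid.mult = (\<lambda>x y. the_elem ((\<lambda>((a, f), (b, g)). fraction A P (a \<otimes>\<^bsub>A\<^esub> b) (f \<otimes>\<^bsub>A\<^esub> g)) ` (x \<times> y))),
      one = fraction A P \<one>\<^bsub>A\<^esub> \<one>\<^bsub>A\<^esub>,
      ring.zero = fraction A P \<zero>\<^bsub>A\<^esub> \<one>\<^bsub>A\<^esub>,
      add = (\<lambda>x y. the_elem ((\<lambda>((a, f), (b, g)).
               fraction A P (g \<otimes>\<^bsub>A\<^esub> a \<oplus>\<^bsub>A\<^esub> f \<otimes>\<^bsub>A\<^esub> b) (f \<otimes>\<^bsub>A\<^esub> g)) ` (x \<times> y)))\<rparr>"

definition spec_topology :: "'a ring \<Rightarrow> 'a set topology" where
  "spec_topology A = topology_generated_by {{P. primeideal P A \<and> f \<notin> P} | f. f \<in> carrier A}"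

definition spec_sections :: "'a ring \<Rightarrow> 'a set set \<Rightarrow> ('a set \<Rightarrow> ('a \<times> 'a) set) ring" where
  "spec_sections A U =
     \<lparr>carrier = {s \<in> (\<Pi>\<^sub>E P\<in>U. carrier (localization A P)).
        \<forall>P\<in>U. \<exists>V a f. openin (spec_topology A) V \<and> P \<in> V \<and> V \<subseteq> U \<and> a \<in> carrier A \<and> f \<in> carrier A \<and>
          (\<forall>Q\<in>V. f \<notin> Q \<and> s Q = fraction A Q a f)},
      monoid.mult = (\<lambda>s t. \<lambda>P\<in>U. s P \<otimes>\<^bsub>localization A P\<^esub> t P),
      one = (\<lambda>P\<in>U. \<one>\<^bsub>localization A P\<^esub>),
      ring.zero = (\<lambda>P\<in>U. \<zero>\<^bsub>localization A P\<^esub>),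
      add = (\<lambda>s t. \<lambda>P\<in>U. s P \<oplus>\<^bsub>localization A P\<^esub> t P)\<rparr>"

definition Spec :: "'a ring \<Rightarrow> ('a set, 'a set \<Rightarrow> ('a \<times> 'a) set) ringed_space" where
  "Spec A = \<lparr>pts = spec_topology A, sec = spec_sections A, res = (\<lambda>U V s. restrict s V)\<rparr>"

text \<open>If a ringed space is isomorphic to a spectrum, it is so to that of its ring of global sections;
  hence it is no restriction to look for \<open>A\<close> on the type of sections.\<close>

definition affine_scheme :: "('p, 'r) ringed_space \<Rightarrow> bool" where
  "affine_scheme X \<longleftrightarrow> is_ringed_space X \<and> (\<exists>A :: 'r ring. cring A \<and> ringed_iso X (Spec A))"

definition open_sub :: "('p, 'r) ringed_space \<Rightarrow> 'p set \<Rightarrow> ('p, 'r) ringed_space" where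
  "open_sub X V = X\<lparr>pts := subtopology (pts X) V\<rparr>"

definition affine_open :: "('p, 'r) ringed_space \<Rightarrow> 'p set \<Rightarrow> bool" where
  "affine_open X V \<longleftrightarrow> openin (pts X) V \<and> affine_scheme (open_sub X V)"

definition scheme :: "('p, 'r) ringed_space \<Rightarrow> bool" where
  "scheme X \<longleftrightarrow> is_ringed_space X \<and> (\<forall>x\<in>topspace (pts X). \<exists>V. affine_open X V \<and> x \<in> V)"

text \<open>The germ at \<open>x\<close> of a section over \<open>U\<close> is a unit of the stalk.\<close>

definition germ_unit :: "('p, 'r) ringed_space \<Rightarrow> 'p set \<Rightarrow> 'r \<Rightarrow> 'p \<Rightarrow> bool" where
  "germ_unit X U s x \<longleftrightarrow> (\<exists>V. openin (pts X) V \<and> x \<in> V \<and> V \<subseteq> U \<and> res X U V s \<in> Units (sec X V))"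

text \<open>Morphisms of schemes are morphisms of ringed spaces that induce local homomorphisms on stalks.\<close>

definition scheme_map ::
  "('p, 'r) ringed_space \<Rightarrow> ('q, 's) ringed_space \<Rightarrow> ('p, 'q, 'r, 's) space_map \<Rightarrow> bool" where
  "scheme_map X Y f \<longleftrightarrow> ringed_map X Y f \<and>
     (\<forall>x\<in>topspace (pts X). \<forall>W. openin (pts Y) W \<and> base f x \<in> W \<longrightarrow>
        (\<forall>s\<in>carrier (sec Y W). germ_unit X (preim X f W) (comor f W s) x \<longrightarrow> germ_unit Y W s (base f x)))"

definition id_map :: "('p, 'p, 'r, 'r) space_map" where
  "id_map = \<lparr>base = (\<lambda>x. x), comor = (\<lambda>W s. s)\<rparr>"

text \<open>The composite of \<open>g\<close> from a space to \<open>Y\<close> and \<open>f\<close> from \<open>Y\<close> to another one.\<close>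

definition comp_map :: "('q, 's) ringed_space \<Rightarrow> ('p, 'q, 'r, 's) space_map \<Rightarrow> ('q, 't, 's, 'u) space_map \<Rightarrow>
    ('p, 't, 'r, 'u) space_map" where
  "comp_map Y g f = \<lparr>base = (\<lambda>x. base f (base g x)),
     comor = (\<lambda>W s. comor g (preim Y f W) (comor f W s))\<rparr>"

definition same_map :: "('p, 'r) ringed_space \<Rightarrow> ('q, 's) ringed_space \<Rightarrow>
    ('p, 'q, 'r, 's) space_map \<Rightarrow> ('p, 'q, 'r, 's) space_map \<Rightarrow> bool" where
  "same_map X Y f g \<longleftrightarrow> (\<forall>x\<in>topspace (pts X). base f x = base g x) \<and>
     (\<forall>W. openin (pts Y) W \<longrightarrow> (\<forall>s\<in>carrier (sec Y W). comor f W s = comor g W s))"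

definition ring_map_on :: "('p, 'r) ringed_space \<Rightarrow> ('p, 'q, 'r, 's) space_map \<Rightarrow> 'p set \<Rightarrow> 'q set \<Rightarrow>
    's \<Rightarrow> 'r" where
  "ring_map_on X f V W s = res X (preim X f W) V (comor f W s)"

text \<open>Separatedness, through the criterion on pairs of affine open sets: their intersection is affine, and
  its functions are the finite sums of products of functions on the two sets. This says that the diagonal
  is a closed immersion, locally on the target.\<close>

definition separated :: "('p, 'r) ringed_space \<Rightarrow> ('q, 's) ringed_space \<Rightarrow> ('p, 'q, 'r, 's) space_map \<Rightarrow> bool" where
  "separated X S f \<longleftrightarrow> (\<forall>V V' W. affine_open X V \<and> affine_open X V' \<and> affine_open S W \<and>
     base f ` V \<subseteq> W \<and> base f ` V' \<subseteq> W \<longrightarrow>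
       affine_open X (V \<inter> V') \<and>
       (\<forall>s\<in>carrier (sec X (V \<inter> V')). \<exists>k :: nat. \<exists>u v.
          (\<forall>i<k. u i \<in> carrier (sec X V) \<and> v i \<in> carrier (sec X V')) \<and>
          s = (\<Oplus>\<^bsub>sec X (V \<inter> V')\<^esub>i\<in>{..<k}.
                 res X V (V \<inter> V') (u i) \<otimes>\<^bsub>sec X (V \<inter> V')\<^esub> res X V' (V \<inter> V') (v i))))"


section \<open>Etale morphisms\<close>

definition poly_ring :: "('a, 'm) ring_scheme \<Rightarrow> nat \<Rightarrow> ('a, (nat \<Rightarrow> nat) \<Rightarrow> 'a) module" where
  "poly_ring R k = monoid_algebra R
     \<lparr>carrier = {..<k} \<rightarrow>\<^sub>E UNIV, monoid.mult = (\<lambda>x y. \<lambda>i\<in>{..<k}. x i + y i), one = (\<lambda>i\<in>{..<k}. 0)\<rparr>"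

definition finitely_presented :: "('a, 'm) ring_scheme \<Rightarrow> ('a, 'b) module \<Rightarrow> bool" where
  "finitely_presented R B \<longleftrightarrow> (\<exists>k. \<exists>h\<in>ring_hom (poly_ring R k) B. \<exists>F.
     (\<forall>r\<in>carrier R. h (r \<odot>\<^bsub>poly_ring R k\<^esub> \<one>\<^bsub>poly_ring R k\<^esub>) = r \<odot>\<^bsub>B\<^esub> \<one>\<^bsub>B\<^esub>) \<and>
     h ` carrier (poly_ring R k) = carrier B \<and>
     finite F \<and> F \<subseteq> carrier (poly_ring R k) \<and> a_kernel (poly_ring R k) B h = Idl\<^bsub>poly_ring R k\<^esub> F)"

text \<open>The equational criterion: every linear relation in the algebra with coefficients in \<open>R\<close> is a
  consequence of relations in \<open>R\<close>.\<close>

definition flat :: "('a, 'm) ring_scheme \<Rightarrow> ('a, 'b) module \<Rightarrow> bool" where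
  "flat R B \<longleftrightarrow> (\<forall>(k :: nat) r b.
     (\<forall>i<k. r i \<in> carrier R \<and> b i \<in> carrier B) \<and> (\<Oplus>\<^bsub>B\<^esub>i\<in>{..<k}. r i \<odot>\<^bsub>B\<^esub> b i) = \<zero>\<^bsub>B\<^esub> \<longrightarrow>
     (\<exists>(l :: nat) a c. (\<forall>j<l. c j \<in> carrier B \<and> (\<forall>i<k. a i j \<in> carrier R)) \<and>
        (\<forall>i<k. b i = (\<Oplus>\<^bsub>B\<^esub>j\<in>{..<l}. a i j \<odot>\<^bsub>B\<^esub> c j)) \<and>
        (\<forall>j<l. (\<Oplus>\<^bsub>R\<^esub>i\<in>{..<k}. r i \<otimes>\<^bsub>R\<^esub> a i j) = \<zero>\<^bsub>R\<^esub>)))"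

definition etale_algebra :: "('a, 'm) ring_scheme \<Rightarrow> ('a, 'b) module \<Rightarrow> bool" where
  "etale_algebra R B \<longleftrightarrow> finitely_presented R B \<and> flat R B \<and> carrier (kaehler R B) = {\<zero>\<^bsub>kaehler R B\<^esub>}"

definition etale :: "('p, 'r) ringed_space \<Rightarrow> ('q, 's) ringed_space \<Rightarrow> ('p, 'q, 'r, 's) space_map \<Rightarrow> bool" where
  "etale U X g \<longleftrightarrow> scheme U \<and> scheme_map U X g \<and>
     (\<forall>x\<in>topspace (pts U). \<exists>V W. x \<in> V \<and> affine_open U V \<and> affine_open X W \<and> base g ` V \<subseteq> W \<and>
        etale_algebra (sec X W) (hom_algebra (ring_map_on U g V W) (sec U V)))"


section \<open>Sheaves of forms on the small etale site\<close>

text \<open>All forms are defined Zariski locally on the scheme and on the base. A sheaf of forms is given by a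
  construction \<open>M\<close> that attaches to a ring \<open>R\<close> and an \<open>R\<close>-algebra \<open>B\<close> a \<open>B\<close>-module, and by its functoriality
  \<open>tr\<close>. For \<open>f\<close> from \<open>U\<close> to \<open>S\<close>, it is evaluated on the pairs consisting of an affine open set of \<open>U\<close> and an
  affine open set of \<open>S\<close> that contains its image; a form on \<open>U\<close> is a compatible family over all these pairs.\<close>

definition aff_pairs :: "('q, 's) ringed_space \<Rightarrow> ('p, 'r) ringed_space \<Rightarrow> ('p, 'q, 'r, 's) space_map \<Rightarrow>
    ('p set \<times> 'q set) set" where
  "aff_pairs S U f = {(V, W). affine_open U V \<and> affine_open S W \<and> base f ` V \<subseteq> W}"

definition pair_alg :: "('p, 'r) ringed_space \<Rightarrow> ('p, 'q, 'r, 's) space_map \<Rightarrow>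
    'p set \<Rightarrow> 'q set \<Rightarrow> ('s, 'r) module" where
  "pair_alg U f V W = hom_algebra (ring_map_on U f V W) (sec U V)"

type_synonym ('s, 'r, 'm) construction = "'s ring \<Rightarrow> ('s, 'r) module \<Rightarrow> ('r, 'm) module"
type_synonym ('s, 'r, 'm) transition =
  "'s ring \<Rightarrow> ('s, 'r) module \<Rightarrow> 's ring \<Rightarrow> ('s, 'r) module \<Rightarrow> ('s \<Rightarrow> 's) \<Rightarrow> ('r \<Rightarrow> 'r) \<Rightarrow> 'm \<Rightarrow> 'm"

text \<open>For a morphism \<open>h\<close> of schemes over \<open>S\<close> from \<open>U'\<close> (with structure morphism \<open>f'\<close>) to \<open>U\<close> (with structure
  morphism \<open>f\<close>): \<open>s'\<close> is the pullback by \<open>h\<close> of \<open>s\<close>. The sets \<open>V'\<close> that are mapped into some affine \<open>V\<close> cover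
  \<open>U'\<close>, so this determines \<open>s'\<close>.\<close>

definition is_pullback :: "('s, 'r, 'm) transition \<Rightarrow> ('q, 's) ringed_space \<Rightarrow>
    ('p, 'r) ringed_space \<Rightarrow> ('p, 'q, 'r, 's) space_map \<Rightarrow>
    ('p, 'r) ringed_space \<Rightarrow> ('p, 'q, 'r, 's) space_map \<Rightarrow> ('p, 'p, 'r, 'r) space_map \<Rightarrow>
    ('p set \<times> 'q set \<Rightarrow> 'm) \<Rightarrow> ('p set \<times> 'q set \<Rightarrow> 'm) \<Rightarrow> bool" where
  "is_pullback tr S U f U' f' h s s' \<longleftrightarrow>
     (\<forall>(V, W)\<in>aff_pairs S U f. \<forall>(V', W')\<in>aff_pairs S U' f'. base h ` V' \<subseteq> V \<and> W' \<subseteq> W \<longrightarrow>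
        s' (V', W') = tr (sec S W) (pair_alg U f V W) (sec S W') (pair_alg U' f' V' W')
          (res S W W') (ring_map_on U' h V' V) (s (V, W)))"

definition forms_on :: "('s, 'r, 'm) construction \<Rightarrow> ('s, 'r, 'm) transition \<Rightarrow> ('q, 's) ringed_space \<Rightarrow>
    ('p, 'r) ringed_space \<Rightarrow> ('p, 'q, 'r, 's) space_map \<Rightarrow> ('r, 'p set \<times> 'q set \<Rightarrow> 'm) module" where
  "forms_on M tr S U f =
     \<lparr>carrier = {s \<in> (\<Pi>\<^sub>E (V, W)\<in>aff_pairs S U f. carrier (M (sec S W) (pair_alg U f V W))).
        is_pullback tr S U f U f id_map s s},
      monoid.mult = undefined, one = undefined,
      ring.zero = (\<lambda>(V, W)\<in>aff_pairs S U f. \<zero>\<^bsub>M (sec S W) (pair_alg U f V W)\<^esub>),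
      add = (\<lambda>s t. \<lambda>(V, W)\<in>aff_pairs S U f.
               s (V, W) \<oplus>\<^bsub>M (sec S W) (pair_alg U f V W)\<^esub> t (V, W)),
      smult = (\<lambda>a s. \<lambda>(V, W)\<in>aff_pairs S U f.
               res U (topspace (pts U)) V a \<odot>\<^bsub>M (sec S W) (pair_alg U f V W)\<^esub> s (V, W))\<rparr>"

text \<open>An isomorphism, linear over the structure sheaf, between two such sheaves on the small etale site
  of \<open>X\<close>. Objects of the site are pairs of a scheme and an etale morphism to \<open>X\<close>.\<close>

type_synonym ('u, 'x, 'c, 'b) site_obj = "('u, 'c) ringed_space \<times> ('u, 'x, 'c, 'b) space_map"

definition sheaf_iso :: "('q, 's) ringed_space \<Rightarrow> ('x, 'b) ringed_space \<Rightarrow> ('x, 'q, 'b, 's) space_map \<Rightarrow>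
    ('s, 'c, 'm) construction \<Rightarrow> ('s, 'c, 'm) transition \<Rightarrow>
    ('s, 'c, 'k) construction \<Rightarrow> ('s, 'c, 'k) transition \<Rightarrow>
    (('u, 'x, 'c, 'b) site_obj \<Rightarrow> ('u set \<times> 'q set \<Rightarrow> 'm) \<Rightarrow> ('u set \<times> 'q set \<Rightarrow> 'k)) \<Rightarrow> bool" where
  "sheaf_iso S X f M tr M' tr' \<nu> \<longleftrightarrow>
     (\<forall>U g. etale U X g \<longrightarrow>
        \<nu> (U, g) \<in> module_iso (sec U (topspace (pts U)))
          (forms_on M tr S U (comp_map X g f)) (forms_on M' tr' S U (comp_map X g f))) \<and>
     (\<forall>U g U' g' h. etale U X g \<and> etale U' X g' \<and> scheme_map U' U h \<and> same_map U' X (comp_map U h g) g' \<longrightarrow>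
        (\<forall>s\<in>carrier (forms_on M tr S U (comp_map X g f)).
         \<forall>s'\<in>carrier (forms_on M tr S U' (comp_map X g' f)).
           is_pullback tr S U (comp_map X g f) U' (comp_map X g' f) h s s' \<longrightarrow>
           is_pullback tr' S U (comp_map X g f) U' (comp_map X g' f) h (\<nu> (U, g) s) (\<nu> (U', g') s')))"

text \<open>Operations on forms that are given on affine pieces.\<close>

definition on_pairs :: "('q, 's) ringed_space \<Rightarrow> ('p, 'r) ringed_space \<Rightarrow> ('p, 'q, 'r, 's) space_map \<Rightarrow>
    ('s ring \<Rightarrow> ('s, 'r) module \<Rightarrow> 'm \<Rightarrow> 'k) \<Rightarrow> ('p set \<times> 'q set \<Rightarrow> 'm) \<Rightarrow> 'p set \<times> 'q set \<Rightarrow> 'k" where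
  "on_pairs S U f op s = (\<lambda>(V, W)\<in>aff_pairs S U f. op (sec S W) (pair_alg U f V W) (s (V, W)))"

definition on_pairs2 :: "('q, 's) ringed_space \<Rightarrow> ('p, 'r) ringed_space \<Rightarrow> ('p, 'q, 'r, 's) space_map \<Rightarrow>
    ('s ring \<Rightarrow> ('s, 'r) module \<Rightarrow> 'm \<Rightarrow> 'l \<Rightarrow> 'k) \<Rightarrow>
    ('p set \<times> 'q set \<Rightarrow> 'm) \<Rightarrow> ('p set \<times> 'q set \<Rightarrow> 'l) \<Rightarrow> 'p set \<times> 'q set \<Rightarrow> 'k" where
  "on_pairs2 S U f op s t =
     (\<lambda>(V, W)\<in>aff_pairs S U f. op (sec S W) (pair_alg U f V W) (s (V, W)) (t (V, W)))"

text \<open>For functions \<open>b 1, \<dots>, b n\<close> on \<open>U\<close>, the family of their restrictions to the affine open sets of \<open>U\<close>.\<close>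

definition local_funs :: "('q, 's) ringed_space \<Rightarrow> ('p, 'r) ringed_space \<Rightarrow> ('p, 'q, 'r, 's) space_map \<Rightarrow>
    (nat \<Rightarrow> 'r) \<Rightarrow> 'p set \<times> 'q set \<Rightarrow> nat \<Rightarrow> 'r" where
  "local_funs S U f b = (\<lambda>(V, W)\<in>aff_pairs S U f. \<lambda>i. res U (topspace (pts U)) V (b i))"

text \<open>The (weak, respectively strong) form \<open>db\<^sub>1 \<and> \<dots> \<and> db\<^sub>n\<close>.\<close>

definition d_wedge_weak :: "nat \<Rightarrow> 'a ring \<Rightarrow> ('a, 'b) module \<Rightarrow> (nat \<Rightarrow> 'b) \<Rightarrow> 'b form_elt" where
  "d_wedge_weak n R B b = wedge_weak n R B (\<lambda>i\<in>{..<n}. kaehler_d R B (b (Suc i)))"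

definition d_wedge_strong :: "nat \<Rightarrow> 'a ring \<Rightarrow> ('a, 'b) module \<Rightarrow> (nat \<Rightarrow> 'b) \<Rightarrow> 'b form_elt" where
  "d_wedge_strong n R B b = wedge_strong n R B (\<lambda>i\<in>{..<n}. kaehler_d R B (b (Suc i)))"

end

theory Submission
  imports Defs
begin

text \<open>The linear map that sends \<open>x\<^sub>0 \<otimes> \<dots> \<otimes> x\<^sub>n\<close> to \<open>x\<^sub>0 dx\<^sub>1 \<and> \<dots> \<and> dx\<^sub>n\<close> kills the ideal of relations between
  combinatorial forms, since by the Leibniz rule it kills all multiples of \<open>d\<^sup>0\<^sup>,\<^sup>ib d\<^sup>0\<^sup>,\<^sup>ie\<close> and of
  \<open>d\<^sup>0\<^sup>,\<^sup>ib d\<^sup>0\<^sup>,\<^sup>je + d\<^sup>0\<^sup>,\<^sup>jb d\<^sup>0\<^sup>,\<^sup>ie\<close>, and for strong forms those of \<open>d\<^sup>0\<^sup>,\<^sup>ib d\<^sup>0\<^sup>,\<^sup>jb\<close>. On combinatorial forms it is inverse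
  to \<open>db\<^sub>1 \<and> \<dots> \<and> db\<^sub>n \<mapsto> d\<^sup>0\<^sup>,\<^sup>1b\<^sub>1 \<dots> d\<^sup>0\<^sup>,\<^sup>nb\<^sub>n\<close>: these are functions that vanish whenever some coordinate
  \<open>x\<^sub>k\<close> is replaced by \<open>x\<^sub>0\<close>, and subtracting from a function its value after this substitution, successively for
  \<open>k = 1, \<dots>, n\<close>, turns \<open>x\<^sub>0 \<otimes> \<dots> \<otimes> x\<^sub>n\<close> into \<open>x\<^sub>0 d\<^sup>0\<^sup>,\<^sup>1x\<^sub>1 \<dots> d\<^sup>0\<^sup>,\<^sup>nx\<^sub>n\<close>. All these maps are natural in the algebra,
  so they glue over the affine pieces of etale schemes.\<close>

section \<open>Modules and quotients\<close>

text \<open>The differentials need not have a basis, so injectivity and surjectivity cannot be read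
  off in coordinates. Both come from two identities on functions. Write \<open>p\<close> for the map
  from functions to forms, \<open>q\<close> for the class of a function modulo the ideal,
  \<open>nu\<close> for the map from forms to combinatorial forms and \<open>Qop n\<close> for the
  composite of all the operators that subtract a substitution. Then
  \<open>nu (p t) = q (Qop n t)\<close> and \<open>p (Qop n t) = p t\<close> for every function
  \<open>t\<close>; as \<open>p\<close> is onto, the first one computes \<open>nu\<close> everywhere
  and the second makes it injective. Two points shape the rest. The map \<open>p\<close> is not
  multiplicative, so its kernel need not be an ideal; relations are therefore tested in the largest
  ideal inside the kernel. And a combinatorial form has for each k a representative that vanishes
  when x_k is replaced by x_0, but a priori no common one; hence the substitutions are made to act
  on the quotient ring. Weak and strong forms run through one argument, with the submodule of
  relations and the ideal left as parameters.\<close>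

definition semilinear :: "('a, 'm) ring_scheme \<Rightarrow> ('a, 'b, 'k) module_scheme \<Rightarrow> ('c, 'd, 'l) module_scheme \<Rightarrow>
    ('a \<Rightarrow> 'c) \<Rightarrow> ('b \<Rightarrow> 'd) \<Rightarrow> bool" where
  "semilinear R M P a h \<longleftrightarrow> h \<in> carrier M \<rightarrow> carrier P \<and>
     (\<forall>x\<in>carrier M. \<forall>y\<in>carrier M. h (x \<oplus>\<^bsub>M\<^esub> y) = h x \<oplus>\<^bsub>P\<^esub> h y) \<and>
     (\<forall>r\<in>carrier R. \<forall>x\<in>carrier M. h (r \<odot>\<^bsub>M\<^esub> x) = a r \<odot>\<^bsub>P\<^esub> h x)"

lemma semilinearI:
  assumes "\<And>x. x \<in> carrier M \<Longrightarrow> h x \<in> carrier P"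
    and "\<And>x y. x \<in> carrier M \<Longrightarrow> y \<in> carrier M \<Longrightarrow> h (x \<oplus>\<^bsub>M\<^esub> y) = h x \<oplus>\<^bsub>P\<^esub> h y"
    and "\<And>r x. r \<in> carrier R \<Longrightarrow> x \<in> carrier M \<Longrightarrow> h (r \<odot>\<^bsub>M\<^esub> x) = a r \<odot>\<^bsub>P\<^esub> h x"
  shows "semilinear R M P a h"
  using assms by (auto simp: semilinear_def)

lemma semilinear_closed: "semilinear R M P a h \<Longrightarrow> x \<in> carrier M \<Longrightarrow> h x \<in> carrier P"
  and semilinear_add: "semilinear R M P a h \<Longrightarrow> x \<in> carrier M \<Longrightarrow> y \<in> carrier M \<Longrightarrow>
      h (x \<oplus>\<^bsub>M\<^esub> y) = h x \<oplus>\<^bsub>P\<^esub> h y"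
  and semilinear_smult: "semilinear R M P a h \<Longrightarrow> r \<in> carrier R \<Longrightarrow> x \<in> carrier M \<Longrightarrow>
      h (r \<odot>\<^bsub>M\<^esub> x) = a r \<odot>\<^bsub>P\<^esub> h x"
  by (auto simp: semilinear_def)

lemma abelian_group_hom_additive:
  assumes "abelian_group M" "abelian_group P" "\<And>x. x \<in> carrier M \<Longrightarrow> h x \<in> carrier P"
    and "\<And>x y. x \<in> carrier M \<Longrightarrow> y \<in> carrier M \<Longrightarrow> h (x \<oplus>\<^bsub>M\<^esub> y) = h x \<oplus>\<^bsub>P\<^esub> h y"
  shows "abelian_group_hom M P h"
proof (intro abelian_group_homI assms(1,2))
  show "group_hom (add_monoid M) (add_monoid P) h"
    using assms by (auto simp: group_hom_def group_hom_axioms_def hom_def abelian_group.a_group)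
qed

lemma additive_minus:
  assumes "abelian_group_hom M P h" "x \<in> carrier M" "y \<in> carrier M"
  shows "h (x \<ominus>\<^bsub>M\<^esub> y) = h x \<ominus>\<^bsub>P\<^esub> h y"
proof -
  interpret abelian_group_hom M P h by fact
  show ?thesis using assms by (simp add: G.minus_eq H.minus_eq)
qed

lemma semilinear_hom:
  assumes "Module.module R M" "Module.module C P" "semilinear R M P a h"
  shows "abelian_group_hom M P h"
  using assms by (intro abelian_group_hom_additive)
    (auto simp: Module.module_def semilinear_closed semilinear_add)

lemma semilinear_zero:
  assumes "Module.module R M" "Module.module C P" "semilinear R M P a h"
  shows "h \<zero>\<^bsub>M\<^esub> = \<zero>\<^bsub>P\<^esub>"
  using abelian_group_hom.hom_zero[OF semilinear_hom[OF assms]] .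

lemma semilinear_minus:
  assumes "Module.module R M" "Module.module C P" "semilinear R M P a h" "x \<in> carrier M" "y \<in> carrier M"
  shows "h (x \<ominus>\<^bsub>M\<^esub> y) = h x \<ominus>\<^bsub>P\<^esub> h y"
  using additive_minus[OF semilinear_hom[OF assms(1-3)] assms(4,5)] .

lemma submodule_preimage:
  assumes "Module.module R M" "Module.module C P" "semilinear R M P a h" "submodule L C P"
    and "\<And>r. r \<in> carrier R \<Longrightarrow> a r \<in> carrier C"
  shows "submodule {x \<in> carrier M. h x \<in> L} R M"
proof -
  interpret M: Module.module R M by fact
  interpret P: Module.module C P by fact
  interpret h: abelian_group_hom M P h using assms semilinear_hom by blast
  note L = P.submoduleE[OF assms(4)]
  have z: "\<zero>\<^bsub>P\<^esub> \<in> L" using L(2) L(1) L(3) L(5) by (metis P.r_neg ex_in_conv subsetD)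
  show ?thesis
    by (rule M.submoduleI) (auto simp: L z semilinear_smult[OF assms(3)] assms(5))
qed

lemma zero_submodule:
  assumes "Module.module R M" shows "submodule {\<zero>\<^bsub>M\<^esub>} R M"
proof -
  interpret M: Module.module R M by fact
  show ?thesis by (rule M.submoduleI) auto
qed

lemma submodule_gen_submodule:
  assumes "Module.module R M" "S \<subseteq> carrier M"
  shows "submodule (submodule_gen R M S) R M"
proof -
  interpret M: Module.module R M by fact
  have c: "carrier M \<in> {N. submodule N R M \<and> S \<subseteq> N}"
    using assms M.carrier_is_submodule by auto
  have z: "\<zero>\<^bsub>M\<^esub> \<in> N" if "submodule N R M" for N
    using subgroup.one_closed[OF submodule.axioms(1)[OF that]] by simp
  show ?thesis unfolding submodule_gen_def
    by (rule M.submoduleI) (use c z in \<open>auto dest: M.submoduleE(1,3,4) intro: M.submoduleE(5)\<close>)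
qed

lemma submodule_gen_superset: "S \<subseteq> submodule_gen R M S"
  by (auto simp: submodule_gen_def)

lemma submodule_gen_minimal: "submodule N R M \<Longrightarrow> S \<subseteq> N \<Longrightarrow> submodule_gen R M S \<subseteq> N"
  by (auto simp: submodule_gen_def)

text \<open>The preimage of a submodule is a submodule, so a generated submodule can be tested on
  generators. Maps out of tensor powers, differentials and forms are shown to respect the relations
  through this lemma or its special case with target zero.\<close>

lemma semilinear_submodule_gen:
  assumes "Module.module R M" "Module.module C P" "semilinear R M P a h" "submodule L C P"
    and "\<And>r. r \<in> carrier R \<Longrightarrow> a r \<in> carrier C"
    and "S \<subseteq> carrier M" "\<And>s. s \<in> S \<Longrightarrow> h s \<in> L" "x \<in> submodule_gen R M S"
  shows "h x \<in> L"
proof -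
  have "submodule_gen R M S \<subseteq> {x \<in> carrier M. h x \<in> L}"
    using assms(6,7) by (intro submodule_gen_minimal submodule_preimage[OF assms(1-5)]) auto
  thus ?thesis using assms(8) by auto
qed

lemma semilinear_submodule_gen_zero:
  assumes "Module.module R M" "Module.module C P" "semilinear R M P a h"
    and "\<And>r. r \<in> carrier R \<Longrightarrow> a r \<in> carrier C"
    and "S \<subseteq> carrier M" "\<And>s. s \<in> S \<Longrightarrow> h s = \<zero>\<^bsub>P\<^esub>" "x \<in> submodule_gen R M S"
  shows "h x = \<zero>\<^bsub>P\<^esub>"
  using semilinear_submodule_gen[OF assms(1-3) zero_submodule[OF assms(2)] assms(4,5) _ assms(7)] assms(6)
  by blast

section \<open>Cosets and maps out of quotients\<close>

lemma submodule_abelian_subgroup: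
  assumes "Module.module R M" "submodule N R M" shows "abelian_subgroup N M"
  using assms by (intro abelian_subgroupI3 additive_subgroup.intro)
    (auto simp: Module.module_def submodule_def)

lemma (in abelian_subgroup) coset_eq_iff:
  assumes "x \<in> carrier G" "y \<in> carrier G"
  shows "H +> x = H +> y \<longleftrightarrow> x \<ominus> y \<in> H"
proof
  assume "H +> x = H +> y"
  hence "x \<in> H +> y" using a_rcos_self assms by blast
  thus "x \<ominus> y \<in> H" using a_rcos_module assms by (simp add: minus_eq)
next
  assume "x \<ominus> y \<in> H"
  hence "x \<in> H +> y" using a_rcos_module assms by (simp add: minus_eq)
  thus "H +> x = H +> y" using a_repr_independence'[of x y] assms by simp
qed

text \<open>\<open>coset_lift\<close> reads off the single element of the image of a coset; a map
  that is constant on the coset turns this image into a singleton.\<close>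

lemma coset_lift_eq:
  assumes "abelian_subgroup N M" "x \<in> carrier M"
    and "\<And>y. y \<in> carrier M \<Longrightarrow> N +>\<^bsub>M\<^esub> y = N +>\<^bsub>M\<^esub> x \<Longrightarrow> h y = h x"
  shows "coset_lift h (N +>\<^bsub>M\<^esub> x) = h x"
proof -
  interpret abelian_subgroup N M by fact
  have "h ` (N +>\<^bsub>M\<^esub> x) = {h x}"
  proof (intro equalityI subsetI)
    fix z assume "z \<in> h ` (N +>\<^bsub>M\<^esub> x)"
    then obtain y where y: "y \<in> N +>\<^bsub>M\<^esub> x" "z = h y" by blast
    have "N +>\<^bsub>M\<^esub> y = N +>\<^bsub>M\<^esub> x" using a_repr_independence'[OF y(1) assms(2)] by simp
    thus "z \<in> {h x}" using assms(3)[OF a_elemrcos_carrier[OF assms(2) y(1)]] y(2) by simp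
  qed (use a_rcos_self[OF assms(2)] in auto)
  thus ?thesis by (simp add: coset_lift_def)
qed

lemma abelian_group_minus_eq_zero_iff:
  assumes "abelian_group M" "x \<in> carrier M" "y \<in> carrier M"
  shows "x \<ominus>\<^bsub>M\<^esub> y = \<zero>\<^bsub>M\<^esub> \<longleftrightarrow> x = y"
proof -
  interpret abelian_group M by fact
  have "x = y" if "x \<ominus>\<^bsub>M\<^esub> y = \<zero>\<^bsub>M\<^esub>"
  proof -
    have "x = (x \<ominus>\<^bsub>M\<^esub> y) \<oplus>\<^bsub>M\<^esub> y" using assms(2,3) by (simp add: minus_eq a_assoc l_neg)
    thus ?thesis using that assms(3) by simp
  qed
  thus ?thesis using assms(2,3) by (auto simp: minus_eq r_neg)
qed

lemma coset_lift_additive: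
  assumes "abelian_subgroup N M" "abelian_group_hom M P h" "\<And>x. x \<in> N \<Longrightarrow> h x = \<zero>\<^bsub>P\<^esub>" "x \<in> carrier M"
  shows "coset_lift h (N +>\<^bsub>M\<^esub> x) = h x"
proof (rule coset_lift_eq[OF assms(1,4)])
  interpret abelian_subgroup N M by fact
  interpret h: abelian_group_hom M P h by fact
  fix y assume y: "y \<in> carrier M" "N +>\<^bsub>M\<^esub> y = N +>\<^bsub>M\<^esub> x"
  have "h (y \<ominus>\<^bsub>M\<^esub> x) = \<zero>\<^bsub>P\<^esub>" using y assms coset_eq_iff by blast
  hence "h y \<ominus>\<^bsub>P\<^esub> h x = \<zero>\<^bsub>P\<^esub>" using additive_minus[OF assms(2)] y assms by simp
  thus "h y = h x" using y(1) assms(4) abelian_group_minus_eq_zero_iff[OF h.H.abelian_group_axioms] by simp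
qed

lemma quot_module_carrier: "carrier (quot_module M N) = (\<lambda>x. N +>\<^bsub>M\<^esub> x) ` carrier M"
  and quot_module_zero: "\<zero>\<^bsub>quot_module M N\<^esub> = N"
  and quot_module_one: "\<one>\<^bsub>quot_module M N\<^esub> = N +>\<^bsub>M\<^esub> \<one>\<^bsub>M\<^esub>"
  by (auto simp: quot_module_def ring.defs module.defs FactRing_def A_RCOSETS_def')

lemma quot_module_add:
  assumes "abelian_subgroup N M" "x \<in> carrier M" "y \<in> carrier M"
  shows "(N +>\<^bsub>M\<^esub> x) \<oplus>\<^bsub>quot_module M N\<^esub> (N +>\<^bsub>M\<^esub> y) = N +>\<^bsub>M\<^esub> (x \<oplus>\<^bsub>M\<^esub> y)"
  using abelian_subgroup.a_rcos_sum[OF assms]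
  by (simp add: quot_module_def ring.defs module.defs FactRing_def)

lemma quot_module_mult:
  assumes "ideal N M" "x \<in> carrier M" "y \<in> carrier M"
  shows "(N +>\<^bsub>M\<^esub> x) \<otimes>\<^bsub>quot_module M N\<^esub> (N +>\<^bsub>M\<^esub> y) = N +>\<^bsub>M\<^esub> (x \<otimes>\<^bsub>M\<^esub> y)"
  using ideal.rcoset_mult_add[OF assms]
  by (simp add: quot_module_def ring.defs module.defs FactRing_def)

text \<open>The scalar multiple of a coset is defined as a union over all representatives. As
  \<open>N\<close> is stable under scalars, the members of this union coincide.\<close>

lemma quot_module_smult:
  assumes "Module.module R M" "submodule N R M" "a \<in> carrier R" "x \<in> carrier M"
  shows "a \<odot>\<^bsub>quot_module M N\<^esub> (N +>\<^bsub>M\<^esub> x) = N +>\<^bsub>M\<^esub> (a \<odot>\<^bsub>M\<^esub> x)"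
proof -
  interpret M: Module.module R M by fact
  interpret N: abelian_subgroup N M using assms submodule_abelian_subgroup by blast
  have "N +>\<^bsub>M\<^esub> (a \<odot>\<^bsub>M\<^esub> y) = N +>\<^bsub>M\<^esub> (a \<odot>\<^bsub>M\<^esub> x)" if "y \<in> N +>\<^bsub>M\<^esub> x" for y
  proof -
    have y: "y \<in> carrier M" using that assms(4) N.a_elemrcos_carrier by blast
    have "y \<ominus>\<^bsub>M\<^esub> x \<in> N" using that assms(4) N.a_rcos_module y by (simp add: M.minus_eq)
    hence "a \<odot>\<^bsub>M\<^esub> (y \<ominus>\<^bsub>M\<^esub> x) \<in> N" using M.submoduleE(4)[OF assms(2)] assms(3) by blast
    hence "a \<odot>\<^bsub>M\<^esub> y \<ominus>\<^bsub>M\<^esub> a \<odot>\<^bsub>M\<^esub> x \<in> N"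
      using y assms by (simp add: M.minus_eq M.smult_r_distr M.smult_r_minus)
    thus ?thesis using N.coset_eq_iff y assms by simp
  qed
  hence "(\<Union>y\<in>N +>\<^bsub>M\<^esub> x. N +>\<^bsub>M\<^esub> (a \<odot>\<^bsub>M\<^esub> y)) = N +>\<^bsub>M\<^esub> (a \<odot>\<^bsub>M\<^esub> x)"
    using N.a_rcos_self[OF assms(4)] by (intro SUP_eq_const) blast+
  thus ?thesis by (simp add: quot_module_def ring.defs module.defs)
qed

lemma module_quot_module:
  assumes M: "Module.module R M" and N: "submodule N R M"
  shows "Module.module R (quot_module M N)"
proof -
  interpret M: Module.module R M by fact
  interpret N: abelian_subgroup N M using assms submodule_abelian_subgroup by blast
  have ab: "abelian_group (quot_module M N)"
  proof (rule abelian_groupI)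
    have "N = N +>\<^bsub>M\<^esub> \<zero>\<^bsub>M\<^esub>" using N.a_rcos_const[of "\<zero>\<^bsub>M\<^esub>"] by simp
    thus "\<zero>\<^bsub>quot_module M N\<^esub> \<in> carrier (quot_module M N)"
      unfolding quot_module_carrier quot_module_zero by (rule image_eqI) simp
  next
    fix X assume "X \<in> carrier (quot_module M N)"
    then obtain x where x: "x \<in> carrier M" "X = N +>\<^bsub>M\<^esub> x" by (auto simp: quot_module_carrier)
    have "N +>\<^bsub>M\<^esub> (\<ominus>\<^bsub>M\<^esub> x \<oplus>\<^bsub>M\<^esub> x) = N"
      using x N.a_rcos_const[of "\<zero>\<^bsub>M\<^esub>"] by (simp add: M.l_neg)
    thus "\<exists>Y\<in>carrier (quot_module M N). Y \<oplus>\<^bsub>quot_module M N\<^esub> X = \<zero>\<^bsub>quot_module M N\<^esub>"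
      using x quot_module_add[OF N.abelian_subgroup_axioms M.a_inv_closed[OF x(1)] x(1)]
      by (auto simp: quot_module_carrier quot_module_zero)
    show "\<zero>\<^bsub>quot_module M N\<^esub> \<oplus>\<^bsub>quot_module M N\<^esub> X = X"
      using x quot_module_add[OF N.abelian_subgroup_axioms M.zero_closed x(1)]
        N.a_rcos_const[of "\<zero>\<^bsub>M\<^esub>"] by (simp add: quot_module_zero)
  qed (use N.a_rcos_const[of "\<zero>\<^bsub>M\<^esub>"] in \<open>auto simp: quot_module_carrier quot_module_zero
      quot_module_add[OF N.abelian_subgroup_axioms] M.a_ac\<close>)
  show ?thesis
    apply (rule moduleI[OF M.is_cring ab])
    unfolding quot_module_carrier
    by (auto simp: quot_module_smult[OF M N] quot_module_add[OF N.abelian_subgroup_axioms]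
        M.smult_l_distr M.smult_r_distr M.smult_assoc1)
qed

lemma quot_module_semilinear:
  assumes M: "Module.module R M" and N: "submodule N R M"
  shows "semilinear R M (quot_module M N) (\<lambda>r. r) (\<lambda>x. N +>\<^bsub>M\<^esub> x)"
  by (rule semilinearI)
     (auto simp: quot_module_carrier quot_module_add[OF submodule_abelian_subgroup[OF M N]]
        quot_module_smult[OF M N])

lemma quot_module_eq_iff:
  assumes M: "Module.module R M" and N: "submodule N R M" and "x \<in> carrier M" "y \<in> carrier M"
  shows "N +>\<^bsub>M\<^esub> x = N +>\<^bsub>M\<^esub> y \<longleftrightarrow> x \<ominus>\<^bsub>M\<^esub> y \<in> N"
  using abelian_subgroup.coset_eq_iff[OF submodule_abelian_subgroup[OF M N]] assms by blast

lemma quot_module_eq_zero_iff: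
  assumes M: "Module.module R M" and N: "submodule N R M" and x: "x \<in> carrier M"
  shows "N +>\<^bsub>M\<^esub> x = \<zero>\<^bsub>quot_module M N\<^esub> \<longleftrightarrow> x \<in> N"
proof -
  interpret M: Module.module R M by fact
  interpret N: abelian_subgroup N M using assms submodule_abelian_subgroup by blast
  show ?thesis using N.coset_eq_iff[OF x M.zero_closed] x N.a_rcos_const[of "\<zero>\<^bsub>M\<^esub>"]
      M.minus_equality[OF M.l_zero[OF M.zero_closed] M.zero_closed M.zero_closed]
    by (simp add: quot_module_zero M.minus_eq)
qed

lemma coset_lift_semilinear:
  assumes M: "Module.module R M" and N: "submodule N R M" and P: "Module.module C P" and h: "semilinear R M P a h"
    and z: "\<And>x. x \<in> N \<Longrightarrow> h x = \<zero>\<^bsub>P\<^esub>"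
  shows "semilinear R (quot_module M N) P a (coset_lift h)"
    and "\<And>x. x \<in> carrier M \<Longrightarrow> coset_lift h (N +>\<^bsub>M\<^esub> x) = h x"
proof -
  interpret M: Module.module R M by fact
  note NM = submodule_abelian_subgroup[OF M N]
  show eq: "coset_lift h (N +>\<^bsub>M\<^esub> x) = h x" if "x \<in> carrier M" for x
    by (rule coset_lift_additive[OF NM semilinear_hom[OF M P h] z that])
  show "semilinear R (quot_module M N) P a (coset_lift h)"
    by (rule semilinearI) (auto simp: quot_module_carrier eq quot_module_add[OF NM] quot_module_smult[OF M N]
        semilinear_closed[OF h] semilinear_add[OF h] semilinear_smult[OF h])
qed

lemma semilinear_comp:
  assumes "semilinear R M P a h" "semilinear C P Q b k" "\<And>r. r \<in> carrier R \<Longrightarrow> a r \<in> carrier C"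
  shows "semilinear R M Q (\<lambda>r. b (a r)) (\<lambda>x. k (h x))"
  using assms by (intro semilinearI) (auto simp: semilinear_closed semilinear_add semilinear_smult)

lemma coset_map_semilinear:
  assumes M: "Module.module R M" and N: "submodule N R M" and P: "Module.module C P" and L: "submodule L C P"
    and h: "semilinear R M P a h" and a: "\<And>r. r \<in> carrier R \<Longrightarrow> a r \<in> carrier C"
    and z: "\<And>x. x \<in> N \<Longrightarrow> h x \<in> L"
  shows "semilinear R (quot_module M N) (quot_module P L) a (coset_map P L h)"
    and "\<And>x. x \<in> carrier M \<Longrightarrow> coset_map P L h (N +>\<^bsub>M\<^esub> x) = L +>\<^bsub>P\<^esub> h x"
proof -
  interpret M: Module.module R M by fact
  have sub: "N \<subseteq> carrier M" using M.submoduleE(1)[OF N] .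
  have l: "semilinear R M (quot_module P L) a (\<lambda>x. L +>\<^bsub>P\<^esub> h x)"
    using semilinear_comp[OF h quot_module_semilinear[OF P L] a] .
  have z': "L +>\<^bsub>P\<^esub> h x = \<zero>\<^bsub>quot_module P L\<^esub>" if "x \<in> N" for x
    using z[OF that] quot_module_eq_zero_iff[OF P L] semilinear_closed[OF h] sub that by blast
  show "semilinear R (quot_module M N) (quot_module P L) a (coset_map P L h)"
    and "\<And>x. x \<in> carrier M \<Longrightarrow> coset_map P L h (N +>\<^bsub>M\<^esub> x) = L +>\<^bsub>P\<^esub> h x"
    unfolding coset_map_def
    using coset_lift_semilinear[OF M N module_quot_module[OF P L] l z'] by auto
qed

section \<open>Free modules\<close>

lemma free_module_carrier:
  "f \<in> carrier (free_module R S) \<longleftrightarrow>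
     (\<forall>s\<in>S. f s \<in> carrier R) \<and> (\<forall>s. s \<notin> S \<longrightarrow> f s = \<zero>\<^bsub>R\<^esub>) \<and> finite {s. f s \<noteq> \<zero>\<^bsub>R\<^esub>}"
  and free_module_zero: "\<zero>\<^bsub>free_module R S\<^esub> = (\<lambda>s. \<zero>\<^bsub>R\<^esub>)"
  and free_module_add: "f \<oplus>\<^bsub>free_module R S\<^esub> g = (\<lambda>s. f s \<oplus>\<^bsub>R\<^esub> g s)"
  and free_module_smult: "a \<odot>\<^bsub>free_module R S\<^esub> f = (\<lambda>s. a \<otimes>\<^bsub>R\<^esub> f s)"
  by (auto simp: free_module_def)

lemma (in cring) free_module_coeff: "f \<in> carrier (free_module R S) \<Longrightarrow> f s \<in> carrier R"
  by (cases "s \<in> S") (auto simp: free_module_carrier)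

lemma (in cring) module_free_module: "Module.module R (free_module R S)"
proof (rule moduleI[OF is_cring])
  have addc: "f \<oplus>\<^bsub>free_module R S\<^esub> g \<in> carrier (free_module R S)"
    if "f \<in> carrier (free_module R S)" "g \<in> carrier (free_module R S)" for f g
  proof -
    have "{s. f s \<oplus> g s \<noteq> \<zero>} \<subseteq> {s. f s \<noteq> \<zero>} \<union> {s. g s \<noteq> \<zero>}" by auto
    thus ?thesis using that by (auto simp: free_module_carrier free_module_add intro: finite_subset)
  qed
  show "abelian_group (free_module R S)"
  proof (rule abelian_groupI)
    fix f assume f: "f \<in> carrier (free_module R S)"
    have "{s. \<ominus> f s \<noteq> \<zero>} \<subseteq> {s. f s \<noteq> \<zero>}" by auto
    hence "(\<lambda>s. \<ominus> f s) \<in> carrier (free_module R S)"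
      using f by (auto simp: free_module_carrier intro: finite_subset)
    thus "\<exists>y\<in>carrier (free_module R S). y \<oplus>\<^bsub>free_module R S\<^esub> f = \<zero>\<^bsub>free_module R S\<^esub>"
      using free_module_coeff[OF f] by (auto simp: free_module_add free_module_zero l_neg intro!: bexI[rotated])
  qed (simp_all add: addc, auto simp: free_module_add free_module_zero free_module_coeff a_assoc,
      auto simp: free_module_carrier free_module_coeff a_comm)
  show "a \<odot>\<^bsub>free_module R S\<^esub> f \<in> carrier (free_module R S)"
    if "a \<in> carrier R" "f \<in> carrier (free_module R S)" for a f
  proof -
    have "{s. a \<otimes> f s \<noteq> \<zero>} \<subseteq> {s. f s \<noteq> \<zero>}" using that(1) by auto
    thus ?thesis using that by (auto simp: free_module_carrier free_module_smult intro: finite_subset)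
  qed
qed (auto simp: free_module_smult free_module_add free_module_coeff l_distr r_distr m_assoc)

lemma (in cring) delta_closed: "s \<in> S \<Longrightarrow> delta R s \<in> carrier (free_module R S)"
  by (auto simp: free_module_carrier delta_def)

text \<open>The induction runs over a finite set containing the support. One point \<open>t\<close>
  is split off at a time: \<open>f\<close> is its value there times \<open>delta R t\<close> plus a
  function supported in the rest.\<close>

lemma (in cring) free_module_induct [consumes 1, case_names zero gen add]:
  assumes "f \<in> carrier (free_module R S)"
    and z: "P \<zero>\<^bsub>free_module R S\<^esub>"
    and g: "\<And>a s. a \<in> carrier R \<Longrightarrow> s \<in> S \<Longrightarrow> P (a \<odot>\<^bsub>free_module R S\<^esub> delta R s)"
    and p: "\<And>f g. f \<in> carrier (free_module R S) \<Longrightarrow> g \<in> carrier (free_module R S) \<Longrightarrow> P f \<Longrightarrow> P g \<Longrightarrow>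
        P (f \<oplus>\<^bsub>free_module R S\<^esub> g)"
  shows "P f"
proof -
  interpret F: Module.module R "free_module R S" by (rule module_free_module)
  have fin: "finite {s. f s \<noteq> \<zero>}" using assms(1) by (auto simp: free_module_carrier)
  have "\<forall>f. f \<in> carrier (free_module R S) \<longrightarrow> {s. f s \<noteq> \<zero>} \<subseteq> A \<longrightarrow> P f" if "finite A" for A
    using that
  proof (induction A)
    case empty
    have "f = \<zero>\<^bsub>free_module R S\<^esub>" if "{s. f s \<noteq> \<zero>} \<subseteq> {}" for f :: "'c \<Rightarrow> 'a"
      using that by (auto simp: free_module_zero)
    thus ?case using z by metis
  next
    case (insert t A)
    show ?case
    proof (intro allI impI)
      fix f assume f: "f \<in> carrier (free_module R S)" "{s. f s \<noteq> \<zero>} \<subseteq> insert t A"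
      show "P f"
      proof (cases "t \<in> S")
        case False
        hence "f t = \<zero>" using f by (auto simp: free_module_carrier)
        hence "{s. f s \<noteq> \<zero>} \<subseteq> A" using f(2) by auto
        thus ?thesis using insert.IH f(1) by simp
      next
        case True
        let ?g = "f(t := \<zero>)"
        have "{s. ?g s \<noteq> \<zero>} \<subseteq> {s. f s \<noteq> \<zero>}" by auto
        hence g: "?g \<in> carrier (free_module R S)" using f
          by (auto simp: free_module_carrier intro: finite_subset)
        have "{s. ?g s \<noteq> \<zero>} \<subseteq> A" using f(2) by auto
        hence Pg: "P ?g" using insert.IH g by blast
        have ft: "f t \<in> carrier R" using free_module_coeff[OF f(1)] .
        have "f = (f t \<odot>\<^bsub>free_module R S\<^esub> delta R t) \<oplus>\<^bsub>free_module R S\<^esub> ?g"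
          using free_module_coeff[OF f(1)] by (auto simp: free_module_smult free_module_add delta_def)
        moreover have "P (f t \<odot>\<^bsub>free_module R S\<^esub> delta R t)" using ft True assms(3) by blast
        ultimately show ?thesis using p[OF F.smult_closed[OF ft delta_closed[OF True]] g _ Pg] by metis
      qed
    qed
  qed
  from this[OF fin] assms(1) show ?thesis by auto
qed

text \<open>\<open>lin_ext\<close> sums over the exact support, which changes under addition and
  scaling. Since \<open>a\<close> preserves zero, any finite index set around the support gives the
  same sum, and several functions can be summed over a common one.\<close>

lemma lin_ext_finite:
  assumes R: "cring R" and P: "Module.module C P" and a: "a \<in> ring_hom R C"
    and v: "\<And>s. s \<in> S \<Longrightarrow> v s \<in> carrier P"
    and f: "f \<in> carrier (free_module R S)" and A: "finite A" "A \<subseteq> S" "{s. f s \<noteq> \<zero>\<^bsub>R\<^esub>} \<subseteq> A"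
  shows "lin_ext R P a v f = (\<Oplus>\<^bsub>P\<^esub>s\<in>A. a (f s) \<odot>\<^bsub>P\<^esub> v s)"
proof -
  interpret P: Module.module C P by fact
  have a0: "a \<zero>\<^bsub>R\<^esub> = \<zero>\<^bsub>C\<^esub>" using ring_hom_zero[OF a] R P.R.ring_axioms by (auto simp: cring_def)
  have "f s \<in> carrier R" for s using cring.free_module_coeff[OF R f] .
  hence c: "a (f s) \<odot>\<^bsub>P\<^esub> v s \<in> carrier P" if "s \<in> A" for s
    using P.smult_closed[OF ring_hom_closed[OF a cring.free_module_coeff[OF R f]] v] that A(2) by blast
  show ?thesis unfolding lin_ext_def
    using A c v by (intro P.add.finprod_mono_neutral_cong_left) (auto simp: a0 subset_iff)
qed

lemma lin_ext_semilinear: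
  assumes R: "cring R" and P: "Module.module C P" and a: "a \<in> ring_hom R C"
    and v: "\<And>s. s \<in> S \<Longrightarrow> v s \<in> carrier P"
  shows "semilinear R (free_module R S) P a (lin_ext R P a v)"
    and "\<And>s. s \<in> S \<Longrightarrow> lin_ext R P a v (delta R s) = v s"
proof -
  interpret R: cring R by fact
  interpret P: Module.module C P by fact
  interpret F: Module.module R "free_module R S" by (rule R.module_free_module)
  have fin: "lin_ext R P a v f = (\<Oplus>\<^bsub>P\<^esub>s\<in>A. a (f s) \<odot>\<^bsub>P\<^esub> v s)"
    if "f \<in> carrier (free_module R S)" "finite A" "A \<subseteq> S" "{s. f s \<noteq> \<zero>\<^bsub>R\<^esub>} \<subseteq> A" for f A
    using lin_ext_finite[OF R P a v that] .
  have supp: "finite {s. f s \<noteq> \<zero>\<^bsub>R\<^esub>}" "{s. f s \<noteq> \<zero>\<^bsub>R\<^esub>} \<subseteq> S" if "f \<in> carrier (free_module R S)" for f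
    using that by (auto simp: free_module_carrier)
  have c: "a (f s) \<odot>\<^bsub>P\<^esub> v s \<in> carrier P" if "s \<in> S" "f \<in> carrier (free_module R S)" for s f
    using P.smult_closed[OF ring_hom_closed[OF a R.free_module_coeff[OF that(2)]] v[OF that(1)]] .
  have cl: "lin_ext R P a v f \<in> carrier P" if f: "f \<in> carrier (free_module R S)" for f
    unfolding lin_ext_def using c[OF _ f] supp[OF f] by (intro P.finsum_closed) auto
  show "semilinear R (free_module R S) P a (lin_ext R P a v)"
  proof (rule semilinearI[OF cl])
    fix f g assume f: "f \<in> carrier (free_module R S)" and g: "g \<in> carrier (free_module R S)"
    let ?A = "{s. f s \<noteq> \<zero>\<^bsub>R\<^esub>} \<union> {s. g s \<noteq> \<zero>\<^bsub>R\<^esub>}"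
    have A: "finite ?A" "?A \<subseteq> S" "{s. (f \<oplus>\<^bsub>free_module R S\<^esub> g) s \<noteq> \<zero>\<^bsub>R\<^esub>} \<subseteq> ?A"
      using supp f g by (auto simp: free_module_add)
    have "lin_ext R P a v (f \<oplus>\<^bsub>free_module R S\<^esub> g) =
        (\<Oplus>\<^bsub>P\<^esub>s\<in>?A. a (f s) \<odot>\<^bsub>P\<^esub> v s \<oplus>\<^bsub>P\<^esub> a (g s) \<odot>\<^bsub>P\<^esub> v s)"
      unfolding fin[OF F.add.m_closed[OF f g] A]
    proof (intro P.finsum_cong' refl)
      fix s assume "s \<in> ?A"
      hence s: "s \<in> S" using A(2) by blast
      show "a ((f \<oplus>\<^bsub>free_module R S\<^esub> g) s) \<odot>\<^bsub>P\<^esub> v s = a (f s) \<odot>\<^bsub>P\<^esub> v s \<oplus>\<^bsub>P\<^esub> a (g s) \<odot>\<^bsub>P\<^esub> v s"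
        using R.free_module_coeff[OF f, of s] R.free_module_coeff[OF g, of s] ring_hom_closed[OF a] v[OF s]
        by (simp add: free_module_add ring_hom_add[OF a] P.smult_l_distr)
    qed (use A(2) c f g in blast)
    also have "\<dots> = lin_ext R P a v f \<oplus>\<^bsub>P\<^esub> lin_ext R P a v g"
      using A c f g by (subst P.finsum_addf) (auto simp: fin[OF f A(1,2)] fin[OF g A(1,2)])
    finally show "lin_ext R P a v (f \<oplus>\<^bsub>free_module R S\<^esub> g) = lin_ext R P a v f \<oplus>\<^bsub>P\<^esub> lin_ext R P a v g" .
  next
    fix r f assume r: "r \<in> carrier R" and f: "f \<in> carrier (free_module R S)"
    let ?A = "{s. f s \<noteq> \<zero>\<^bsub>R\<^esub>}"
    have A: "finite ?A" "?A \<subseteq> S" "{s. (r \<odot>\<^bsub>free_module R S\<^esub> f) s \<noteq> \<zero>\<^bsub>R\<^esub>} \<subseteq> ?A"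
      using supp f r by (auto simp: free_module_smult)
    have "lin_ext R P a v (r \<odot>\<^bsub>free_module R S\<^esub> f) = (\<Oplus>\<^bsub>P\<^esub>s\<in>?A. a r \<odot>\<^bsub>P\<^esub> (a (f s) \<odot>\<^bsub>P\<^esub> v s))"
      unfolding fin[OF F.smult_closed[OF r f] A]
    proof (intro P.finsum_cong' refl)
      fix s assume "s \<in> ?A"
      hence s: "s \<in> S" using A(2) by blast
      show "a ((r \<odot>\<^bsub>free_module R S\<^esub> f) s) \<odot>\<^bsub>P\<^esub> v s = a r \<odot>\<^bsub>P\<^esub> (a (f s) \<odot>\<^bsub>P\<^esub> v s)"
        using R.free_module_coeff[OF f, of s] r ring_hom_closed[OF a] v[OF s]
        by (simp add: free_module_smult ring_hom_mult[OF a] P.smult_assoc1)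
    qed (use A(2) c[OF _ f] P.smult_closed[OF ring_hom_closed[OF a r]] in blast)
    also have "\<dots> = a r \<odot>\<^bsub>P\<^esub> lin_ext R P a v f"
      unfolding lin_ext_def
      using A c f r ring_hom_closed[OF a] by (intro P.finsum_smult_ldistr[symmetric]) auto
    finally show "lin_ext R P a v (r \<odot>\<^bsub>free_module R S\<^esub> f) = a r \<odot>\<^bsub>P\<^esub> lin_ext R P a v f" .
  qed
  fix s assume s: "s \<in> S"
  have "lin_ext R P a v (delta R s) = (\<Oplus>\<^bsub>P\<^esub>t\<in>{s}. a (delta R s t) \<odot>\<^bsub>P\<^esub> v t)"
    using s by (intro fin R.delta_closed) (auto simp: delta_def)
  also have "\<dots> = v s" using v[OF s] by (simp add: delta_def ring_hom_one[OF a])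
  finally show "lin_ext R P a v (delta R s) = v s" .
qed

section \<open>Tensor powers\<close>

text \<open>The module axioms see only the additive group and the scalars. So a record with a new
  product, such as a monoid algebra, inherits them from the free module.\<close>

lemma module_cong:
  assumes M: "Module.module R M" and c: "carrier M' = carrier M" and z: "\<zero>\<^bsub>M'\<^esub> = \<zero>\<^bsub>M\<^esub>"
    and p: "add M' = add M" and s: "smult M' = smult M"
  shows "Module.module R M'"
proof -
  interpret M: Module.module R M by fact
  have ab: "abelian_group M'"
    by (rule abelian_groupI) (auto simp: c z p M.a_ac intro: M.l_neg)
  show ?thesis
    by (rule moduleI[OF M.is_cring ab]) (auto simp: c p s M.smult_l_distr M.smult_r_distr M.smult_assoc1)
qed

lemma monoid_algebra_simps:
  "carrier (monoid_algebra R G) = carrier (free_module R (carrier G))"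
  "\<zero>\<^bsub>monoid_algebra R G\<^esub> = \<zero>\<^bsub>free_module R (carrier G)\<^esub>"
  "add (monoid_algebra R G) = add (free_module R (carrier G))"
  "smult (monoid_algebra R G) = smult (free_module R (carrier G))"
  "\<one>\<^bsub>monoid_algebra R G\<^esub> = delta R \<one>\<^bsub>G\<^esub>"
  by (auto simp: monoid_algebra_def)

section \<open>Monoid algebras, the source of the product of tensors\<close>

locale monoid_alg = R?: cring R + G: comm_monoid G for R (structure) and G
begin

abbreviation "A \<equiv> monoid_algebra R G"

lemma module_monoid_algebra: "Module.module R A"
  by (rule module_cong[OF module_free_module]) (auto simp: monoid_algebra_simps)

sublocale A: Module.module R A by (rule module_monoid_algebra)

lemma coeff: "f \<in> carrier A \<Longrightarrow> f s \<in> carrier R"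
  using free_module_coeff by (auto simp: monoid_algebra_simps)

lemma supp: "f \<in> carrier A \<Longrightarrow> finite {s. f s \<noteq> \<zero>}" "f \<in> carrier A \<Longrightarrow> f s \<noteq> \<zero> \<Longrightarrow> s \<in> carrier G"
  by (auto simp: monoid_algebra_simps free_module_carrier)

lemma delta_A: "s \<in> carrier G \<Longrightarrow> delta R s \<in> carrier A"
  using delta_closed by (auto simp: monoid_algebra_simps)

lemma induct_A [consumes 1, case_names zero gen add]:
  assumes "f \<in> carrier A" "P \<zero>\<^bsub>A\<^esub>"
    and "\<And>a s. a \<in> carrier R \<Longrightarrow> s \<in> carrier G \<Longrightarrow> P (a \<odot>\<^bsub>A\<^esub> delta R s)"
    and "\<And>f g. f \<in> carrier A \<Longrightarrow> g \<in> carrier A \<Longrightarrow> P f \<Longrightarrow> P g \<Longrightarrow> P (f \<oplus>\<^bsub>A\<^esub> g)"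
  shows "P f"
  using assms unfolding monoid_algebra_simps by (rule free_module_induct)

text \<open>The defining sum runs over pairs in the exact supports. Enlarging it to a rectangle
  \<open>F\<close> times \<open>H\<close> puts products with different factors over a common index
  set, as distributivity requires.\<close>

lemma mult_finite:
  assumes f: "f \<in> carrier A" and g: "g \<in> carrier A"
    and F: "finite F" "{s. f s \<noteq> \<zero>} \<subseteq> F" and H: "finite H" "{s. g s \<noteq> \<zero>} \<subseteq> H"
  shows "(f \<otimes>\<^bsub>A\<^esub> g) z = (\<Oplus>p\<in>{p \<in> F \<times> H. fst p \<otimes>\<^bsub>G\<^esub> snd p = z}. f (fst p) \<otimes> g (snd p))"
proof -
  have "(f \<otimes>\<^bsub>A\<^esub> g) z = (\<Oplus>p\<in>{(x, y). f x \<noteq> \<zero> \<and> g y \<noteq> \<zero> \<and> x \<otimes>\<^bsub>G\<^esub> y = z}. f (fst p) \<otimes> g (snd p))"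
    by (simp add: monoid_algebra_def)
  also have "\<dots> = (\<Oplus>p\<in>{p \<in> F \<times> H. fst p \<otimes>\<^bsub>G\<^esub> snd p = z}. f (fst p) \<otimes> g (snd p))"
  proof (rule R.add.finprod_mono_neutral_cong_left)
    show "finite {p \<in> F \<times> H. fst p \<otimes>\<^bsub>G\<^esub> snd p = z}" using F H by auto
    show "f (fst i) \<otimes> g (snd i) = \<zero>"
      if "i \<in> {p \<in> F \<times> H. fst p \<otimes>\<^bsub>G\<^esub> snd p = z} - {(x, y). f x \<noteq> \<zero> \<and> g y \<noteq> \<zero> \<and> x \<otimes>\<^bsub>G\<^esub> y = z}" for i
    proof -
      have "f (fst i) = \<zero> \<or> g (snd i) = \<zero>" using that by auto
      thus ?thesis using coeff[OF f] coeff[OF g] by auto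
    qed
  qed (use F H coeff[OF f] coeff[OF g] in auto)
  finally show ?thesis .
qed

lemma mult_add_right:
  assumes f: "f \<in> carrier A" and g: "g \<in> carrier A" and h: "h \<in> carrier A"
  shows "f \<otimes>\<^bsub>A\<^esub> (g \<oplus>\<^bsub>A\<^esub> h) = f \<otimes>\<^bsub>A\<^esub> g \<oplus>\<^bsub>A\<^esub> f \<otimes>\<^bsub>A\<^esub> h"
proof
  fix z
  let ?F = "{s. f s \<noteq> \<zero>}" and ?H = "{s. g s \<noteq> \<zero>} \<union> {s. h s \<noteq> \<zero>}"
  let ?I = "{p \<in> ?F \<times> ?H. fst p \<otimes>\<^bsub>G\<^esub> snd p = z}"
  have fin: "finite ?F" "finite ?H" using supp(1) f g h by auto
  have sub: "{s. (g \<oplus>\<^bsub>A\<^esub> h) s \<noteq> \<zero>} \<subseteq> ?H" by (auto simp: monoid_algebra_simps free_module_add)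
  note c = coeff[OF f] coeff[OF g] coeff[OF h]
  have "(f \<otimes>\<^bsub>A\<^esub> (g \<oplus>\<^bsub>A\<^esub> h)) z = (\<Oplus>p\<in>?I. f (fst p) \<otimes> (g \<oplus>\<^bsub>A\<^esub> h) (snd p))"
    by (rule mult_finite[OF f A.add.m_closed[OF g h] fin(1) subset_refl fin(2) sub])
  also have "\<dots> = (\<Oplus>p\<in>?I. f (fst p) \<otimes> g (snd p) \<oplus> f (fst p) \<otimes> h (snd p))"
    using c by (simp add: monoid_algebra_simps free_module_add R.r_distr)
  also have "\<dots> = (f \<otimes>\<^bsub>A\<^esub> g) z \<oplus> (f \<otimes>\<^bsub>A\<^esub> h) z"
    using c by (subst R.finsum_addf) (auto simp: mult_finite[OF f g fin(1) _ fin(2)] mult_finite[OF f h fin(1) _ fin(2)])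
  finally show "(f \<otimes>\<^bsub>A\<^esub> (g \<oplus>\<^bsub>A\<^esub> h)) z = (f \<otimes>\<^bsub>A\<^esub> g \<oplus>\<^bsub>A\<^esub> f \<otimes>\<^bsub>A\<^esub> h) z"
    by (simp add: monoid_algebra_simps free_module_add)
qed

lemma mult_smult_right:
  assumes f: "f \<in> carrier A" and g: "g \<in> carrier A" and a: "a \<in> carrier R"
  shows "f \<otimes>\<^bsub>A\<^esub> (a \<odot>\<^bsub>A\<^esub> g) = a \<odot>\<^bsub>A\<^esub> (f \<otimes>\<^bsub>A\<^esub> g)"
proof
  fix z
  let ?F = "{s. f s \<noteq> \<zero>}" and ?H = "{s. g s \<noteq> \<zero>}"
  let ?I = "{p \<in> ?F \<times> ?H. fst p \<otimes>\<^bsub>G\<^esub> snd p = z}"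
  have fin: "finite ?F" "finite ?H" using supp(1) f g by auto
  have sub: "{s. (a \<odot>\<^bsub>A\<^esub> g) s \<noteq> \<zero>} \<subseteq> ?H" using a by (auto simp: monoid_algebra_simps free_module_smult)
  note c = coeff[OF f] coeff[OF g]
  have "(f \<otimes>\<^bsub>A\<^esub> (a \<odot>\<^bsub>A\<^esub> g)) z = (\<Oplus>p\<in>?I. f (fst p) \<otimes> (a \<odot>\<^bsub>A\<^esub> g) (snd p))"
    by (rule mult_finite[OF f A.smult_closed[OF a g] fin(1) subset_refl fin(2) sub])
  also have "\<dots> = (\<Oplus>p\<in>?I. a \<otimes> (f (fst p) \<otimes> g (snd p)))"
    using c a by (simp add: monoid_algebra_simps free_module_smult R.m_lcomm)
  also have "\<dots> = a \<otimes> (f \<otimes>\<^bsub>A\<^esub> g) z"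
    using c a fin by (subst R.finsum_rdistr[symmetric]) (auto simp: mult_finite[OF f g fin(1) _ fin(2)])
  finally show "(f \<otimes>\<^bsub>A\<^esub> (a \<odot>\<^bsub>A\<^esub> g)) z = (a \<odot>\<^bsub>A\<^esub> (f \<otimes>\<^bsub>A\<^esub> g)) z"
    by (simp add: monoid_algebra_simps free_module_smult)
qed

lemma mult_comm:
  assumes f: "f \<in> carrier A" and g: "g \<in> carrier A"
  shows "f \<otimes>\<^bsub>A\<^esub> g = g \<otimes>\<^bsub>A\<^esub> f"
proof
  fix z
  let ?F = "{s. f s \<noteq> \<zero>}" and ?H = "{s. g s \<noteq> \<zero>}"
  have fin: "finite ?F" "finite ?H" using supp(1) f g by auto
  note c = coeff[OF f] coeff[OF g]
  have sub: "?F \<subseteq> carrier G" "?H \<subseteq> carrier G" using supp(2) f g by auto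
  \<comment> \<open>Commutativity of the monoid: exchanging the two entries of a pair matches the
    index sets of the two products.\<close>
  have im: "{p \<in> ?F \<times> ?H. fst p \<otimes>\<^bsub>G\<^esub> snd p = z} = prod.swap ` {p \<in> ?H \<times> ?F. fst p \<otimes>\<^bsub>G\<^esub> snd p = z}"
    using sub by (auto simp: image_iff G.m_comm subset_iff)
  have "(f \<otimes>\<^bsub>A\<^esub> g) z = (\<Oplus>p\<in>{p \<in> ?F \<times> ?H. fst p \<otimes>\<^bsub>G\<^esub> snd p = z}. f (fst p) \<otimes> g (snd p))"
    by (rule mult_finite[OF f g fin(1) subset_refl fin(2) subset_refl])
  also have "\<dots> = (\<Oplus>p\<in>{p \<in> ?H \<times> ?F. fst p \<otimes>\<^bsub>G\<^esub> snd p = z}. g (fst p) \<otimes> f (snd p))"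
    unfolding im using c by (subst R.finsum_reindex) (auto simp: R.m_comm)
  also have "\<dots> = (g \<otimes>\<^bsub>A\<^esub> f) z"
    by (rule mult_finite[OF g f fin(2) subset_refl fin(1) subset_refl, symmetric])
  finally show "(f \<otimes>\<^bsub>A\<^esub> g) z = (g \<otimes>\<^bsub>A\<^esub> f) z" .
qed

lemma mult_closed:
  assumes f: "f \<in> carrier A" and g: "g \<in> carrier A"
  shows "f \<otimes>\<^bsub>A\<^esub> g \<in> carrier A"
proof -
  let ?F = "{s. f s \<noteq> \<zero>}" and ?H = "{s. g s \<noteq> \<zero>}"
  have fin: "finite ?F" "finite ?H" using supp(1) f g by auto
  note c = coeff[OF f] coeff[OF g]
  have e: "(f \<otimes>\<^bsub>A\<^esub> g) z = (\<Oplus>p\<in>{p \<in> ?F \<times> ?H. fst p \<otimes>\<^bsub>G\<^esub> snd p = z}. f (fst p) \<otimes> g (snd p))" for z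
    by (rule mult_finite[OF f g fin(1) subset_refl fin(2) subset_refl])
  \<comment> \<open>The product can be nonzero only at products of support points, of which there
    are finitely many.\<close>
  let ?S = "(\<lambda>p. fst p \<otimes>\<^bsub>G\<^esub> snd p) ` (?F \<times> ?H)"
  have S: "?S \<subseteq> carrier G" using supp(2)[OF f] supp(2)[OF g] by auto
  have z: "(f \<otimes>\<^bsub>A\<^esub> g) z = \<zero>" if "z \<notin> ?S" for z
  proof -
    have "{p \<in> ?F \<times> ?H. fst p \<otimes>\<^bsub>G\<^esub> snd p = z} = {}" using that by blast
    thus ?thesis using e[of z] by (simp only: R.finsum_empty)
  qed
  have "(f \<otimes>\<^bsub>A\<^esub> g) z \<in> carrier R" for z
    unfolding e using c by (intro R.finsum_closed) auto
  moreover have "{z. (f \<otimes>\<^bsub>A\<^esub> g) z \<noteq> \<zero>} \<subseteq> ?S" using z by blast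
  hence "finite {z. (f \<otimes>\<^bsub>A\<^esub> g) z \<noteq> \<zero>}"
    using finite_imageI[OF finite_cartesian_product[OF fin]] by (rule finite_subset)
  moreover have "(f \<otimes>\<^bsub>A\<^esub> g) z = \<zero>" if "z \<notin> carrier G" for z
    using z[of z] S that by blast
  ultimately show ?thesis unfolding monoid_algebra_simps(1) free_module_carrier by blast
qed

lemma mult_delta:
  assumes x: "x \<in> carrier G" and y: "y \<in> carrier G"
  shows "delta R x \<otimes>\<^bsub>A\<^esub> delta R y = delta R (x \<otimes>\<^bsub>G\<^esub> y)"
proof
  fix z
  have "(delta R x \<otimes>\<^bsub>A\<^esub> delta R y) z =
      (\<Oplus>p\<in>{p \<in> {x} \<times> {y}. fst p \<otimes>\<^bsub>G\<^esub> snd p = z}. delta R x (fst p) \<otimes> delta R y (snd p))"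
    by (rule mult_finite[OF delta_A[OF x] delta_A[OF y]]) (auto simp: delta_def)
  also have "{p \<in> {x} \<times> {y}. fst p \<otimes>\<^bsub>G\<^esub> snd p = z} = (if x \<otimes>\<^bsub>G\<^esub> y = z then {(x, y)} else {})" by auto
  finally show "(delta R x \<otimes>\<^bsub>A\<^esub> delta R y) z = delta R (x \<otimes>\<^bsub>G\<^esub> y) z" by (auto simp: delta_def)
qed

lemma mult_add_left:
  assumes "f \<in> carrier A" "g \<in> carrier A" "h \<in> carrier A"
  shows "(g \<oplus>\<^bsub>A\<^esub> h) \<otimes>\<^bsub>A\<^esub> f = g \<otimes>\<^bsub>A\<^esub> f \<oplus>\<^bsub>A\<^esub> h \<otimes>\<^bsub>A\<^esub> f"
  using mult_add_right[OF assms] mult_comm assms A.add.m_closed by metis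

lemma mult_smult_left:
  assumes "f \<in> carrier A" "g \<in> carrier A" "a \<in> carrier R"
  shows "(a \<odot>\<^bsub>A\<^esub> g) \<otimes>\<^bsub>A\<^esub> f = a \<odot>\<^bsub>A\<^esub> (g \<otimes>\<^bsub>A\<^esub> f)"
  using mult_smult_right[OF assms] mult_comm assms A.smult_closed by metis

lemma mult_zero_right: "f \<in> carrier A \<Longrightarrow> f \<otimes>\<^bsub>A\<^esub> \<zero>\<^bsub>A\<^esub> = \<zero>\<^bsub>A\<^esub>"
  using mult_smult_right[of f "\<zero>\<^bsub>A\<^esub>" \<zero>] by (simp add: mult_closed)

lemma mult_zero_left: "f \<in> carrier A \<Longrightarrow> \<zero>\<^bsub>A\<^esub> \<otimes>\<^bsub>A\<^esub> f = \<zero>\<^bsub>A\<^esub>"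
  using mult_zero_right mult_comm by simp

text \<open>Both sides are additive and homogeneous in each factor, so the three factors are reduced
  one after another to basis elements, where the claim is associativity in the monoid; no triple sum
  occurs.\<close>

lemma mult_assoc:
  assumes f: "f \<in> carrier A" and g: "g \<in> carrier A" and h: "h \<in> carrier A"
  shows "(f \<otimes>\<^bsub>A\<^esub> g) \<otimes>\<^bsub>A\<^esub> h = f \<otimes>\<^bsub>A\<^esub> (g \<otimes>\<^bsub>A\<^esub> h)"
  using f
proof (induction rule: induct_A)
  case zero
  show ?case by (simp add: mult_zero_left mult_closed g h)
next
  case (add f f')
  thus ?case by (simp add: mult_add_left mult_closed g h)
next
  case (gen a x)
  note x = gen delta_A[OF gen(2)]
  have "(delta R x \<otimes>\<^bsub>A\<^esub> g) \<otimes>\<^bsub>A\<^esub> h = delta R x \<otimes>\<^bsub>A\<^esub> (g \<otimes>\<^bsub>A\<^esub> h)"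
    using g
  proof (induction rule: induct_A)
    case zero
    show ?case by (simp add: mult_zero_left mult_zero_right mult_closed x h)
  next
    case (add g g')
    thus ?case by (simp add: mult_add_left mult_add_right mult_closed x h)
  next
    case (gen b y)
    note y = gen delta_A[OF gen(2)]
    have "(delta R x \<otimes>\<^bsub>A\<^esub> delta R y) \<otimes>\<^bsub>A\<^esub> h = delta R x \<otimes>\<^bsub>A\<^esub> (delta R y \<otimes>\<^bsub>A\<^esub> h)"
      using h
    proof (induction rule: induct_A)
      case zero
      show ?case by (simp add: mult_zero_right mult_closed x y)
    next
      case (add h h')
      thus ?case by (simp add: mult_add_right mult_closed x y)
    next
      case (gen c z)
      note z = gen delta_A[OF gen(2)]
      show ?case using x y z by (simp add: mult_smult_right mult_closed mult_delta G.m_assoc delta_A)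
    qed
    thus ?case using x y h by (simp add: mult_smult_right mult_smult_left mult_closed)
  qed
  thus ?case using x g h by (simp add: mult_smult_left mult_closed)
qed

lemma mult_one: "f \<in> carrier A \<Longrightarrow> \<one>\<^bsub>A\<^esub> \<otimes>\<^bsub>A\<^esub> f = f"
proof (induction rule: induct_A)
  case zero
  show ?case by (simp add: mult_zero_right monoid_algebra_simps(5) delta_A)
next
  case (add f f')
  thus ?case by (simp add: mult_add_right monoid_algebra_simps(5) delta_A)
next
  case (gen a x)
  thus ?case by (simp add: mult_smult_right mult_delta monoid_algebra_simps(5) delta_A)
qed

lemma algebra_monoid_algebra: "Module.algebra R A"
proof (rule algebraI[OF R.is_cring])
  show "cring A"
  proof (rule cringI)
    show "abelian_group A" by (rule A.abelian_group_axioms)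
    show "comm_monoid A"
    proof (rule comm_monoidI)
      show "\<one>\<^bsub>A\<^esub> \<in> carrier A" by (simp only: monoid_algebra_simps(5) delta_A G.one_closed)
    qed (rule mult_closed mult_assoc mult_one mult_comm; assumption)+
  qed (simp add: mult_add_left)
qed (auto simp: A.smult_l_distr A.smult_r_distr A.smult_assoc1 mult_smult_left)

end

lemma module_cring: "Module.module R M \<Longrightarrow> cring R"
  by (simp add: Module.module_def)

section \<open>Tensor powers of a module and their universal property\<close>

lemma comm_monoid_tuple_monoid:
  assumes "comm_monoid M" shows "comm_monoid (tuple_monoid M n)"
proof -
  interpret M: comm_monoid M by fact
  show ?thesis
    by (rule comm_monoidI)
      (auto simp: tuple_monoid_def PiE_iff extensional_def restrict_def fun_eq_iff M.m_assoc intro!: M.m_comm)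
qed

lemma tuple_carrier: "carrier (tuple_monoid M n) = {..<n} \<rightarrow>\<^sub>E carrier M"
  by (simp add: tuple_monoid_def)

lemma tuple_update: "x \<in> {..<n} \<rightarrow>\<^sub>E A \<Longrightarrow> i < n \<Longrightarrow> y \<in> A \<Longrightarrow> x(i := y) \<in> {..<n} \<rightarrow>\<^sub>E A"
  by (auto simp: PiE_iff extensional_def)

lemma tensor_free_simps:
  "carrier (tensor_free R M n) = carrier (free_module R ({..<n} \<rightarrow>\<^sub>E carrier M))"
  "\<zero>\<^bsub>tensor_free R M n\<^esub> = \<zero>\<^bsub>free_module R ({..<n} \<rightarrow>\<^sub>E carrier M)\<^esub>"
  "add (tensor_free R M n) = add (free_module R ({..<n} \<rightarrow>\<^sub>E carrier M))"
  "smult (tensor_free R M n) = smult (free_module R ({..<n} \<rightarrow>\<^sub>E carrier M))"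
  by (simp_all add: tensor_free_def monoid_algebra_simps tuple_carrier)

lemma semilinear_tensor_free:
  "semilinear R (tensor_free R M n) P a h \<longleftrightarrow> semilinear R (free_module R ({..<n} \<rightarrow>\<^sub>E carrier M)) P a h"
  by (simp add: semilinear_def tensor_free_simps)

lemma module_tensor_free: "cring R \<Longrightarrow> Module.module R (tensor_free R M n)"
  by (rule module_cong[OF cring.module_free_module]) (auto simp: tensor_free_simps)

lemma delta_tensor_free: "cring R \<Longrightarrow> x \<in> {..<n} \<rightarrow>\<^sub>E carrier M \<Longrightarrow> delta R x \<in> carrier (tensor_free R M n)"
  using cring.delta_closed by (auto simp: tensor_free_simps)

definition tensor_gens :: "('a, 'm) ring_scheme \<Rightarrow> ('a, 'b, 'k) module_scheme \<Rightarrow> nat \<Rightarrow> ((nat \<Rightarrow> 'b) \<Rightarrow> 'a) set" where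
  "tensor_gens R M n = {delta R (x(i := y \<oplus>\<^bsub>M\<^esub> z)) \<ominus>\<^bsub>tensor_free R M n\<^esub>
         (delta R (x(i := y)) \<oplus>\<^bsub>tensor_free R M n\<^esub> delta R (x(i := z))) | x i y z.
         x \<in> {..<n} \<rightarrow>\<^sub>E carrier M \<and> i < n \<and> y \<in> carrier M \<and> z \<in> carrier M} \<union>
      {delta R (x(i := a \<odot>\<^bsub>M\<^esub> y)) \<ominus>\<^bsub>tensor_free R M n\<^esub>
         (a \<odot>\<^bsub>tensor_free R M n\<^esub> delta R (x(i := y))) | x i a y.
         x \<in> {..<n} \<rightarrow>\<^sub>E carrier M \<and> i < n \<and> a \<in> carrier R \<and> y \<in> carrier M}"

lemma tensor_rel_gens: "tensor_rel R M n = submodule_gen R (tensor_free R M n) (tensor_gens R M n)"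
  by (simp add: tensor_rel_def tensor_gens_def)

lemma tensor_gens_cases:
  assumes "g \<in> tensor_gens R M n"
  obtains (add) x i y z where "x \<in> {..<n} \<rightarrow>\<^sub>E carrier M" "i < n" "y \<in> carrier M" "z \<in> carrier M"
      "g = delta R (x(i := y \<oplus>\<^bsub>M\<^esub> z)) \<ominus>\<^bsub>tensor_free R M n\<^esub>
         (delta R (x(i := y)) \<oplus>\<^bsub>tensor_free R M n\<^esub> delta R (x(i := z)))"
    | (smult) x i a y where "x \<in> {..<n} \<rightarrow>\<^sub>E carrier M" "i < n" "a \<in> carrier R" "y \<in> carrier M"
      "g = delta R (x(i := a \<odot>\<^bsub>M\<^esub> y)) \<ominus>\<^bsub>tensor_free R M n\<^esub>
         (a \<odot>\<^bsub>tensor_free R M n\<^esub> delta R (x(i := y)))"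
  using assms unfolding tensor_gens_def by blast

lemma tensor_gens_addI:
  assumes "x \<in> {..<n} \<rightarrow>\<^sub>E carrier M" "i < n" "y \<in> carrier M" "z \<in> carrier M"
  shows "delta R (x(i := y \<oplus>\<^bsub>M\<^esub> z)) \<ominus>\<^bsub>tensor_free R M n\<^esub>
         (delta R (x(i := y)) \<oplus>\<^bsub>tensor_free R M n\<^esub> delta R (x(i := z))) \<in> tensor_rel R M n"
  unfolding tensor_rel_gens using assms
  by (intro subsetD[OF submodule_gen_superset]) (unfold tensor_gens_def, blast)

lemma tensor_gens_smultI:
  assumes "x \<in> {..<n} \<rightarrow>\<^sub>E carrier M" "i < n" "a \<in> carrier R" "y \<in> carrier M"
  shows "delta R (x(i := a \<odot>\<^bsub>M\<^esub> y)) \<ominus>\<^bsub>tensor_free R M n\<^esub>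
         (a \<odot>\<^bsub>tensor_free R M n\<^esub> delta R (x(i := y))) \<in> tensor_rel R M n"
  unfolding tensor_rel_gens using assms
  by (intro subsetD[OF submodule_gen_superset]) (unfold tensor_gens_def, blast)

lemma tensor_gens_carrier:
  assumes "Module.module R M"
  shows "tensor_gens R M n \<subseteq> carrier (tensor_free R M n)"
proof
  interpret M: Module.module R M by fact
  interpret F: Module.module R "tensor_free R M n" by (rule module_tensor_free[OF M.is_cring])
  note d = delta_tensor_free[OF M.is_cring tuple_update]
  fix g assume "g \<in> tensor_gens R M n"
  thus "g \<in> carrier (tensor_free R M n)"
    by (cases rule: tensor_gens_cases) (auto intro!: F.minus_closed F.add.m_closed F.smult_closed d)
qed

lemma submodule_tensor_rel:
  assumes "Module.module R M"
  shows "submodule (tensor_rel R M n) R (tensor_free R M n)"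
  unfolding tensor_rel_gens
  by (rule submodule_gen_submodule[OF module_tensor_free[OF module_cring[OF assms]] tensor_gens_carrier[OF assms]])

lemma module_tensor_power:
  assumes "Module.module R M" shows "Module.module R (tensor_power R M n)"
  unfolding tensor_power_def
  by (rule module_quot_module[OF module_tensor_free[OF module_cring[OF assms]] submodule_tensor_rel[OF assms]])

lemma pure_tensor_closed:
  assumes "Module.module R M" "x \<in> {..<n} \<rightarrow>\<^sub>E carrier M"
  shows "pure_tensor R M n x \<in> carrier (tensor_power R M n)"
  using delta_tensor_free[OF module_cring[OF assms(1)] assms(2)]
  by (auto simp: tensor_power_def pure_tensor_def quot_module_carrier)

lemma pure_tensor_add:
  assumes M: "Module.module R M" and x: "x \<in> {..<n} \<rightarrow>\<^sub>E carrier M" "i < n" "y \<in> carrier M" "z \<in> carrier M"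
  shows "pure_tensor R M n (x(i := y \<oplus>\<^bsub>M\<^esub> z)) =
    pure_tensor R M n (x(i := y)) \<oplus>\<^bsub>tensor_power R M n\<^esub> pure_tensor R M n (x(i := z))"
proof -
  interpret M: Module.module R M by fact
  note F = module_tensor_free[OF M.is_cring, of M n]
  interpret F: Module.module R "tensor_free R M n" by (rule F)
  note N = submodule_tensor_rel[OF M, of n]
  note d = delta_tensor_free[OF M.is_cring tuple_update[OF x(1,2)]]
  have "delta R (x(i := y \<oplus>\<^bsub>M\<^esub> z)) \<ominus>\<^bsub>tensor_free R M n\<^esub>
         (delta R (x(i := y)) \<oplus>\<^bsub>tensor_free R M n\<^esub> delta R (x(i := z))) \<in> tensor_rel R M n"
    by (rule tensor_gens_addI[OF x])
  thus ?thesis unfolding pure_tensor_def tensor_power_def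
    using x d by (simp add: quot_module_add[OF submodule_abelian_subgroup[OF F N]] quot_module_eq_iff[OF F N])
qed

lemma pure_tensor_smult:
  assumes M: "Module.module R M" and x: "x \<in> {..<n} \<rightarrow>\<^sub>E carrier M" "i < n" "y \<in> carrier M" "a \<in> carrier R"
  shows "pure_tensor R M n (x(i := a \<odot>\<^bsub>M\<^esub> y)) = a \<odot>\<^bsub>tensor_power R M n\<^esub> pure_tensor R M n (x(i := y))"
proof -
  interpret M: Module.module R M by fact
  note F = module_tensor_free[OF M.is_cring, of M n]
  interpret F: Module.module R "tensor_free R M n" by (rule F)
  note N = submodule_tensor_rel[OF M, of n]
  note d = delta_tensor_free[OF M.is_cring tuple_update[OF x(1,2)]]
  have "delta R (x(i := a \<odot>\<^bsub>M\<^esub> y)) \<ominus>\<^bsub>tensor_free R M n\<^esub>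
         (a \<odot>\<^bsub>tensor_free R M n\<^esub> delta R (x(i := y))) \<in> tensor_rel R M n"
    by (rule tensor_gens_smultI[OF x(1,2,4,3)])
  thus ?thesis unfolding pure_tensor_def tensor_power_def
    using x d by (simp add: quot_module_smult[OF F N] quot_module_eq_iff[OF F N])
qed

text \<open>Zero is covered by \<open>gen\<close>: it is the multiple by the scalar zero of the pure
  tensor of zeros.\<close>

lemma tensor_power_induct [consumes 2, case_names gen add]:
  assumes M: "Module.module R M" and t: "t \<in> carrier (tensor_power R M n)"
    and g: "\<And>a x. a \<in> carrier R \<Longrightarrow> x \<in> {..<n} \<rightarrow>\<^sub>E carrier M \<Longrightarrow> P (a \<odot>\<^bsub>tensor_power R M n\<^esub> pure_tensor R M n x)"
    and p: "\<And>s t. s \<in> carrier (tensor_power R M n) \<Longrightarrow> t \<in> carrier (tensor_power R M n) \<Longrightarrow> P s \<Longrightarrow> P t \<Longrightarrow>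
        P (s \<oplus>\<^bsub>tensor_power R M n\<^esub> t)"
  shows "P t"
proof -
  interpret M: Module.module R M by fact
  note F = module_tensor_free[OF M.is_cring, of M n]
  interpret F: Module.module R "tensor_free R M n" by (rule F)
  note N = submodule_tensor_rel[OF M, of n]
  interpret T: Module.module R "tensor_power R M n" by (rule module_tensor_power[OF M])
  obtain f where f: "f \<in> carrier (tensor_free R M n)" "t = tensor_rel R M n +>\<^bsub>tensor_free R M n\<^esub> f"
    using t by (auto simp: tensor_power_def quot_module_carrier)
  have "f \<in> carrier (free_module R ({..<n} \<rightarrow>\<^sub>E carrier M))" using f(1) by (simp add: tensor_free_simps)
  hence "P (tensor_rel R M n +>\<^bsub>tensor_free R M n\<^esub> f)"
  proof (induction rule: M.R.free_module_induct)
    case zero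
    have x: "(\<lambda>i\<in>{..<n}. \<zero>\<^bsub>M\<^esub>) \<in> {..<n} \<rightarrow>\<^sub>E carrier M" by auto
    have "tensor_rel R M n +>\<^bsub>tensor_free R M n\<^esub> \<zero>\<^bsub>tensor_free R M n\<^esub> = \<zero>\<^bsub>tensor_power R M n\<^esub>"
      using semilinear_zero[OF F module_quot_module[OF F N] quot_module_semilinear[OF F N]]
      by (simp add: tensor_power_def)
    thus ?case using g[OF M.R.zero_closed x] pure_tensor_closed[OF M x] by (simp add: tensor_free_simps)
  next
    case (gen a x)
    thus ?case using g[OF gen] quot_module_smult[OF F N gen(1) delta_tensor_free[OF M.is_cring gen(2)]]
      by (simp add: tensor_free_simps pure_tensor_def tensor_power_def)
  next
    case (add f h)
    hence c: "f \<in> carrier (tensor_free R M n)" "h \<in> carrier (tensor_free R M n)"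
      by (simp_all add: tensor_free_simps)
    hence "tensor_rel R M n +>\<^bsub>tensor_free R M n\<^esub> f \<in> carrier (tensor_power R M n)"
      "tensor_rel R M n +>\<^bsub>tensor_free R M n\<^esub> h \<in> carrier (tensor_power R M n)"
      by (auto simp: tensor_power_def quot_module_carrier)
    from p[OF this add(3,4)] show ?case
      using quot_module_add[OF submodule_abelian_subgroup[OF F N] c]
      by (simp add: tensor_free_simps tensor_power_def)
  qed
  thus ?thesis using f(2) by simp
qed

text \<open>The universal property, with target a module over another ring \<open>C\<close> and
  linearity along \<open>a\<close>. The two conditions on \<open>v\<close> say that its extension to
  the free module kills the two kinds of generators of \<open>tensor_rel\<close>. The twist by
  \<open>a\<close> serves base change as well as targets whose natural scalars form an algebra over
  \<open>R\<close>.\<close>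

lemma tensor_lift:
  assumes M: "Module.module R M" and P: "Module.module C P" and a: "a \<in> ring_hom R C"
    and v: "\<And>x. x \<in> {..<n} \<rightarrow>\<^sub>E carrier M \<Longrightarrow> v x \<in> carrier P"
    and va: "\<And>x i y z. x \<in> {..<n} \<rightarrow>\<^sub>E carrier M \<Longrightarrow> i < n \<Longrightarrow> y \<in> carrier M \<Longrightarrow> z \<in> carrier M \<Longrightarrow>
        v (x(i := y \<oplus>\<^bsub>M\<^esub> z)) = v (x(i := y)) \<oplus>\<^bsub>P\<^esub> v (x(i := z))"
    and vs: "\<And>x i y r. x \<in> {..<n} \<rightarrow>\<^sub>E carrier M \<Longrightarrow> i < n \<Longrightarrow> y \<in> carrier M \<Longrightarrow> r \<in> carrier R \<Longrightarrow>
        v (x(i := r \<odot>\<^bsub>M\<^esub> y)) = a r \<odot>\<^bsub>P\<^esub> v (x(i := y))"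
  shows "semilinear R (tensor_power R M n) P a (coset_lift (lin_ext R P a v))"
    and "\<And>x. x \<in> {..<n} \<rightarrow>\<^sub>E carrier M \<Longrightarrow> coset_lift (lin_ext R P a v) (pure_tensor R M n x) = v x"
proof -
  interpret M: Module.module R M by fact
  interpret P: Module.module C P by fact
  note F = module_tensor_free[OF M.is_cring, of M n]
  interpret F: Module.module R "tensor_free R M n" by (rule F)
  note N = submodule_tensor_rel[OF M, of n]
  have l: "semilinear R (tensor_free R M n) P a (lin_ext R P a v)"
    and d: "lin_ext R P a v (delta R x) = v x" if "x \<in> {..<n} \<rightarrow>\<^sub>E carrier M" for x
    using lin_ext_semilinear[OF M.is_cring P a v] that by (auto simp: semilinear_tensor_free)
  have l: "semilinear R (tensor_free R M n) P a (lin_ext R P a v)"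
    using lin_ext_semilinear(1)[OF M.is_cring P a v] by (auto simp: semilinear_tensor_free)
  note dc = delta_tensor_free[OF M.is_cring tuple_update]
  note ll = semilinear_add[OF l] semilinear_smult[OF l] semilinear_minus[OF F P l]
  have z: "lin_ext R P a v t = \<zero>\<^bsub>P\<^esub>" if "t \<in> tensor_rel R M n" for t
  proof (rule semilinear_submodule_gen_zero[OF F P l _ tensor_gens_carrier[OF M] _ that[unfolded tensor_rel_gens]])
    fix g assume "g \<in> tensor_gens R M n"
    thus "lin_ext R P a v g = \<zero>\<^bsub>P\<^esub>"
    proof (cases rule: tensor_gens_cases)
      case (add x i y z)
      thus ?thesis
        using tuple_update[OF add(1,2)] v
        by (simp add: ll dc d va abelian_group_minus_eq_zero_iff[OF P.abelian_group_axioms])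
    next
      case (smult x i r y)
      thus ?thesis
        using tuple_update[OF smult(1,2)] v ring_hom_closed[OF a]
        by (simp add: ll dc d vs abelian_group_minus_eq_zero_iff[OF P.abelian_group_axioms])
    qed
  qed (use ring_hom_closed[OF a] in auto)
  show "semilinear R (tensor_power R M n) P a (coset_lift (lin_ext R P a v))"
    unfolding tensor_power_def by (rule coset_lift_semilinear(1)[OF F N P l z])
  fix x assume x: "x \<in> {..<n} \<rightarrow>\<^sub>E carrier M"
  show "coset_lift (lin_ext R P a v) (pure_tensor R M n x) = v x"
    unfolding pure_tensor_def
    using coset_lift_semilinear(2)[OF F N P l z delta_tensor_free[OF M.is_cring x]] d[OF x] by simp
qed

lemma restrict_update: "i < n \<Longrightarrow> (\<lambda>j\<in>{..<n}. u ((x(i := y)) j)) = (\<lambda>j\<in>{..<n}. u (x j))(i := u y)"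
  by (auto simp: fun_eq_iff)

lemma tensor_map:
  assumes M: "Module.module R M" and M': "Module.module R' M'" and a: "a \<in> ring_hom R R'"
    and u: "semilinear R M M' a u"
  shows "semilinear R (tensor_power R M n) (tensor_power R' M' n) a (tensor_map R R' M' n a u)"
    and "\<And>x. x \<in> {..<n} \<rightarrow>\<^sub>E carrier M \<Longrightarrow>
      tensor_map R R' M' n a u (pure_tensor R M n x) = pure_tensor R' M' n (\<lambda>i\<in>{..<n}. u (x i))"
proof -
  have t: "(\<lambda>i\<in>{..<n}. u (x i)) \<in> {..<n} \<rightarrow>\<^sub>E carrier M'" if "x \<in> {..<n} \<rightarrow>\<^sub>E carrier M" for x
    using that semilinear_closed[OF u] by auto
  let ?v = "\<lambda>x. pure_tensor R' M' n (\<lambda>i\<in>{..<n}. u (x i))"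
  have va: "?v (x(i := y \<oplus>\<^bsub>M\<^esub> z)) = ?v (x(i := y)) \<oplus>\<^bsub>tensor_power R' M' n\<^esub> ?v (x(i := z))"
    if "x \<in> {..<n} \<rightarrow>\<^sub>E carrier M" "i < n" "y \<in> carrier M" "z \<in> carrier M" for x i y z
    unfolding restrict_update[OF that(2)] semilinear_add[OF u that(3,4)]
    by (rule pure_tensor_add[OF M' t[OF that(1)] that(2) semilinear_closed[OF u that(3)] semilinear_closed[OF u that(4)]])
  have vs: "?v (x(i := r \<odot>\<^bsub>M\<^esub> y)) = a r \<odot>\<^bsub>tensor_power R' M' n\<^esub> ?v (x(i := y))"
    if "x \<in> {..<n} \<rightarrow>\<^sub>E carrier M" "i < n" "y \<in> carrier M" "r \<in> carrier R" for x i y r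
    unfolding restrict_update[OF that(2)] semilinear_smult[OF u that(4,3)]
    by (rule pure_tensor_smult[OF M' t[OF that(1)] that(2) semilinear_closed[OF u that(3)] ring_hom_closed[OF a that(4)]])
  show "semilinear R (tensor_power R M n) (tensor_power R' M' n) a (tensor_map R R' M' n a u)"
    and "\<And>x. x \<in> {..<n} \<rightarrow>\<^sub>E carrier M \<Longrightarrow>
      tensor_map R R' M' n a u (pure_tensor R M n x) = pure_tensor R' M' n (\<lambda>i\<in>{..<n}. u (x i))"
    unfolding tensor_map_def
    using tensor_lift[where v = ?v, OF M module_tensor_power[OF M'] a pure_tensor_closed[OF M' t] va vs] by blast+
qed

section \<open>The product on tensor powers of an algebra\<close>

lemma algebra_quot_module:
  assumes M: "Module.algebra R M" and N: "submodule N R M" and I: "ideal N M"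
  shows "Module.algebra R (quot_module M N)"
proof -
  interpret M: Module.algebra R M by fact
  note q = quot_module_carrier quot_module_mult[OF I] quot_module_one
    quot_module_add[OF submodule_abelian_subgroup[OF M.module N]] quot_module_smult[OF M.module N]
  interpret Q: Module.module R "quot_module M N" by (rule module_quot_module[OF M.module N])
  show ?thesis
  proof (rule algebraI[OF M.R_cring])
    show "cring (quot_module M N)"
    proof (rule cringI)
      show "abelian_group (quot_module M N)" by (rule Q.abelian_group_axioms)
      show "comm_monoid (quot_module M N)"
        by (rule comm_monoidI) (auto simp: q M.m_assoc M.m_comm M.m_lcomm)
    qed (auto simp: q M.l_distr)
  qed (auto simp: Q.smult_l_distr Q.smult_r_distr Q.smult_assoc1, auto simp: q M.smult_assoc2)
qed

lemma submodule_ideal: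
  assumes R: "cring M" and N: "submodule N K M"
    and c: "\<And>a x. a \<in> N \<Longrightarrow> x \<in> carrier M \<Longrightarrow> x \<otimes>\<^bsub>M\<^esub> a \<in> N"
  shows "ideal N M"
proof -
  interpret M: cring M by fact
  have s: "subgroup N (add_monoid M)" by (rule submodule.axioms(1)[OF N])
  hence "N \<subseteq> carrier M" using subgroup.subset by fastforce
  hence "a \<otimes>\<^bsub>M\<^esub> x \<in> N" if "a \<in> N" "x \<in> carrier M" for a x
    using c[OF that] that M.m_comm[of a x] by auto
  thus ?thesis using s c by (intro idealI M.ring_axioms)
qed

lemma tensor_free_monoid_alg:
  assumes "Module.algebra R M" shows "monoid_alg R (tuple_monoid M n)"
proof -
  interpret M: Module.algebra R M by fact
  show ?thesis using comm_monoid_tuple_monoid[OF M.comm_monoid_axioms]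
    by (intro monoid_alg.intro M.R_cring)
qed

text \<open>Multiplying a generator by a basis tuple \<open>w\<close> multiplies its tuples
  componentwise by \<open>w\<close> and yields a generator of the same kind. By additivity in the
  multiplier, arbitrary multiples of relations are relations.\<close>

lemma ideal_tensor_rel:
  assumes A: "Module.algebra R M" shows "ideal (tensor_rel R M n) (tensor_free R M n)"
proof -
  interpret M: Module.algebra R M by fact
  interpret F: monoid_alg R "tuple_monoid M n" by (rule tensor_free_monoid_alg[OF A])
  interpret F: Module.algebra R "tensor_free R M n"
    unfolding tensor_free_def by (rule F.algebra_monoid_algebra)
  note N = submodule_tensor_rel[OF M.module, of n]
  have d: "delta R x \<in> carrier (tensor_free R M n)" if "x \<in> {..<n} \<rightarrow>\<^sub>E carrier M" for x
    using delta_tensor_free[OF M.R_cring that] .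
  have m: "delta R x \<otimes>\<^bsub>tensor_free R M n\<^esub> delta R y = delta R (\<lambda>i\<in>{..<n}. x i \<otimes>\<^bsub>M\<^esub> y i)"
    if "x \<in> {..<n} \<rightarrow>\<^sub>E carrier M" "y \<in> {..<n} \<rightarrow>\<^sub>E carrier M" for x y
    using F.mult_delta[of x y] that by (simp add: tuple_carrier tensor_free_def tuple_monoid_def)
  have dm: "delta R w \<otimes>\<^bsub>tensor_free R M n\<^esub> t \<in> tensor_rel R M n"
    if w: "w \<in> {..<n} \<rightarrow>\<^sub>E carrier M" and t: "t \<in> tensor_rel R M n" for w t
  proof -
    let ?h = "\<lambda>t. delta R w \<otimes>\<^bsub>tensor_free R M n\<^esub> t"
    have l: "semilinear R (tensor_free R M n) (tensor_free R M n) (\<lambda>r. r) ?h"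
      using d[OF w] unfolding tensor_free_def
      by (intro semilinearI F.mult_closed F.mult_add_right F.mult_smult_right)
    have u: "(\<lambda>j\<in>{..<n}. w j \<otimes>\<^bsub>M\<^esub> (x(i := y)) j) = (\<lambda>j\<in>{..<n}. w j \<otimes>\<^bsub>M\<^esub> x j)(i := w i \<otimes>\<^bsub>M\<^esub> y)"
      if "i < n" for x i y using that by (auto simp: fun_eq_iff)
    have wx: "(\<lambda>j\<in>{..<n}. w j \<otimes>\<^bsub>M\<^esub> x j) \<in> {..<n} \<rightarrow>\<^sub>E carrier M" if "x \<in> {..<n} \<rightarrow>\<^sub>E carrier M" for x
      using that w by auto
    have wi: "w i \<in> carrier M" if "i < n" for i using that w by auto
    have mu: "delta R w \<otimes>\<^bsub>tensor_free R M n\<^esub> delta R (x(i := y)) =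
        delta R ((\<lambda>j\<in>{..<n}. w j \<otimes>\<^bsub>M\<^esub> x j)(i := w i \<otimes>\<^bsub>M\<^esub> y))"
      if "x \<in> {..<n} \<rightarrow>\<^sub>E carrier M" "i < n" "y \<in> carrier M" for x i y
      using m[OF w tuple_update[OF that]] u[OF that(2)] by (simp only:)
    have "?h g \<in> tensor_rel R M n" if "g \<in> tensor_gens R M n" for g
      using that
    proof (cases rule: tensor_gens_cases)
      case (add x i y z)
      note t = tuple_update[OF add(1,2)]
      have "?h g = delta R ((\<lambda>j\<in>{..<n}. w j \<otimes>\<^bsub>M\<^esub> x j)(i := w i \<otimes>\<^bsub>M\<^esub> y \<oplus>\<^bsub>M\<^esub> w i \<otimes>\<^bsub>M\<^esub> z)) \<ominus>\<^bsub>tensor_free R M n\<^esub>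
         (delta R ((\<lambda>j\<in>{..<n}. w j \<otimes>\<^bsub>M\<^esub> x j)(i := w i \<otimes>\<^bsub>M\<^esub> y)) \<oplus>\<^bsub>tensor_free R M n\<^esub>
          delta R ((\<lambda>j\<in>{..<n}. w j \<otimes>\<^bsub>M\<^esub> x j)(i := w i \<otimes>\<^bsub>M\<^esub> z)))"
        using add(2-4) wi
        by (simp add: add(5) semilinear_minus[OF F.module F.module l] d t mu[OF add(1,2)] w F.r_distr M.r_distr)
      thus ?thesis using tensor_gens_addI[OF wx[OF add(1)] add(2) M.m_closed[OF wi[OF add(2)] add(3)]
          M.m_closed[OF wi[OF add(2)] add(4)], of R] by (simp only:)
    next
      case (smult x i a y)
      note t = tuple_update[OF smult(1,2)]
      have "w i \<otimes>\<^bsub>M\<^esub> (a \<odot>\<^bsub>M\<^esub> y) = a \<odot>\<^bsub>M\<^esub> (w i \<otimes>\<^bsub>M\<^esub> y)"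
        using smult wi M.smult_assoc2[of a y "w i"] by (simp add: M.m_comm)
      hence "?h g = delta R ((\<lambda>j\<in>{..<n}. w j \<otimes>\<^bsub>M\<^esub> x j)(i := a \<odot>\<^bsub>M\<^esub> (w i \<otimes>\<^bsub>M\<^esub> y))) \<ominus>\<^bsub>tensor_free R M n\<^esub>
         (a \<odot>\<^bsub>tensor_free R M n\<^esub> delta R ((\<lambda>j\<in>{..<n}. w j \<otimes>\<^bsub>M\<^esub> x j)(i := w i \<otimes>\<^bsub>M\<^esub> y)))"
        using smult(2-4) wi
        by (simp add: smult(5) semilinear_minus[OF F.module F.module l] semilinear_smult[OF l] d t mu[OF smult(1,2)] w)
      thus ?thesis using tensor_gens_smultI[OF wx[OF smult(1)] smult(2,3) M.m_closed[OF wi[OF smult(2)] smult(4)]]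
        by (simp only:)
    qed
    thus ?thesis
      using semilinear_submodule_gen[OF F.module F.module l N _ tensor_gens_carrier[OF M.module] _ t[unfolded tensor_rel_gens]]
      by blast
  qed
  show ?thesis
  proof (rule submodule_ideal[OF F.M_cring N])
    fix t f assume t: "t \<in> tensor_rel R M n" and f: "f \<in> carrier (tensor_free R M n)"
    note S = F.submoduleE[OF N]
    have tc: "t \<in> carrier (tensor_free R M n)" using S(1) t by blast
    have z: "\<zero>\<^bsub>tensor_free R M n\<^esub> \<in> tensor_rel R M n"
      using subgroup.one_closed[OF submodule.axioms(1)[OF N]] by simp
    have "f \<in> carrier (free_module R ({..<n} \<rightarrow>\<^sub>E carrier M))" using f by (simp add: tensor_free_simps)
    thus "f \<otimes>\<^bsub>tensor_free R M n\<^esub> t \<in> tensor_rel R M n"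
    proof (induction rule: M.R.free_module_induct)
      case zero
      thus ?case using tc z by (simp add: tensor_free_simps(2)[symmetric])
    next
      case (gen a x)
      thus ?case using tc dm[OF gen(2) t] S(4) d[OF gen(2)] F.smult_assoc2
        by (simp add: tensor_free_simps(4)[symmetric])
    next
      case (add f g)
      thus ?case using tc S(5) by (simp add: tensor_free_simps(1)[symmetric] tensor_free_simps(3)[symmetric] F.l_distr)
    qed
  qed
qed

lemma algebra_tensor_power:
  assumes A: "Module.algebra R M" shows "Module.algebra R (tensor_power R M n)"
proof -
  interpret M: Module.algebra R M by fact
  interpret F: monoid_alg R "tuple_monoid M n" by (rule tensor_free_monoid_alg[OF A])
  show ?thesis unfolding tensor_power_def
    using F.algebra_monoid_algebra
    by (intro algebra_quot_module submodule_tensor_rel[OF M.module] ideal_tensor_rel[OF A]) (simp add: tensor_free_def)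
qed

lemma pure_tensor_mult:
  assumes A: "Module.algebra R M" and x: "x \<in> {..<n} \<rightarrow>\<^sub>E carrier M" and y: "y \<in> {..<n} \<rightarrow>\<^sub>E carrier M"
  shows "pure_tensor R M n x \<otimes>\<^bsub>tensor_power R M n\<^esub> pure_tensor R M n y =
    pure_tensor R M n (\<lambda>i\<in>{..<n}. x i \<otimes>\<^bsub>M\<^esub> y i)"
proof -
  interpret M: Module.algebra R M by fact
  interpret F: monoid_alg R "tuple_monoid M n" by (rule tensor_free_monoid_alg[OF A])
  have m: "delta R x \<otimes>\<^bsub>tensor_free R M n\<^esub> delta R y = delta R (\<lambda>i\<in>{..<n}. x i \<otimes>\<^bsub>M\<^esub> y i)"
    using F.mult_delta[of x y] x y by (simp add: tuple_carrier tensor_free_def tuple_monoid_def)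
  show ?thesis unfolding tensor_power_def pure_tensor_def
    by (simp add: quot_module_mult[OF ideal_tensor_rel[OF A] delta_tensor_free[OF M.R_cring x] delta_tensor_free[OF M.R_cring y]] m)
qed

lemma tensor_power_one: "\<one>\<^bsub>tensor_power R M n\<^esub> = pure_tensor R M n (\<lambda>i\<in>{..<n}. \<one>\<^bsub>M\<^esub>)"
  by (simp add: tensor_power_def quot_module_one pure_tensor_def tensor_free_def monoid_algebra_simps tuple_monoid_def)

section \<open>Differentials and functions on powers\<close>

definition kaehler_gens :: "('a, 'm) ring_scheme \<Rightarrow> ('a, 'b) module \<Rightarrow> ('b \<Rightarrow> 'b) set" where
  "kaehler_gens R B = (let F = free_module B (carrier B) in
      {delta B (b \<oplus>\<^bsub>B\<^esub> c) \<ominus>\<^bsub>F\<^esub> (delta B b \<oplus>\<^bsub>F\<^esub> delta B c) | b c. b \<in> carrier B \<and> c \<in> carrier B} \<union>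
      {delta B (b \<otimes>\<^bsub>B\<^esub> c) \<ominus>\<^bsub>F\<^esub> (b \<odot>\<^bsub>F\<^esub> delta B c \<oplus>\<^bsub>F\<^esub> c \<odot>\<^bsub>F\<^esub> delta B b) | b c.
         b \<in> carrier B \<and> c \<in> carrier B} \<union>
      {delta B (r \<odot>\<^bsub>B\<^esub> \<one>\<^bsub>B\<^esub>) | r. r \<in> carrier R})"

lemma kaehler_rel_gens:
  "kaehler_rel R B = submodule_gen B (free_module B (carrier B)) (kaehler_gens R B)"
  by (simp add: kaehler_rel_def kaehler_gens_def Let_def)

locale comm_algebra = Module.algebra R B for R :: "'a ring" and B :: "('a, 'b) module"
begin

abbreviation "F \<equiv> free_module B (carrier B)"
abbreviation "K \<equiv> kaehler R B"
abbreviation "d \<equiv> kaehler_d R B"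

sublocale F: Module.module B F by (rule module_free_module)

lemma delta_F: "b \<in> carrier B \<Longrightarrow> delta B b \<in> carrier F"
  by (rule delta_closed)

lemma smult_one_closed: "r \<in> carrier R \<Longrightarrow> r \<odot>\<^bsub>B\<^esub> \<one>\<^bsub>B\<^esub> \<in> carrier B"
  by simp

lemma kaehler_gens_carrier: "kaehler_gens R B \<subseteq> carrier F"
  using delta_F smult_one_closed by (auto simp: kaehler_gens_def Let_def intro!: F.minus_closed)

lemma submodule_kaehler_rel: "submodule (kaehler_rel R B) B F"
  unfolding kaehler_rel_gens
  by (rule submodule_gen_submodule[OF F.module_axioms kaehler_gens_carrier])

lemma module_kaehler: "Module.module B K"
  unfolding kaehler_def by (rule module_quot_module[OF F.module_axioms submodule_kaehler_rel])

sublocale K: Module.module B K by (rule module_kaehler)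

lemma d_closed: "b \<in> carrier B \<Longrightarrow> d b \<in> carrier K"
  using delta_F by (auto simp: kaehler_def kaehler_d_def quot_module_carrier)

lemma d_gen: "g \<in> kaehler_gens R B \<Longrightarrow> g \<in> kaehler_rel R B"
  unfolding kaehler_rel_gens by (rule subsetD[OF submodule_gen_superset])

lemma d_add:
  assumes "b \<in> carrier B" "c \<in> carrier B" shows "d (b \<oplus>\<^bsub>B\<^esub> c) = d b \<oplus>\<^bsub>K\<^esub> d c"
proof -
  have "delta B (b \<oplus>\<^bsub>B\<^esub> c) \<ominus>\<^bsub>F\<^esub> (delta B b \<oplus>\<^bsub>F\<^esub> delta B c) \<in> kaehler_rel R B"
    using assms by (intro d_gen) (auto simp: kaehler_gens_def Let_def)
  thus ?thesis unfolding kaehler_d_def kaehler_def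
    using assms by (simp add: delta_F quot_module_eq_iff[OF F.module_axioms submodule_kaehler_rel]
        quot_module_add[OF submodule_abelian_subgroup[OF F.module_axioms submodule_kaehler_rel]])
qed

lemma d_mult:
  assumes "b \<in> carrier B" "c \<in> carrier B" shows "d (b \<otimes>\<^bsub>B\<^esub> c) = b \<odot>\<^bsub>K\<^esub> d c \<oplus>\<^bsub>K\<^esub> c \<odot>\<^bsub>K\<^esub> d b"
proof -
  have "delta B (b \<otimes>\<^bsub>B\<^esub> c) \<ominus>\<^bsub>F\<^esub> (b \<odot>\<^bsub>F\<^esub> delta B c \<oplus>\<^bsub>F\<^esub> c \<odot>\<^bsub>F\<^esub> delta B b) \<in> kaehler_rel R B"
    using assms by (intro d_gen) (auto simp: kaehler_gens_def Let_def)
  thus ?thesis unfolding kaehler_d_def kaehler_def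
    using assms by (simp add: delta_F quot_module_eq_iff[OF F.module_axioms submodule_kaehler_rel]
        quot_module_smult[OF F.module_axioms submodule_kaehler_rel]
        quot_module_add[OF submodule_abelian_subgroup[OF F.module_axioms submodule_kaehler_rel]])
qed

lemma d_scalar:
  assumes "r \<in> carrier R" shows "d (r \<odot>\<^bsub>B\<^esub> \<one>\<^bsub>B\<^esub>) = \<zero>\<^bsub>K\<^esub>"
proof -
  have "delta B (r \<odot>\<^bsub>B\<^esub> \<one>\<^bsub>B\<^esub>) \<in> kaehler_rel R B"
    using assms by (intro d_gen) (auto simp: kaehler_gens_def Let_def)
  thus ?thesis unfolding kaehler_d_def kaehler_def
    using quot_module_eq_zero_iff[OF F.module_axioms submodule_kaehler_rel delta_F[OF smult_one_closed[OF assms]]]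
    by simp
qed

lemma kaehler_induct [consumes 1, case_names gen add]:
  assumes t: "t \<in> carrier K"
    and g: "\<And>b c. b \<in> carrier B \<Longrightarrow> c \<in> carrier B \<Longrightarrow> P (b \<odot>\<^bsub>K\<^esub> d c)"
    and p: "\<And>s t. s \<in> carrier K \<Longrightarrow> t \<in> carrier K \<Longrightarrow> P s \<Longrightarrow> P t \<Longrightarrow> P (s \<oplus>\<^bsub>K\<^esub> t)"
  shows "P t"
proof -
  note N = submodule_kaehler_rel
  obtain f where f: "f \<in> carrier F" "t = kaehler_rel R B +>\<^bsub>F\<^esub> f"
    using t by (auto simp: kaehler_def quot_module_carrier)
  have "P (kaehler_rel R B +>\<^bsub>F\<^esub> f)"
    using f(1)
  proof (induction rule: free_module_induct)
    case zero
    have "kaehler_rel R B +>\<^bsub>F\<^esub> \<zero>\<^bsub>F\<^esub> = \<zero>\<^bsub>K\<^esub>"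
      using semilinear_zero[OF F.module_axioms module_quot_module[OF F.module_axioms N]
          quot_module_semilinear[OF F.module_axioms N]] by (simp add: kaehler_def)
    thus ?case using g[of "\<zero>\<^bsub>B\<^esub>" "\<zero>\<^bsub>B\<^esub>"] d_closed by simp
  next
    case (gen a x)
    thus ?case using g[OF gen] quot_module_smult[OF F.module_axioms N gen(1) delta_F[OF gen(2)]]
      by (simp add: kaehler_d_def kaehler_def)
  next
    case (add f h)
    have "kaehler_rel R B +>\<^bsub>F\<^esub> f \<in> carrier K" "kaehler_rel R B +>\<^bsub>F\<^esub> h \<in> carrier K"
      using add by (auto simp: kaehler_def quot_module_carrier)
    from p[OF this add(3,4)] show ?case
      using quot_module_add[OF submodule_abelian_subgroup[OF F.module_axioms N] add(1,2)]
      by (simp add: kaehler_def)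
  qed
  thus ?thesis using f(2) by simp
qed

text \<open>The universal property of differentials, for a \<open>D\<close> that satisfies the
  Leibniz rule along a ring map \<open>a\<close>. With \<open>a\<close> a change of rings it yields
  \<open>kaehler_map\<close>, with \<open>a\<close> the identity the maps \<open>phi\<close> into
  rings of combinatorial functions.\<close>

lemma kaehler_lift:
  assumes P: "Module.module C P" and a: "a \<in> ring_hom B C"
    and v: "\<And>b. b \<in> carrier B \<Longrightarrow> D b \<in> carrier P"
    and va: "\<And>b c. b \<in> carrier B \<Longrightarrow> c \<in> carrier B \<Longrightarrow> D (b \<oplus>\<^bsub>B\<^esub> c) = D b \<oplus>\<^bsub>P\<^esub> D c"
    and vm: "\<And>b c. b \<in> carrier B \<Longrightarrow> c \<in> carrier B \<Longrightarrow> D (b \<otimes>\<^bsub>B\<^esub> c) = a b \<odot>\<^bsub>P\<^esub> D c \<oplus>\<^bsub>P\<^esub> a c \<odot>\<^bsub>P\<^esub> D b"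
    and vs: "\<And>r. r \<in> carrier R \<Longrightarrow> D (r \<odot>\<^bsub>B\<^esub> \<one>\<^bsub>B\<^esub>) = \<zero>\<^bsub>P\<^esub>"
  shows "semilinear B K P a (coset_lift (lin_ext B P a D))"
    and "\<And>b. b \<in> carrier B \<Longrightarrow> coset_lift (lin_ext B P a D) (d b) = D b"
proof -
  interpret P: Module.module C P by fact
  note N = submodule_kaehler_rel
  have l: "semilinear B F P a (lin_ext B P a D)"
    by (rule lin_ext_semilinear(1)[OF is_cring P a v])
  have dl: "lin_ext B P a D (delta B b) = D b" if "b \<in> carrier B" for b
    by (rule lin_ext_semilinear(2)[OF is_cring P a v that])
  note ll = semilinear_add[OF l] semilinear_smult[OF l] semilinear_minus[OF F.module_axioms P l] dl
  have z: "lin_ext B P a D t = \<zero>\<^bsub>P\<^esub>" if "t \<in> kaehler_rel R B" for t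
  proof (rule semilinear_submodule_gen_zero[OF F.module_axioms P l _ kaehler_gens_carrier _ that[unfolded kaehler_rel_gens]])
    fix g assume "g \<in> kaehler_gens R B"
    then consider (add) b c where "b \<in> carrier B" "c \<in> carrier B"
         "g = delta B (b \<oplus>\<^bsub>B\<^esub> c) \<ominus>\<^bsub>F\<^esub> (delta B b \<oplus>\<^bsub>F\<^esub> delta B c)"
      | (mult) b c where "b \<in> carrier B" "c \<in> carrier B"
         "g = delta B (b \<otimes>\<^bsub>B\<^esub> c) \<ominus>\<^bsub>F\<^esub> (b \<odot>\<^bsub>F\<^esub> delta B c \<oplus>\<^bsub>F\<^esub> c \<odot>\<^bsub>F\<^esub> delta B b)"
      | (scal) r where "r \<in> carrier R" "g = delta B (r \<odot>\<^bsub>B\<^esub> \<one>\<^bsub>B\<^esub>)"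
      unfolding kaehler_gens_def Let_def by blast
    thus "lin_ext B P a D g = \<zero>\<^bsub>P\<^esub>"
    proof cases
      case add
      thus ?thesis using v by (simp add: ll delta_F va abelian_group_minus_eq_zero_iff[OF P.abelian_group_axioms])
    next
      case mult
      thus ?thesis using v ring_hom_closed[OF a]
        by (simp add: ll delta_F vm abelian_group_minus_eq_zero_iff[OF P.abelian_group_axioms])
    next
      case scal
      thus ?thesis by (simp add: ll vs)
    qed
  qed (use ring_hom_closed[OF a] in auto)
  show "semilinear B K P a (coset_lift (lin_ext B P a D))"
    unfolding kaehler_def by (rule coset_lift_semilinear(1)[OF F.module_axioms N P l z])
  fix b assume b: "b \<in> carrier B"
  show "coset_lift (lin_ext B P a D) (d b) = D b"
    unfolding kaehler_d_def
    using coset_lift_semilinear(2)[OF F.module_axioms N P l z delta_F[OF b]] dl[OF b] by simp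
qed

lemma scalar_hom: "(\<lambda>r. r \<odot>\<^bsub>B\<^esub> \<one>\<^bsub>B\<^esub>) \<in> ring_hom R B"
  by (rule ring_hom_memI) (simp_all add: smult_l_distr smult_assoc1 smult_assoc2)

lemma smult_eq: "r \<in> carrier R \<Longrightarrow> b \<in> carrier B \<Longrightarrow> r \<odot>\<^bsub>B\<^esub> b = (r \<odot>\<^bsub>B\<^esub> \<one>\<^bsub>B\<^esub>) \<otimes>\<^bsub>B\<^esub> b"
  by (simp add: smult_assoc2)

lemma d_smult:
  assumes "r \<in> carrier R" "b \<in> carrier B"
  shows "d (r \<odot>\<^bsub>B\<^esub> b) = (r \<odot>\<^bsub>B\<^esub> \<one>\<^bsub>B\<^esub>) \<odot>\<^bsub>K\<^esub> d b"
  unfolding smult_eq[OF assms] using assms by (simp add: d_mult d_scalar d_closed)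

end

text \<open>A commutative square of rings. This is the form in which both the restriction to smaller
  affine pieces and the pullback along a morphism over \<open>S\<close> reach the algebra.\<close>

locale algebra_map = A: comm_algebra R B + A': comm_algebra R' B' for R R' :: "'a ring" and B B' +
  fixes \<alpha> and \<beta>
  assumes alpha: "\<alpha> \<in> ring_hom R R'" and beta: "\<beta> \<in> ring_hom B B'"
    and square: "\<And>r. r \<in> carrier R \<Longrightarrow> \<beta> (r \<odot>\<^bsub>B\<^esub> \<one>\<^bsub>B\<^esub>) = \<alpha> r \<odot>\<^bsub>B'\<^esub> \<one>\<^bsub>B'\<^esub>"
begin

lemmas beta_simps = ring_hom_closed[OF beta] ring_hom_add[OF beta] ring_hom_mult[OF beta] ring_hom_one[OF beta]

lemma beta_smult: "r \<in> carrier R \<Longrightarrow> b \<in> carrier B \<Longrightarrow> \<beta> (r \<odot>\<^bsub>B\<^esub> b) = \<alpha> r \<odot>\<^bsub>B'\<^esub> \<beta> b"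
  using A.smult_eq[of r b] A'.smult_eq[of "\<alpha> r" "\<beta> b"] ring_hom_closed[OF alpha]
  by (simp add: beta_simps square A.smult_one_closed)

lemma beta_semilinear: "semilinear R B B' \<alpha> \<beta>"
  by (rule semilinearI) (auto simp: beta_simps beta_smult)

lemma kaehler_map:
  shows "semilinear B (kaehler R B) (kaehler R' B') \<beta> (kaehler_map B R' B' \<beta>)"
    and "\<And>b. b \<in> carrier B \<Longrightarrow> kaehler_map B R' B' \<beta> (kaehler_d R B b) = kaehler_d R' B' (\<beta> b)"
  unfolding kaehler_map_def
  by (rule A.kaehler_lift[OF A'.module_kaehler beta];
      simp add: A'.d_closed A'.d_add A'.d_mult A'.d_scalar beta_simps square ring_hom_closed[OF alpha])+

end

text \<open>Once the factor with index \<open>i\<close> is isolated, a product of functions of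
  single entries is seen to be additive and homogeneous in each entry as soon as each factor is.
  This is how \<open>coord_pull\<close> and \<open>nu0\<close> are shown to be well defined.\<close>

lemma (in comm_monoid) finprod_update:
  assumes "finite I" "i \<in> I" "\<And>j. j \<in> I \<Longrightarrow> j \<noteq> i \<Longrightarrow> u j (x j) \<in> carrier G" "u i y \<in> carrier G"
  shows "(\<Otimes>j\<in>I. u j ((x(i := y)) j)) = u i y \<otimes> (\<Otimes>j\<in>I - {i}. u j (x j))"
proof -
  have I: "insert i (I - {i}) = I" using assms(2) by auto
  have "(\<Otimes>j\<in>insert i (I - {i}). u j ((x(i := y)) j)) =
      u i ((x(i := y)) i) \<otimes> (\<Otimes>j\<in>I - {i}. u j ((x(i := y)) j))"
    using assms by (intro finprod_insert) auto
  also have "(\<Otimes>j\<in>I - {i}. u j ((x(i := y)) j)) = (\<Otimes>j\<in>I - {i}. u j (x j))"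
    using assms by (intro finprod_cong') auto
  finally show ?thesis unfolding I by simp
qed

section \<open>The ring of functions on a power and its coordinate functions\<close>

locale power_algebra = comm_algebra R B for R :: "'a ring" and B :: "('a, 'b) module" + fixes n :: nat
begin

abbreviation "T \<equiv> fun_ring n R B"
abbreviation "c \<equiv> coord n R B"
abbreviation "tuples \<equiv> {..<Suc n} \<rightarrow>\<^sub>E carrier B"
abbreviation "pure \<equiv> pure_tensor R B (Suc n)"

sublocale T: Module.algebra R T
  unfolding fun_ring_def by (rule algebra_tensor_power) (rule algebra_axioms)

lemma R_module: "Module.module R B" by (rule module)

lemma pure_closed: "x \<in> tuples \<Longrightarrow> pure x \<in> carrier T"
  unfolding fun_ring_def by (rule pure_tensor_closed[OF R_module])

lemma coord_tuple: "b \<in> carrier B \<Longrightarrow> (\<lambda>i\<in>{..<Suc n}. if i = r then b else \<one>\<^bsub>B\<^esub>) \<in> tuples"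
  by auto

lemma coord_closed: "b \<in> carrier B \<Longrightarrow> c r b \<in> carrier T"
  unfolding coord_def by (rule pure_closed[OF coord_tuple])

lemma coord_update: "r \<le> n \<Longrightarrow> c r b = pure ((\<lambda>i\<in>{..<Suc n}. \<one>\<^bsub>B\<^esub>)(r := b))"
  unfolding coord_def by (rule arg_cong[where f = "pure"]) auto

lemma one_tuple: "(\<lambda>i\<in>{..<Suc n}. \<one>\<^bsub>B\<^esub>) \<in> tuples" by auto

lemma coord_hom:
  assumes "r \<le> n" shows "c r \<in> ring_hom B T"
proof (rule ring_hom_memI)
  fix x y assume x: "x \<in> carrier B" and y: "y \<in> carrier B"
  show "c r (x \<otimes>\<^bsub>B\<^esub> y) = c r x \<otimes>\<^bsub>T\<^esub> c r y"
    unfolding coord_def fun_ring_def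
    by (subst pure_tensor_mult[OF algebra_axioms coord_tuple[OF x] coord_tuple[OF y]])
      (rule arg_cong[where f = "pure"], auto)
  show "c r (x \<oplus>\<^bsub>B\<^esub> y) = c r x \<oplus>\<^bsub>T\<^esub> c r y"
    unfolding coord_update[OF assms] fun_ring_def
    using assms by (intro pure_tensor_add[OF R_module one_tuple _ x y]) simp
next
  show "c r \<one>\<^bsub>B\<^esub> = \<one>\<^bsub>T\<^esub>"
    unfolding coord_def fun_ring_def tensor_power_one by (rule arg_cong[where f = "pure"]) auto
qed (rule coord_closed)

lemma coord_smult:
  assumes "i \<le> n" "r \<in> carrier R" "b \<in> carrier B"
  shows "c i (r \<odot>\<^bsub>B\<^esub> b) = r \<odot>\<^bsub>T\<^esub> c i b"
  unfolding coord_update[OF assms(1)] fun_ring_def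
  using assms by (intro pure_tensor_smult[OF R_module one_tuple]) auto

lemma coord_scalar:
  assumes "i \<le> n" "r \<in> carrier R"
  shows "c i (r \<odot>\<^bsub>B\<^esub> \<one>\<^bsub>B\<^esub>) = r \<odot>\<^bsub>T\<^esub> \<one>\<^bsub>T\<^esub>"
  using coord_smult[OF assms, of "\<one>\<^bsub>B\<^esub>"] ring_hom_one[OF coord_hom[OF assms(1)]] by simp

text \<open>Partial products over a set \<open>A\<close> of coordinates are pure tensors with entry
  1 outside \<open>A\<close>. Consequently the coordinate functions generate the ring, and ring maps
  out of it are determined by their values on them.\<close>

lemma pure_eq_finprod:
  assumes x: "x \<in> tuples" shows "pure x = (\<Otimes>\<^bsub>T\<^esub>i\<in>{..n}. c i (x i))"
proof -
  have xi: "x i \<in> carrier B" if "i \<le> n" for i using PiE_mem[OF x, of i] that by simp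
  have "(\<Otimes>\<^bsub>T\<^esub>i\<in>A. c i (x i)) = pure (\<lambda>i\<in>{..<Suc n}. if i \<in> A then x i else \<one>\<^bsub>B\<^esub>)"
    if "finite A" "A \<subseteq> {..n}" for A
    using that
  proof (induction A)
    case empty
    have "\<one>\<^bsub>T\<^esub> = pure (\<lambda>i\<in>{..<Suc n}. \<one>\<^bsub>B\<^esub>)" unfolding fun_ring_def by (rule tensor_power_one)
    thus ?case by (simp only: T.finprod_empty empty_iff if_False)
  next
    case (insert k A)
    hence k: "k \<le> n" "k \<notin> A" "finite A" "A \<subseteq> {..n}" by auto
    have t: "(\<lambda>i\<in>{..<Suc n}. if i \<in> A then x i else \<one>\<^bsub>B\<^esub>) \<in> tuples"
      using xi by auto
    have "(\<Otimes>\<^bsub>T\<^esub>i\<in>insert k A. c i (x i)) = c k (x k) \<otimes>\<^bsub>T\<^esub> (\<Otimes>\<^bsub>T\<^esub>i\<in>A. c i (x i))"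
      using k xi coord_closed by (intro T.finprod_insert) (auto simp: subset_iff)
    also have "\<dots> = c k (x k) \<otimes>\<^bsub>T\<^esub> pure (\<lambda>i\<in>{..<Suc n}. if i \<in> A then x i else \<one>\<^bsub>B\<^esub>)"
      unfolding insert.IH[OF k(4)] ..
    also have "\<dots> = pure (\<lambda>i\<in>{..<Suc n}. if i \<in> insert k A then x i else \<one>\<^bsub>B\<^esub>)"
      unfolding coord_def fun_ring_def pure_tensor_mult[OF algebra_axioms coord_tuple[OF xi[OF k(1)]] t]
      using xi k by (intro arg_cong[where f = "pure"]) (auto simp: fun_eq_iff restrict_def less_Suc_eq_le)
    finally show ?case .
  qed
  from this[of "{..n}"] have "(\<Otimes>\<^bsub>T\<^esub>i\<in>{..n}. c i (x i)) = pure (\<lambda>i\<in>{..<Suc n}. if i \<in> {..n} then x i else \<one>\<^bsub>B\<^esub>)"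
    by simp
  also have "(\<lambda>i\<in>{..<Suc n}. if i \<in> {..n} then x i else \<one>\<^bsub>B\<^esub>) = x"
    using x by (auto simp: fun_eq_iff restrict_def PiE_iff extensional_def)
  finally show ?thesis by simp
qed

text \<open>A scalar in front of a pure tensor is absorbed into its entry at coordinate 0, so sums
  of pure tensors exhaust the ring.\<close>

lemma fun_ring_induct [consumes 1, case_names pure add]:
  assumes t: "t \<in> carrier T"
    and g: "\<And>x. x \<in> tuples \<Longrightarrow> P (pure x)"
    and p: "\<And>s t. s \<in> carrier T \<Longrightarrow> t \<in> carrier T \<Longrightarrow> P s \<Longrightarrow> P t \<Longrightarrow> P (s \<oplus>\<^bsub>T\<^esub> t)"
  shows "P t"
  using R_module t unfolding fun_ring_def
proof (induction rule: tensor_power_induct)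
  case (gen a x)
  have x0: "x 0 \<in> carrier B" using gen by auto
  have "a \<odot>\<^bsub>tensor_power R B (Suc n)\<^esub> pure x = pure (x(0 := a \<odot>\<^bsub>B\<^esub> x 0))"
    using pure_tensor_smult[OF R_module gen(2) _ x0 gen(1), of 0] by simp
  thus ?case using g[OF tuple_update[OF gen(2), of 0 "a \<odot>\<^bsub>B\<^esub> x 0"]] gen x0 by simp
next
  case (add s t)
  thus ?case using p unfolding fun_ring_def by blast
qed

text \<open>The tensor power is a coproduct of algebras. An additive map that is the product of ring
  maps \<open>g i\<close> on pure tensors is multiplicative on pure tensors, and then everywhere by
  additivity in each factor. At a coordinate function its value is \<open>g i b\<close>, because the
  other entries 1 go to 1.\<close>

lemma fun_ring_hom:
  assumes Q: "cring Q" and h: "\<And>t. t \<in> carrier T \<Longrightarrow> h t \<in> carrier Q"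
    and ha: "\<And>s t. s \<in> carrier T \<Longrightarrow> t \<in> carrier T \<Longrightarrow> h (s \<oplus>\<^bsub>T\<^esub> t) = h s \<oplus>\<^bsub>Q\<^esub> h t"
    and g: "\<And>i. i \<le> n \<Longrightarrow> g i \<in> ring_hom B Q"
    and hp: "\<And>x. x \<in> tuples \<Longrightarrow> h (pure x) = (\<Otimes>\<^bsub>Q\<^esub>i\<in>{..n}. g i (x i))"
  shows "h \<in> ring_hom T Q" and "\<And>i b. i \<le> n \<Longrightarrow> b \<in> carrier B \<Longrightarrow> h (c i b) = g i b"
proof -
  interpret Q: cring Q by fact
  have gc: "g i (x i) \<in> carrier Q" if "x \<in> tuples" "i \<le> n" for i x
    using that ring_hom_closed[OF g] by (auto simp: PiE_iff)
  have hc: "h (c i b) = g i b" if i: "i \<le> n" and b: "b \<in> carrier B" for i b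
  proof -
    have "h (c i b) = (\<Otimes>\<^bsub>Q\<^esub>j\<in>{..n}. if i = j then g j b else \<one>\<^bsub>Q\<^esub>)"
      unfolding coord_def hp[OF coord_tuple[OF b]]
      using b g by (intro Q.finprod_cong') (auto simp: ring_hom_one[OF g] ring_hom_closed[OF g])
    also have "\<dots> = g i b"
      using i b g by (intro Q.finprod_singleton) (auto simp: ring_hom_closed[OF g])
    finally show ?thesis .
  qed
  thus "\<And>i b. i \<le> n \<Longrightarrow> b \<in> carrier B \<Longrightarrow> h (c i b) = g i b" .
  have mp: "h (pure x \<otimes>\<^bsub>T\<^esub> pure y) = h (pure x) \<otimes>\<^bsub>Q\<^esub> h (pure y)" if x: "x \<in> tuples" and y: "y \<in> tuples" for x y
  proof -
    have xy: "(\<lambda>i\<in>{..<Suc n}. x i \<otimes>\<^bsub>B\<^esub> y i) \<in> tuples" using x y by auto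
    have "h (pure x \<otimes>\<^bsub>T\<^esub> pure y) = (\<Otimes>\<^bsub>Q\<^esub>i\<in>{..n}. g i (x i \<otimes>\<^bsub>B\<^esub> y i))"
      unfolding fun_ring_def pure_tensor_mult[OF algebra_axioms x y] hp[OF xy]
      using x y ring_hom_closed[OF g] by (intro Q.finprod_cong') (auto simp: PiE_iff)
    also have "\<dots> = (\<Otimes>\<^bsub>Q\<^esub>i\<in>{..n}. g i (x i) \<otimes>\<^bsub>Q\<^esub> g i (y i))"
      using x y gc by (intro Q.finprod_cong') (auto simp: PiE_iff ring_hom_mult[OF g])
    also have "\<dots> = h (pure x) \<otimes>\<^bsub>Q\<^esub> h (pure y)"
      unfolding hp[OF x] hp[OF y] using gc x y by (intro Q.finprod_multf) auto
    finally show ?thesis .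
  qed
  have m1: "h (pure x \<otimes>\<^bsub>T\<^esub> t) = h (pure x) \<otimes>\<^bsub>Q\<^esub> h t" if x: "x \<in> tuples" and t: "t \<in> carrier T" for x t
    using t by (induction rule: fun_ring_induct)
      (simp_all add: mp x T.r_distr ha pure_closed h Q.r_distr)
  have m2: "h (s \<otimes>\<^bsub>T\<^esub> t) = h s \<otimes>\<^bsub>Q\<^esub> h t" if s: "s \<in> carrier T" and t: "t \<in> carrier T" for s t
    using s by (induction rule: fun_ring_induct)
      (simp_all add: m1 t T.l_distr ha pure_closed h Q.l_distr)
  have "h \<one>\<^bsub>T\<^esub> = \<one>\<^bsub>Q\<^esub>"
    using hc[of 0 "\<one>\<^bsub>B\<^esub>"] ring_hom_one[OF coord_hom[of 0]] ring_hom_one[OF g[of 0]] by simp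
  thus "h \<in> ring_hom T Q" using h ha m2 by (intro ring_hom_memI)
qed

end

lemma (in comm_algebra) power_algebra: "power_algebra R B"
  by (simp add: power_algebra_def comm_algebra_axioms)

lemma (in algebra_map) power_map:
  fixes n :: nat
  defines "h \<equiv> tensor_map R R' B' (Suc n) \<alpha> \<beta>"
  shows "h \<in> ring_hom (fun_ring n R B) (fun_ring n R' B')"
    and "\<And>i b. i \<le> n \<Longrightarrow> b \<in> carrier B \<Longrightarrow> h (coord n R B i b) = coord n R' B' i (\<beta> b)"
    and "\<And>x. x \<in> {..<Suc n} \<rightarrow>\<^sub>E carrier B \<Longrightarrow>
      h (pure_tensor R B (Suc n) x) = pure_tensor R' B' (Suc n) (\<lambda>i\<in>{..<Suc n}. \<beta> (x i))"
proof -
  interpret A: power_algebra R B n by (rule A.power_algebra)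
  interpret A': power_algebra R' B' n by (rule A'.power_algebra)
  note tm = tensor_map[OF A.R_module A'.R_module alpha beta_semilinear, where n = "Suc n"]
  have s: "semilinear R A.T A'.T \<alpha> h" using tm(1) by (simp add: fun_ring_def h_def)
  show p: "h (A.pure x) = A'.pure (\<lambda>i\<in>{..<Suc n}. \<beta> (x i))" if "x \<in> A.tuples" for x
    using tm(2)[OF that] by (simp only: h_def)
  let ?g = "\<lambda>i. A'.c i \<circ> \<beta>"
  have g: "?g i \<in> ring_hom B A'.T" if "i \<le> n" for i
    by (rule ring_hom_trans[OF beta A'.coord_hom[OF that]])
  have hp: "h (A.pure x) = (\<Otimes>\<^bsub>A'.T\<^esub>i\<in>{..n}. ?g i (x i))" if x: "x \<in> A.tuples" for x
  proof -
    have t: "(\<lambda>i\<in>{..<Suc n}. \<beta> (x i)) \<in> A'.tuples" using x by (auto simp: beta_simps PiE_iff)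
    have xi: "x i \<in> carrier B" if "i \<le> n" for i using PiE_mem[OF x, of i] that by simp
    show ?thesis unfolding p[OF x] A'.pure_eq_finprod[OF t]
      using A'.coord_closed beta_simps(1) xi by (intro A'.T.finprod_cong') auto
  qed
  show "h \<in> ring_hom A.T A'.T"
    by (rule A.fun_ring_hom(1)[where g = ?g, OF A'.T.M_cring semilinear_closed[OF s] semilinear_add[OF s] g hp])
  show "h (A.c i b) = A'.c i (\<beta> b)" if "i \<le> n" "b \<in> carrier B" for i b
    using A.fun_ring_hom(2)[where g = ?g, OF A'.T.M_cring semilinear_closed[OF s] semilinear_add[OF s] g hp that]
    by simp
qed

text \<open>Entries at positions with the same image under \<open>\<sigma>\<close> are multiplied
  together, and a position outside the image receives the empty product 1. Regrouped by fibres, a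
  pure tensor goes to the product of the coordinate functions at the positions
  \<open>\<sigma> j\<close>, so the criterion \<open>fun_ring_hom\<close> applies.\<close>

lemma (in comm_algebra) coord_pull:
  assumes \<sigma>: "\<And>j. j \<le> m \<Longrightarrow> \<sigma> j \<le> k"
  shows "coord_pull m k R B \<sigma> \<in> ring_hom (fun_ring m R B) (fun_ring k R B)"
    and "\<And>j b. j \<le> m \<Longrightarrow> b \<in> carrier B \<Longrightarrow> coord_pull m k R B \<sigma> (coord m R B j b) = coord k R B (\<sigma> j) b"
proof -
  interpret M: power_algebra R B m by (rule power_algebra)
  interpret k: power_algebra R B k by (rule power_algebra)
  let ?g = "\<lambda>j. k.c (\<sigma> j)"
  let ?v = "\<lambda>x. k.pure (\<lambda>i\<in>{..<Suc k}. \<Otimes>\<^bsub>B\<^esub>j\<in>{j. j \<le> m \<and> \<sigma> j = i}. x j)"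
  have v: "?v x = (\<Otimes>\<^bsub>k.T\<^esub>j\<in>{..m}. ?g j (x j))" if x: "x \<in> M.tuples" for x
  proof -
    have xj: "x j \<in> carrier B" if "j \<le> m" for j using PiE_mem[OF x, of j] that by simp
    have t: "(\<lambda>i\<in>{..<Suc k}. \<Otimes>\<^bsub>B\<^esub>j\<in>{j. j \<le> m \<and> \<sigma> j = i}. x j) \<in> k.tuples"
      using xj by (auto intro!: finprod_closed)
    \<comment> \<open>The product over all positions is organised by the fibres of
      \<open>\<sigma>\<close>: the coordinate map of a target position is a ring map and distributes
      over the fibre.\<close>
    have "?v x = (\<Otimes>\<^bsub>k.T\<^esub>i\<in>{..k}. \<Otimes>\<^bsub>k.T\<^esub>j\<in>{j. j \<le> m \<and> \<sigma> j = i}. k.c (\<sigma> j) (x j))"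
      unfolding k.pure_eq_finprod[OF t]
    proof (rule k.T.finprod_cong')
      fix i assume i: "i \<in> {..k}"
      interpret h: ring_hom_cring B k.T "k.c i"
        using i k.coord_hom by unfold_locales auto
      show "k.c i ((\<lambda>i\<in>{..<Suc k}. \<Otimes>\<^bsub>B\<^esub>j\<in>{j. j \<le> m \<and> \<sigma> j = i}. x j) i) =
          (\<Otimes>\<^bsub>k.T\<^esub>j\<in>{j. j \<le> m \<and> \<sigma> j = i}. k.c (\<sigma> j) (x j))"
      proof -
        have f: "x \<in> {j. j \<le> m \<and> \<sigma> j = i} \<rightarrow> carrier B" using xj by auto
        have "k.c i (\<Otimes>\<^bsub>B\<^esub>j\<in>{j. j \<le> m \<and> \<sigma> j = i}. x j) =
            (\<Otimes>\<^bsub>k.T\<^esub>j\<in>{j. j \<le> m \<and> \<sigma> j = i}. (k.c i \<circ> x) j)"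
          by (rule h.hom_finprod[OF f])
        also have "\<dots> = (\<Otimes>\<^bsub>k.T\<^esub>j\<in>{j. j \<le> m \<and> \<sigma> j = i}. k.c (\<sigma> j) (x j))"
          using xj k.coord_closed by (intro k.T.finprod_cong') auto
        finally show ?thesis using i by simp
      qed
    qed (use xj k.coord_closed in \<open>auto intro!: k.T.finprod_closed\<close>)
    also have "\<dots> = (\<Otimes>\<^bsub>k.T\<^esub>j\<in>(\<Union>i\<in>{..k}. {j. j \<le> m \<and> \<sigma> j = i}). k.c (\<sigma> j) (x j))"
      using xj k.coord_closed
      by (intro k.T.finprod_UN_disjoint[symmetric]) (auto simp: pairwise_def disjnt_def)
    also have "(\<Union>i\<in>{..k}. {j. j \<le> m \<and> \<sigma> j = i}) = {..m}" using \<sigma> by auto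
    finally show ?thesis .
  qed
  have upd: "?v (x(i := y)) = ?g i y \<otimes>\<^bsub>k.T\<^esub> (\<Otimes>\<^bsub>k.T\<^esub>j\<in>{..m} - {i}. ?g j (x j))"
    if x: "x \<in> M.tuples" and i: "i < Suc m" and y: "y \<in> carrier B" for x i y
    unfolding v[OF tuple_update[OF x i y]]
    using i y x k.coord_closed by (intro k.T.finprod_update) (auto simp: PiE_iff)
  have rest: "(\<Otimes>\<^bsub>k.T\<^esub>j\<in>{..m} - {i}. ?g j (x j)) \<in> carrier k.T" if "x \<in> M.tuples" for x i
    using that k.coord_closed by (intro k.T.finprod_closed) (auto simp: PiE_iff)
  have vc: "?v x \<in> carrier k.T" if x: "x \<in> M.tuples" for x
    unfolding v[OF x] using x k.coord_closed by (intro k.T.finprod_closed) (auto simp: PiE_iff)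
  note gh = k.coord_hom[OF \<sigma>]
  have va: "?v (x(i := y \<oplus>\<^bsub>B\<^esub> z)) = ?v (x(i := y)) \<oplus>\<^bsub>k.T\<^esub> ?v (x(i := z))"
    if x: "x \<in> M.tuples" and i: "i < Suc m" and y: "y \<in> carrier B" and z: "z \<in> carrier B" for x i y z
    unfolding upd[OF x i y] upd[OF x i z] upd[OF x i a_closed[OF y z]]
    using rest[OF x] i k.coord_closed y z by (simp add: ring_hom_add[OF gh] k.T.l_distr)
  have vs: "?v (x(i := r \<odot>\<^bsub>B\<^esub> y)) = r \<odot>\<^bsub>k.T\<^esub> ?v (x(i := y))"
    if x: "x \<in> M.tuples" and i: "i < Suc m" and y: "y \<in> carrier B" and r: "r \<in> carrier R" for x i y r
    unfolding upd[OF x i y] upd[OF x i smult_closed[OF r y]]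
    using rest[OF x] i k.coord_closed y r \<sigma> by (simp add: k.coord_smult k.T.smult_assoc2)
  have idh: "(\<lambda>a. a) \<in> ring_hom R R" by (rule ring_hom_memI) auto
  let ?h = "coord_pull m k R B \<sigma>"
  have s: "semilinear R M.T k.T (\<lambda>a. a) ?h"
    unfolding coord_pull_def fun_ring_def[of m]
    by (rule tensor_lift(1)[where v = ?v, OF module k.T.module idh vc va vs])
  have hp: "?h (M.pure x) = (\<Otimes>\<^bsub>k.T\<^esub>j\<in>{..m}. ?g j (x j))" if x: "x \<in> M.tuples" for x
    unfolding v[OF x, symmetric] coord_pull_def
    by (rule tensor_lift(2)[where v = ?v, OF module k.T.module idh vc va vs x])
  show "?h \<in> ring_hom M.T k.T"
    by (rule M.fun_ring_hom(1)[where g = ?g, OF k.T.M_cring semilinear_closed[OF s] semilinear_add[OF s] gh hp])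
  show "?h (M.c j b) = k.c (\<sigma> j) b" if "j \<le> m" "b \<in> carrier B" for j b
    by (rule M.fun_ring_hom(2)[where g = ?g, OF k.T.M_cring semilinear_closed[OF s] semilinear_add[OF s] gh hp that])
qed

section \<open>The ideals\<close>

text \<open>This is the colon ideal (L : S). It lets membership of products in \<open>L\<close> be
  tested on generators, one factor at a time.\<close>

lemma (in cring) colon_ideal:
  assumes L: "ideal L R" and S: "S \<subseteq> carrier R"
  shows "ideal {x \<in> carrier R. \<forall>s\<in>S. s \<otimes> x \<in> L} R"
proof -
  interpret L: ideal L R by fact
  have sub: "subgroup {x \<in> carrier R. \<forall>s\<in>S. s \<otimes> x \<in> L} (add_monoid R)"
  proof (rule add.subgroupI)
    show "{x \<in> carrier R. \<forall>s\<in>S. s \<otimes> x \<in> L} \<noteq> {}" using S by (auto intro!: exI[of _ \<zero>])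
  qed (use S in \<open>auto simp: r_distr r_minus subset_iff\<close>)
  have mult: "x \<otimes> a \<in> {x \<in> carrier R. \<forall>s\<in>S. s \<otimes> x \<in> L}"
    if a: "a \<in> {x \<in> carrier R. \<forall>s\<in>S. s \<otimes> x \<in> L}" and x: "x \<in> carrier R" for a x
  proof -
    have "s \<otimes> (x \<otimes> a) \<in> L" if s: "s \<in> S" for s
    proof -
      have "s \<otimes> (x \<otimes> a) = x \<otimes> (s \<otimes> a)" using a x s S by (auto simp: m_lcomm)
      thus ?thesis using L.I_l_closed a x s by auto
    qed
    thus ?thesis using a x by auto
  qed
  show ?thesis
  proof (rule idealI[OF ring_axioms sub mult])
    show "a \<otimes> x \<in> {x \<in> carrier R. \<forall>s\<in>S. s \<otimes> x \<in> L}"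
      if "a \<in> {x \<in> carrier R. \<forall>s\<in>S. s \<otimes> x \<in> L}" "x \<in> carrier R" for a x
      using mult[OF that] that m_comm[of a x] by auto
  qed
qed

text \<open>Two passes through colon ideals: with the generators \<open>S\<close> fixed the second
  factor is extended to its ideal, then with that ideal fixed the first factor is extended.\<close>

lemma (in cring) ideal_prod_Idl_subset:
  assumes L: "ideal L R" and S: "S \<subseteq> carrier R" and S': "S' \<subseteq> carrier R"
    and p: "\<And>s s'. s \<in> S \<Longrightarrow> s' \<in> S' \<Longrightarrow> s \<otimes> s' \<in> L"
  shows "(Idl S) \<cdot> (Idl S') \<subseteq> L"
proof -
  interpret L: ideal L R by fact
  have I: "ideal (Idl S) R" and I': "ideal (Idl S') R" using genideal_ideal S S' by auto
  have 1: "Idl S' \<subseteq> {x \<in> carrier R. \<forall>s\<in>S. s \<otimes> x \<in> L}"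
    by (rule genideal_minimal[OF colon_ideal[OF L S]]) (use p S' in auto)
  have c: "Idl S' \<subseteq> carrier R" using ideal.Icarr[OF I'] by blast
  have 2: "Idl S \<subseteq> {x \<in> carrier R. \<forall>s\<in>Idl S'. s \<otimes> x \<in> L}"
  proof (rule genideal_minimal[OF colon_ideal[OF L c]], clarify)
    fix s assume s: "s \<in> S"
    have "s' \<otimes> s \<in> L" if "s' \<in> Idl S'" for s'
    proof -
      have "s' \<in> carrier R" "s \<otimes> s' \<in> L" using 1 that s by auto
      thus ?thesis using m_comm[of s s'] s S by auto
    qed
    thus "s \<in> carrier R \<and> (\<forall>s'\<in>Idl S'. s' \<otimes> s \<in> L)" using s S by auto
  qed
  show ?thesis
  proof
    fix x assume "x \<in> (Idl S) \<cdot> (Idl S')"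
    thus "x \<in> L"
    proof (induction rule: ideal_prod.induct)
      case (prod i j)
      hence "j \<otimes> i \<in> L" "i \<in> carrier R" "j \<in> carrier R" using 2 c by auto
      thus ?case using m_comm[of j i] by auto
    qed auto
  qed
qed

text \<open>The kernel of an additive map need not be an ideal. The set given here is the largest
  ideal contained in it, so an ideal of relations can be shown to be killed by placing its
  generators in this set.\<close>

lemma (in cring) additive_kernel_ideal:
  assumes h: "abelian_group_hom R P h"
  shows "ideal {x \<in> carrier R. \<forall>t\<in>carrier R. h (t \<otimes> x) = \<zero>\<^bsub>P\<^esub>} R"
proof -
  interpret h: abelian_group_hom R P h by fact
  have sub: "subgroup {x \<in> carrier R. \<forall>t\<in>carrier R. h (t \<otimes> x) = \<zero>\<^bsub>P\<^esub>} (add_monoid R)"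
  proof (rule add.subgroupI)
    show "{x \<in> carrier R. \<forall>t\<in>carrier R. h (t \<otimes> x) = \<zero>\<^bsub>P\<^esub>} \<noteq> {}" by (auto intro!: exI[of _ \<zero>])
    show "\<ominus> a \<in> {x \<in> carrier R. \<forall>t\<in>carrier R. h (t \<otimes> x) = \<zero>\<^bsub>P\<^esub>}"
      if "a \<in> {x \<in> carrier R. \<forall>t\<in>carrier R. h (t \<otimes> x) = \<zero>\<^bsub>P\<^esub>}" for a
    proof -
      have "h (t \<otimes> (\<ominus> a)) = \<zero>\<^bsub>P\<^esub>" if t: "t \<in> carrier R" for t
      proof -
        have "t \<otimes> (\<ominus> a) = (\<ominus> t) \<otimes> a" using t \<open>a \<in> _\<close> by (simp add: r_minus l_minus)
        moreover have "h ((\<ominus> t) \<otimes> a) = \<zero>\<^bsub>P\<^esub>" using t \<open>a \<in> _\<close> by blast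
        ultimately show ?thesis by simp
      qed
      thus ?thesis using that by auto
    qed
  qed (auto simp: r_distr)
  have mult: "x \<otimes> a \<in> {x \<in> carrier R. \<forall>t\<in>carrier R. h (t \<otimes> x) = \<zero>\<^bsub>P\<^esub>}"
    if a: "a \<in> {x \<in> carrier R. \<forall>t\<in>carrier R. h (t \<otimes> x) = \<zero>\<^bsub>P\<^esub>}" and x: "x \<in> carrier R" for a x
    using a x by (auto simp: m_assoc[symmetric])
  show ?thesis
  proof (rule idealI[OF ring_axioms sub mult])
    show "a \<otimes> x \<in> {x \<in> carrier R. \<forall>t\<in>carrier R. h (t \<otimes> x) = \<zero>\<^bsub>P\<^esub>}"
      if "a \<in> {x \<in> carrier R. \<forall>t\<in>carrier R. h (t \<otimes> x) = \<zero>\<^bsub>P\<^esub>}" "x \<in> carrier R" for a x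
      using mult[OF that] that m_comm[of a x] by auto
  qed
qed

lemma ring_hom_preimage_ideal:
  assumes "cring R" "cring S" and h: "h \<in> ring_hom R S" and L: "ideal L S"
  shows "ideal {x \<in> carrier R. h x \<in> L} R"
proof -
  interpret ring_hom_cring R S h using assms by (intro ring_hom_cring.intro ring_hom_cring_axioms.intro)
  interpret L: ideal L S by fact
  show ?thesis
  proof (rule idealI[OF R.ring_axioms])
    show "subgroup {x \<in> carrier R. h x \<in> L} (add_monoid R)"
    proof (rule R.add.subgroupI)
      show "{x \<in> carrier R. h x \<in> L} \<noteq> {}" by (auto intro!: exI[of _ "\<zero>\<^bsub>R\<^esub>"])
    qed auto
  qed (auto simp: L.I_l_closed L.I_r_closed)
qed

section \<open>Differences of coordinates and the ideals they generate\<close>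

context power_algebra
begin

abbreviation "D \<equiv> diff n R B"
abbreviation "\<delta> i \<equiv> diff n R B 0 i"
abbreviation "Jw \<equiv> J_weak n R B"
abbreviation "Ja \<equiv> J_alt n R B"
abbreviation "Js \<equiv> J_strong n R B"
abbreviation "J \<equiv> J_ideal n R B"

lemma diff_closed: "b \<in> carrier B \<Longrightarrow> D r s b \<in> carrier T"
  by (simp add: diff_def coord_closed)

lemma J_ideal: "ideal (J r s) T"
  unfolding J_ideal_def by (rule T.genideal_ideal) (auto simp: diff_closed)

lemma J_mem: "b \<in> carrier B \<Longrightarrow> D r s b \<in> J r s"
  unfolding J_ideal_def by (rule subsetD[OF T.genideal_self]) (auto simp: diff_closed)

lemma J_minimal: "ideal L T \<Longrightarrow> (\<And>b. b \<in> carrier B \<Longrightarrow> D r s b \<in> L) \<Longrightarrow> J r s \<subseteq> L"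
  unfolding J_ideal_def by (rule T.genideal_minimal) auto

lemma J_weak_carrier:
  "\<Union>{J r s \<cdot>\<^bsub>T\<^esub> J r s | r s. r < s \<and> s \<le> n} \<subseteq> carrier T"
  by (rule Union_least) (use T.ideal_prod_in_carrier[OF J_ideal J_ideal] in blast)

lemma Jw_ideal: "ideal Jw T"
  unfolding J_weak_def by (rule T.genideal_ideal[OF J_weak_carrier])

lemma Jw_mem:
  assumes "r < s" "s \<le> n" "x \<in> J r s" "y \<in> J r s" shows "x \<otimes>\<^bsub>T\<^esub> y \<in> Jw"
proof -
  have "x \<otimes>\<^bsub>T\<^esub> y \<in> J r s \<cdot>\<^bsub>T\<^esub> J r s" by (rule ideal_prod.prod[OF assms(3,4)])
  moreover have "J r s \<cdot>\<^bsub>T\<^esub> J r s \<subseteq> \<Union>{J r s \<cdot>\<^bsub>T\<^esub> J r s | r s. r < s \<and> s \<le> n}"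
    by (rule Union_upper, rule CollectI, rule exI[of _ r], rule exI[of _ s]) (simp add: assms(1,2))
  ultimately show ?thesis
    unfolding J_weak_def using T.genideal_self[OF J_weak_carrier] by (meson subsetD)
qed

lemma Jw_minimal:
  assumes L: "ideal L T"
    and "\<And>r s b c. r < s \<Longrightarrow> s \<le> n \<Longrightarrow> b \<in> carrier B \<Longrightarrow> c \<in> carrier B \<Longrightarrow> D r s b \<otimes>\<^bsub>T\<^esub> D r s c \<in> L"
  shows "Jw \<subseteq> L"
  unfolding J_weak_def
proof (rule T.genideal_minimal[OF L], clarify)
  fix x r s assume x: "x \<in> J r s \<cdot>\<^bsub>T\<^esub> J r s" and rs: "r < s" "s \<le> n"
  have "J r s \<cdot>\<^bsub>T\<^esub> J r s \<subseteq> L" unfolding J_ideal_def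
    by (rule T.ideal_prod_Idl_subset[OF L]) (use assms(2) rs in \<open>auto simp: diff_closed\<close>)
  thus "x \<in> L" using x by blast
qed

lemma J_alt_carrier: "{\<delta> r b \<otimes>\<^bsub>T\<^esub> \<delta> s b | r s b. r \<le> n \<and> s \<le> n \<and> b \<in> carrier B} \<subseteq> carrier T"
  by (auto simp: diff_closed)

lemma Ja_ideal: "ideal Ja T"
  unfolding J_alt_def by (rule T.genideal_ideal[OF J_alt_carrier])

lemma Ja_mem: "r \<le> n \<Longrightarrow> s \<le> n \<Longrightarrow> b \<in> carrier B \<Longrightarrow> \<delta> r b \<otimes>\<^bsub>T\<^esub> \<delta> s b \<in> Ja"
  unfolding J_alt_def by (rule subsetD[OF T.genideal_self[OF J_alt_carrier]]) blast

lemma Ja_minimal: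
  assumes L: "ideal L T"
    and "\<And>r s b. r \<le> n \<Longrightarrow> s \<le> n \<Longrightarrow> b \<in> carrier B \<Longrightarrow> \<delta> r b \<otimes>\<^bsub>T\<^esub> \<delta> s b \<in> L"
  shows "Ja \<subseteq> L"
  unfolding J_alt_def by (rule T.genideal_minimal[OF L]) (use assms(2) in blast)

lemma Js_ideal: "ideal Js T"
  unfolding J_strong_def by (rule T.add_ideals[OF Jw_ideal Ja_ideal])

lemma Jw_le_Js: "Jw \<subseteq> Js"
proof
  fix x assume x: "x \<in> Jw"
  have "x = x \<oplus>\<^bsub>T\<^esub> \<zero>\<^bsub>T\<^esub>" using ideal.Icarr[OF Jw_ideal x] by simp
  moreover have "\<zero>\<^bsub>T\<^esub> \<in> Ja" using additive_subgroup.zero_closed[OF ideal.axioms(1)[OF Ja_ideal]] .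
  ultimately show "x \<in> Js" using x unfolding J_strong_def set_add_def' by blast
qed

lemma Ja_le_Js: "Ja \<subseteq> Js"
proof
  fix x assume x: "x \<in> Ja"
  have "x = \<zero>\<^bsub>T\<^esub> \<oplus>\<^bsub>T\<^esub> x" using ideal.Icarr[OF Ja_ideal x] by simp
  moreover have "\<zero>\<^bsub>T\<^esub> \<in> Jw" using additive_subgroup.zero_closed[OF ideal.axioms(1)[OF Jw_ideal]] .
  ultimately show "x \<in> Js" using x unfolding J_strong_def set_add_def' by blast
qed

lemma Js_minimal:
  assumes "ideal L T" "Jw \<subseteq> L" "Ja \<subseteq> L" shows "Js \<subseteq> L"
proof
  fix x assume "x \<in> Js"
  then obtain u v where "u \<in> Jw" "v \<in> Ja" "x = u \<oplus>\<^bsub>T\<^esub> v" unfolding J_strong_def set_add_def' by blast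
  thus "x \<in> L" using additive_subgroup.a_closed[OF ideal.axioms(1)[OF assms(1)], of u v] assms(2,3) by blast
qed

lemma diff_self: "b \<in> carrier B \<Longrightarrow> D r r b = \<zero>\<^bsub>T\<^esub>"
  by (simp add: diff_def coord_closed T.minus_eq T.r_neg)

lemma diff_eq: "b \<in> carrier B \<Longrightarrow> D r s b = \<delta> s b \<ominus>\<^bsub>T\<^esub> \<delta> r b"
proof -
  assume b: "b \<in> carrier B"
  have "y \<ominus>\<^bsub>T\<^esub> x = (y \<ominus>\<^bsub>T\<^esub> z) \<ominus>\<^bsub>T\<^esub> (x \<ominus>\<^bsub>T\<^esub> z)"
    if "x \<in> carrier T" "y \<in> carrier T" "z \<in> carrier T" for x y z
  proof -
    have "z \<oplus>\<^bsub>T\<^esub> (\<ominus>\<^bsub>T\<^esub> x \<oplus>\<^bsub>T\<^esub> \<ominus>\<^bsub>T\<^esub> z) = \<ominus>\<^bsub>T\<^esub> x"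
      using that by (simp add: T.a_lcomm[of z "\<ominus>\<^bsub>T\<^esub> x"] T.r_neg)
    thus ?thesis using that by (simp add: T.minus_eq T.minus_add T.a_ac)
  qed
  thus ?thesis unfolding diff_def using coord_closed[OF b] by blast
qed

text \<open>Rewriting with base point 0 turns a generator of the square of \<open>J r s\<close> into
  two products with equal indices minus a symmetric mixed term. Thus \<open>J_weak\<close> amounts
  to the squares at base point 0 together with antisymmetry between different indices.\<close>

lemma diff_mult_eq:
  assumes "b \<in> carrier B" "e \<in> carrier B"
  shows "D r s b \<otimes>\<^bsub>T\<^esub> D r s e = (\<delta> s b \<otimes>\<^bsub>T\<^esub> \<delta> s e \<oplus>\<^bsub>T\<^esub> \<delta> r b \<otimes>\<^bsub>T\<^esub> \<delta> r e) \<ominus>\<^bsub>T\<^esub>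
    (\<delta> r b \<otimes>\<^bsub>T\<^esub> \<delta> s e \<oplus>\<^bsub>T\<^esub> \<delta> s b \<otimes>\<^bsub>T\<^esub> \<delta> r e)"
proof -
  have "(y \<ominus>\<^bsub>T\<^esub> x) \<otimes>\<^bsub>T\<^esub> (v \<ominus>\<^bsub>T\<^esub> u) = (y \<otimes>\<^bsub>T\<^esub> v \<oplus>\<^bsub>T\<^esub> x \<otimes>\<^bsub>T\<^esub> u) \<ominus>\<^bsub>T\<^esub> (x \<otimes>\<^bsub>T\<^esub> v \<oplus>\<^bsub>T\<^esub> y \<otimes>\<^bsub>T\<^esub> u)"
    if "x \<in> carrier T" "y \<in> carrier T" "u \<in> carrier T" "v \<in> carrier T" for x y u v
    using that by (simp add: T.minus_eq T.minus_add T.r_distr T.l_distr T.l_minus T.r_minus T.a_ac)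
  thus ?thesis unfolding diff_eq[OF assms(1), of r s] diff_eq[OF assms(2), of r s]
    using diff_closed assms by blast
qed

text \<open>Generators adapted to base point 0: a pair with r = 0 gives \<open>sq\<close> directly,
  and the other pairs are combinations of \<open>sq\<close> and \<open>sym\<close>. In this shape
  the relations can be compared with those between forms.\<close>

lemma Jw_minimal':
  assumes L: "ideal L T"
    and sq: "\<And>i b e. 1 \<le> i \<Longrightarrow> i \<le> n \<Longrightarrow> b \<in> carrier B \<Longrightarrow> e \<in> carrier B \<Longrightarrow> \<delta> i b \<otimes>\<^bsub>T\<^esub> \<delta> i e \<in> L"
    and sym: "\<And>i j b e. 1 \<le> i \<Longrightarrow> i < j \<Longrightarrow> j \<le> n \<Longrightarrow> b \<in> carrier B \<Longrightarrow> e \<in> carrier B \<Longrightarrow>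
        \<delta> i b \<otimes>\<^bsub>T\<^esub> \<delta> j e \<oplus>\<^bsub>T\<^esub> \<delta> j b \<otimes>\<^bsub>T\<^esub> \<delta> i e \<in> L"
  shows "Jw \<subseteq> L"
proof (rule Jw_minimal[OF L])
  interpret L: ideal L T by fact
  fix r s b e assume rs: "r < s" "s \<le> n" and b: "b \<in> carrier B" and e: "e \<in> carrier B"
  show "D r s b \<otimes>\<^bsub>T\<^esub> D r s e \<in> L"
  proof (cases "r = 0")
    case True
    thus ?thesis using sq rs b e by simp
  next
    case False
    thus ?thesis unfolding diff_mult_eq[OF b e, of r s]
      using sq[of s b e] sq[of r b e] sym[of r s b e] rs b e by (simp add: T.minus_eq)
  qed
qed

lemma delta_sq_mem: "1 \<le> i \<Longrightarrow> i \<le> n \<Longrightarrow> b \<in> carrier B \<Longrightarrow> e \<in> carrier B \<Longrightarrow> \<delta> i b \<otimes>\<^bsub>T\<^esub> \<delta> i e \<in> Jw"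
  by (rule Jw_mem[of 0 i]) (auto simp: J_mem)

text \<open>The expansion \<open>diff_mult_eq\<close> read in the opposite direction: the generator
  with indices \<open>i\<close>, \<open>j\<close> and the two products with equal indices lie in
  \<open>Jw\<close>, hence so does the mixed term. This term is symmetric in \<open>i\<close> and
  \<open>j\<close>, so the case i < j suffices.\<close>

lemma delta_sym_mem:
  assumes ij: "1 \<le> i" "i \<le> n" "1 \<le> j" "j \<le> n" "i \<noteq> j" and b: "b \<in> carrier B" and e: "e \<in> carrier B"
  shows "\<delta> i b \<otimes>\<^bsub>T\<^esub> \<delta> j e \<oplus>\<^bsub>T\<^esub> \<delta> j b \<otimes>\<^bsub>T\<^esub> \<delta> i e \<in> Jw"
proof -
  interpret L: ideal Jw T by (rule Jw_ideal)
  have *: "\<delta> i b \<otimes>\<^bsub>T\<^esub> \<delta> j e \<oplus>\<^bsub>T\<^esub> \<delta> j b \<otimes>\<^bsub>T\<^esub> \<delta> i e \<in> Jw"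
    if ij: "1 \<le> i" "i < j" "j \<le> n" for i j
  proof -
    let ?a = "\<delta> j b \<otimes>\<^bsub>T\<^esub> \<delta> j e \<oplus>\<^bsub>T\<^esub> \<delta> i b \<otimes>\<^bsub>T\<^esub> \<delta> i e"
    let ?s = "\<delta> i b \<otimes>\<^bsub>T\<^esub> \<delta> j e \<oplus>\<^bsub>T\<^esub> \<delta> j b \<otimes>\<^bsub>T\<^esub> \<delta> i e"
    have c: "?a \<in> carrier T" "?s \<in> carrier T" by (auto simp: diff_closed b e)
    have m: "?a \<ominus>\<^bsub>T\<^esub> ?s \<in> Jw" unfolding diff_mult_eq[OF b e, of i j, symmetric]
      by (rule Jw_mem[of i j]) (use ij J_mem b e in auto)
    have a: "?a \<in> Jw" using delta_sq_mem ij b e by simp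
    have "?s = ?a \<oplus>\<^bsub>T\<^esub> \<ominus>\<^bsub>T\<^esub> (?a \<ominus>\<^bsub>T\<^esub> ?s)"
      using c by (simp add: T.minus_eq T.minus_add T.r_neg1 T.r_neg2 del: T.m_closed)
    thus ?thesis using m a L.a_closed L.a_inv_closed by metis
  qed
  show ?thesis
  proof (cases "i < j")
    case True
    thus ?thesis using * ij by simp
  next
    case False
    hence "\<delta> j b \<otimes>\<^bsub>T\<^esub> \<delta> i e \<oplus>\<^bsub>T\<^esub> \<delta> i b \<otimes>\<^bsub>T\<^esub> \<delta> j e \<in> Jw" using *[of j i] ij by simp
    thus ?thesis using T.a_comm by (simp add: diff_closed b e)
  qed
qed

end

lemma (in abelian_group) add_minus_cancel:
  "x \<in> carrier G \<Longrightarrow> y \<in> carrier G \<Longrightarrow> (x \<oplus> y) \<ominus> y = x"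
  by (simp add: minus_eq a_assoc r_neg)

text \<open>Exchanging \<open>r\<close> and \<open>s\<close> changes the sign of both factors. The
  version for unordered indices is there because a substitution of coordinates may reverse a pair or
  collapse it to equal indices.\<close>

lemma (in power_algebra) diff_mult_mem:
  assumes rs: "r \<le> n" "s \<le> n" and b: "b \<in> carrier B" and e: "e \<in> carrier B"
  shows "D r s b \<otimes>\<^bsub>T\<^esub> D r s e \<in> Jw"
proof -
  interpret L: ideal Jw T by (rule Jw_ideal)
  have lt: "D r s b \<otimes>\<^bsub>T\<^esub> D r s e \<in> Jw" if "r < s" "s \<le> n" for r s
    by (rule Jw_mem[of r s]) (use that J_mem b e in auto)
  consider "r < s" | "r = s" | "s < r" by linarith
  thus ?thesis
  proof cases
    case 1
    thus ?thesis using lt rs by simp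
  next
    case 2
    thus ?thesis using b e by (simp add: diff_self)
  next
    case 3
    have "D r s b \<otimes>\<^bsub>T\<^esub> D r s e = D s r b \<otimes>\<^bsub>T\<^esub> D s r e"
    proof -
      have "(x \<ominus>\<^bsub>T\<^esub> y) \<otimes>\<^bsub>T\<^esub> (u \<ominus>\<^bsub>T\<^esub> v) = (y \<ominus>\<^bsub>T\<^esub> x) \<otimes>\<^bsub>T\<^esub> (v \<ominus>\<^bsub>T\<^esub> u)"
        if "x \<in> carrier T" "y \<in> carrier T" "u \<in> carrier T" "v \<in> carrier T" for x y u v
        using that by (simp add: T.minus_eq T.minus_add T.r_distr T.l_distr T.l_minus T.r_minus T.a_ac)
      thus ?thesis unfolding diff_def using coord_closed b e by blast
    qed
    thus ?thesis using lt[of s r] 3 rs by simp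
  qed
qed

text \<open>\<open>J_alt\<close> is defined with base point 0, but a map of coordinates may move the
  base point, as happens to the second factor of a star product. After expansion each of the four
  terms is a defining product of \<open>J_alt\<close>.\<close>

lemma (in power_algebra) diff_mult_alt:
  assumes rs: "q \<le> n" "r \<le> n" "s \<le> n" and b: "b \<in> carrier B"
  shows "D q r b \<otimes>\<^bsub>T\<^esub> D q s b \<in> Ja"
proof -
  interpret L: ideal Ja T by (rule Ja_ideal)
  have e: "(y \<ominus>\<^bsub>T\<^esub> x) \<otimes>\<^bsub>T\<^esub> (v \<ominus>\<^bsub>T\<^esub> x) =
      (y \<otimes>\<^bsub>T\<^esub> v \<oplus>\<^bsub>T\<^esub> x \<otimes>\<^bsub>T\<^esub> x) \<ominus>\<^bsub>T\<^esub> (x \<otimes>\<^bsub>T\<^esub> v \<oplus>\<^bsub>T\<^esub> y \<otimes>\<^bsub>T\<^esub> x)"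
    if "x \<in> carrier T" "y \<in> carrier T" "v \<in> carrier T" for x y v
    using that by (simp add: T.minus_eq T.minus_add T.r_distr T.l_distr T.l_minus T.r_minus T.a_ac)
  show ?thesis unfolding diff_eq[OF b, of q r] diff_eq[OF b, of q s]
      e[OF diff_closed[OF b] diff_closed[OF b] diff_closed[OF b]]
    using Ja_mem rs b by (simp add: T.minus_eq)
qed

text \<open>Preimages of ideals are ideals, so each inclusion is checked on generators. A single
  statement for maps acting on coordinates by \<open>\<sigma>\<close> and on functions by
  \<open>\<beta>\<close> covers base change (with \<open>\<sigma>\<close> the identity) as well as
  the substitutions and the two pullbacks in the star product (with \<open>\<beta>\<close> the
  identity).\<close>

lemma hom_ideals:
  assumes M: "power_algebra R B" and k: "power_algebra R' B'"
    and h: "h \<in> ring_hom (fun_ring m R B) (fun_ring k R' B')"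
    and hc: "\<And>j b. j \<le> m \<Longrightarrow> b \<in> carrier B \<Longrightarrow> h (coord m R B j b) = coord k R' B' (\<sigma> j) (\<beta> b)"
    and \<sigma>: "\<And>j. j \<le> m \<Longrightarrow> \<sigma> j \<le> k" and \<beta>: "\<And>b. b \<in> carrier B \<Longrightarrow> \<beta> b \<in> carrier B'"
  shows "\<And>r s b. r \<le> m \<Longrightarrow> s \<le> m \<Longrightarrow> b \<in> carrier B \<Longrightarrow>
      h (diff m R B r s b) = diff k R' B' (\<sigma> r) (\<sigma> s) (\<beta> b)"
    and "\<And>x. x \<in> J_weak m R B \<Longrightarrow> h x \<in> J_weak k R' B'"
    and "\<And>x. x \<in> J_strong m R B \<Longrightarrow> h x \<in> J_strong k R' B'"
    and "\<And>x r s. r \<le> m \<Longrightarrow> s \<le> m \<Longrightarrow> x \<in> J_ideal m R B r s \<Longrightarrow> h x \<in> J_ideal k R' B' (\<sigma> r) (\<sigma> s)"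
proof -
  interpret M: power_algebra R B m by (rule M)
  interpret k: power_algebra R' B' k by (rule k)
  interpret h: ring_hom_cring M.T k.T h using h by unfold_locales
  show D: "h (M.D r s b) = k.D (\<sigma> r) (\<sigma> s) (\<beta> b)" if "r \<le> m" "s \<le> m" "b \<in> carrier B" for r s b
    using that by (simp add: diff_def hc M.coord_closed M.T.minus_eq k.T.minus_eq)
  note pre = ring_hom_preimage_ideal[OF M.T.M_cring k.T.M_cring h]
  have w: "M.Jw \<subseteq> {x \<in> carrier M.T. h x \<in> k.Jw}"
    by (rule M.Jw_minimal[OF pre[OF k.Jw_ideal]])
      (use k.diff_mult_mem \<sigma> \<beta> in \<open>auto simp: D M.diff_closed\<close>)
  thus "h x \<in> k.Jw" if "x \<in> M.Jw" for x using that by blast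
  have w': "M.Jw \<subseteq> {x \<in> carrier M.T. h x \<in> k.Js}" using w k.Jw_le_Js by blast
  have a: "M.Ja \<subseteq> {x \<in> carrier M.T. h x \<in> k.Js}"
    by (rule M.Ja_minimal[OF pre[OF k.Js_ideal]])
      (use k.diff_mult_alt k.Ja_le_Js \<sigma> \<beta> in \<open>auto simp: D M.diff_closed subset_iff\<close>)
  show "h x \<in> k.Js" if "x \<in> M.Js" for x
    using M.Js_minimal[OF pre[OF k.Js_ideal] w' a] that by blast
  show "h x \<in> k.J (\<sigma> r) (\<sigma> s)" if rs: "r \<le> m" "s \<le> m" and x: "x \<in> M.J r s" for x r s
  proof -
    have "M.J r s \<subseteq> {x \<in> carrier M.T. h x \<in> k.J (\<sigma> r) (\<sigma> s)}"
      by (rule M.J_minimal[OF pre[OF k.J_ideal]]) (use rs k.J_mem \<beta> in \<open>auto simp: D M.diff_closed\<close>)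
    thus ?thesis using x by blast
  qed
qed

section \<open>From functions to forms\<close>

context power_algebra
begin

abbreviation "P \<equiv> tensor_power B K n"
abbreviation "ktuples \<equiv> {..<n} \<rightarrow>\<^sub>E carrier K"
abbreviation "ptens \<equiv> pure_tensor B K n"
abbreviation "dtup x \<equiv> (\<lambda>i\<in>{..<n}. d (x (Suc i)))"

sublocale P: Module.module B P by (rule module_tensor_power[OF module_kaehler])

text \<open>The values lie in the tensor power, before any antisymmetry is imposed, so that one map
  serves weak and strong forms. Scalars from \<open>R\<close> act on the target through their image
  in \<open>B\<close>.\<close>

definition pi0 where
  "pi0 = coset_lift (lin_ext R P (\<lambda>r. r \<odot>\<^bsub>B\<^esub> \<one>\<^bsub>B\<^esub>) (\<lambda>x. x 0 \<odot>\<^bsub>P\<^esub> ptens (dtup x)))"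

lemma tuple_mem: "x \<in> tuples \<Longrightarrow> i \<le> n \<Longrightarrow> x i \<in> carrier B"
  using PiE_mem[of x "{..<Suc n}" "\<lambda>_. carrier B" i] by simp

lemma dtup: "x \<in> tuples \<Longrightarrow> dtup x \<in> ktuples"
  using tuple_mem by (intro restrict_PiE_iff[THEN iffD2] ballI d_closed) auto

lemma dtup_update0: "dtup (x(0 := y)) = dtup x"
  by auto

lemma dtup_update: "k < n \<Longrightarrow> dtup (x(Suc k := y)) = (dtup x)(k := d y)"
  by (auto simp: fun_eq_iff)

lemma ptens_closed: "y \<in> ktuples \<Longrightarrow> ptens y \<in> carrier P"
  by (rule pure_tensor_closed[OF module_kaehler])

lemmas ptens_add = pure_tensor_add[OF module_kaehler, where n = n]
lemmas ptens_smult = pure_tensor_smult[OF module_kaehler, where n = n]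

lemma pi0:
  shows "semilinear R T P (\<lambda>r. r \<odot>\<^bsub>B\<^esub> \<one>\<^bsub>B\<^esub>) pi0"
    and "\<And>x. x \<in> tuples \<Longrightarrow> pi0 (pure x) = x 0 \<odot>\<^bsub>P\<^esub> ptens (dtup x)"
proof -
  let ?v = "\<lambda>x. x 0 \<odot>\<^bsub>P\<^esub> ptens (dtup x)"
  have vc: "?v x \<in> carrier P" if "x \<in> tuples" for x
    by (rule P.smult_closed[OF tuple_mem[OF that] ptens_closed[OF dtup[OF that]]]) simp
  have va: "?v (x(i := y \<oplus>\<^bsub>B\<^esub> z)) = ?v (x(i := y)) \<oplus>\<^bsub>P\<^esub> ?v (x(i := z))"
    if x: "x \<in> tuples" and i: "i < Suc n" and y: "y \<in> carrier B" and z: "z \<in> carrier B" for x i y z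
  proof (cases i)
    case 0
    show ?thesis unfolding 0 dtup_update0 using ptens_closed[OF dtup[OF x]] y z by (simp add: P.smult_l_distr)
  next
    case (Suc k)
    have k: "k < n" using i Suc by simp
    note t = ptens_closed[OF tuple_update[OF dtup[OF x] k d_closed]]
    show ?thesis unfolding Suc dtup_update[OF k] d_add[OF y z]
        ptens_add[OF dtup[OF x] k d_closed[OF y] d_closed[OF z]]
      using t[OF y] t[OF z] tuple_mem[OF x, of 0] by (simp add: P.smult_r_distr)
  qed
  have vs: "?v (x(i := r \<odot>\<^bsub>B\<^esub> y)) = (r \<odot>\<^bsub>B\<^esub> \<one>\<^bsub>B\<^esub>) \<odot>\<^bsub>P\<^esub> ?v (x(i := y))"
    if x: "x \<in> tuples" and i: "i < Suc n" and y: "y \<in> carrier B" and r: "r \<in> carrier R" for x i y r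
  proof (cases i)
    case 0
    show ?thesis unfolding 0 dtup_update0 using ptens_closed[OF dtup[OF x]] y r
      by (simp add: P.smult_assoc1[symmetric] smult_eq[OF r y])
  next
    case (Suc k)
    have k: "k < n" using i Suc by simp
    note t = ptens_closed[OF tuple_update[OF dtup[OF x] k d_closed[OF y]]]
    have e: "x 0 \<odot>\<^bsub>P\<^esub> (b \<odot>\<^bsub>P\<^esub> u) = b \<odot>\<^bsub>P\<^esub> (x 0 \<odot>\<^bsub>P\<^esub> u)" if "b \<in> carrier B" "u \<in> carrier P" for b u
      using that tuple_mem[OF x, of 0] by (simp add: P.smult_assoc1[symmetric] m_comm)
    show ?thesis unfolding Suc dtup_update[OF k] d_smult[OF r y]
        ptens_smult[OF dtup[OF x] k d_closed[OF y] smult_one_closed[OF r]]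
      using e[OF smult_one_closed[OF r] t] by simp
  qed
  show "semilinear R T P (\<lambda>r. r \<odot>\<^bsub>B\<^esub> \<one>\<^bsub>B\<^esub>) pi0"
    unfolding pi0_def fun_ring_def by (rule tensor_lift(1)[OF R_module P.module_axioms scalar_hom vc va vs])
  show "\<And>x. x \<in> tuples \<Longrightarrow> pi0 (pure x) = x 0 \<odot>\<^bsub>P\<^esub> ptens (dtup x)"
    unfolding pi0_def by (rule tensor_lift(2)[OF R_module P.module_axioms scalar_hom vc va vs])
qed

text \<open>Every differential is a sum of terms b dc, and coefficients can be moved out of a tensor
  factor to the front. The inner induction is on the number \<open>k\<close> of leading factors not
  yet known to be exact; \<open>kaehler_induct\<close> treats the last of them.\<close>

lemma pi0_surj: "u \<in> carrier P \<Longrightarrow> \<exists>t\<in>carrier T. pi0 t = u"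
  using module_kaehler
proof (induction rule: tensor_power_induct)
  case (add s t)
  then obtain s' t' where "s' \<in> carrier T" "t' \<in> carrier T" "pi0 s' = s" "pi0 t' = t" by blast
  thus ?case using semilinear_add[OF pi0(1)] T.a_closed by metis
next
  case (gen a y)
  have "\<forall>a y. a \<in> carrier B \<longrightarrow> y \<in> ktuples \<longrightarrow> (\<forall>i. k \<le> i \<longrightarrow> i < n \<longrightarrow> (\<exists>b\<in>carrier B. y i = d b)) \<longrightarrow>
      (\<exists>t\<in>carrier T. pi0 t = a \<odot>\<^bsub>P\<^esub> ptens y)" if "k \<le> n" for k
    using that
  proof (induction k)
    case 0
    show ?case
    proof (intro allI impI)
      fix a y assume a: "a \<in> carrier B" and y: "y \<in> ktuples"
        and e: "\<forall>i. 0 \<le> i \<longrightarrow> i < n \<longrightarrow> (\<exists>b\<in>carrier B. y i = d b)"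
      then obtain b where b: "\<And>i. i < n \<Longrightarrow> b i \<in> carrier B \<and> y i = d (b i)" by (metis le0)
      let ?x = "\<lambda>i\<in>{..<Suc n}. if i = 0 then a else b (i - 1)"
      have x: "?x \<in> tuples" using a b by auto
      have "dtup ?x = y" using b y by (auto simp: fun_eq_iff restrict_def PiE_iff extensional_def)
      thus "\<exists>t\<in>carrier T. pi0 t = a \<odot>\<^bsub>P\<^esub> ptens y"
        using pi0(2)[OF x] pure_closed[OF x] by auto
    qed
  next
    case (Suc k)
    hence k: "k < n" by simp
    show ?case
    proof (intro allI impI)
      fix a y assume a: "a \<in> carrier B" and y: "y \<in> ktuples"
        and e: "\<forall>i. Suc k \<le> i \<longrightarrow> i < n \<longrightarrow> (\<exists>b\<in>carrier B. y i = d b)"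
      have *: "\<exists>t\<in>carrier T. pi0 t = a \<odot>\<^bsub>P\<^esub> ptens (y(k := z))" if z: "z \<in> carrier K" for z
        using z
      proof (induction rule: kaehler_induct)
        case (gen b e')
        have "y(k := d e') \<in> ktuples" using tuple_update[OF y k d_closed[OF gen(2)]] .
        moreover have "\<forall>i. k \<le> i \<longrightarrow> i < n \<longrightarrow> (\<exists>b\<in>carrier B. (y(k := d e')) i = d b)"
          using e gen(2) by auto
        \<comment> \<open>The coefficient \<open>b\<close> of factor \<open>k\<close> joins the
          scalar \<open>a\<close>, after which one more factor is exact.\<close>
        ultimately have "\<exists>t\<in>carrier T. pi0 t = (a \<otimes>\<^bsub>B\<^esub> b) \<odot>\<^bsub>P\<^esub> ptens (y(k := d e'))"
          using Suc.IH k a gen(1) m_closed[OF a gen(1)] by (meson less_imp_le)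
        thus ?case
          unfolding ptens_smult[OF y k d_closed[OF gen(2)] gen(1)]
          using P.smult_assoc1[OF a gen(1) ptens_closed[OF \<open>y(k := d e') \<in> ktuples\<close>]] by simp
      next
        case (add s t)
        then obtain s' t' where st: "s' \<in> carrier T" "t' \<in> carrier T" "pi0 s' = a \<odot>\<^bsub>P\<^esub> ptens (y(k := s))"
          "pi0 t' = a \<odot>\<^bsub>P\<^esub> ptens (y(k := t))" by blast
        have "pi0 (s' \<oplus>\<^bsub>T\<^esub> t') = a \<odot>\<^bsub>P\<^esub> ptens (y(k := s \<oplus>\<^bsub>K\<^esub> t))"
          unfolding semilinear_add[OF pi0(1) st(1,2)] st(3,4) ptens_add[OF y k add(1,2)]
          by (rule P.smult_r_distr[OF a, symmetric]) (rule ptens_closed tuple_update[OF y k] add)+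
        thus ?case using st T.a_closed by blast
      qed
      have "y k \<in> carrier K" using y k by auto
      from *[OF this] show "\<exists>t\<in>carrier T. pi0 t = a \<odot>\<^bsub>P\<^esub> ptens y" by simp
    qed
  qed
  from this[of n] show ?case using gen by auto
qed

lemma pure_mult_coord:
  assumes x: "x \<in> tuples" and r: "r \<le> n" and b: "b \<in> carrier B"
  shows "pure x \<otimes>\<^bsub>T\<^esub> c r b = pure (x(r := x r \<otimes>\<^bsub>B\<^esub> b))"
proof -
  have "(\<lambda>i\<in>{..<Suc n}. x i \<otimes>\<^bsub>B\<^esub> (\<lambda>i\<in>{..<Suc n}. if i = r then b else \<one>\<^bsub>B\<^esub>) i) = x(r := x r \<otimes>\<^bsub>B\<^esub> b)"
    using r tuple_mem[OF x] PiE_arb[OF x] by (auto simp: fun_eq_iff restrict_def less_Suc_eq_le)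
  thus ?thesis unfolding coord_def fun_ring_def using pure_tensor_mult[OF algebra_axioms x coord_tuple[OF b]] by simp
qed

section \<open>The relations between weak and between strong forms\<close>

definition wgens where
  "wgens = {ptens x \<oplus>\<^bsub>P\<^esub> ptens (x(i := x j, j := x i)) | x i j. x \<in> ktuples \<and> i < n \<and> j < n \<and> i \<noteq> j}"

definition sgens where
  "sgens = {ptens x | x. x \<in> ktuples \<and> (\<exists>i<n. \<exists>j<n. i \<noteq> j \<and> x i = x j)}"

lemma omega_weak_rel_eq: "omega_weak_rel R B n = submodule_gen B P wgens"
  by (simp add: omega_weak_rel_def wgens_def)

lemma omega_strong_rel_eq: "omega_strong_rel R B n = submodule_gen B P sgens"
  by (simp add: omega_strong_rel_def sgens_def)

lemma swap_tuple: "x \<in> ktuples \<Longrightarrow> i < n \<Longrightarrow> j < n \<Longrightarrow> x(i := x j, j := x i) \<in> ktuples"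
  by (intro tuple_update) auto

lemma wgens_carrier: "wgens \<subseteq> carrier P"
  using ptens_closed swap_tuple by (auto simp: wgens_def simp del: fun_upd_apply)

lemma sgens_carrier: "sgens \<subseteq> carrier P"
  using ptens_closed by (auto simp: sgens_def)

lemma submodule_weak: "submodule (omega_weak_rel R B n) B P"
  unfolding omega_weak_rel_eq by (rule submodule_gen_submodule[OF P.module_axioms wgens_carrier])

lemma submodule_strong: "submodule (omega_strong_rel R B n) B P"
  unfolding omega_strong_rel_eq by (rule submodule_gen_submodule[OF P.module_axioms sgens_carrier])

text \<open>Polarisation: tensors with x_i + x_j in both places, with x_i in both and with x_j in
  both are strong relations. Expanding the first by bilinearity and subtracting the other two leaves
  the sum of a tensor and its exchanged version.\<close>

lemma weak_le_strong: "omega_weak_rel R B n \<subseteq> omega_strong_rel R B n"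
  unfolding omega_weak_rel_eq
proof (rule submodule_gen_minimal[OF submodule_strong], rule subsetI)
  fix g assume "g \<in> wgens"
  then obtain x i j where x: "x \<in> ktuples" "i < n" "j < n" "i \<noteq> j"
    and g: "g = ptens x \<oplus>\<^bsub>P\<^esub> ptens (x(i := x j, j := x i))" unfolding wgens_def by blast
  note S = P.submoduleE[OF submodule_strong]
  define u where "u a b = ptens (x(i := a, j := b))" for a b
  have t: "x(i := a) \<in> ktuples" if "a \<in> carrier K" for a by (rule tuple_update[OF x(1,2) that])
  have t2: "x(i := a, j := b) \<in> ktuples" if "a \<in> carrier K" "b \<in> carrier K" for a b
    by (rule tuple_update[OF t[OF that(1)] x(3) that(2)])
  have uc: "u a b \<in> carrier P" if "a \<in> carrier K" "b \<in> carrier K" for a b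
    unfolding u_def by (rule ptens_closed[OF t2[OF that]])
  have ur: "u a (b \<oplus>\<^bsub>K\<^esub> b') = u a b \<oplus>\<^bsub>P\<^esub> u a b'" if "a \<in> carrier K" "b \<in> carrier K" "b' \<in> carrier K" for a b b'
    unfolding u_def by (rule ptens_add[OF t[OF that(1)] x(3) that(2,3)])
  have ul: "u (a \<oplus>\<^bsub>K\<^esub> a') b = u a b \<oplus>\<^bsub>P\<^esub> u a' b" if "a \<in> carrier K" "a' \<in> carrier K" "b \<in> carrier K" for a a' b
    unfolding u_def fun_upd_twist[OF x(4)]
    by (rule ptens_add[OF tuple_update[OF x(1) x(3) that(3)] x(2) that(1,2)])
  have um: "u a a \<in> omega_strong_rel R B n" if "a \<in> carrier K" for a
    unfolding u_def omega_strong_rel_eq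
  proof (rule subsetD[OF submodule_gen_superset])
    have "(x(i := a, j := a)) i = (x(i := a, j := a)) j" by simp
    thus "ptens (x(i := a, j := a)) \<in> sgens" unfolding sgens_def using t2[OF that that] x(2-4) by blast
  qed
  have xi: "x i \<in> carrier K" "x j \<in> carrier K" using x by auto
  let ?s = "x i \<oplus>\<^bsub>K\<^esub> x j"
  have g': "g = u (x i) (x j) \<oplus>\<^bsub>P\<^esub> u (x j) (x i)" unfolding g u_def by simp
  have "u ?s ?s = (u (x i) (x i) \<oplus>\<^bsub>P\<^esub> u (x j) (x j)) \<oplus>\<^bsub>P\<^esub> g"
    unfolding g' using xi uc by (simp add: ur ul P.M.a_ac)
  moreover have gc: "g \<in> carrier P" "u (x i) (x i) \<oplus>\<^bsub>P\<^esub> u (x j) (x j) \<in> carrier P"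
    unfolding g' using uc xi by auto
  ultimately have "g = u ?s ?s \<oplus>\<^bsub>P\<^esub> \<ominus>\<^bsub>P\<^esub> (u (x i) (x i) \<oplus>\<^bsub>P\<^esub> u (x j) (x j))"
    using abelian_group.add_minus_cancel[OF P.abelian_group_axioms gc] abelian_monoid.a_comm[OF _ gc]
      P.abelian_monoid_axioms by (simp add: a_minus_def)
  thus "g \<in> omega_strong_rel R B n"
    using S(3,5) um xi by (metis K.M.a_closed)
qed

end

text \<open>\<open>N\<close> stands for the weak or the strong relations. Only antisymmetry is
  assumed, so that the computations with the Leibniz rule are made once for both.\<close>

locale form_quotient = power_algebra R B n for R :: "'a ring" and B :: "('a, 'b) module" and n +
  fixes N
  assumes N_sub: "submodule N B P" and weak_le: "omega_weak_rel R B n \<subseteq> N"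
begin

abbreviation "Om \<equiv> quot_module P N"
abbreviation "cls u \<equiv> N +>\<^bsub>P\<^esub> u"
abbreviation "w y \<equiv> cls (ptens y)"
abbreviation "p t \<equiv> cls (pi0 t)"

sublocale Om: Module.module B Om by (rule module_quot_module[OF P.module_axioms N_sub])

lemma cls_lin: "semilinear B P Om (\<lambda>b. b) (\<lambda>u. cls u)"
  by (rule quot_module_semilinear[OF P.module_axioms N_sub])

lemma cls_zero_iff: "u \<in> carrier P \<Longrightarrow> cls u = \<zero>\<^bsub>Om\<^esub> \<longleftrightarrow> u \<in> N"
  by (rule quot_module_eq_zero_iff[OF P.module_axioms N_sub])

lemma w_closed: "y \<in> ktuples \<Longrightarrow> w y \<in> carrier Om"
  by (rule semilinear_closed[OF cls_lin ptens_closed])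

lemma w_add:
  assumes y: "y \<in> ktuples" "k < n" "a \<in> carrier K" "b \<in> carrier K"
  shows "w (y(k := a \<oplus>\<^bsub>K\<^esub> b)) = w (y(k := a)) \<oplus>\<^bsub>Om\<^esub> w (y(k := b))"
  unfolding ptens_add[OF y]
  by (rule semilinear_add[OF cls_lin]) (rule ptens_closed tuple_update[OF y(1,2)] y)+

lemma w_smult:
  assumes y: "y \<in> ktuples" "k < n" "a \<in> carrier K" "b \<in> carrier B"
  shows "w (y(k := b \<odot>\<^bsub>K\<^esub> a)) = b \<odot>\<^bsub>Om\<^esub> w (y(k := a))"
  unfolding ptens_smult[OF y]
  by (rule semilinear_smult[OF cls_lin y(4)]) (rule ptens_closed tuple_update[OF y(1,2)] y)+

lemma w_anti:
  assumes y: "y \<in> ktuples" "i < n" "j < n" "i \<noteq> j"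
  shows "w y \<oplus>\<^bsub>Om\<^esub> w (y(i := y j, j := y i)) = \<zero>\<^bsub>Om\<^esub>"
proof -
  note c = ptens_closed[OF y(1)] ptens_closed[OF swap_tuple[OF y(1-3)]]
  have "ptens y \<oplus>\<^bsub>P\<^esub> ptens (y(i := y j, j := y i)) \<in> wgens"
    unfolding wgens_def using y by blast
  hence "ptens y \<oplus>\<^bsub>P\<^esub> ptens (y(i := y j, j := y i)) \<in> N"
    using submodule_gen_superset[of wgens B P] weak_le unfolding omega_weak_rel_eq by (meson subsetD)
  thus ?thesis using cls_zero_iff[OF P.add.m_closed[OF c]] semilinear_add[OF cls_lin c] by simp
qed

lemma p_closed: "t \<in> carrier T \<Longrightarrow> p t \<in> carrier Om"
  by (rule semilinear_closed[OF cls_lin semilinear_closed[OF pi0(1)]])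

lemma p_add: "s \<in> carrier T \<Longrightarrow> t \<in> carrier T \<Longrightarrow> p (s \<oplus>\<^bsub>T\<^esub> t) = p s \<oplus>\<^bsub>Om\<^esub> p t"
  using semilinear_add[OF pi0(1)] semilinear_add[OF cls_lin] semilinear_closed[OF pi0(1)] by simp

lemma p_hom: "abelian_group_hom T Om (\<lambda>t. p t)"
  by (rule abelian_group_hom_additive[OF T.abelian_group_axioms Om.abelian_group_axioms p_closed p_add])

lemma p_minus: "s \<in> carrier T \<Longrightarrow> t \<in> carrier T \<Longrightarrow> p (s \<ominus>\<^bsub>T\<^esub> t) = p s \<ominus>\<^bsub>Om\<^esub> p t"
  using additive_minus[OF p_hom] by simp

lemma p_pure:
  assumes x: "x \<in> tuples" shows "p (pure x) = x 0 \<odot>\<^bsub>Om\<^esub> w (dtup x)"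
  unfolding pi0(2)[OF x]
  by (rule semilinear_smult[OF cls_lin tuple_mem[OF x] ptens_closed[OF dtup[OF x]]]) simp

lemma p_surj: "v \<in> carrier Om \<Longrightarrow> \<exists>t\<in>carrier T. p t = v"
  using pi0_surj by (auto simp: quot_module_carrier)

text \<open>By the Leibniz rule d(sb) = s db + b ds, and since factor \<open>k\<close> of
  \<open>y\<close> is ds, the second term reproduces the subtracted tensor. This is the computation
  behind multiplication by a difference of coordinates.\<close>

lemma leibniz_cancel:
  assumes y: "y \<in> ktuples" "k < n" and a: "a \<in> carrier B" and s: "s \<in> carrier B" "y k = d s" and b: "b \<in> carrier B"
  shows "a \<odot>\<^bsub>Om\<^esub> w (y(k := d (s \<otimes>\<^bsub>B\<^esub> b))) \<ominus>\<^bsub>Om\<^esub> (a \<otimes>\<^bsub>B\<^esub> b) \<odot>\<^bsub>Om\<^esub> w y = a \<odot>\<^bsub>Om\<^esub> w (y(k := s \<odot>\<^bsub>K\<^esub> d b))"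
proof -
  have c: "s \<odot>\<^bsub>K\<^esub> d b \<in> carrier K" "b \<odot>\<^bsub>K\<^esub> d s \<in> carrier K" using s b d_closed by auto
  have A: "w (y(k := s \<odot>\<^bsub>K\<^esub> d b)) \<in> carrier Om" by (rule w_closed[OF tuple_update[OF y c(1)]])
  have W: "w y \<in> carrier Om" by (rule w_closed[OF y(1)])
  have yk: "y(k := d s) = y" using fun_upd_triv[of y k] s(2) by simp
  have "w (y(k := d (s \<otimes>\<^bsub>B\<^esub> b))) = w (y(k := s \<odot>\<^bsub>K\<^esub> d b)) \<oplus>\<^bsub>Om\<^esub> b \<odot>\<^bsub>Om\<^esub> w y"
    unfolding d_mult[OF s(1) b] w_add[OF y c] w_smult[OF y d_closed[OF s(1)] b] yk ..
  thus ?thesis using A W a b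
    by (simp add: Om.smult_r_distr Om.smult_assoc1 abelian_group.add_minus_cancel[OF Om.abelian_group_axioms])
qed

lemma delta_expand:
  assumes x: "x \<in> tuples" and r: "r \<le> n" and b: "b \<in> carrier B"
  shows "pure x \<otimes>\<^bsub>T\<^esub> \<delta> r b = pure (x(r := x r \<otimes>\<^bsub>B\<^esub> b)) \<ominus>\<^bsub>T\<^esub> pure (x(0 := x 0 \<otimes>\<^bsub>B\<^esub> b))"
proof -
  have "u \<otimes>\<^bsub>T\<^esub> (v \<ominus>\<^bsub>T\<^esub> z) = u \<otimes>\<^bsub>T\<^esub> v \<ominus>\<^bsub>T\<^esub> u \<otimes>\<^bsub>T\<^esub> z" if "u \<in> carrier T" "v \<in> carrier T" "z \<in> carrier T" for u v z
    using that by (simp add: T.minus_eq T.r_distr T.r_minus)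
  from this[OF pure_closed[OF x] coord_closed[OF b] coord_closed[OF b]]
  show ?thesis unfolding diff_def pure_mult_coord[OF x r b, symmetric] pure_mult_coord[OF x le0 b, symmetric] .
qed

lemma tuple_mult_update: "x \<in> tuples \<Longrightarrow> r \<le> n \<Longrightarrow> b \<in> carrier B \<Longrightarrow> x(r := x r \<otimes>\<^bsub>B\<^esub> b) \<in> tuples"
  using tuple_update[of x "Suc n" "carrier B" r "x r \<otimes>\<^bsub>B\<^esub> b"] tuple_mem[of x r] by simp

text \<open>Multiplying by the difference subtracts a multiplication at coordinate 0 from one at
  coordinate \<open>Suc k\<close>; after cancellation the factor dx becomes x db. Coordinate
  \<open>Suc k\<close> corresponds to factor \<open>k\<close> of the form.\<close>

lemma p_delta:
  assumes x: "x \<in> tuples" and k: "k < n" and b: "b \<in> carrier B"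
  shows "p (pure x \<otimes>\<^bsub>T\<^esub> \<delta> (Suc k) b) = x 0 \<odot>\<^bsub>Om\<^esub> w ((dtup x)(k := x (Suc k) \<odot>\<^bsub>K\<^esub> d b))"
proof -
  have k': "Suc k \<le> n" using k by simp
  note t1 = tuple_mult_update[OF x k' b] and t2 = tuple_mult_update[OF x le0 b]
  have xk: "(dtup x) k = d (x (Suc k))" using k by simp
  have "p (pure x \<otimes>\<^bsub>T\<^esub> \<delta> (Suc k) b) = x 0 \<odot>\<^bsub>Om\<^esub> w ((dtup x)(k := d (x (Suc k) \<otimes>\<^bsub>B\<^esub> b))) \<ominus>\<^bsub>Om\<^esub>
      (x 0 \<otimes>\<^bsub>B\<^esub> b) \<odot>\<^bsub>Om\<^esub> w (dtup x)"
    unfolding delta_expand[OF x k' b] p_minus[OF pure_closed[OF t1] pure_closed[OF t2]] p_pure[OF t1] p_pure[OF t2]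
      dtup_update[OF k] dtup_update0 by simp
  also have "\<dots> = x 0 \<odot>\<^bsub>Om\<^esub> w ((dtup x)(k := x (Suc k) \<odot>\<^bsub>K\<^esub> d b))"
    by (rule leibniz_cancel[OF dtup[OF x] k tuple_mem[OF x le0] tuple_mem[OF x k'] xk b])
  finally show ?thesis .
qed

text \<open>Only the first difference is expanded, the second being handled by
  \<open>p_delta\<close>. Whether \<open>j\<close> and \<open>k\<close> agree is left open: the
  updated entry at \<open>Suc k\<close> contains \<open>b\<close> precisely when they do.\<close>

lemma p_delta_delta_expand:
  assumes x: "x \<in> tuples" and j: "j < n" and k: "k < n" and b: "b \<in> carrier B" and e: "e \<in> carrier B"
  shows "p ((pure x \<otimes>\<^bsub>T\<^esub> \<delta> (Suc j) b) \<otimes>\<^bsub>T\<^esub> \<delta> (Suc k) e) =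
    x 0 \<odot>\<^bsub>Om\<^esub> w ((dtup x)(j := d (x (Suc j) \<otimes>\<^bsub>B\<^esub> b),
        k := (x(Suc j := x (Suc j) \<otimes>\<^bsub>B\<^esub> b)) (Suc k) \<odot>\<^bsub>K\<^esub> d e)) \<ominus>\<^bsub>Om\<^esub>
    (x 0 \<otimes>\<^bsub>B\<^esub> b) \<odot>\<^bsub>Om\<^esub> w ((dtup x)(k := x (Suc k) \<odot>\<^bsub>K\<^esub> d e))"
proof -
  have j': "Suc j \<le> n" using j by simp
  note t1 = tuple_mult_update[OF x j' b] and t2 = tuple_mult_update[OF x le0 b]
  have "(u \<ominus>\<^bsub>T\<^esub> v) \<otimes>\<^bsub>T\<^esub> z = u \<otimes>\<^bsub>T\<^esub> z \<ominus>\<^bsub>T\<^esub> v \<otimes>\<^bsub>T\<^esub> z" if "u \<in> carrier T" "v \<in> carrier T" "z \<in> carrier T" for u v z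
    using that by (simp add: T.minus_eq T.l_distr T.l_minus)
  note m = this[OF pure_closed[OF t1] pure_closed[OF t2] diff_closed[OF e]]
  show ?thesis
    unfolding delta_expand[OF x j' b] m p_minus[OF T.m_closed[OF pure_closed[OF t1] diff_closed[OF e]]
        T.m_closed[OF pure_closed[OF t2] diff_closed[OF e]]]
      p_delta[OF t1 k e] p_delta[OF t2 k e] dtup_update[OF j] dtup_update0 by simp
qed

text \<open>Both terms of the expansion have a multiple of de in factor \<open>k\<close>. With x the
  entry at \<open>Suc k\<close>, the total coefficients are x_0 (x b) and (x_0 b) x, so the terms
  cancel.\<close>

lemma p_delta_sq:
  assumes x: "x \<in> tuples" and k: "k < n" and b: "b \<in> carrier B" and e: "e \<in> carrier B"
  shows "p ((pure x \<otimes>\<^bsub>T\<^esub> \<delta> (Suc k) b) \<otimes>\<^bsub>T\<^esub> \<delta> (Suc k) e) = \<zero>\<^bsub>Om\<^esub>"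
proof -
  have xk: "x (Suc k) \<in> carrier B" "x 0 \<in> carrier B" using tuple_mem[OF x] k by auto
  note y = dtup[OF x] k
  let ?V = "w ((dtup x)(k := d e))"
  have V: "?V \<in> carrier Om" by (rule w_closed[OF tuple_update[OF y d_closed[OF e]]])
  have "p ((pure x \<otimes>\<^bsub>T\<^esub> \<delta> (Suc k) b) \<otimes>\<^bsub>T\<^esub> \<delta> (Suc k) e) =
      x 0 \<odot>\<^bsub>Om\<^esub> ((x (Suc k) \<otimes>\<^bsub>B\<^esub> b) \<odot>\<^bsub>Om\<^esub> ?V) \<ominus>\<^bsub>Om\<^esub> (x 0 \<otimes>\<^bsub>B\<^esub> b) \<odot>\<^bsub>Om\<^esub> (x (Suc k) \<odot>\<^bsub>Om\<^esub> ?V)"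
    unfolding p_delta_delta_expand[OF x k k b e] fun_upd_upd fun_upd_same
      w_smult[OF y d_closed[OF e] xk(1)] w_smult[OF y d_closed[OF e] m_closed[OF xk(1) b]] ..
  moreover have "x 0 \<odot>\<^bsub>Om\<^esub> ((x (Suc k) \<otimes>\<^bsub>B\<^esub> b) \<odot>\<^bsub>Om\<^esub> ?V) = (x 0 \<otimes>\<^bsub>B\<^esub> b) \<odot>\<^bsub>Om\<^esub> (x (Suc k) \<odot>\<^bsub>Om\<^esub> ?V)"
    using xk b V by (simp add: Om.smult_assoc1[symmetric] m_ac)
  ultimately show ?thesis using xk b V
    by (simp add: abelian_group_minus_eq_zero_iff[OF Om.abelian_group_axioms])
qed

text \<open>For different factors the Leibniz cancellation applies a second time and leaves db and
  de. The coefficient is symmetric in the two indices, so exchanging the indices amounts to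
  exchanging two factors of the form.\<close>

lemma p_delta_delta:
  assumes x: "x \<in> tuples" and j: "j < n" and k: "k < n" and jk: "j \<noteq> k" and b: "b \<in> carrier B" and e: "e \<in> carrier B"
  shows "p ((pure x \<otimes>\<^bsub>T\<^esub> \<delta> (Suc j) b) \<otimes>\<^bsub>T\<^esub> \<delta> (Suc k) e) =
    (x 0 \<otimes>\<^bsub>B\<^esub> (x (Suc j) \<otimes>\<^bsub>B\<^esub> x (Suc k))) \<odot>\<^bsub>Om\<^esub> w ((dtup x)(j := d b, k := d e))"
proof -
  have xk: "x (Suc k) \<in> carrier B" "x (Suc j) \<in> carrier B" "x 0 \<in> carrier B" using tuple_mem[OF x] j k by auto
  let ?Z = "x (Suc k) \<odot>\<^bsub>K\<^esub> d e"
  have Z: "?Z \<in> carrier K" using xk e d_closed by auto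
  have y': "(dtup x)(k := ?Z) \<in> ktuples" by (rule tuple_update[OF dtup[OF x] k Z])
  have yj: "(dtup x)(j := a) \<in> ktuples" if "a \<in> carrier K" for a by (rule tuple_update[OF dtup[OF x] j that])
  have y'j: "((dtup x)(k := ?Z)) j = d (x (Suc j))" using jk j by simp
  have tw: "(dtup x)(j := a, k := ?Z) = ((dtup x)(k := ?Z))(j := a)" for a
    by (rule fun_upd_twist[OF jk])
  have xsk: "(x(Suc j := x (Suc j) \<otimes>\<^bsub>B\<^esub> b)) (Suc k) = x (Suc k)" using jk by simp
  let ?V = "w ((dtup x)(j := d b, k := d e))"
  have V: "?V \<in> carrier Om" by (rule w_closed[OF tuple_update[OF yj[OF d_closed[OF b]] k d_closed[OF e]]])
  have "p ((pure x \<otimes>\<^bsub>T\<^esub> \<delta> (Suc j) b) \<otimes>\<^bsub>T\<^esub> \<delta> (Suc k) e) =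
      x 0 \<odot>\<^bsub>Om\<^esub> w (((dtup x)(k := ?Z))(j := x (Suc j) \<odot>\<^bsub>K\<^esub> d b))"
    unfolding p_delta_delta_expand[OF x j k b e] xsk tw
    by (rule leibniz_cancel[OF y' j xk(3) xk(2) y'j b])
  also have "w (((dtup x)(k := ?Z))(j := x (Suc j) \<odot>\<^bsub>K\<^esub> d b)) =
      x (Suc j) \<odot>\<^bsub>Om\<^esub> (x (Suc k) \<odot>\<^bsub>Om\<^esub> ?V)"
    using w_smult[OF y' j d_closed[OF b] xk(2)] w_smult[OF yj[OF d_closed[OF b]] k d_closed[OF e] xk(1)]
    unfolding tw by simp
  finally show ?thesis using xk V by (simp add: Om.smult_assoc1)
qed

lemma p_kernel_ideal: "ideal {g \<in> carrier T. \<forall>t\<in>carrier T. p (t \<otimes>\<^bsub>T\<^esub> g) = \<zero>\<^bsub>Om\<^esub>} T"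
  by (rule T.additive_kernel_ideal[OF p_hom])

text \<open>By additivity it is enough to consider multiples by pure tensors, on which
  \<open>p\<close> is explicit.\<close>

lemma p_kernelI:
  assumes g: "g \<in> carrier T" and x: "\<And>x. x \<in> tuples \<Longrightarrow> p (pure x \<otimes>\<^bsub>T\<^esub> g) = \<zero>\<^bsub>Om\<^esub>"
  shows "g \<in> {g \<in> carrier T. \<forall>t\<in>carrier T. p (t \<otimes>\<^bsub>T\<^esub> g) = \<zero>\<^bsub>Om\<^esub>}"
proof -
  have "p (t \<otimes>\<^bsub>T\<^esub> g) = \<zero>\<^bsub>Om\<^esub>" if t: "t \<in> carrier T" for t
    using t
  proof (induction rule: fun_ring_induct)
    case (pure x)
    thus ?case by (rule x)
  next
    case (add s t)
    thus ?case using p_add[of "s \<otimes>\<^bsub>T\<^esub> g" "t \<otimes>\<^bsub>T\<^esub> g"] g by (simp add: T.l_distr)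
  qed
  thus ?thesis using g by blast
qed

lemma p_kernelD: "g \<in> {g \<in> carrier T. \<forall>t\<in>carrier T. p (t \<otimes>\<^bsub>T\<^esub> g) = \<zero>\<^bsub>Om\<^esub>} \<Longrightarrow> p g = \<zero>\<^bsub>Om\<^esub>"
  using T.one_closed T.l_one by fastforce

lemma Jw_kernel: "Jw \<subseteq> {g \<in> carrier T. \<forall>t\<in>carrier T. p (t \<otimes>\<^bsub>T\<^esub> g) = \<zero>\<^bsub>Om\<^esub>}"
proof (rule Jw_minimal'[OF p_kernel_ideal])
  fix i b e assume i: "1 \<le> i" "i \<le> n" and b: "b \<in> carrier B" and e: "e \<in> carrier B"
  then obtain k where k: "i = Suc k" "k < n" by (cases i) auto
  show "\<delta> i b \<otimes>\<^bsub>T\<^esub> \<delta> i e \<in> {g \<in> carrier T. \<forall>t\<in>carrier T. p (t \<otimes>\<^bsub>T\<^esub> g) = \<zero>\<^bsub>Om\<^esub>}"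
  proof (rule p_kernelI[OF T.m_closed[OF diff_closed[OF b] diff_closed[OF e]]])
    fix x assume x: "x \<in> tuples"
    show "p (pure x \<otimes>\<^bsub>T\<^esub> (\<delta> i b \<otimes>\<^bsub>T\<^esub> \<delta> i e)) = \<zero>\<^bsub>Om\<^esub>"
      unfolding k(1) T.m_assoc[OF pure_closed[OF x] diff_closed[OF b] diff_closed[OF e], symmetric]
      by (rule p_delta_sq[OF x k(2) b e])
  qed
next
  fix i j b e assume "1 \<le> i" "i < j" "j \<le> n" and b: "b \<in> carrier B" and e: "e \<in> carrier B"
  then obtain k l where kl: "i = Suc k" "j = Suc l" "k < n" "l < n" "k \<noteq> l" by (cases i; cases j) auto
  show "\<delta> i b \<otimes>\<^bsub>T\<^esub> \<delta> j e \<oplus>\<^bsub>T\<^esub> \<delta> j b \<otimes>\<^bsub>T\<^esub> \<delta> i e \<in> {g \<in> carrier T. \<forall>t\<in>carrier T. p (t \<otimes>\<^bsub>T\<^esub> g) = \<zero>\<^bsub>Om\<^esub>}"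
  proof (rule p_kernelI)
    fix x assume x: "x \<in> tuples"
    have xk: "x (Suc k) \<in> carrier B" "x (Suc l) \<in> carrier B" "x 0 \<in> carrier B" using tuple_mem[OF x] kl by auto
    let ?a = "x 0 \<otimes>\<^bsub>B\<^esub> (x (Suc k) \<otimes>\<^bsub>B\<^esub> x (Suc l))"
    let ?y = "(dtup x)(k := d b, l := d e)"
    have y: "?y \<in> ktuples" using tuple_update[OF tuple_update[OF dtup[OF x] kl(3) d_closed[OF b]] kl(4) d_closed[OF e]] .
    \<comment> \<open>Exchanging factors \<open>k\<close> and \<open>l\<close> of this tensor gives
      the tensor of the second summand, so antisymmetry applies to the sum of the two.\<close>
    have sw: "?y(k := ?y l, l := ?y k) = (dtup x)(l := d b, k := d e)" using kl(5) by (auto simp: fun_eq_iff)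
    note wy = w_closed[OF y] w_closed[OF swap_tuple[OF y kl(3,4)], unfolded sw]
    have "pure x \<otimes>\<^bsub>T\<^esub> (\<delta> i b \<otimes>\<^bsub>T\<^esub> \<delta> j e \<oplus>\<^bsub>T\<^esub> \<delta> j b \<otimes>\<^bsub>T\<^esub> \<delta> i e) =
        (pure x \<otimes>\<^bsub>T\<^esub> \<delta> i b) \<otimes>\<^bsub>T\<^esub> \<delta> j e \<oplus>\<^bsub>T\<^esub> (pure x \<otimes>\<^bsub>T\<^esub> \<delta> j b) \<otimes>\<^bsub>T\<^esub> \<delta> i e"
      using pure_closed[OF x] diff_closed b e by (simp add: T.r_distr T.m_assoc)
    hence "p (pure x \<otimes>\<^bsub>T\<^esub> (\<delta> i b \<otimes>\<^bsub>T\<^esub> \<delta> j e \<oplus>\<^bsub>T\<^esub> \<delta> j b \<otimes>\<^bsub>T\<^esub> \<delta> i e)) =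
        p ((pure x \<otimes>\<^bsub>T\<^esub> \<delta> i b) \<otimes>\<^bsub>T\<^esub> \<delta> j e) \<oplus>\<^bsub>Om\<^esub> p ((pure x \<otimes>\<^bsub>T\<^esub> \<delta> j b) \<otimes>\<^bsub>T\<^esub> \<delta> i e)"
      using p_add[of "(pure x \<otimes>\<^bsub>T\<^esub> \<delta> i b) \<otimes>\<^bsub>T\<^esub> \<delta> j e" "(pure x \<otimes>\<^bsub>T\<^esub> \<delta> j b) \<otimes>\<^bsub>T\<^esub> \<delta> i e"]
        pure_closed[OF x] diff_closed b e by simp
    also have "\<dots> = ?a \<odot>\<^bsub>Om\<^esub> w ?y \<oplus>\<^bsub>Om\<^esub> ?a \<odot>\<^bsub>Om\<^esub> w ((dtup x)(l := d b, k := d e))"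
      unfolding kl(1,2) p_delta_delta[OF x kl(3,4,5) b e] p_delta_delta[OF x kl(4,3) kl(5)[symmetric] b e]
      using xk by (simp add: m_comm)
    also have "\<dots> = ?a \<odot>\<^bsub>Om\<^esub> (w ?y \<oplus>\<^bsub>Om\<^esub> w ((dtup x)(l := d b, k := d e)))"
      using xk wy by (simp add: Om.smult_r_distr)
    also have "\<dots> = \<zero>\<^bsub>Om\<^esub>"
      unfolding w_anti[OF y kl(3,4,5), unfolded sw] using xk by simp
    finally show "p (pure x \<otimes>\<^bsub>T\<^esub> (\<delta> i b \<otimes>\<^bsub>T\<^esub> \<delta> j e \<oplus>\<^bsub>T\<^esub> \<delta> j b \<otimes>\<^bsub>T\<^esub> \<delta> i e)) = \<zero>\<^bsub>Om\<^esub>" .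
  qed (use diff_closed b e in auto)
qed

lemma p_Jw: "t \<in> Jw \<Longrightarrow> p t = \<zero>\<^bsub>Om\<^esub>"
  using p_kernelD Jw_kernel by blast

lemma Js_kernel:
  assumes "omega_strong_rel R B n \<subseteq> N"
  shows "Js \<subseteq> {g \<in> carrier T. \<forall>t\<in>carrier T. p (t \<otimes>\<^bsub>T\<^esub> g) = \<zero>\<^bsub>Om\<^esub>}"
proof (rule Js_minimal[OF p_kernel_ideal Jw_kernel], rule Ja_minimal[OF p_kernel_ideal])
  fix r s b assume rs: "r \<le> n" "s \<le> n" and b: "b \<in> carrier B"
  let ?L = "{g \<in> carrier T. \<forall>t\<in>carrier T. p (t \<otimes>\<^bsub>T\<^esub> g) = \<zero>\<^bsub>Om\<^esub>}"
  note db = diff_closed[OF b]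
  \<comment> \<open>Differences with index 0 vanish, equal indices give an element of
    \<open>Jw\<close>, and different ones lead to a tensor in which the factor db occurs
    twice.\<close>
  consider "r = 0" | "s = 0" | "1 \<le> r" "r = s" | k l where "r = Suc k" "s = Suc l" "k < n" "l < n" "k \<noteq> l"
    using rs by (cases r; cases s) auto
  thus "\<delta> r b \<otimes>\<^bsub>T\<^esub> \<delta> s b \<in> ?L"
  proof cases
    case 1
    hence z: "\<delta> r b \<otimes>\<^bsub>T\<^esub> \<delta> s b = \<zero>\<^bsub>T\<^esub>" using db b by (simp add: diff_self)
    show ?thesis unfolding z by (rule additive_subgroup.zero_closed[OF ideal.axioms(1)[OF p_kernel_ideal]])
  next
    case 2
    hence z: "\<delta> r b \<otimes>\<^bsub>T\<^esub> \<delta> s b = \<zero>\<^bsub>T\<^esub>" using db b by (simp add: diff_self)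
    show ?thesis unfolding z by (rule additive_subgroup.zero_closed[OF ideal.axioms(1)[OF p_kernel_ideal]])
  next
    case 3
    thus ?thesis using delta_sq_mem[of s b b] Jw_kernel rs b by blast
  next
    case 4
    show ?thesis
    proof (rule p_kernelI[OF T.m_closed[OF db db]])
      fix x assume x: "x \<in> tuples"
      have xk: "x (Suc k) \<in> carrier B" "x (Suc l) \<in> carrier B" "x 0 \<in> carrier B" using tuple_mem[OF x] 4 by auto
      let ?y = "(dtup x)(k := d b, l := d b)"
      have y: "?y \<in> ktuples" using tuple_update[OF tuple_update[OF dtup[OF x] 4(3) d_closed[OF b]] 4(4) d_closed[OF b]] .
      have "?y k = ?y l" by simp
      hence "ptens ?y \<in> sgens" unfolding sgens_def using y 4(3-5) by blast
      hence "ptens ?y \<in> N"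
        using submodule_gen_superset[of sgens B P] assms unfolding omega_strong_rel_eq by (meson subsetD)
      hence z: "w ?y = \<zero>\<^bsub>Om\<^esub>" using cls_zero_iff[OF ptens_closed[OF y]] by simp
      show "p (pure x \<otimes>\<^bsub>T\<^esub> (\<delta> r b \<otimes>\<^bsub>T\<^esub> \<delta> s b)) = \<zero>\<^bsub>Om\<^esub>"
        unfolding T.m_assoc[OF pure_closed[OF x] db db, symmetric] 4(1,2) p_delta_delta[OF x 4(3-5) b b] z
        using xk by simp
    qed
  qed
qed

lemma p_Js: "omega_strong_rel R B n \<subseteq> N \<Longrightarrow> t \<in> Js \<Longrightarrow> p t = \<zero>\<^bsub>Om\<^esub>"
  using p_kernelD Js_kernel by blast

end

section \<open>From forms to functions\<close>

lemma (in comm_monoid) finprod_extract2: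
  assumes "finite I" "i \<in> I" "j \<in> I" "i \<noteq> j" "\<And>k. k \<in> I \<Longrightarrow> f k \<in> carrier G"
  shows "finprod G f I = (f i \<otimes> f j) \<otimes> finprod G f (I - {i, j})"
proof -
  have 1: "insert i (I - {i}) = I" and 2: "insert j (I - {i, j}) = I - {i}" using assms by auto
  have "finprod G f (insert i (I - {i})) = f i \<otimes> finprod G f (I - {i})"
    using assms by (intro finprod_insert) auto
  moreover have "finprod G f (insert j (I - {i, j})) = f j \<otimes> finprod G f (I - {i, j})"
    using assms by (intro finprod_insert) auto
  moreover have "finprod G f (I - {i, j}) \<in> carrier G" using assms by (intro finprod_closed) auto
  ultimately show ?thesis unfolding 1 2 using assms by (simp add: m_assoc)
qed

text \<open>With \<open>a\<close> and \<open>b\<close> read as values at the base point, this is the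
  Leibniz rule up to the product of the two differences, an error term that lies in the square of
  the ideal of differences.\<close>

lemma (in cring) diff_product_identity:
  assumes "a \<in> carrier R" "b \<in> carrier R" "x \<in> carrier R" "y \<in> carrier R"
  shows "x \<otimes> y \<ominus> a \<otimes> b = (a \<otimes> (y \<ominus> b) \<oplus> b \<otimes> (x \<ominus> a)) \<oplus> (x \<ominus> a) \<otimes> (y \<ominus> b)"
  using assms by algebra

lemma (in cring) diff_sum_identity:
  assumes "a \<in> carrier R" "b \<in> carrier R" "x \<in> carrier R" "y \<in> carrier R"
  shows "(x \<oplus> y) \<ominus> (a \<oplus> b) = (x \<ominus> a) \<oplus> (y \<ominus> b)"
  using assms by algebra

lemma (in cring) anti_identity:
  assumes "s \<in> carrier R" "t \<in> carrier R" "u \<in> carrier R" "v \<in> carrier R" "u' \<in> carrier R" "v' \<in> carrier R"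
  shows "(s \<otimes> u) \<otimes> (t \<otimes> v) \<oplus> (t \<otimes> v') \<otimes> (s \<otimes> u') = (s \<otimes> t) \<otimes> (u \<otimes> v \<oplus> u' \<otimes> v')"
  using assms by algebra

lemma (in cring) add_exchange:
  assumes "x \<in> carrier R" "y \<in> carrier R" "u \<in> carrier R" "v \<in> carrier R"
  shows "(x \<oplus> y) \<oplus> (u \<oplus> v) = (x \<oplus> u) \<oplus> (y \<oplus> v)"
  using assms by algebra

lemma (in cring) alt_exchange:
  assumes "a \<in> carrier R" "b \<in> carrier R" "a' \<in> carrier R" "b' \<in> carrier R"
  shows "(a \<oplus> b) \<otimes> (a' \<oplus> b') = (a \<otimes> a' \<oplus> b \<otimes> b') \<oplus> (a \<otimes> b' \<oplus> b \<otimes> a')"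
  using assms by algebra

lemma comb_module_simps:
  "carrier (comb_module n R B L \<Psi>) = \<Psi>"
  "\<zero>\<^bsub>comb_module n R B L \<Psi>\<^esub> = \<zero>\<^bsub>fun_ring n R B Quot L\<^esub>"
  "add (comb_module n R B L \<Psi>) = add (fun_ring n R B Quot L)"
  "b \<odot>\<^bsub>comb_module n R B L \<Psi>\<^esub> X =
     (L +>\<^bsub>fun_ring n R B\<^esub> coord n R B 0 b) \<otimes>\<^bsub>fun_ring n R B Quot L\<^esub> X"
  by (simp_all add: comb_module_def ring.defs module.defs)

text \<open>The counterpart of \<open>form_quotient\<close> on the side of functions.
  \<open>QM\<close> is the whole quotient ring with \<open>B\<close> acting through coordinate 0;
  the combinatorial forms are singled out inside it only later.\<close>

locale comb_quotient = power_algebra R B n for R :: "'a ring" and B :: "('a, 'b) module" and n +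
  fixes L
  assumes L_ideal: "ideal L T" and Jw_le: "Jw \<subseteq> L"
begin

abbreviation "Q \<equiv> T Quot L"
abbreviation "q t \<equiv> L +>\<^bsub>T\<^esub> t"
abbreviation "QM \<equiv> comb_module n R B L (carrier Q)"

lemma Q_cring: "cring Q"
  by (rule ideal.quotient_is_cring[OF L_ideal T.M_cring])

sublocale Q: cring Q by (rule Q_cring)

lemma q_hom: "(\<lambda>t. q t) \<in> ring_hom T Q"
  by (rule ideal.rcos_ring_hom[OF L_ideal])

lemma q_ring_hom: "ring_hom_cring T Q (\<lambda>t. q t)"
  by (intro ring_hom_cring.intro ring_hom_cring_axioms.intro T.M_cring Q_cring q_hom)

lemmas q_closed = ring_hom_closed[OF q_hom]
lemmas q_add = ring_hom_add[OF q_hom]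
lemmas q_mult = ring_hom_mult[OF q_hom]

lemma q_minus: "s \<in> carrier T \<Longrightarrow> t \<in> carrier T \<Longrightarrow> q (s \<ominus>\<^bsub>T\<^esub> t) = q s \<ominus>\<^bsub>Q\<^esub> q t"
  by (simp add: T.minus_eq Q.minus_eq q_add ring_hom_cring.hom_a_inv[OF q_ring_hom])

lemma q_surj: "X \<in> carrier Q \<Longrightarrow> \<exists>t\<in>carrier T. X = q t"
  by (auto simp: FactRing_def A_RCOSETS_def')

lemma q_eq_iff: "s \<in> carrier T \<Longrightarrow> t \<in> carrier T \<Longrightarrow> q s = q t \<longleftrightarrow> s \<ominus>\<^bsub>T\<^esub> t \<in> L"
  using abelian_subgroup.coset_eq_iff[OF abelian_subgroupI3[OF ideal.axioms(1)[OF L_ideal] T.abelian_group_axioms]] .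

lemma q_zero_iff: "t \<in> carrier T \<Longrightarrow> q t = \<zero>\<^bsub>Q\<^esub> \<longleftrightarrow> t \<in> L"
  using q_eq_iff[of t "\<zero>\<^bsub>T\<^esub>"] ring_hom_cring.hom_zero[OF q_ring_hom] by (simp add: T.minus_eq)

lemma module_comb: "Module.module B QM"
proof (rule moduleI)
  show "abelian_group QM"
    by (rule abelian_groupI) (auto simp: comb_module_simps Q.a_ac intro: Q.l_neg)
  show "\<one>\<^bsub>B\<^esub> \<odot>\<^bsub>QM\<^esub> x = x" if "x \<in> carrier QM" for x
    using that by (simp add: comb_module_simps ring_hom_one[OF coord_hom[OF le0]] ring_hom_one[OF q_hom])
qed (auto simp: comb_module_simps ring_hom_closed[OF coord_hom[OF le0]] ring_hom_add[OF coord_hom[OF le0]]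
    ring_hom_mult[OF coord_hom[OF le0]] q_closed q_add q_mult Q.l_distr Q.r_distr Q.m_assoc is_cring)

sublocale QM: Module.module B QM by (rule module_comb)

lemma id_hom: "(\<lambda>b. b) \<in> ring_hom B B"
  by (rule ring_hom_memI) auto

lemma qc_closed: "b \<in> carrier B \<Longrightarrow> q (c r b) \<in> carrier Q"
  by (rule q_closed[OF coord_closed])

lemma qd_closed: "b \<in> carrier B \<Longrightarrow> q (D r s b) \<in> carrier Q"
  by (rule q_closed[OF diff_closed])

definition phi where "phi i = coset_lift (lin_ext B QM (\<lambda>b. b) (\<lambda>b. q (\<delta> i b)))"

text \<open>The class of \<open>\<delta> i b\<close> is a derivation in \<open>b\<close> for the
  action through coordinate 0: the error in the Leibniz rule is a product of two differences with
  the same indices and belongs to \<open>Jw\<close>. Constants from \<open>R\<close> agree at all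
  coordinates, so their differences vanish.\<close>

lemma phi:
  assumes i: "1 \<le> i" "i \<le> n"
  shows "semilinear B K QM (\<lambda>b. b) (phi i)" and "\<And>b. b \<in> carrier B \<Longrightarrow> phi i (d b) = q (\<delta> i b)"
proof -
  have v: "q (\<delta> i b) \<in> carrier QM" if "b \<in> carrier B" for b
    using qd_closed[OF that] by (simp add: comb_module_simps)
  have va: "q (\<delta> i (b \<oplus>\<^bsub>B\<^esub> e)) = q (\<delta> i b) \<oplus>\<^bsub>QM\<^esub> q (\<delta> i e)" if b: "b \<in> carrier B" and e: "e \<in> carrier B" for b e
  proof -
    have "\<delta> i (b \<oplus>\<^bsub>B\<^esub> e) = \<delta> i b \<oplus>\<^bsub>T\<^esub> \<delta> i e"
      unfolding diff_def ring_hom_add[OF coord_hom[OF i(2)] b e] ring_hom_add[OF coord_hom[OF le0] b e]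
      by (rule T.diff_sum_identity) (rule coord_closed b e)+
    thus ?thesis using q_add[OF diff_closed[OF b] diff_closed[OF e]] by (simp add: comb_module_simps)
  qed
  have vm: "q (\<delta> i (b \<otimes>\<^bsub>B\<^esub> e)) = b \<odot>\<^bsub>QM\<^esub> q (\<delta> i e) \<oplus>\<^bsub>QM\<^esub> e \<odot>\<^bsub>QM\<^esub> q (\<delta> i b)"
    if b: "b \<in> carrier B" and e: "e \<in> carrier B" for b e
  proof -
    have 1: "\<delta> i (b \<otimes>\<^bsub>B\<^esub> e) = (c 0 b \<otimes>\<^bsub>T\<^esub> \<delta> i e \<oplus>\<^bsub>T\<^esub> c 0 e \<otimes>\<^bsub>T\<^esub> \<delta> i b) \<oplus>\<^bsub>T\<^esub> \<delta> i b \<otimes>\<^bsub>T\<^esub> \<delta> i e"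
      unfolding diff_def ring_hom_mult[OF coord_hom[OF i(2)] b e] ring_hom_mult[OF coord_hom[OF le0] b e]
      by (rule T.diff_product_identity) (rule coord_closed b e)+
    have z: "q (\<delta> i b \<otimes>\<^bsub>T\<^esub> \<delta> i e) = \<zero>\<^bsub>Q\<^esub>"
      using q_zero_iff delta_sq_mem[OF i b e] Jw_le diff_closed b e by blast
    show ?thesis unfolding 1 using z coord_closed diff_closed b e
      by (simp add: q_add q_mult q_closed comb_module_simps del: q_zero_iff)
  qed
  have vs: "q (\<delta> i (r \<odot>\<^bsub>B\<^esub> \<one>\<^bsub>B\<^esub>)) = \<zero>\<^bsub>QM\<^esub>" if "r \<in> carrier R" for r
    unfolding diff_def coord_scalar[OF i(2) that] coord_scalar[OF le0 that]
    using that ring_hom_cring.hom_zero[OF q_ring_hom] by (simp add: comb_module_simps T.minus_eq T.r_neg)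
  show "semilinear B K QM (\<lambda>b. b) (phi i)" unfolding phi_def
    by (rule kaehler_lift(1)[where D = "\<lambda>b. q (\<delta> i b)", OF module_comb id_hom v va vm vs])
  show "phi i (d b) = q (\<delta> i b)" if "b \<in> carrier B" for b unfolding phi_def
    by (rule kaehler_lift(2)[where D = "\<lambda>b. q (\<delta> i b)", OF module_comb id_hom v va vm vs that])
qed

lemma phi_closed: "1 \<le> i \<Longrightarrow> i \<le> n \<Longrightarrow> a \<in> carrier K \<Longrightarrow> phi i a \<in> carrier Q"
  using semilinear_closed[OF phi(1)] by (simp add: comb_module_simps)

lemma phi_add: "1 \<le> i \<Longrightarrow> i \<le> n \<Longrightarrow> a \<in> carrier K \<Longrightarrow> b \<in> carrier K \<Longrightarrow> phi i (a \<oplus>\<^bsub>K\<^esub> b) = phi i a \<oplus>\<^bsub>Q\<^esub> phi i b"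
  using semilinear_add[OF phi(1)] by (simp add: comb_module_simps)

lemma phi_smult: "1 \<le> i \<Longrightarrow> i \<le> n \<Longrightarrow> b \<in> carrier B \<Longrightarrow> a \<in> carrier K \<Longrightarrow>
    phi i (b \<odot>\<^bsub>K\<^esub> a) = q (c 0 b) \<otimes>\<^bsub>Q\<^esub> phi i a"
  using semilinear_smult[OF phi(1)] by (simp add: comb_module_simps)

lemma phi_gen: "1 \<le> i \<Longrightarrow> i \<le> n \<Longrightarrow> b \<in> carrier B \<Longrightarrow> e \<in> carrier B \<Longrightarrow>
    phi i (b \<odot>\<^bsub>K\<^esub> d e) = q (c 0 b) \<otimes>\<^bsub>Q\<^esub> q (\<delta> i e)"
  by (simp add: phi_smult d_closed phi(2))

text \<open>Both arguments run through sums of terms b dc. The coefficients are functions of x_0 in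
  either position and come out in front; what is left is the mixed term of
  \<open>delta_sym_mem\<close>.\<close>

lemma phi_anti:
  assumes i: "1 \<le> i" "i \<le> n" and j: "1 \<le> j" "j \<le> n" and ij: "i \<noteq> j" and a: "a \<in> carrier K" and b: "b \<in> carrier K"
  shows "phi i a \<otimes>\<^bsub>Q\<^esub> phi j b \<oplus>\<^bsub>Q\<^esub> phi i b \<otimes>\<^bsub>Q\<^esub> phi j a = \<zero>\<^bsub>Q\<^esub>"
  using a
proof (induction rule: kaehler_induct)
  case (add a a')
  note cl = phi_closed[OF i add(1)] phi_closed[OF i add(2)] phi_closed[OF j add(1)] phi_closed[OF j add(2)]
    phi_closed[OF i b] phi_closed[OF j b]
  have "phi i (a \<oplus>\<^bsub>K\<^esub> a') \<otimes>\<^bsub>Q\<^esub> phi j b \<oplus>\<^bsub>Q\<^esub> phi i b \<otimes>\<^bsub>Q\<^esub> phi j (a \<oplus>\<^bsub>K\<^esub> a') =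
      (phi i a \<otimes>\<^bsub>Q\<^esub> phi j b \<oplus>\<^bsub>Q\<^esub> phi i a' \<otimes>\<^bsub>Q\<^esub> phi j b) \<oplus>\<^bsub>Q\<^esub> (phi i b \<otimes>\<^bsub>Q\<^esub> phi j a \<oplus>\<^bsub>Q\<^esub> phi i b \<otimes>\<^bsub>Q\<^esub> phi j a')"
    unfolding phi_add[OF i add(1,2)] phi_add[OF j add(1,2)] using cl by (simp add: Q.l_distr Q.r_distr)
  also have "\<dots> = (phi i a \<otimes>\<^bsub>Q\<^esub> phi j b \<oplus>\<^bsub>Q\<^esub> phi i b \<otimes>\<^bsub>Q\<^esub> phi j a) \<oplus>\<^bsub>Q\<^esub> (phi i a' \<otimes>\<^bsub>Q\<^esub> phi j b \<oplus>\<^bsub>Q\<^esub> phi i b \<otimes>\<^bsub>Q\<^esub> phi j a')"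
    by (rule Q.add_exchange) (rule Q.m_closed cl)+
  finally show ?case unfolding add(3,4) by simp
next
  case (gen s u)
  note su = gen
  show ?case using b
  proof (induction rule: kaehler_induct)
    case (add b b')
    let ?a = "s \<odot>\<^bsub>K\<^esub> d u"
    have a: "?a \<in> carrier K" using su d_closed by auto
    note cl = phi_closed[OF i add(1)] phi_closed[OF i add(2)] phi_closed[OF j add(1)] phi_closed[OF j add(2)]
      phi_closed[OF i a] phi_closed[OF j a]
    have "phi i ?a \<otimes>\<^bsub>Q\<^esub> phi j (b \<oplus>\<^bsub>K\<^esub> b') \<oplus>\<^bsub>Q\<^esub> phi i (b \<oplus>\<^bsub>K\<^esub> b') \<otimes>\<^bsub>Q\<^esub> phi j ?a =
        (phi i ?a \<otimes>\<^bsub>Q\<^esub> phi j b \<oplus>\<^bsub>Q\<^esub> phi i ?a \<otimes>\<^bsub>Q\<^esub> phi j b') \<oplus>\<^bsub>Q\<^esub> (phi i b \<otimes>\<^bsub>Q\<^esub> phi j ?a \<oplus>\<^bsub>Q\<^esub> phi i b' \<otimes>\<^bsub>Q\<^esub> phi j ?a)"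
      unfolding phi_add[OF i add(1,2)] phi_add[OF j add(1,2)] using cl by (simp add: Q.l_distr Q.r_distr)
    also have "\<dots> = (phi i ?a \<otimes>\<^bsub>Q\<^esub> phi j b \<oplus>\<^bsub>Q\<^esub> phi i b \<otimes>\<^bsub>Q\<^esub> phi j ?a) \<oplus>\<^bsub>Q\<^esub> (phi i ?a \<otimes>\<^bsub>Q\<^esub> phi j b' \<oplus>\<^bsub>Q\<^esub> phi i b' \<otimes>\<^bsub>Q\<^esub> phi j ?a)"
      by (rule Q.add_exchange) (rule Q.m_closed cl)+
    finally show ?case unfolding add(3,4) by simp
  next
    case (gen t v)
    have m: "q (\<delta> i u \<otimes>\<^bsub>T\<^esub> \<delta> j v \<oplus>\<^bsub>T\<^esub> \<delta> j u \<otimes>\<^bsub>T\<^esub> \<delta> i v) = \<zero>\<^bsub>Q\<^esub>"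
      by (rule q_zero_iff[THEN iffD2, OF _ subsetD[OF Jw_le delta_sym_mem[OF i j ij su(2) gen(2)]]])
        (simp add: diff_closed su gen)
    have "phi i (s \<odot>\<^bsub>K\<^esub> d u) \<otimes>\<^bsub>Q\<^esub> phi j (t \<odot>\<^bsub>K\<^esub> d v) \<oplus>\<^bsub>Q\<^esub> phi i (t \<odot>\<^bsub>K\<^esub> d v) \<otimes>\<^bsub>Q\<^esub> phi j (s \<odot>\<^bsub>K\<^esub> d u) =
        (q (c 0 s) \<otimes>\<^bsub>Q\<^esub> q (c 0 t)) \<otimes>\<^bsub>Q\<^esub> (q (\<delta> i u) \<otimes>\<^bsub>Q\<^esub> q (\<delta> j v) \<oplus>\<^bsub>Q\<^esub> q (\<delta> j u) \<otimes>\<^bsub>Q\<^esub> q (\<delta> i v))"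
      unfolding phi_gen[OF i su] phi_gen[OF j su] phi_gen[OF i gen] phi_gen[OF j gen]
      by (rule Q.anti_identity) (rule qc_closed qd_closed su gen)+
    also have "q (\<delta> i u) \<otimes>\<^bsub>Q\<^esub> q (\<delta> j v) \<oplus>\<^bsub>Q\<^esub> q (\<delta> j u) \<otimes>\<^bsub>Q\<^esub> q (\<delta> i v) = \<zero>\<^bsub>Q\<^esub>"
      using m diff_closed su gen by (simp add: q_add q_mult del: q_zero_iff)
    finally show ?case using qc_closed su gen by simp
  qed
qed

text \<open>The expression is quadratic in \<open>a\<close>, not additive. On a term s du it is a
  multiple of a generator of \<open>J_alt\<close>, and in a sum the cross terms cancel by
  \<open>phi_anti\<close>.\<close>

lemma phi_alt:
  assumes Ja: "Ja \<subseteq> L"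
    and i: "1 \<le> i" "i \<le> n" and j: "1 \<le> j" "j \<le> n" and ij: "i \<noteq> j" and a: "a \<in> carrier K"
  shows "phi i a \<otimes>\<^bsub>Q\<^esub> phi j a = \<zero>\<^bsub>Q\<^esub>"
  using a
proof (induction rule: kaehler_induct)
  case (add a a')
  have "phi i (a \<oplus>\<^bsub>K\<^esub> a') \<otimes>\<^bsub>Q\<^esub> phi j (a \<oplus>\<^bsub>K\<^esub> a') =
      (phi i a \<otimes>\<^bsub>Q\<^esub> phi j a \<oplus>\<^bsub>Q\<^esub> phi i a' \<otimes>\<^bsub>Q\<^esub> phi j a') \<oplus>\<^bsub>Q\<^esub> (phi i a \<otimes>\<^bsub>Q\<^esub> phi j a' \<oplus>\<^bsub>Q\<^esub> phi i a' \<otimes>\<^bsub>Q\<^esub> phi j a)"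
    unfolding phi_add[OF i add(1,2)] phi_add[OF j add(1,2)]
    by (rule Q.alt_exchange) (rule phi_closed i j add(1,2))+
  thus ?case unfolding add(3,4) phi_anti[OF i j ij add(1,2)] by simp
next
  case (gen s u)
  have m: "q (\<delta> i u \<otimes>\<^bsub>T\<^esub> \<delta> j u) = \<zero>\<^bsub>Q\<^esub>"
    using q_zero_iff Ja_mem[OF i(2) j(2) gen(2)] Ja diff_closed gen by blast
  have "phi i (s \<odot>\<^bsub>K\<^esub> d u) \<otimes>\<^bsub>Q\<^esub> phi j (s \<odot>\<^bsub>K\<^esub> d u) =
      (q (c 0 s) \<otimes>\<^bsub>Q\<^esub> q (c 0 s)) \<otimes>\<^bsub>Q\<^esub> (q (\<delta> i u) \<otimes>\<^bsub>Q\<^esub> q (\<delta> j u))"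
    unfolding phi_gen[OF i gen] phi_gen[OF j gen] using qc_closed qd_closed gen by (simp add: Q.m_ac)
  also have "q (\<delta> i u) \<otimes>\<^bsub>Q\<^esub> q (\<delta> j u) = \<zero>\<^bsub>Q\<^esub>"
    using m diff_closed gen by (simp add: q_mult del: q_zero_iff)
  finally show ?case using qc_closed gen by simp
qed

definition nu0 where
  "nu0 = coset_lift (lin_ext B QM (\<lambda>b. b) (\<lambda>y. \<Otimes>\<^bsub>Q\<^esub>k\<in>{..<n}. phi (Suc k) (y k)))"

lemma ktuple_mem: "y \<in> ktuples \<Longrightarrow> k < n \<Longrightarrow> y k \<in> carrier K"
  using PiE_mem[of y "{..<n}" "\<lambda>_. carrier K" k] by simp

lemma phi_tuple: "y \<in> ktuples \<Longrightarrow> k < n \<Longrightarrow> phi (Suc k) (y k) \<in> carrier Q"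
  by (rule phi_closed) (auto intro: ktuple_mem)

lemma nu0:
  shows "semilinear B P QM (\<lambda>b. b) nu0"
    and "\<And>y. y \<in> ktuples \<Longrightarrow> nu0 (ptens y) = (\<Otimes>\<^bsub>Q\<^esub>k\<in>{..<n}. phi (Suc k) (y k))"
proof -
  let ?v = "\<lambda>y. \<Otimes>\<^bsub>Q\<^esub>k\<in>{..<n}. phi (Suc k) (y k)"
  have vc: "?v y \<in> carrier QM" if "y \<in> ktuples" for y
    unfolding comb_module_simps using phi_tuple[OF that] by (intro Q.finprod_closed) auto
  have rest: "(\<Otimes>\<^bsub>Q\<^esub>k\<in>{..<n} - {i}. phi (Suc k) (y k)) \<in> carrier Q" if "y \<in> ktuples" for y i
    using phi_tuple[OF that] by (intro Q.finprod_closed) auto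
  have upd: "?v (y(i := a)) = phi (Suc i) a \<otimes>\<^bsub>Q\<^esub> (\<Otimes>\<^bsub>Q\<^esub>k\<in>{..<n} - {i}. phi (Suc k) (y k))"
    if y: "y \<in> ktuples" and i: "i < n" and a: "a \<in> carrier K" for y i a
    using i phi_tuple[OF y] phi_closed[OF _ _ a]
    by (intro Q.finprod_update[where u = "\<lambda>k. phi (Suc k)"]) auto
  have va: "?v (y(i := a \<oplus>\<^bsub>K\<^esub> b)) = ?v (y(i := a)) \<oplus>\<^bsub>QM\<^esub> ?v (y(i := b))"
    if y: "y \<in> ktuples" and i: "i < n" and a: "a \<in> carrier K" and b: "b \<in> carrier K" for y i a b
    unfolding upd[OF y i a] upd[OF y i b] upd[OF y i K.add.m_closed[OF a b]]
    using i a b rest[OF y] by (simp add: phi_add phi_closed comb_module_simps Q.l_distr)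
  have vs: "?v (y(i := b \<odot>\<^bsub>K\<^esub> a)) = b \<odot>\<^bsub>QM\<^esub> ?v (y(i := a))"
    if y: "y \<in> ktuples" and i: "i < n" and a: "a \<in> carrier K" and b: "b \<in> carrier B" for y i a b
    unfolding upd[OF y i a] upd[OF y i K.smult_closed[OF b a]]
    using i a b rest[OF y] by (simp add: phi_smult phi_closed comb_module_simps Q.m_assoc qc_closed)
  show "semilinear B P QM (\<lambda>b. b) nu0" unfolding nu0_def
    by (rule tensor_lift(1)[where v = ?v, OF module_kaehler module_comb id_hom vc va vs])
  show "nu0 (ptens y) = ?v y" if "y \<in> ktuples" for y unfolding nu0_def
    by (rule tensor_lift(2)[where v = ?v, OF module_kaehler module_comb id_hom vc va vs that])
qed

text \<open>The two exchanged factors are split off; the remaining product \<open>?r\<close> is the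
  same for both tensors, and \<open>phi_anti\<close> applies to what stands in front of it.\<close>

lemma nu0_weak: "u \<in> omega_weak_rel R B n \<Longrightarrow> nu0 u = \<zero>\<^bsub>QM\<^esub>"
  unfolding omega_weak_rel_eq
proof (rule semilinear_submodule_gen_zero[OF P.module_axioms module_comb nu0(1) _ wgens_carrier])
  fix g assume "g \<in> wgens"
  then obtain y i j where y: "y \<in> ktuples" "i < n" "j < n" "i \<noteq> j"
    and g: "g = ptens y \<oplus>\<^bsub>P\<^esub> ptens (y(i := y j, j := y i))" unfolding wgens_def by blast
  let ?s = "y(i := y j, j := y i)"
  have s: "?s \<in> ktuples" by (rule swap_tuple[OF y(1-3)])
  let ?r = "\<Otimes>\<^bsub>Q\<^esub>k\<in>{..<n} - {i, j}. phi (Suc k) (y k)"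
  have r: "?r \<in> carrier Q" using phi_tuple[OF y(1)] by (intro Q.finprod_closed) auto
  have rs: "(\<Otimes>\<^bsub>Q\<^esub>k\<in>{..<n} - {i, j}. phi (Suc k) (?s k)) = ?r"
    using phi_tuple[OF y(1)] by (intro Q.finprod_cong') auto
  have ex: "(\<Otimes>\<^bsub>Q\<^esub>k\<in>{..<n}. phi (Suc k) (z k)) =
      (phi (Suc i) (z i) \<otimes>\<^bsub>Q\<^esub> phi (Suc j) (z j)) \<otimes>\<^bsub>Q\<^esub> (\<Otimes>\<^bsub>Q\<^esub>k\<in>{..<n} - {i, j}. phi (Suc k) (z k))"
    if "z \<in> ktuples" for z
    using phi_tuple[OF that] y by (intro Q.finprod_extract2) auto
  have si: "?s i = y j" "?s j = y i" using y(4) by auto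
  have "nu0 g = (phi (Suc i) (y i) \<otimes>\<^bsub>Q\<^esub> phi (Suc j) (y j)) \<otimes>\<^bsub>Q\<^esub> ?r \<oplus>\<^bsub>Q\<^esub> (phi (Suc i) (y j) \<otimes>\<^bsub>Q\<^esub> phi (Suc j) (y i)) \<otimes>\<^bsub>Q\<^esub> ?r"
    unfolding g semilinear_add[OF nu0(1) ptens_closed[OF y(1)] ptens_closed[OF s]] nu0(2)[OF y(1)] nu0(2)[OF s]
      ex[OF y(1)] ex[OF s] rs si comb_module_simps ..
  also have "\<dots> = (phi (Suc i) (y i) \<otimes>\<^bsub>Q\<^esub> phi (Suc j) (y j) \<oplus>\<^bsub>Q\<^esub> phi (Suc i) (y j) \<otimes>\<^bsub>Q\<^esub> phi (Suc j) (y i)) \<otimes>\<^bsub>Q\<^esub> ?r"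
    using y r phi_closed ktuple_mem[OF y(1)] by (subst Q.l_distr) auto
  also have "\<dots> = \<zero>\<^bsub>Q\<^esub>"
    using phi_anti[of "Suc i" "Suc j" "y i" "y j"] y ktuple_mem[OF y(1)] r by simp
  finally show "nu0 g = \<zero>\<^bsub>QM\<^esub>" by (simp add: comb_module_simps)
qed auto

lemma nu0_strong:
  assumes Ja: "Ja \<subseteq> L"
  shows "u \<in> omega_strong_rel R B n \<Longrightarrow> nu0 u = \<zero>\<^bsub>QM\<^esub>"
  unfolding omega_strong_rel_eq
proof (rule semilinear_submodule_gen_zero[OF P.module_axioms module_comb nu0(1) _ sgens_carrier])
  fix g assume "g \<in> sgens"
  then obtain y i j where y: "y \<in> ktuples" "i < n" "j < n" "i \<noteq> j" "y i = y j"
    and g: "g = ptens y" unfolding sgens_def by blast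
  let ?r = "\<Otimes>\<^bsub>Q\<^esub>k\<in>{..<n} - {i, j}. phi (Suc k) (y k)"
  have r: "?r \<in> carrier Q" using phi_tuple[OF y(1)] by (intro Q.finprod_closed) auto
  have "nu0 g = (phi (Suc i) (y i) \<otimes>\<^bsub>Q\<^esub> phi (Suc j) (y j)) \<otimes>\<^bsub>Q\<^esub> ?r"
    unfolding g nu0(2)[OF y(1)] using phi_tuple[OF y(1)] y by (intro Q.finprod_extract2) auto
  also have "\<dots> = \<zero>\<^bsub>Q\<^esub>"
    using phi_alt[OF Ja, of "Suc i" "Suc j" "y i"] y ktuple_mem[OF y(1)] r by simp
  finally show "nu0 g = \<zero>\<^bsub>QM\<^esub>" by (simp add: comb_module_simps)
qed auto

end

section \<open>The isomorphism\<close>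

lemma (in comm_monoid) finprod_remove:
  assumes "finite I" "i \<in> I" "\<And>k. k \<in> I \<Longrightarrow> f k \<in> carrier G"
  shows "finprod G f I = f i \<otimes> finprod G f (I - {i})"
proof -
  have 1: "insert i (I - {i}) = I" using assms by auto
  have "finprod G f (insert i (I - {i})) = f i \<otimes> finprod G f (I - {i})"
    using assms by (intro finprod_insert) auto
  thus ?thesis unfolding 1 .
qed

context power_algebra
begin

text \<open>The substitution of the coordinate \<open>0\<close> for the coordinate \<open>k\<close>. The operators \<open>1 - subst0 k\<close> for
  \<open>1 \<le> k \<le> n\<close> send \<open>x\<^sub>0 \<otimes> \<dots> \<otimes> x\<^sub>n\<close> to \<open>x\<^sub>0 d\<^sup>0\<^sup>,\<^sup>1x\<^sub>1 \<dots> d\<^sup>0\<^sup>,\<^sup>nx\<^sub>n\<close>; they are invisible to forms, and act as the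
  identity on combinatorial forms.\<close>

definition subst0 where "subst0 k = coord_pull n n R B (\<lambda>j. if j = k then 0 else j)"

lemma subst0_hom: "subst0 k \<in> ring_hom T T"
  unfolding subst0_def by (rule coord_pull(1)) simp

lemma subst0_coord: "j \<le> n \<Longrightarrow> b \<in> carrier B \<Longrightarrow> subst0 k (c j b) = c (if j = k then 0 else j) b"
  unfolding subst0_def by (rule coord_pull(2)) simp_all

lemma subst0_ring_hom: "ring_hom_cring T T (subst0 k)"
  by (intro ring_hom_cring.intro ring_hom_cring_axioms.intro T.M_cring subst0_hom)

lemma subst0_ideals:
  shows "\<And>r s b. r \<le> n \<Longrightarrow> s \<le> n \<Longrightarrow> b \<in> carrier B \<Longrightarrow>
      subst0 k (D r s b) = D (if r = k then 0 else r) (if s = k then 0 else s) b"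
    and "\<And>x. x \<in> Jw \<Longrightarrow> subst0 k x \<in> Jw"
    and "\<And>x. x \<in> Js \<Longrightarrow> subst0 k x \<in> Js"
    and "\<And>x r s. r \<le> n \<Longrightarrow> s \<le> n \<Longrightarrow> x \<in> J r s \<Longrightarrow> subst0 k x \<in> J (if r = k then 0 else r) (if s = k then 0 else s)"
proof -
  have s: "(if j = k then 0 else j) \<le> n" if "j \<le> n" for j using that by simp
  note * = hom_ideals[where \<sigma> = "\<lambda>j. if j = k then 0 else j" and \<beta> = "\<lambda>b. b", OF power_algebra power_algebra subst0_hom]
  show "\<And>r s b. r \<le> n \<Longrightarrow> s \<le> n \<Longrightarrow> b \<in> carrier B \<Longrightarrow>
      subst0 k (D r s b) = D (if r = k then 0 else r) (if s = k then 0 else s) b"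
    by (rule *(1)) (simp_all add: subst0_coord)
  show "\<And>x. x \<in> Jw \<Longrightarrow> subst0 k x \<in> Jw" by (rule *(2)) (simp_all add: subst0_coord)
  show "\<And>x. x \<in> Js \<Longrightarrow> subst0 k x \<in> Js" by (rule *(3)) (simp_all add: subst0_coord)
  show "\<And>x r s. r \<le> n \<Longrightarrow> s \<le> n \<Longrightarrow> x \<in> J r s \<Longrightarrow> subst0 k x \<in> J (if r = k then 0 else r) (if s = k then 0 else s)"
    by (rule *(4)) (simp_all add: subst0_coord)
qed

text \<open>The substitution sends \<open>J 0 k\<close> into \<open>J 0 0\<close>, whose generators
  are differences of a function with itself.\<close>

lemma subst0_kills:
  assumes "k \<le> n" "x \<in> J 0 k" shows "subst0 k x = \<zero>\<^bsub>T\<^esub>"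
proof -
  have "subst0 k x \<in> J 0 0" using subst0_ideals(4)[OF le0 assms, of k] by simp
  moreover have "J 0 0 \<subseteq> {\<zero>\<^bsub>T\<^esub>}" by (rule J_minimal[OF T.zeroideal]) (simp add: diff_self)
  ultimately show ?thesis by blast
qed

primrec Qop where
  "Qop 0 t = t"
| "Qop (Suc k) t = Qop k t \<ominus>\<^bsub>T\<^esub> subst0 (Suc k) (Qop k t)"

lemma Qop_closed: "t \<in> carrier T \<Longrightarrow> Qop k t \<in> carrier T"
  by (induction k) (auto intro!: T.minus_closed ring_hom_closed[OF subst0_hom])

lemma Qop_add: "s \<in> carrier T \<Longrightarrow> t \<in> carrier T \<Longrightarrow> Qop k (s \<oplus>\<^bsub>T\<^esub> t) = Qop k s \<oplus>\<^bsub>T\<^esub> Qop k t"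
proof (induction k)
  case (Suc k)
  note c = Qop_closed[OF Suc.prems(1), of k] Qop_closed[OF Suc.prems(2), of k]
  show ?case unfolding Qop.simps Suc.IH[OF Suc.prems] ring_hom_add[OF subst0_hom c]
    by (rule T.diff_sum_identity) (rule c ring_hom_closed[OF subst0_hom])+
qed simp

text \<open>In the product reached after \<open>k\<close> steps only the factor at
  \<open>Suc k\<close> involves that coordinate. The substitution fixes the other factors and
  replaces this one by its value at x_0, so the subtraction turns it into a difference.\<close>

lemma Qop_pure:
  assumes x: "x \<in> tuples"
  shows "k \<le> n \<Longrightarrow> Qop k (pure x) = (\<Otimes>\<^bsub>T\<^esub>i\<in>{..n}. if 1 \<le> i \<and> i \<le> k then \<delta> i (x i) else c i (x i))"
proof (induction k)
  case 0
  have "(\<Otimes>\<^bsub>T\<^esub>i\<in>{..n}. if 1 \<le> i \<and> i \<le> 0 then \<delta> i (x i) else c i (x i)) = (\<Otimes>\<^bsub>T\<^esub>i\<in>{..n}. c i (x i))"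
    using coord_closed tuple_mem[OF x] by (intro T.finprod_cong') auto
  thus ?case using pure_eq_finprod[OF x] by simp
next
  case (Suc k)
  let ?f = "\<lambda>k i. if 1 \<le> i \<and> i \<le> k then \<delta> i (x i) else c i (x i)"
  have k: "Suc k \<le> n" "Suc k \<in> {..n}" using Suc.prems by auto
  have cl: "?f k i \<in> carrier T" if "i \<le> n" for k i
    using that diff_closed coord_closed tuple_mem[OF x] by auto
  have rc: "finprod T (?f k) ({..n} - {Suc k}) \<in> carrier T" using cl by (intro T.finprod_closed) auto
  have r: "finprod T (?f (Suc k)) ({..n} - {Suc k}) = finprod T (?f k) ({..n} - {Suc k})"
    using cl[of _ k] by (intro T.finprod_cong') auto
  have ef: "subst0 (Suc k) (?f k i) = ?f k i" if "i \<le> n" "i \<noteq> Suc k" for i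
    using that tuple_mem[OF x that(1)] by (simp add: subst0_coord subst0_ideals(1))
  have ek: "subst0 (Suc k) (?f k (Suc k)) = c 0 (x (Suc k))"
    using k tuple_mem[OF x k(1)] by (simp add: subst0_coord)
  have er: "finprod T (subst0 (Suc k) \<circ> ?f k) ({..n} - {Suc k}) = finprod T (?f k) ({..n} - {Suc k})"
    using cl[of _ k] ef by (intro T.finprod_cong') (auto simp: o_def)
  have "subst0 (Suc k) (finprod T (?f k) {..n}) = finprod T (subst0 (Suc k) \<circ> ?f k) {..n}"
    using cl by (intro ring_hom_cring.hom_finprod[OF subst0_ring_hom]) auto
  also have "\<dots> = (subst0 (Suc k) \<circ> ?f k) (Suc k) \<otimes>\<^bsub>T\<^esub> finprod T (subst0 (Suc k) \<circ> ?f k) ({..n} - {Suc k})"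
    using k cl ring_hom_closed[OF subst0_hom] by (intro T.finprod_remove) auto
  also have "\<dots> = c 0 (x (Suc k)) \<otimes>\<^bsub>T\<^esub> finprod T (?f k) ({..n} - {Suc k})"
    unfolding er using ek by simp
  finally have 1: "subst0 (Suc k) (finprod T (?f k) {..n}) = c 0 (x (Suc k)) \<otimes>\<^bsub>T\<^esub> finprod T (?f k) ({..n} - {Suc k})" .
  have "finprod T (?f k) {..n} = ?f k (Suc k) \<otimes>\<^bsub>T\<^esub> finprod T (?f k) ({..n} - {Suc k})"
    using k cl by (intro T.finprod_remove) auto
  hence 2: "finprod T (?f k) {..n} = c (Suc k) (x (Suc k)) \<otimes>\<^bsub>T\<^esub> finprod T (?f k) ({..n} - {Suc k})" by simp
  have "finprod T (?f (Suc k)) {..n} = ?f (Suc k) (Suc k) \<otimes>\<^bsub>T\<^esub> finprod T (?f (Suc k)) ({..n} - {Suc k})"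
    using k cl by (intro T.finprod_remove) auto
  hence 3: "finprod T (?f (Suc k)) {..n} = \<delta> (Suc k) (x (Suc k)) \<otimes>\<^bsub>T\<^esub> finprod T (?f k) ({..n} - {Suc k})"
    unfolding r by simp
  have "u \<otimes>\<^bsub>T\<^esub> z \<ominus>\<^bsub>T\<^esub> v \<otimes>\<^bsub>T\<^esub> z = (u \<ominus>\<^bsub>T\<^esub> v) \<otimes>\<^bsub>T\<^esub> z" if "u \<in> carrier T" "v \<in> carrier T" "z \<in> carrier T" for u v z
    using that by (simp add: T.minus_eq T.l_distr T.l_minus)
  note m = this[OF coord_closed[OF tuple_mem[OF x k(1)]] coord_closed[OF tuple_mem[OF x k(1)]] rc]
  have IH: "Qop k (pure x) = finprod T (?f k) {..n}" using Suc.IH k by simp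
  have dd: "\<delta> (Suc k) (x (Suc k)) = c (Suc k) (x (Suc k)) \<ominus>\<^bsub>T\<^esub> c 0 (x (Suc k))" by (simp add: diff_def)
  show ?case unfolding Qop.simps IH 1 3 unfolding 2 m dd ..
qed

lemma Qop_pure_n:
  assumes x: "x \<in> tuples"
  shows "Qop n (pure x) = c 0 (x 0) \<otimes>\<^bsub>T\<^esub> (\<Otimes>\<^bsub>T\<^esub>k\<in>{..<n}. \<delta> (Suc k) (x (Suc k)))"
proof -
  let ?f = "\<lambda>i. if 1 \<le> i \<and> i \<le> n then \<delta> i (x i) else c i (x i)"
  have cl: "?f i \<in> carrier T" if "i \<le> n" for i
    using that diff_closed coord_closed tuple_mem[OF x] by auto
  have im: "{..n} - {0} = Suc ` {..<n}"
    by (auto simp: lessThan_Suc_atMost[symmetric] lessThan_Suc_eq_insert_0)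
  have "finprod T ?f {..n} = ?f 0 \<otimes>\<^bsub>T\<^esub> finprod T ?f ({..n} - {0})"
    using cl by (intro T.finprod_remove) auto
  also have "finprod T ?f ({..n} - {0}) = (\<Otimes>\<^bsub>T\<^esub>k\<in>{..<n}. ?f (Suc k))"
    unfolding im using diff_closed tuple_mem[OF x] by (intro T.finprod_reindex) auto
  also have "\<dots> = (\<Otimes>\<^bsub>T\<^esub>k\<in>{..<n}. \<delta> (Suc k) (x (Suc k)))"
    using diff_closed tuple_mem[OF x] by (intro T.finprod_cong') auto
  finally show ?thesis unfolding Qop_pure[OF x le_refl] by simp
qed

text \<open>Splitting off the factor at coordinate \<open>k\<close> leaves a tensor with entry 1
  there, which the substitution fixes; the factor itself moves to coordinate 0. The entry 1 is what
  makes the corresponding form vanish.\<close>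

lemma subst0_pure:
  assumes x: "x \<in> tuples" and k: "1 \<le> k" "k \<le> n"
  shows "subst0 k (pure x) = pure ((x(k := \<one>\<^bsub>B\<^esub>))(0 := x 0 \<otimes>\<^bsub>B\<^esub> x k))"
proof -
  let ?y = "x(k := \<one>\<^bsub>B\<^esub>)"
  have y: "?y \<in> tuples" using k by (intro tuple_update[OF x]) auto
  have xk: "x k \<in> carrier B" using tuple_mem[OF x k(2)] .
  have x': "pure x = pure ?y \<otimes>\<^bsub>T\<^esub> c k (x k)"
    unfolding pure_mult_coord[OF y k(2) xk] using xk by simp
  have "subst0 k (pure ?y) = finprod T (subst0 k \<circ> (\<lambda>i. c i (?y i))) {..n}"
    unfolding pure_eq_finprod[OF y] using coord_closed tuple_mem[OF y]
    by (intro ring_hom_cring.hom_finprod[OF subst0_ring_hom]) auto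
  also have "\<dots> = (\<Otimes>\<^bsub>T\<^esub>i\<in>{..n}. c i (?y i))"
    using coord_closed tuple_mem[OF y] tuple_mem[OF x]
    by (intro T.finprod_cong') (auto simp: subst0_coord ring_hom_one[OF coord_hom])
  finally have y': "subst0 k (pure ?y) = pure ?y" unfolding pure_eq_finprod[OF y] .
  have "subst0 k (pure x) = pure ?y \<otimes>\<^bsub>T\<^esub> c 0 (x k)"
    unfolding x' ring_hom_mult[OF subst0_hom pure_closed[OF y] coord_closed[OF xk]] y' subst0_coord[OF k(2) xk] by simp
  also have "\<dots> = pure (?y(0 := ?y 0 \<otimes>\<^bsub>B\<^esub> x k))" by (rule pure_mult_coord[OF y le0 xk])
  finally show ?thesis using k by simp
qed

lemma d_one: "d \<one>\<^bsub>B\<^esub> = \<zero>\<^bsub>K\<^esub>"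
  using d_scalar[of "\<one>\<^bsub>R\<^esub>"] by simp

end

context form_quotient
begin

lemma p_subst0:
  assumes k: "1 \<le> k" "k \<le> n" and t: "t \<in> carrier T"
  shows "p (subst0 k t) = \<zero>\<^bsub>Om\<^esub>"
  using t
proof (induction rule: fun_ring_induct)
  case (pure x)
  obtain l where l: "k = Suc l" "l < n" using k by (cases k) auto
  let ?z = "(x(k := \<one>\<^bsub>B\<^esub>))(0 := x 0 \<otimes>\<^bsub>B\<^esub> x k)"
  have x0: "x 0 \<in> carrier B" "x k \<in> carrier B" using tuple_mem[OF pure] k by auto
  have y: "x(k := \<one>\<^bsub>B\<^esub>) \<in> tuples" using k by (intro tuple_update[OF pure]) auto
  have z: "?z \<in> tuples" using x0 by (intro tuple_update[OF y]) auto
  \<comment> \<open>The differential of the entry 1 is zero. It is written as the zero multiple of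
    zero, so that homogeneity in factor \<open>l\<close> shows the vanishing of the whole
    tensor.\<close>
  have dt: "dtup ?z = (dtup x)(l := \<zero>\<^bsub>B\<^esub> \<odot>\<^bsub>K\<^esub> \<zero>\<^bsub>K\<^esub>)"
    unfolding dtup_update0 l(1) dtup_update[OF l(2)] d_one by simp
  have c: "w ((dtup x)(l := \<zero>\<^bsub>K\<^esub>)) \<in> carrier Om"
    by (rule w_closed[OF tuple_update[OF dtup[OF pure] l(2) K.zero_closed]])
  have "w (dtup ?z) = \<zero>\<^bsub>Om\<^esub>"
    unfolding dt w_smult[OF dtup[OF pure] l(2) K.zero_closed zero_closed] using c by simp
  thus ?case unfolding subst0_pure[OF pure k] p_pure[OF z] using x0 by simp
next
  case (add s t)
  note c = ring_hom_closed[OF subst0_hom add(1)] ring_hom_closed[OF subst0_hom add(2)]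
  show ?case unfolding ring_hom_add[OF subst0_hom add(1,2)] p_add[OF c] add(3,4) by simp
qed

lemma p_Qop: "t \<in> carrier T \<Longrightarrow> k \<le> n \<Longrightarrow> p (Qop k t) = p t"
proof (induction k)
  case (Suc k)
  have c: "Qop k t \<in> carrier T" by (rule Qop_closed[OF Suc.prems(1)])
  have "p (Qop (Suc k) t) = p (Qop k t) \<ominus>\<^bsub>Om\<^esub> p (subst0 (Suc k) (Qop k t))"
    unfolding Qop.simps by (rule p_minus[OF c ring_hom_closed[OF subst0_hom c]])
  also have "\<dots> = p t \<ominus>\<^bsub>Om\<^esub> \<zero>\<^bsub>Om\<^esub>"
    using Suc p_subst0[OF _ _ c, of "Suc k"] by simp
  also have "\<dots> = p t"
    using abelian_group.add_minus_cancel[OF Om.abelian_group_axioms p_closed[OF Suc.prems(1)], of "\<zero>\<^bsub>Om\<^esub>"]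
      p_closed[OF Suc.prems(1)] by simp
  finally show ?case .
qed simp

end

context comb_quotient
begin

text \<open>Both sides are additive, and on a pure tensor both are the class of x_0 times the
  product of the differences of x_1, ..., x_n. As \<open>pi0\<close> is onto, this describes
  \<open>nu0\<close> completely.\<close>

lemma nu0_pi0:
  assumes t: "t \<in> carrier T" shows "nu0 (pi0 t) = q (Qop n t)"
  using t
proof (induction rule: fun_ring_induct)
  case (pure x)
  have c: "\<delta> (Suc k) (x (Suc k)) \<in> carrier T" if "k < n" for k
    using that diff_closed tuple_mem[OF pure] by auto
  have "nu0 (ptens (dtup x)) = (\<Otimes>\<^bsub>Q\<^esub>k\<in>{..<n}. q (\<delta> (Suc k) (x (Suc k))))"
    unfolding nu0(2)[OF dtup[OF pure]] using c tuple_mem[OF pure]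
    by (intro Q.finprod_cong') (auto simp: phi(2) q_closed)
  also have "\<dots> = (\<Otimes>\<^bsub>Q\<^esub>k\<in>{..<n}. ((\<lambda>t. q t) \<circ> (\<lambda>k. \<delta> (Suc k) (x (Suc k)))) k)"
    by (simp add: o_def)
  also have "\<dots> = q (\<Otimes>\<^bsub>T\<^esub>k\<in>{..<n}. \<delta> (Suc k) (x (Suc k)))"
    using c by (intro ring_hom_cring.hom_finprod[OF q_ring_hom, symmetric]) auto
  finally have 1: "nu0 (ptens (dtup x)) = q (\<Otimes>\<^bsub>T\<^esub>k\<in>{..<n}. \<delta> (Suc k) (x (Suc k)))" .
  have x0: "x 0 \<in> carrier B" by (rule tuple_mem[OF pure le0])
  have "(\<Otimes>\<^bsub>T\<^esub>k\<in>{..<n}. \<delta> (Suc k) (x (Suc k))) \<in> carrier T" using c by (intro T.finprod_closed) auto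
  thus ?case
    unfolding pi0(2)[OF pure] Qop_pure_n[OF pure] semilinear_smult[OF nu0(1) x0 ptens_closed[OF dtup[OF pure]]] 1
      comb_module_simps using coord_closed[OF x0] by (simp add: q_mult)
next
  case (add s t)
  note c = semilinear_closed[OF pi0(1) add(1)] semilinear_closed[OF pi0(1) add(2)]
  show ?case
    unfolding semilinear_add[OF pi0(1) add(1,2)] semilinear_add[OF nu0(1) c] add(3,4) Qop_add[OF add(1,2)]
      q_add[OF Qop_closed[OF add(1)] Qop_closed[OF add(2)]] comb_module_simps ..
qed

end

text \<open>These conditions collect what has to be checked separately for weak and strong forms.
  The first two let \<open>p\<close> and \<open>nu0\<close> descend, and \<open>subst0_L\<close>
  lets the substitutions act on the quotient ring. \<open>Psi_image\<close> provides, for each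
  \<open>i\<close> separately, a representative in \<open>J 0 i\<close>; \<open>Psi_gen\<close> and
  \<open>Psi_add\<close> put the image of \<open>nu\<close> inside \<open>Psi\<close>.\<close>

locale form_iso = form_quotient R B n N + comb_quotient R B n L
  for R :: "'a ring" and B :: "('a, 'b) module" and n N L +
  fixes Psi
  assumes p_L: "\<And>t. t \<in> L \<Longrightarrow> p t = \<zero>\<^bsub>Om\<^esub>"
    and nu0_N: "\<And>u. u \<in> N \<Longrightarrow> nu0 u = \<zero>\<^bsub>QM\<^esub>"
    and subst0_L: "\<And>k t. t \<in> L \<Longrightarrow> subst0 k t \<in> L"
    and Psi_carrier: "Psi \<subseteq> carrier Q"
    and Psi_image: "\<And>X i. X \<in> Psi \<Longrightarrow> 1 \<le> i \<Longrightarrow> i \<le> n \<Longrightarrow> X \<in> (\<lambda>t. q t) ` J 0 i"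
    and Psi_gen: "\<And>x. x \<in> tuples \<Longrightarrow> q (Qop n (pure x)) \<in> Psi"
    and Psi_add: "\<And>X Y. X \<in> Psi \<Longrightarrow> Y \<in> Psi \<Longrightarrow> X \<oplus>\<^bsub>Q\<^esub> Y \<in> Psi"
begin

definition nu where "nu = coset_lift nu0"

lemma nu:
  shows "semilinear B Om QM (\<lambda>b. b) nu" and "\<And>u. u \<in> carrier P \<Longrightarrow> nu (cls u) = nu0 u"
  unfolding nu_def using coset_lift_semilinear[OF P.module_axioms N_sub module_comb nu0(1) nu0_N] by auto

lemma nu_p: "t \<in> carrier T \<Longrightarrow> nu (p t) = q (Qop n t)"
  by (simp add: nu(2) semilinear_closed[OF pi0(1)] nu0_pi0)

lemma q_subst0_eq:
  assumes "s \<in> carrier T" "t \<in> carrier T" "q s = q t"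
  shows "q (subst0 k s) = q (subst0 k t)"
proof -
  have "s \<ominus>\<^bsub>T\<^esub> t \<in> L" using assms q_eq_iff by simp
  hence "subst0 k (s \<ominus>\<^bsub>T\<^esub> t) \<in> L" by (rule subst0_L)
  moreover have "subst0 k (s \<ominus>\<^bsub>T\<^esub> t) = subst0 k s \<ominus>\<^bsub>T\<^esub> subst0 k t"
    using assms ring_hom_cring.hom_a_inv[OF subst0_ring_hom] ring_hom_add[OF subst0_hom]
    by (simp add: T.minus_eq)
  ultimately show ?thesis using q_eq_iff ring_hom_closed[OF subst0_hom] assms by simp
qed

text \<open>At the step for \<open>Suc k\<close> the class is represented by an element of
  \<open>J 0 (Suc k)\<close>, which the substitution kills, so zero is subtracted. The
  representative may be a different one at every step; this is harmless because the substitutions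
  respect classes.\<close>

lemma q_Qop:
  assumes t: "t \<in> carrier T" and im: "\<And>i. 1 \<le> i \<Longrightarrow> i \<le> n \<Longrightarrow> q t \<in> (\<lambda>t. q t) ` J 0 i"
  shows "k \<le> n \<Longrightarrow> q (Qop k t) = q t"
proof (induction k)
  case (Suc k)
  have c: "Qop k t \<in> carrier T" by (rule Qop_closed[OF t])
  obtain u where u: "u \<in> J 0 (Suc k)" "q t = q u" using im[of "Suc k"] Suc.prems by auto
  have uc: "u \<in> carrier T" using ideal.Icarr[OF J_ideal u(1)] .
  have "q (subst0 (Suc k) (Qop k t)) = q (subst0 (Suc k) u)"
    using Suc u by (intro q_subst0_eq[OF c uc]) auto
  also have "\<dots> = \<zero>\<^bsub>Q\<^esub>"
    using subst0_kills[OF Suc.prems u(1)] ring_hom_cring.hom_zero[OF q_ring_hom] by simp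
  finally show ?case
    using Suc c q_closed[OF t] by (simp add: q_minus ring_hom_closed[OF subst0_hom] Q.minus_eq)
qed simp

lemma q_Qop_Psi:
  assumes t: "t \<in> carrier T" shows "q (Qop n t) \<in> Psi"
  using t
proof (induction rule: fun_ring_induct)
  case (pure x)
  thus ?case by (rule Psi_gen)
next
  case (add s t)
  thus ?case by (simp add: Qop_add q_add Qop_closed Psi_add)
qed

text \<open>If \<open>nu\<close> agrees on \<open>p s\<close> and \<open>p t\<close>, then
  \<open>Qop n s\<close> and \<open>Qop n t\<close> differ by an element of \<open>L\<close>, which
  \<open>p\<close> kills; as \<open>p\<close> does not notice \<open>Qop\<close>, the forms agree.
  Conversely, a combinatorial form \<open>q t\<close> equals \<open>q (Qop n t)\<close>, which is
  \<open>nu (p t)\<close>.\<close>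

lemma nu_iso: "nu \<in> module_iso B Om (comb_module n R B L Psi)"
proof -
  have inj: "inj_on nu (carrier Om)"
  proof (rule inj_onI)
    fix v v' assume v: "v \<in> carrier Om" "v' \<in> carrier Om" "nu v = nu v'"
    then obtain s t where st: "s \<in> carrier T" "t \<in> carrier T" "v = p s" "v' = p t" using p_surj by metis
    have "q (Qop n s) = q (Qop n t)" using v(3) st by (simp add: nu_p)
    hence "Qop n s \<ominus>\<^bsub>T\<^esub> Qop n t \<in> L" using q_eq_iff Qop_closed st by simp
    hence "p (Qop n s \<ominus>\<^bsub>T\<^esub> Qop n t) = \<zero>\<^bsub>Om\<^esub>" by (rule p_L)
    hence "p s \<ominus>\<^bsub>Om\<^esub> p t = \<zero>\<^bsub>Om\<^esub>" using p_minus[OF Qop_closed Qop_closed] p_Qop st by simp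
    thus "v = v'" using abelian_group_minus_eq_zero_iff[OF Om.abelian_group_axioms] v st by simp
  qed
  have im: "nu ` carrier Om = Psi"
  proof (intro equalityI subsetI)
    fix X assume "X \<in> nu ` carrier Om"
    then obtain t where "t \<in> carrier T" "X = nu (p t)" using p_surj by blast
    thus "X \<in> Psi" using q_Qop_Psi by (simp add: nu_p)
  next
    fix X assume X: "X \<in> Psi"
    then obtain t where t: "t \<in> carrier T" "X = q t" using Psi_carrier q_surj by blast
    have "q (Qop n t) = q t" using Psi_image[OF X] t by (intro q_Qop) auto
    hence "X = nu (p t)" using t by (simp add: nu_p)
    thus "X \<in> nu ` carrier Om" using p_closed t by blast
  qed
  show ?thesis
    unfolding module_iso_def bij_betw_def
    using inj im semilinear_add[OF nu(1)] semilinear_smult[OF nu(1)] by (simp add: comb_module_simps)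
qed

lemma nu_diff_prod:
  assumes b: "\<And>i. i \<in> {1..n} \<Longrightarrow> b i \<in> carrier B"
  shows "nu (w (\<lambda>i\<in>{..<n}. d (b (Suc i)))) = q (\<Otimes>\<^bsub>T\<^esub>i\<in>{1..n}. \<delta> i (b i))"
proof -
  \<comment> \<open>Entry 1 at coordinate 0, so that the form has coefficient 1.\<close>
  let ?x = "\<lambda>i\<in>{..<Suc n}. if i = 0 then \<one>\<^bsub>B\<^esub> else b i"
  have x: "?x \<in> tuples" using b by auto
  have xi: "?x 0 = \<one>\<^bsub>B\<^esub>" "\<And>k. k < n \<Longrightarrow> ?x (Suc k) = b (Suc k)" by auto
  have dt: "dtup ?x = (\<lambda>i\<in>{..<n}. d (b (Suc i)))" by (auto simp: fun_eq_iff)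
  have im: "{1..n} = Suc ` {..<n}" by (rule image_Suc_lessThan[symmetric])
  have c: "\<delta> (Suc k) (b (Suc k)) \<in> carrier T" if "k < n" for k using that b diff_closed by simp
  have 1: "(\<Otimes>\<^bsub>T\<^esub>i\<in>{1..n}. \<delta> i (b i)) = (\<Otimes>\<^bsub>T\<^esub>k\<in>{..<n}. \<delta> (Suc k) (b (Suc k)))"
    unfolding im using c by (intro T.finprod_reindex) auto
  have 2: "(\<Otimes>\<^bsub>T\<^esub>k\<in>{..<n}. \<delta> (Suc k) (?x (Suc k))) = (\<Otimes>\<^bsub>T\<^esub>k\<in>{..<n}. \<delta> (Suc k) (b (Suc k)))"
    using c by (intro T.finprod_cong') auto
  have 3: "(\<Otimes>\<^bsub>T\<^esub>k\<in>{..<n}. \<delta> (Suc k) (b (Suc k))) \<in> carrier T" using c by (intro T.finprod_closed) auto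
  have "p (pure ?x) = w (\<lambda>i\<in>{..<n}. d (b (Suc i)))"
    using p_pure[OF x] w_closed[OF dtup[OF x]] unfolding xi(1) dt by simp
  hence "nu (w (\<lambda>i\<in>{..<n}. d (b (Suc i)))) = q (Qop n (pure ?x))"
    using nu_p[OF pure_closed[OF x]] by simp
  also have "Qop n (pure ?x) = (\<Otimes>\<^bsub>T\<^esub>i\<in>{1..n}. \<delta> i (b i))"
    unfolding Qop_pure_n[OF x] 2 1 xi(1) ring_hom_one[OF coord_hom[OF le0]] using 3 by simp
  finally show ?thesis .
qed

end

text \<open>These are the facts about the product of ideals that strong forms call for: containment
  in each factor gives representatives in every \<open>J 0 i\<close>, and closure under products of
  elements gives the generators.\<close>

lemma (in cring) finprod_ideals:
  assumes "finite A" "\<And>i. i \<in> A \<Longrightarrow> ideal (I i) R"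
  shows "ideal (finprod (ideals_set R) I A) R"
    and "\<And>i. i \<in> A \<Longrightarrow> finprod (ideals_set R) I A \<subseteq> I i"
    and "\<And>x. (\<And>i. i \<in> A \<Longrightarrow> x i \<in> I i) \<Longrightarrow> finprod R x A \<in> finprod (ideals_set R) I A"
proof -
  interpret S: comm_monoid "ideals_set R" by (rule ideals_set_is_comm_monoid)
  have "ideal (finprod (ideals_set R) I A) R \<and> (\<forall>i\<in>A. finprod (ideals_set R) I A \<subseteq> I i) \<and>
      (\<forall>x. (\<forall>i\<in>A. x i \<in> I i) \<longrightarrow> finprod R x A \<in> finprod (ideals_set R) I A)"
    using assms
  proof (induction A)
    case empty
    show ?case by (simp add: ideals_set_def[THEN arg_cong[where f = one]] oneideal)
  next
    case (insert k A)
    hence IH: "ideal (finprod (ideals_set R) I A) R" "\<And>i. i \<in> A \<Longrightarrow> finprod (ideals_set R) I A \<subseteq> I i"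
      "\<And>x. (\<forall>i\<in>A. x i \<in> I i) \<Longrightarrow> finprod R x A \<in> finprod (ideals_set R) I A"
      and Ik: "ideal (I k) R" by auto
    have m: "finprod (ideals_set R) I (insert k A) = I k \<cdot> finprod (ideals_set R) I A"
      using insert by (subst S.finprod_insert) (auto simp: ideals_set_def)
    have sub: "I k \<cdot> finprod (ideals_set R) I A \<subseteq> I k \<inter> finprod (ideals_set R) I A"
      by (rule ideal_prod_inter[OF Ik IH(1)])
    have "finprod R x (insert k A) \<in> I k \<cdot> finprod (ideals_set R) I A" if x: "\<forall>i\<in>insert k A. x i \<in> I i" for x
    proof -
      have "x i \<in> carrier R" if "i \<in> insert k A" for i
        using ideal.Icarr insert.prems x that by metis
      hence "finprod R x (insert k A) = x k \<otimes> finprod R x A"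
        using insert.hyps by (intro finprod_insert) auto
      thus ?thesis using ideal_prod.prod[of "x k" "I k" "finprod R x A"] IH(3) x by auto
    qed
    thus ?case unfolding m using ideal_prod_is_ideal[OF Ik IH(1)] sub IH(2) by blast
  qed
  thus "ideal (finprod (ideals_set R) I A) R" "\<And>i. i \<in> A \<Longrightarrow> finprod (ideals_set R) I A \<subseteq> I i"
    "\<And>x. (\<And>i. i \<in> A \<Longrightarrow> x i \<in> I i) \<Longrightarrow> finprod R x A \<in> finprod (ideals_set R) I A" by auto
qed

section \<open>The weak and the strong case as instances\<close>

definition weak_psi where
  "weak_psi n R B = \<Inter>{image_ideal (fun_ring n R B) (J_weak n R B) (J_ideal n R B r s) | r s. r < s \<and> s \<le> n}"

definition strong_psi where
  "strong_psi n R B = finprod (ideals_set (fun_ring n R B Quot J_strong n R B))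
        (\<lambda>i. image_ideal (fun_ring n R B) (J_strong n R B) (J_ideal n R B 0 i)) {1..n}"

lemma psi_eq:
  "psi_weak n R B = comb_module n R B (J_weak n R B) (weak_psi n R B)"
  "psi_strong n R B = comb_module n R B (J_strong n R B) (strong_psi n R B)"
  by (simp_all add: psi_weak_def psi_strong_def weak_psi_def strong_psi_def)

context power_algebra
begin

lemma delta_prod_closed: "x \<in> tuples \<Longrightarrow> k < n \<Longrightarrow> \<delta> (Suc k) (x (Suc k)) \<in> carrier T"
  using diff_closed tuple_mem by auto

lemma weak_comb_quotient: "comb_quotient R B n Jw"
  by (rule comb_quotient.intro[OF power_algebra comb_quotient_axioms.intro[OF Jw_ideal subset_refl]])

lemma strong_comb_quotient: "comb_quotient R B n Js"
  by (rule comb_quotient.intro[OF power_algebra comb_quotient_axioms.intro[OF Js_ideal Jw_le_Js]])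

lemma weak_form_quotient: "form_quotient R B n (omega_weak_rel R B n)"
  by (rule form_quotient.intro[OF power_algebra form_quotient_axioms.intro[OF submodule_weak subset_refl]])

lemma strong_form_quotient: "form_quotient R B n (omega_strong_rel R B n)"
  by (rule form_quotient.intro[OF power_algebra form_quotient_axioms.intro[OF submodule_strong weak_le_strong]])

text \<open>For r = 0 the factor with index \<open>s\<close> lies in \<open>J r s\<close>. For r > 0
  the difference of \<open>b\<close> from 0 to \<open>r\<close> is the one from 0 to
  \<open>s\<close> minus the one from \<open>r\<close> to \<open>s\<close>. The first part, times
  the factor with index \<open>s\<close>, lies in the square of \<open>J 0 s\<close>; so modulo
  \<open>Jw\<close> the product is a multiple of \<open>D r s b\<close>.\<close>

lemma Qop_pure_image:
  assumes x: "x \<in> tuples" and rs: "r < s" "s \<le> n"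
  shows "Jw +>\<^bsub>T\<^esub> Qop n (pure x) \<in> image_ideal T Jw (J r s)"
proof -
  interpret C: comb_quotient R B n Jw by (rule weak_comb_quotient)
  interpret I: ideal "J r s" T by (rule J_ideal)
  interpret W: ideal Jw T by (rule Jw_ideal)
  obtain l where l: "s = Suc l" "l < n" using rs by (cases s) auto
  have x0: "c 0 (x 0) \<in> carrier T" by (rule coord_closed[OF tuple_mem[OF x le0]])
  note dc = delta_prod_closed[OF x]
  show ?thesis
  proof (cases r)
    case 0
    have "(\<Otimes>\<^bsub>T\<^esub>k\<in>{..<n}. \<delta> (Suc k) (x (Suc k))) =
        \<delta> (Suc l) (x (Suc l)) \<otimes>\<^bsub>T\<^esub> (\<Otimes>\<^bsub>T\<^esub>k\<in>{..<n} - {l}. \<delta> (Suc k) (x (Suc k)))"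
      using dc l by (intro T.finprod_remove) auto
    moreover have "\<delta> (Suc l) (x (Suc l)) \<in> J r s"
      using J_mem[OF tuple_mem[OF x rs(2)], of 0 s] 0 l by simp
    moreover have "(\<Otimes>\<^bsub>T\<^esub>k\<in>{..<n} - {l}. \<delta> (Suc k) (x (Suc k))) \<in> carrier T"
      using dc by (intro T.finprod_closed) auto
    ultimately have "Qop n (pure x) \<in> J r s"
      unfolding Qop_pure_n[OF x] using x0 I.I_l_closed I.I_r_closed by simp
    thus ?thesis by (auto simp: image_ideal_def)
  next
    case (Suc k)
    hence k: "k < n" "k \<noteq> l" using rs l by auto
    let ?b = "x (Suc k)" and ?e = "x (Suc l)"
    have be: "?b \<in> carrier B" "?e \<in> carrier B" using tuple_mem[OF x] k l by auto
    let ?z = "\<Otimes>\<^bsub>T\<^esub>k\<in>{..<n} - {k, l}. \<delta> (Suc k) (x (Suc k))"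
    have z: "?z \<in> carrier T" using dc by (intro T.finprod_closed) auto
    have 1: "Qop n (pure x) = c 0 (x 0) \<otimes>\<^bsub>T\<^esub> ((\<delta> (Suc k) ?b \<otimes>\<^bsub>T\<^esub> \<delta> (Suc l) ?e) \<otimes>\<^bsub>T\<^esub> ?z)"
      unfolding Qop_pure_n[OF x] using T.finprod_extract2[of "{..<n}" k l "\<lambda>k. \<delta> (Suc k) (x (Suc k))"] dc k l by simp
    \<comment> \<open>The element of \<open>J r s\<close> congruent to the product: its factor with
      index \<open>r\<close> is replaced by the negative of \<open>D r s ?b\<close>.\<close>
    let ?u = "c 0 (x 0) \<otimes>\<^bsub>T\<^esub> ((\<ominus>\<^bsub>T\<^esub> D r s ?b \<otimes>\<^bsub>T\<^esub> \<delta> s ?e) \<otimes>\<^bsub>T\<^esub> ?z)"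
    have u: "?u \<in> J r s"
      using J_mem[OF be(1), of r s] x0 z diff_closed[OF be(2)] I.I_l_closed I.I_r_closed by simp
    have id: "c \<otimes>\<^bsub>T\<^esub> ((v \<otimes>\<^bsub>T\<^esub> g) \<otimes>\<^bsub>T\<^esub> z) \<ominus>\<^bsub>T\<^esub> c \<otimes>\<^bsub>T\<^esub> ((\<ominus>\<^bsub>T\<^esub> (h \<ominus>\<^bsub>T\<^esub> v) \<otimes>\<^bsub>T\<^esub> g) \<otimes>\<^bsub>T\<^esub> z) =
        (c \<otimes>\<^bsub>T\<^esub> z) \<otimes>\<^bsub>T\<^esub> (h \<otimes>\<^bsub>T\<^esub> g)"
      if "c \<in> carrier T" "v \<in> carrier T" "g \<in> carrier T" "z \<in> carrier T" "h \<in> carrier T" for c v g z h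
      using that by algebra
    have "Qop n (pure x) \<ominus>\<^bsub>T\<^esub> ?u = (c 0 (x 0) \<otimes>\<^bsub>T\<^esub> ?z) \<otimes>\<^bsub>T\<^esub> (\<delta> s ?b \<otimes>\<^bsub>T\<^esub> \<delta> s ?e)"
      unfolding 1 Suc l(1) diff_eq[OF be(1), of "Suc k" "Suc l"]
      by (rule id) (rule x0 z diff_closed be)+
    also have "\<dots> \<in> Jw"
      using delta_sq_mem[of s ?b ?e] rs be x0 z W.I_l_closed by simp
    finally have "Qop n (pure x) \<ominus>\<^bsub>T\<^esub> ?u \<in> Jw" .
    hence "Jw +>\<^bsub>T\<^esub> Qop n (pure x) = Jw +>\<^bsub>T\<^esub> ?u"
      using C.q_eq_iff[OF Qop_closed[OF pure_closed[OF x]] I.Icarr[OF u]] by simp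
    thus ?thesis using u by (auto simp: image_ideal_def)
  qed
qed

lemma weak_form_iso:
  assumes n: "1 \<le> n" shows "form_iso R B n (omega_weak_rel R B n) Jw (weak_psi n R B)"
proof -
  interpret C: comb_quotient R B n Jw by (rule weak_comb_quotient)
  interpret F: form_quotient R B n "omega_weak_rel R B n" by (rule weak_form_quotient)
  have id: "ideal (image_ideal T Jw (J r s)) C.Q" for r s
    unfolding image_ideal_def by (rule T.ring_ideal_imp_quot_ideal[OF Jw_ideal J_ideal])
  show ?thesis
  proof unfold_locales
    show "Jw +>\<^bsub>T\<^esub> Qop n (pure x) \<in> weak_psi n R B" if "x \<in> tuples" for x
      unfolding weak_psi_def using Qop_pure_image[OF that] by blast
    have im: "X \<in> image_ideal T Jw (J r s)" if "X \<in> weak_psi n R B" "r < s" "s \<le> n" for X r s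
      using that unfolding weak_psi_def by blast
    \<comment> \<open>As \<open>n\<close> is at least 1 the pair (0, 1) occurs, so the intersection
      is over a nonempty family and lies in the quotient ring.\<close>
    show "weak_psi n R B \<subseteq> carrier C.Q"
      using im[of _ 0 1] ideal.Icarr[OF id] n by (metis subsetI zero_less_one)
    show "X \<in> (\<lambda>t. C.q t) ` J 0 i" if "X \<in> weak_psi n R B" "1 \<le> i" "i \<le> n" for X i
      using im[of X 0 i] that by (simp add: image_ideal_def)
    show "X \<oplus>\<^bsub>C.Q\<^esub> Y \<in> weak_psi n R B" if X: "X \<in> weak_psi n R B" and Y: "Y \<in> weak_psi n R B" for X Y
      using additive_subgroup.a_closed[OF ideal.axioms(1)[OF id]] im[OF X] im[OF Y]
      unfolding weak_psi_def by auto
  qed (auto simp: F.p_Jw C.nu0_weak subst0_ideals(2))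
qed

lemma strong_form_iso:
  assumes n: "1 \<le> n" shows "form_iso R B n (omega_strong_rel R B n) Js (strong_psi n R B)"
proof -
  interpret C: comb_quotient R B n Js by (rule strong_comb_quotient)
  interpret F: form_quotient R B n "omega_strong_rel R B n" by (rule strong_form_quotient)
  have id: "ideal (image_ideal T Js (J 0 i)) C.Q" for i
    unfolding image_ideal_def by (rule T.ring_ideal_imp_quot_ideal[OF Js_ideal J_ideal])
  note fp = C.Q.finprod_ideals[of "{1..n}" "\<lambda>i. image_ideal T Js (J 0 i)", OF finite_atLeastAtMost id, folded strong_psi_def]
  show ?thesis
  proof unfold_locales
    fix x assume x: "x \<in> tuples"
    have dc: "\<delta> i (x i) \<in> carrier T" if "i \<le> n" for i using diff_closed tuple_mem[OF x that] by blast
    have x0: "c 0 (x 0) \<in> carrier T" by (rule coord_closed[OF tuple_mem[OF x le0]])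
    have im: "{1..n} = Suc ` {..<n}" by (rule image_Suc_lessThan[symmetric])
    have 1: "(\<Otimes>\<^bsub>T\<^esub>k\<in>{..<n}. \<delta> (Suc k) (x (Suc k))) = (\<Otimes>\<^bsub>T\<^esub>i\<in>{1..n}. \<delta> i (x i))"
      unfolding im using dc by (intro T.finprod_reindex[symmetric]) auto
    have 2: "C.q (\<Otimes>\<^bsub>T\<^esub>i\<in>{1..n}. \<delta> i (x i)) = (\<Otimes>\<^bsub>C.Q\<^esub>i\<in>{1..n}. ((\<lambda>t. C.q t) \<circ> (\<lambda>i. \<delta> i (x i))) i)"
      using dc by (intro ring_hom_cring.hom_finprod[OF C.q_ring_hom]) auto
    \<comment> \<open>Each class of a difference lies in its own factor of the product of ideals.
      The coefficient at coordinate 0 is absorbed afterwards, the product being an ideal.\<close>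
    have 3: "(\<Otimes>\<^bsub>C.Q\<^esub>i\<in>{1..n}. ((\<lambda>t. C.q t) \<circ> (\<lambda>i. \<delta> i (x i))) i) \<in> strong_psi n R B"
      by (rule fp(3)) (auto simp: image_ideal_def intro!: J_mem tuple_mem[OF x])
    have 4: "(\<Otimes>\<^bsub>T\<^esub>i\<in>{1..n}. \<delta> i (x i)) \<in> carrier T" using dc by (intro T.finprod_closed) auto
    show "C.q (Qop n (pure x)) \<in> strong_psi n R B"
      unfolding Qop_pure_n[OF x] 1 C.q_mult[OF x0 4] 2
      by (rule ideal.I_l_closed[OF fp(1) 3 C.q_closed[OF x0]])
  next
    show "strong_psi n R B \<subseteq> carrier C.Q" using ideal.Icarr[OF fp(1)] by blast
    show "X \<in> (\<lambda>t. C.q t) ` J 0 i" if "X \<in> strong_psi n R B" "1 \<le> i" "i \<le> n" for X i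
      using fp(2)[of i] that by (auto simp: image_ideal_def)
    show "X \<oplus>\<^bsub>C.Q\<^esub> Y \<in> strong_psi n R B" if "X \<in> strong_psi n R B" "Y \<in> strong_psi n R B" for X Y
      using additive_subgroup.a_closed[OF ideal.axioms(1)[OF fp(1)]] that by blast
  qed (auto simp: F.p_Js C.nu0_strong[OF Ja_le_Js] subst0_ideals(3))
qed

end

section \<open>Functoriality\<close>

lemma coset_map_eq:
  assumes T: "abelian_group T" and T': "abelian_group T'" and L: "additive_subgroup L T" and L': "additive_subgroup L' T'"
    and h: "abelian_group_hom T T' h" and hL: "\<And>t. t \<in> L \<Longrightarrow> h t \<in> L'" and t: "t \<in> carrier T"
  shows "coset_map T' L' h (L +>\<^bsub>T\<^esub> t) = L' +>\<^bsub>T'\<^esub> h t"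
proof -
  interpret h: abelian_group_hom T T' h by (rule h)
  have a: "abelian_subgroup L T" "abelian_subgroup L' T'" using abelian_subgroupI3 T T' L L' by auto
  show ?thesis unfolding coset_map_def
  proof (rule coset_lift_eq[OF a(1) t])
    fix s assume s: "s \<in> carrier T" "L +>\<^bsub>T\<^esub> s = L +>\<^bsub>T\<^esub> t"
    hence "s \<ominus>\<^bsub>T\<^esub> t \<in> L" using abelian_subgroup.coset_eq_iff[OF a(1) s(1) t] by simp
    hence "h s \<ominus>\<^bsub>T'\<^esub> h t \<in> L'" using hL additive_minus[OF h s(1) t] by force
    thus "L' +>\<^bsub>T'\<^esub> h s = L' +>\<^bsub>T'\<^esub> h t"
      using abelian_subgroup.coset_eq_iff[OF a(2) h.hom_closed[OF s(1)] h.hom_closed[OF t]] by simp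
  qed
qed

lemma ring_hom_additive:
  assumes "ring R" "ring S" "h \<in> ring_hom R S" shows "abelian_group_hom R S h"
  using assms by (intro abelian_group_hom_additive) (auto simp: ring.is_abelian_group ring_hom_closed ring_hom_add)

lemma (in power_algebra) ring_hom_ext:
  assumes S: "cring S" and f: "f \<in> ring_hom T S" and g: "g \<in> ring_hom T S"
    and e: "\<And>j b. j \<le> n \<Longrightarrow> b \<in> carrier B \<Longrightarrow> f (c j b) = g (c j b)" and t: "t \<in> carrier T"
  shows "f t = g t"
  using t
proof (induction rule: fun_ring_induct)
  case (pure x)
  interpret S: cring S by (rule S)
  have f': "ring_hom_cring T S f" by (intro ring_hom_cring.intro ring_hom_cring_axioms.intro T.M_cring S f)
  have g': "ring_hom_cring T S g" by (intro ring_hom_cring.intro ring_hom_cring_axioms.intro T.M_cring S g)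
  have cl: "(\<lambda>i. c i (x i)) \<in> {..n} \<rightarrow> carrier T" using coord_closed tuple_mem[OF pure] by auto
  have "(\<Otimes>\<^bsub>S\<^esub>i\<in>{..n}. (f \<circ> (\<lambda>i. c i (x i))) i) = (\<Otimes>\<^bsub>S\<^esub>i\<in>{..n}. (g \<circ> (\<lambda>i. c i (x i))) i)"
    using e tuple_mem[OF pure] ring_hom_closed[OF g] coord_closed by (intro S.finprod_cong') auto
  thus ?case unfolding pure_eq_finprod[OF pure] ring_hom_cring.hom_finprod[OF f' cl] ring_hom_cring.hom_finprod[OF g' cl] .
next
  case (add s t)
  thus ?case by (simp add: ring_hom_add[OF f] ring_hom_add[OF g])
qed

context power_algebra
begin

lemma wgensE:
  assumes "g \<in> wgens"
  obtains x i j where "x \<in> ktuples" "i < n" "j < n" "i \<noteq> j" "g = ptens x \<oplus>\<^bsub>P\<^esub> ptens (x(i := x j, j := x i))"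
  using assms unfolding wgens_def by blast

lemma wgensI:
  "x \<in> ktuples \<Longrightarrow> i < n \<Longrightarrow> j < n \<Longrightarrow> i \<noteq> j \<Longrightarrow> ptens x \<oplus>\<^bsub>P\<^esub> ptens (x(i := x j, j := x i)) \<in> wgens"
  unfolding wgens_def by blast

lemma sgensE:
  assumes "g \<in> sgens"
  obtains x i j where "x \<in> ktuples" "i < n" "j < n" "i \<noteq> j" "x i = x j" "g = ptens x"
  using assms unfolding sgens_def by blast

lemma sgensI: "x \<in> ktuples \<Longrightarrow> i < n \<Longrightarrow> j < n \<Longrightarrow> i \<noteq> j \<Longrightarrow> x i = x j \<Longrightarrow> ptens x \<in> sgens"
  unfolding sgens_def by blast

end

context algebra_map
begin

lemma A_power: "power_algebra R B" by (rule A.power_algebra)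
lemma A'_power: "power_algebra R' B'" by (rule A'.power_algebra)

abbreviation "fm n \<equiv> tensor_map R R' B' (Suc n) \<alpha> \<beta>"
abbreviation "km \<equiv> kaehler_map B R' B' \<beta>"
abbreviation "tm n \<equiv> tensor_map B B' (kaehler R' B') n \<beta> km"

lemma fm_additive: "abelian_group_hom (fun_ring n R B) (fun_ring n R' B') (fm n)"
proof -
  interpret M: power_algebra R B n by (rule A_power)
  interpret M': power_algebra R' B' n by (rule A'_power)
  show ?thesis by (rule ring_hom_additive[OF M.T.ring_axioms M'.T.ring_axioms power_map(1)])
qed

lemma fm_ideals:
  shows "\<And>x. x \<in> J_weak n R B \<Longrightarrow> fm n x \<in> J_weak n R' B'"
    and "\<And>x. x \<in> J_strong n R B \<Longrightarrow> fm n x \<in> J_strong n R' B'"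
  by (rule hom_ideals(2,3)[where \<sigma> = "\<lambda>j. j" and \<beta> = \<beta>, OF A_power A'_power power_map(1)];
      simp add: power_map(2) beta_simps)+

lemma tm:
  shows "semilinear B (tensor_power B A.K n) (tensor_power B' A'.K n) \<beta> (tm n)"
    and "\<And>y. y \<in> {..<n} \<rightarrow>\<^sub>E carrier A.K \<Longrightarrow>
      tm n (pure_tensor B A.K n y) = pure_tensor B' A'.K n (\<lambda>i\<in>{..<n}. km (y i))"
  by (rule tensor_map[OF A.module_kaehler A'.module_kaehler beta kaehler_map(1)]; assumption)+

lemma km_tuple: "y \<in> {..<n} \<rightarrow>\<^sub>E carrier A.K \<Longrightarrow> (\<lambda>i\<in>{..<n}. km (y i)) \<in> {..<n} \<rightarrow>\<^sub>E carrier A'.K"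
  using semilinear_closed[OF kaehler_map(1)] by (auto simp: PiE_iff)

lemma tm_rels:
  shows "u \<in> omega_weak_rel R B n \<Longrightarrow> tm n u \<in> omega_weak_rel R' B' n"
    and "u \<in> omega_strong_rel R B n \<Longrightarrow> tm n u \<in> omega_strong_rel R' B' n"
proof -
  interpret M: power_algebra R B n by (rule A_power)
  interpret M': power_algebra R' B' n by (rule A'_power)
  have w: "tm n g \<in> omega_weak_rel R' B' n" if gg: "g \<in> M.wgens" for g
  proof -
    obtain y i j where y: "y \<in> M.ktuples" "i < n" "j < n" "i \<noteq> j"
      and g: "g = M.ptens y \<oplus>\<^bsub>M.P\<^esub> M.ptens (y(i := y j, j := y i))" by (rule M.wgensE[OF gg])
    let ?z = "\<lambda>k\<in>{..<n}. km (y k)"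
    have s: "(\<lambda>k\<in>{..<n}. km ((y(i := y j, j := y i)) k)) = ?z(i := ?z j, j := ?z i)"
      using y by (auto simp: fun_eq_iff)
    have "tm n g = M'.ptens ?z \<oplus>\<^bsub>M'.P\<^esub> M'.ptens (?z(i := ?z j, j := ?z i))"
      unfolding g semilinear_add[OF tm(1) M.ptens_closed[OF y(1)] M.ptens_closed[OF M.swap_tuple[OF y(1-3)]]]
        tm(2)[OF y(1)] tm(2)[OF M.swap_tuple[OF y(1-3)]] s ..
    hence "tm n g \<in> M'.wgens" using M'.wgensI[OF km_tuple[OF y(1)] y(2-4)] by (simp only:)
    thus ?thesis unfolding M'.omega_weak_rel_eq by (rule subsetD[OF submodule_gen_superset])
  qed
  show "tm n u \<in> omega_weak_rel R' B' n" if "u \<in> omega_weak_rel R B n"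
    using semilinear_submodule_gen[OF M.P.module_axioms M'.P.module_axioms tm(1) M'.submodule_weak _ M.wgens_carrier w]
      that beta_simps(1) unfolding M.omega_weak_rel_eq by blast
  have s: "tm n g \<in> omega_strong_rel R' B' n" if gg: "g \<in> M.sgens" for g
  proof -
    obtain y i j where y: "y \<in> M.ktuples" "i < n" "j < n" "i \<noteq> j" "y i = y j" and g: "g = M.ptens y"
      by (rule M.sgensE[OF gg])
    have "(\<lambda>k\<in>{..<n}. km (y k)) i = (\<lambda>k\<in>{..<n}. km (y k)) j" using y by simp
    hence "tm n g \<in> M'.sgens" unfolding g tm(2)[OF y(1)] by (rule M'.sgensI[OF km_tuple[OF y(1)] y(2-4)])
    thus ?thesis unfolding M'.omega_strong_rel_eq by (rule subsetD[OF submodule_gen_superset])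
  qed
  show "tm n u \<in> omega_strong_rel R' B' n" if "u \<in> omega_strong_rel R B n"
    using semilinear_submodule_gen[OF M.P.module_axioms M'.P.module_axioms tm(1) M'.submodule_strong _ M.sgens_carrier s]
      that beta_simps(1) unfolding M.omega_strong_rel_eq by blast
qed

lemma tm_pi0:
  assumes "t \<in> carrier (fun_ring n R B)"
  shows "tm n (power_algebra.pi0 R B n t) = power_algebra.pi0 R' B' n (fm n t)"
proof -
  interpret M: power_algebra R B n by (rule A_power)
  interpret M': power_algebra R' B' n by (rule A'_power)
  show ?thesis using assms
  proof (induction rule: M.fun_ring_induct)
    case (pure x)
    let ?y = "\<lambda>i\<in>{..<Suc n}. \<beta> (x i)"
    have y: "?y \<in> M'.tuples" using M.tuple_mem[OF pure] beta_simps(1) by auto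
    have x0: "x 0 \<in> carrier B" by (rule M.tuple_mem[OF pure le0])
    have "(\<lambda>i\<in>{..<n}. km (M.dtup x i)) = M'.dtup ?y"
      using M.tuple_mem[OF pure] by (auto simp: fun_eq_iff kaehler_map(2))
    thus ?case
      unfolding power_map(3)[OF pure] M.pi0(2)[OF pure] M'.pi0(2)[OF y]
        semilinear_smult[OF tm(1) x0 M.ptens_closed[OF M.dtup[OF pure]]] tm(2)[OF M.dtup[OF pure]]
      by simp
  next
    case (add s t)
    note c = semilinear_closed[OF M.pi0(1)]
    show ?case
      unfolding semilinear_add[OF M.pi0(1) add(1,2)] semilinear_add[OF tm(1) c[OF add(1)] c[OF add(2)]] add(3,4)
        ring_hom_add[OF power_map(1) add(1,2)]
      by (rule semilinear_add[OF M'.pi0(1), symmetric]) (rule ring_hom_closed[OF power_map(1)] add)+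
  qed
qed

lemma fm_Qop:
  assumes t: "t \<in> carrier (fun_ring n R B)"
  shows "fm n (power_algebra.Qop R B n k t) = power_algebra.Qop R' B' n k (fm n t)"
proof -
  interpret M: power_algebra R B n by (rule A_power)
  interpret M': power_algebra R' B' n by (rule A'_power)
  have s: "fm n (M.subst0 k t) = M'.subst0 k (fm n t)" if "t \<in> carrier M.T" for k t
  proof -
    \<comment> \<open>Both composites are ring maps sending a coordinate function of
      \<open>b\<close> to the coordinate function of \<open>\<beta> b\<close> at the substituted
      position, and agreement on coordinate functions suffices.\<close>
    have f: "fm n \<circ> M.subst0 k \<in> ring_hom M.T M'.T" by (rule ring_hom_trans[OF M.subst0_hom power_map(1)])
    have g: "M'.subst0 k \<circ> fm n \<in> ring_hom M.T M'.T" by (rule ring_hom_trans[OF power_map(1) M'.subst0_hom])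
    have "(fm n \<circ> M.subst0 k) t = (M'.subst0 k \<circ> fm n) t"
      by (rule M.ring_hom_ext[OF M'.T.M_cring f g _ that])
        (simp add: M.subst0_coord M'.subst0_coord power_map(2) beta_simps)
    thus ?thesis by simp
  qed
  show ?thesis
  proof (induction k)
    case (Suc k)
    note c = M.Qop_closed[OF t, of k]
    show ?case
      unfolding M.Qop.simps M'.Qop.simps additive_minus[OF fm_additive c ring_hom_closed[OF M.subst0_hom c]] s[OF c] Suc ..
  qed simp
qed

text \<open>A form is written as \<open>p t\<close> for a function \<open>t\<close>. Base change
  commutes with \<open>pi0\<close> and with \<open>Qop\<close> on functions, so the formula
  \<open>nu_p\<close> carries naturality over from functions to forms.\<close>

lemma form_iso_natural:
  assumes I: "form_iso R B n N L Psi" and I': "form_iso R' B' n N' L' Psi'"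
    and N: "\<And>u. u \<in> N \<Longrightarrow> tm n u \<in> N'" and L: "\<And>t. t \<in> L \<Longrightarrow> fm n t \<in> L'"
    and v: "v \<in> carrier (quot_module (tensor_power B (kaehler R B) n) N)"
  shows "coset_map (tensor_power B' (kaehler R' B') n) N' (tm n) v \<in>
      carrier (quot_module (tensor_power B' (kaehler R' B') n) N')"
    and "coset_map (fun_ring n R' B') L' (fm n) (form_iso.nu R B n L v) =
      form_iso.nu R' B' n L' (coset_map (tensor_power B' (kaehler R' B') n) N' (tm n) v)"
proof -
  interpret M: form_iso R B n N L Psi by (rule I)
  interpret M': form_iso R' B' n N' L' Psi' by (rule I')
  obtain t where t: "t \<in> carrier M.T" "v = M.p t" using M.p_surj[OF v] by blast
  have ft: "fm n t \<in> carrier M'.T" by (rule ring_hom_closed[OF power_map(1) t(1)])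
  have om: "coset_map M'.P N' (tm n) v = M'.p (fm n t)"
    unfolding t(2) tm_pi0[OF t(1), symmetric]
    by (rule coset_map_semilinear(2)[OF M.P.module_axioms M.N_sub M'.P.module_axioms M'.N_sub tm(1) beta_simps(1) N
        semilinear_closed[OF M.pi0(1) t(1)]])
  show "coset_map M'.P N' (tm n) v \<in> carrier M'.Om" unfolding om by (rule M'.p_closed[OF ft])
  have "coset_map M'.T L' (fm n) (M.q (M.Qop n t)) = M'.q (fm n (M.Qop n t))"
    by (rule coset_map_eq[OF M.T.abelian_group_axioms M'.T.abelian_group_axioms ideal.axioms(1)[OF M.L_ideal]
        ideal.axioms(1)[OF M'.L_ideal] fm_additive L M.Qop_closed[OF t(1)]])
  thus "coset_map M'.T L' (fm n) (M.nu v) = M'.nu (coset_map M'.P N' (tm n) v)"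
    unfolding om unfolding t(2) M.nu_p[OF t(1)] M'.nu_p[OF ft] fm_Qop[OF t(1)] .
qed

end

text \<open>Both isomorphisms are given by the same formula in a function that represents the form.
  Hence the one for the smaller relations induces the one for the larger relations.\<close>

lemma (in power_algebra) form_iso_proj:
  assumes I: "form_iso R B n N L Psi" and I': "form_iso R B n N' L' Psi'"
    and N: "N \<subseteq> N'" and L: "L \<subseteq> L'" and v: "v \<in> carrier (quot_module P N)"
  shows "coset_map T L' (\<lambda>t. t) (form_iso.nu R B n L v) = form_iso.nu R B n L' (coset_map P N' (\<lambda>t. t) v)"
proof -
  interpret M: form_iso R B n N L Psi by (rule I)
  interpret M': form_iso R B n N' L' Psi' by (rule I')
  obtain t where t: "t \<in> carrier T" "v = M.p t" using M.p_surj[OF v] by blast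
  have idh: "abelian_group_hom M (M :: ('z, 'y) ring_scheme) (\<lambda>t. t)" if "abelian_group M" for M :: "('z, 'y) ring_scheme"
    using that by (intro abelian_group_hom_additive) auto
  have om: "coset_map P N' (\<lambda>t. t) v = M'.p t" unfolding t(2)
  proof (rule coset_map_eq)
    show "additive_subgroup N P" "additive_subgroup N' P"
      using submodule.axioms(1)[OF M.N_sub] submodule.axioms(1)[OF M'.N_sub] by (auto intro: additive_subgroupI)
  qed (use N idh semilinear_closed[OF pi0(1) t(1)] P.abelian_group_axioms in auto)
  have "coset_map T L' (\<lambda>t. t) (M.q (Qop n t)) = M'.q (Qop n t)"
    by (rule coset_map_eq[OF T.abelian_group_axioms T.abelian_group_axioms ideal.axioms(1)[OF M.L_ideal]
        ideal.axioms(1)[OF M'.L_ideal] idh[OF T.abelian_group_axioms] _ Qop_closed[OF t(1)]]) (use L in blast)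
  thus ?thesis unfolding om unfolding t(2) M.nu_p[OF t(1)] M'.nu_p[OF t(1)] .
qed

section \<open>Products\<close>

lemma coset_map_ring_hom:
  assumes T: "cring T" and T': "cring T'" and L: "ideal L T" and L': "ideal L' T'"
    and h: "h \<in> ring_hom T T'" and hL: "\<And>t. t \<in> L \<Longrightarrow> h t \<in> L'"
  shows "\<And>t. t \<in> carrier T \<Longrightarrow> coset_map T' L' h (L +>\<^bsub>T\<^esub> t) = L' +>\<^bsub>T'\<^esub> h t"
    and "coset_map T' L' h \<in> ring_hom (T Quot L) (T' Quot L')"
proof -
  interpret T: cring T by (rule T)
  interpret T': cring T' by (rule T')
  show e: "coset_map T' L' h (L +>\<^bsub>T\<^esub> t) = L' +>\<^bsub>T'\<^esub> h t" if "t \<in> carrier T" for t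
    by (rule coset_map_eq[OF T.abelian_group_axioms T'.abelian_group_axioms ideal.axioms(1)[OF L] ideal.axioms(1)[OF L']
        ring_hom_additive[OF T.ring_axioms T'.ring_axioms h] hL that])
  note q = ideal.rcos_ring_hom[OF L] and q' = ideal.rcos_ring_hom[OF L']
  have sj: "\<exists>t\<in>carrier T. X = L +>\<^bsub>T\<^esub> t" if "X \<in> carrier (T Quot L)" for X
    using that by (auto simp: FactRing_def A_RCOSETS_def')
  show "coset_map T' L' h \<in> ring_hom (T Quot L) (T' Quot L')"
  proof (rule ring_hom_memI)
    fix X Y assume "X \<in> carrier (T Quot L)" "Y \<in> carrier (T Quot L)"
    then obtain s t where st: "s \<in> carrier T" "t \<in> carrier T" "X = L +>\<^bsub>T\<^esub> s" "Y = L +>\<^bsub>T\<^esub> t" using sj by metis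
    note hc = ring_hom_closed[OF h st(1)] ring_hom_closed[OF h st(2)]
    show "coset_map T' L' h (X \<otimes>\<^bsub>T Quot L\<^esub> Y) = coset_map T' L' h X \<otimes>\<^bsub>T' Quot L'\<^esub> coset_map T' L' h Y"
      unfolding st(3,4) ring_hom_mult[OF q st(1,2), symmetric] e[OF st(1)] e[OF st(2)] e[OF T.m_closed[OF st(1,2)]]
        ring_hom_mult[OF h st(1,2)] by (rule ring_hom_mult[OF q' hc])
    show "coset_map T' L' h (X \<oplus>\<^bsub>T Quot L\<^esub> Y) = coset_map T' L' h X \<oplus>\<^bsub>T' Quot L'\<^esub> coset_map T' L' h Y"
      unfolding st(3,4) ring_hom_add[OF q st(1,2), symmetric] e[OF st(1)] e[OF st(2)] e[OF T.a_closed[OF st(1,2)]]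
        ring_hom_add[OF h st(1,2)] by (rule ring_hom_add[OF q' hc])
  next
    show "coset_map T' L' h X \<in> carrier (T' Quot L')" if X: "X \<in> carrier (T Quot L)" for X
      using sj[OF X] e ring_hom_closed[OF q'] ring_hom_closed[OF h] by auto
    show "coset_map T' L' h \<one>\<^bsub>T Quot L\<^esub> = \<one>\<^bsub>T' Quot L'\<^esub>"
      using e[OF T.one_closed] ring_hom_one[OF q] ring_hom_one[OF q'] ring_hom_one[OF h] by simp
  qed
qed

context comb_quotient
begin

text \<open>\<open>phi i a\<close> is a sum of multiples of differences with index \<open>i\<close>,
  and a product of two of these lies in the square of \<open>J 0 i\<close>.\<close>

lemma phi_delta:
  assumes i: "1 \<le> i" "i \<le> n" and a: "a \<in> carrier K" and b: "b \<in> carrier B"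
  shows "phi i a \<otimes>\<^bsub>Q\<^esub> q (\<delta> i b) = \<zero>\<^bsub>Q\<^esub>"
  using a
proof (induction rule: kaehler_induct)
  case (gen s u)
  have "q (\<delta> i u \<otimes>\<^bsub>T\<^esub> \<delta> i b) = \<zero>\<^bsub>Q\<^esub>"
    by (rule q_zero_iff[THEN iffD2, OF _ subsetD[OF Jw_le delta_sq_mem[OF i gen(2) b]]])
      (simp add: diff_closed gen b)
  hence "q (\<delta> i u) \<otimes>\<^bsub>Q\<^esub> q (\<delta> i b) = \<zero>\<^bsub>Q\<^esub>" using q_mult[OF diff_closed[OF gen(2)] diff_closed[OF b]] by simp
  thus ?case unfolding phi_gen[OF i gen] using qc_closed[OF gen(1)] qd_closed[OF gen(2)] qd_closed[OF b]
    by (simp add: Q.m_assoc)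
next
  case (add s t)
  thus ?case unfolding phi_add[OF i add(1,2)]
    using phi_closed[OF i add(1)] phi_closed[OF i add(2)] qd_closed[OF b] by (simp add: Q.l_distr)
qed

end

text \<open>The factor \<open>f (x\<^sub>0, \<dots>, x\<^sub>m)\<close> of a star product is annihilated by the differences \<open>d\<^sup>0\<^sup>,\<^sup>m b\<close>, so that
  behind it the base point \<open>x\<^sub>m\<close> of the second factor may be replaced by \<open>x\<^sub>0\<close>.\<close>

locale comb_product = comm_algebra R B for R :: "'a ring" and B :: "('a, 'b) module" +
  fixes m n :: nat
  assumes m: "1 \<le> m" and n: "1 \<le> n"
begin

sublocale M: form_iso R B m "omega_strong_rel R B m" "J_strong m R B" "strong_psi m R B"
  by (rule power_algebra.strong_form_iso[OF power_algebra m])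
sublocale N: form_iso R B n "omega_strong_rel R B n" "J_strong n R B" "strong_psi n R B"
  by (rule power_algebra.strong_form_iso[OF power_algebra n])
sublocale S: form_iso R B "m + n" "omega_strong_rel R B (m + n)" "J_strong (m + n) R B" "strong_psi (m + n) R B"
  by (rule power_algebra.strong_form_iso[OF power_algebra]) (use m in simp)

definition "p1 = coset_map S.T S.Js (coord_pull m (m + n) R B (\<lambda>j. j))"
definition "p2 = coset_map S.T S.Js (coord_pull n (m + n) R B (\<lambda>j. m + j))"

lemma pull1:
  shows "coord_pull m (m + n) R B (\<lambda>j. j) \<in> ring_hom M.T S.T"
    and "\<And>j b. j \<le> m \<Longrightarrow> b \<in> carrier B \<Longrightarrow> coord_pull m (m + n) R B (\<lambda>j. j) (M.c j b) = S.c j b"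
  by (rule coord_pull[where \<sigma> = "\<lambda>j. j"]; simp)+

lemma pull2:
  shows "coord_pull n (m + n) R B (\<lambda>j. m + j) \<in> ring_hom N.T S.T"
    and "\<And>j b. j \<le> n \<Longrightarrow> b \<in> carrier B \<Longrightarrow> coord_pull n (m + n) R B (\<lambda>j. m + j) (N.c j b) = S.c (m + j) b"
  by (rule coord_pull[where \<sigma> = "\<lambda>j. m + j"]; simp)+

lemma pull1_ideals:
  shows "\<And>r s b. r \<le> m \<Longrightarrow> s \<le> m \<Longrightarrow> b \<in> carrier B \<Longrightarrow>
      coord_pull m (m + n) R B (\<lambda>j. j) (M.D r s b) = S.D r s b"
    and "\<And>x. x \<in> M.Js \<Longrightarrow> coord_pull m (m + n) R B (\<lambda>j. j) x \<in> S.Js"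
  by (rule hom_ideals(1,3)[where \<sigma> = "\<lambda>j. j" and \<beta> = "\<lambda>b. b", OF power_algebra power_algebra pull1(1)];
      simp add: pull1(2))+

lemma pull2_ideals:
  shows "\<And>r s b. r \<le> n \<Longrightarrow> s \<le> n \<Longrightarrow> b \<in> carrier B \<Longrightarrow>
      coord_pull n (m + n) R B (\<lambda>j. m + j) (N.D r s b) = S.D (m + r) (m + s) b"
    and "\<And>x. x \<in> N.Js \<Longrightarrow> coord_pull n (m + n) R B (\<lambda>j. m + j) x \<in> S.Js"
  by (rule hom_ideals(1,3)[where \<sigma> = "\<lambda>j. m + j" and \<beta> = "\<lambda>b. b", OF power_algebra power_algebra pull2(1)];
      simp add: pull2(2))+

lemma p1:
  shows "p1 \<in> ring_hom M.Q S.Q"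
    and "\<And>t. t \<in> carrier M.T \<Longrightarrow> p1 (M.q t) = S.q (coord_pull m (m + n) R B (\<lambda>j. j) t)"
  unfolding p1_def
  by (rule coset_map_ring_hom[OF M.T.M_cring S.T.M_cring M.L_ideal S.L_ideal pull1(1) pull1_ideals(2)]; assumption)+

lemma p2:
  shows "p2 \<in> ring_hom N.Q S.Q"
    and "\<And>t. t \<in> carrier N.T \<Longrightarrow> p2 (N.q t) = S.q (coord_pull n (m + n) R B (\<lambda>j. m + j) t)"
  unfolding p2_def
  by (rule coset_map_ring_hom[OF N.T.M_cring S.T.M_cring N.L_ideal S.L_ideal pull2(1) pull2_ideals(2)]; assumption)+

lemma p1_ring_hom: "ring_hom_cring M.Q S.Q p1"
  by (intro ring_hom_cring.intro ring_hom_cring_axioms.intro M.Q_cring S.Q_cring p1(1))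

lemma p2_ring_hom: "ring_hom_cring N.Q S.Q p2"
  by (intro ring_hom_cring.intro ring_hom_cring_axioms.intro N.Q_cring S.Q_cring p2(1))

lemma p1_phi:
  assumes i: "1 \<le> i" "i \<le> m" and a: "a \<in> carrier K" shows "p1 (M.phi i a) = S.phi i a"
  using a
proof (induction rule: kaehler_induct)
  case (gen b e)
  have i': "i \<le> m + n" using i by simp
  show ?case
    unfolding M.phi_gen[OF i gen] S.phi_gen[OF i(1) i' gen]
      ring_hom_mult[OF p1(1) M.qc_closed[OF gen(1)] M.qd_closed[OF gen(2)]]
      p1(2)[OF M.coord_closed[OF gen(1)]] p1(2)[OF M.diff_closed[OF gen(2)]]
      pull1(2)[OF le0 gen(1)] pull1_ideals(1)[OF le0 i(2) gen(2)] ..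
next
  case (add s t)
  have i': "i \<le> m + n" using i by simp
  show ?case
    unfolding M.phi_add[OF i add(1,2)] S.phi_add[OF i(1) i' add(1,2)]
      ring_hom_add[OF p1(1) M.phi_closed[OF i add(1)] M.phi_closed[OF i add(2)]] add(3,4) ..
qed

text \<open>The property is stated for an arbitrary element instead of the first factor of a star
  product, because further factors are joined to that element one by one; multiplication preserves
  it.\<close>

definition absorbs where
  "absorbs A \<longleftrightarrow> A \<in> carrier S.Q \<and> (\<forall>b\<in>carrier B. A \<otimes>\<^bsub>S.Q\<^esub> S.q (S.\<delta> m b) = \<zero>\<^bsub>S.Q\<^esub>)"

lemma absorbs_mult:
  assumes "absorbs A" "X \<in> carrier S.Q" shows "absorbs (A \<otimes>\<^bsub>S.Q\<^esub> X)"
proof -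
  have "(A \<otimes>\<^bsub>S.Q\<^esub> X) \<otimes>\<^bsub>S.Q\<^esub> Y = (A \<otimes>\<^bsub>S.Q\<^esub> Y) \<otimes>\<^bsub>S.Q\<^esub> X" if "Y \<in> carrier S.Q" for Y
    using assms that by (simp add: absorbs_def S.Q.m_ac)
  thus ?thesis using assms S.qd_closed by (simp add: absorbs_def)
qed

lemma absorbs_coord:
  assumes A: "absorbs A" and b: "b \<in> carrier B"
  shows "A \<otimes>\<^bsub>S.Q\<^esub> S.q (S.c m b) = A \<otimes>\<^bsub>S.Q\<^esub> S.q (S.c 0 b)"
proof -
  have Ac: "A \<in> carrier S.Q" using A by (simp add: absorbs_def)
  have id: "a \<otimes>\<^bsub>S.Q\<^esub> x = a \<otimes>\<^bsub>S.Q\<^esub> y \<oplus>\<^bsub>S.Q\<^esub> a \<otimes>\<^bsub>S.Q\<^esub> (x \<ominus>\<^bsub>S.Q\<^esub> y)"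
    if "a \<in> carrier S.Q" "x \<in> carrier S.Q" "y \<in> carrier S.Q" for a x y
    using that by (simp add: S.Q.minus_eq S.Q.r_distr S.Q.r_minus S.Q.a_lcomm S.Q.r_neg)
  have "A \<otimes>\<^bsub>S.Q\<^esub> (S.q (S.c m b) \<ominus>\<^bsub>S.Q\<^esub> S.q (S.c 0 b)) = \<zero>\<^bsub>S.Q\<^esub>"
    unfolding S.q_minus[OF S.coord_closed[OF b] S.coord_closed[OF b], symmetric]
    using A b by (simp add: absorbs_def diff_def)
  thus ?thesis using id[OF Ac S.qc_closed[OF b, of m] S.qc_closed[OF b, of 0]] Ac S.qc_closed[OF b] by simp
qed

text \<open>The pullback of b de is based at x_m: it is b(x_m) times the difference of e from x_m to
  x_(m+j). Replacing x_m by x_0 in the coefficient and in the difference costs multiples of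
  differences with index \<open>m\<close>, which \<open>A\<close> annihilates.\<close>

lemma absorbs_p2_phi:
  assumes A: "absorbs A" and j: "1 \<le> j" "j \<le> n" and a: "a \<in> carrier K"
  shows "A \<otimes>\<^bsub>S.Q\<^esub> p2 (N.phi j a) = A \<otimes>\<^bsub>S.Q\<^esub> S.phi (m + j) a"
  using a
proof (induction rule: kaehler_induct)
  case (gen b e)
  have mj: "1 \<le> m + j" "m + j \<le> m + n" using j by auto
  have Ac: "A \<in> carrier S.Q" using A by (simp add: absorbs_def)
  note cl = S.qc_closed[OF gen(1)] S.qd_closed[OF gen(2)]
  have z: "A \<otimes>\<^bsub>S.Q\<^esub> S.q (S.\<delta> m e) = \<zero>\<^bsub>S.Q\<^esub>" using A gen(2) by (simp add: absorbs_def)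
  have "p2 (N.phi j (b \<odot>\<^bsub>K\<^esub> d e)) = S.q (S.c m b) \<otimes>\<^bsub>S.Q\<^esub> S.q (S.D m (m + j) e)"
    unfolding N.phi_gen[OF j gen]
      ring_hom_mult[OF p2(1) N.qc_closed[OF gen(1)] N.qd_closed[OF gen(2)]]
      p2(2)[OF N.coord_closed[OF gen(1)]] p2(2)[OF N.diff_closed[OF gen(2)]]
      pull2(2)[OF le0 gen(1)] pull2_ideals(1)[OF le0 j(2) gen(2)] by simp
  also have "S.q (S.D m (m + j) e) = S.q (S.\<delta> (m + j) e) \<ominus>\<^bsub>S.Q\<^esub> S.q (S.\<delta> m e)"
    unfolding S.diff_eq[OF gen(2), of m "m + j"] by (rule S.q_minus) (rule S.diff_closed gen)+
  finally have "A \<otimes>\<^bsub>S.Q\<^esub> p2 (N.phi j (b \<odot>\<^bsub>K\<^esub> d e)) =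
      A \<otimes>\<^bsub>S.Q\<^esub> (S.q (S.c m b) \<otimes>\<^bsub>S.Q\<^esub> (S.q (S.\<delta> (m + j) e) \<ominus>\<^bsub>S.Q\<^esub> S.q (S.\<delta> m e)))" by simp
  also have "\<dots> = (A \<otimes>\<^bsub>S.Q\<^esub> S.q (S.c m b)) \<otimes>\<^bsub>S.Q\<^esub> S.q (S.\<delta> (m + j) e) \<ominus>\<^bsub>S.Q\<^esub>
      (A \<otimes>\<^bsub>S.Q\<^esub> S.q (S.\<delta> m e)) \<otimes>\<^bsub>S.Q\<^esub> S.q (S.c m b)"
  proof -
    have id: "a \<otimes>\<^bsub>S.Q\<^esub> (x \<otimes>\<^bsub>S.Q\<^esub> (y \<ominus>\<^bsub>S.Q\<^esub> z)) = (a \<otimes>\<^bsub>S.Q\<^esub> x) \<otimes>\<^bsub>S.Q\<^esub> y \<ominus>\<^bsub>S.Q\<^esub> (a \<otimes>\<^bsub>S.Q\<^esub> z) \<otimes>\<^bsub>S.Q\<^esub> x"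
      if "a \<in> carrier S.Q" "x \<in> carrier S.Q" "y \<in> carrier S.Q" "z \<in> carrier S.Q" for a x y z
      using that by (simp add: S.Q.minus_eq S.Q.r_distr S.Q.r_minus S.Q.m_ac)
    show ?thesis by (rule id[OF Ac cl(1) S.qd_closed[OF gen(2)] S.qd_closed[OF gen(2)]])
  qed
  also have "\<dots> = (A \<otimes>\<^bsub>S.Q\<^esub> S.q (S.c 0 b)) \<otimes>\<^bsub>S.Q\<^esub> S.q (S.\<delta> (m + j) e)"
    unfolding z absorbs_coord[OF A gen(1)] using Ac cl by (simp add: S.Q.minus_eq)
  finally show ?case unfolding S.phi_gen[OF mj gen] using Ac cl by (simp add: S.Q.m_assoc)
next
  case (add s t)
  have mj: "1 \<le> m + j" "m + j \<le> m + n" using j by auto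
  have Ac: "A \<in> carrier S.Q" using A by (simp add: absorbs_def)
  note cl = N.phi_closed[OF j add(1)] N.phi_closed[OF j add(2)]
  note cl' = ring_hom_closed[OF p2(1) cl(1)] ring_hom_closed[OF p2(1) cl(2)]
    S.phi_closed[OF mj add(1)] S.phi_closed[OF mj add(2)]
  show ?case unfolding N.phi_add[OF j add(1,2)] S.phi_add[OF mj add(1,2)] ring_hom_add[OF p2(1) cl]
    using add(3,4) Ac cl' by (simp add: S.Q.r_distr)
qed

text \<open>\<open>A\<close> varies in the induction: once a factor has been rewritten it is joined
  to \<open>A\<close>, which still absorbs.\<close>

lemma absorbs_p2_finprod:
  assumes A: "absorbs A" and y: "y \<in> N.ktuples" and I: "I \<subseteq> {..<n}"
  shows "A \<otimes>\<^bsub>S.Q\<^esub> (\<Otimes>\<^bsub>S.Q\<^esub>k\<in>I. p2 (N.phi (Suc k) (y k))) = A \<otimes>\<^bsub>S.Q\<^esub> (\<Otimes>\<^bsub>S.Q\<^esub>k\<in>I. S.phi (m + Suc k) (y k))"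
proof -
  have fin: "finite I" using I finite_subset by blast
  have yk: "y k \<in> carrier K" if "k < n" for k by (rule N.ktuple_mem[OF y that])
  have cl: "p2 (N.phi (Suc k) (y k)) \<in> carrier S.Q" "S.phi (m + Suc k) (y k) \<in> carrier S.Q" if "k < n" for k
    using that yk[OF that] by (auto intro!: ring_hom_closed[OF p2(1)] N.phi_closed S.phi_closed)
  show ?thesis using fin I A
  proof (induction I arbitrary: A)
    case (insert k I)
    hence k: "k < n" and I: "I \<subseteq> {..<n}" by auto
    have Ac: "A \<in> carrier S.Q" using insert.prems by (simp add: absorbs_def)
    let ?f = "\<lambda>k. p2 (N.phi (Suc k) (y k))" and ?g = "\<lambda>k. S.phi (m + Suc k) (y k)"
    have fc: "finprod S.Q ?f I \<in> carrier S.Q" "finprod S.Q ?g I \<in> carrier S.Q"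
      using cl I by (auto intro!: S.Q.finprod_closed)
    have "A \<otimes>\<^bsub>S.Q\<^esub> finprod S.Q ?f (insert k I) = (A \<otimes>\<^bsub>S.Q\<^esub> ?f k) \<otimes>\<^bsub>S.Q\<^esub> finprod S.Q ?f I"
      using insert.hyps cl k I Ac fc by (subst S.Q.finprod_insert) (auto simp: S.Q.m_assoc)
    also have "A \<otimes>\<^bsub>S.Q\<^esub> ?f k = A \<otimes>\<^bsub>S.Q\<^esub> ?g k"
      using k by (intro absorbs_p2_phi[OF insert.prems(2)] yk) auto
    also have "(A \<otimes>\<^bsub>S.Q\<^esub> ?g k) \<otimes>\<^bsub>S.Q\<^esub> finprod S.Q ?f I = (A \<otimes>\<^bsub>S.Q\<^esub> ?g k) \<otimes>\<^bsub>S.Q\<^esub> finprod S.Q ?g I"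
      by (rule insert.IH[OF I absorbs_mult[OF insert.prems(2) cl(2)[OF k]]])
    also have "\<dots> = A \<otimes>\<^bsub>S.Q\<^esub> finprod S.Q ?g (insert k I)"
      using insert.hyps cl k I Ac fc by (subst S.Q.finprod_insert) (auto simp: S.Q.m_assoc)
    finally show ?case .
  qed simp
qed

abbreviation "juxt x y \<equiv> (\<lambda>i\<in>{..<m + n}. if i < m then x i else y (i - m))"

lemma juxt_tuple: "x \<in> M.ktuples \<Longrightarrow> y \<in> N.ktuples \<Longrightarrow> juxt x y \<in> S.ktuples"
  using M.ktuple_mem N.ktuple_mem by auto

text \<open>The image of a juxtaposed tuple is the product of its first \<open>m\<close> and its
  last \<open>n\<close> factors, all based at x_0. The product of the first \<open>m\<close> absorbs
  differences with index \<open>m\<close>, so on the other side the \<open>n\<close> pulled back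
  factors and the coefficient b(x_m) may be rewritten at base point x_0.\<close>

lemma star_generators:
  assumes x: "x \<in> M.ktuples" and y: "y \<in> N.ktuples" and a: "a \<in> carrier B" and b: "b \<in> carrier B"
  shows "S.nu (a \<odot>\<^bsub>S.Om\<^esub> (b \<odot>\<^bsub>S.Om\<^esub> S.w (juxt x y))) =
    p1 (M.nu (a \<odot>\<^bsub>M.Om\<^esub> M.w x)) \<otimes>\<^bsub>S.Q\<^esub> p2 (N.nu (b \<odot>\<^bsub>N.Om\<^esub> N.w y))"
proof -
  note xy = juxt_tuple[OF x y]
  let ?X = "\<Otimes>\<^bsub>S.Q\<^esub>i\<in>{..<m}. S.phi (Suc i) (x i)" and ?Y = "\<Otimes>\<^bsub>S.Q\<^esub>k\<in>{..<n}. S.phi (m + Suc k) (y k)"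
  let ?Y' = "\<Otimes>\<^bsub>S.Q\<^esub>k\<in>{..<n}. p2 (N.phi (Suc k) (y k))"
  have px: "S.phi (Suc i) (x i) \<in> carrier S.Q" if "i < m" for i
    using that M.ktuple_mem[OF x that] by (intro S.phi_closed) auto
  have py: "S.phi (m + Suc k) (y k) \<in> carrier S.Q" if "k < n" for k
    using that N.ktuple_mem[OF y that] by (intro S.phi_closed) auto
  have py': "p2 (N.phi (Suc k) (y k)) \<in> carrier S.Q" if "k < n" for k
    by (rule ring_hom_closed[OF p2(1) N.phi_tuple[OF y that]])
  have X: "?X \<in> carrier S.Q" using px by (intro S.Q.finprod_closed) auto
  have Y: "?Y \<in> carrier S.Q" using py by (intro S.Q.finprod_closed) auto
  have Y': "?Y' \<in> carrier S.Q" using py' by (intro S.Q.finprod_closed) auto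
  have ca: "S.q (S.c r a) \<in> carrier S.Q" for r by (rule S.qc_closed[OF a])
  have cb: "S.q (S.c r b) \<in> carrier S.Q" for r by (rule S.qc_closed[OF b])
  have un: "{..<m + n} = {..<m} \<union> (\<lambda>k. m + k) ` {..<n}"
  proof (intro equalityI subsetI)
    fix i assume "i \<in> {..<m + n}"
    thus "i \<in> {..<m} \<union> (\<lambda>k. m + k) ` {..<n}"
      by (cases "i < m") (auto intro!: image_eqI[of i _ "i - m"])
  qed auto
  have split: "(\<Otimes>\<^bsub>S.Q\<^esub>i\<in>{..<m + n}. S.phi (Suc i) (juxt x y i)) = ?X \<otimes>\<^bsub>S.Q\<^esub> ?Y"
  proof -
    let ?f = "\<lambda>i. S.phi (Suc i) (juxt x y i)"
    have "finprod S.Q ?f {..<m + n} = finprod S.Q ?f {..<m} \<otimes>\<^bsub>S.Q\<^esub> finprod S.Q ?f ((\<lambda>k. m + k) ` {..<n})"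
      unfolding un by (intro S.Q.finprod_Un_disjoint) (use px py in auto)
    also have "finprod S.Q ?f {..<m} = ?X" by (intro S.Q.finprod_cong') (auto simp: px)
    also have "finprod S.Q ?f ((\<lambda>k. m + k) ` {..<n}) = finprod S.Q (\<lambda>k. ?f (m + k)) {..<n}"
      by (intro S.Q.finprod_reindex) (use py in \<open>auto simp: inj_on_def\<close>)
    also have "\<dots> = ?Y" by (intro S.Q.finprod_cong') (use py in auto)
    finally show ?thesis .
  qed
  have w: "S.w (juxt x y) \<in> carrier S.Om" by (rule S.w_closed[OF xy])
  have "S.nu (S.w (juxt x y)) = ?X \<otimes>\<^bsub>S.Q\<^esub> ?Y"
    unfolding S.nu(2)[OF S.ptens_closed[OF xy]] S.nu0(2)[OF xy] by (rule split)
  hence lhs: "S.nu (a \<odot>\<^bsub>S.Om\<^esub> (b \<odot>\<^bsub>S.Om\<^esub> S.w (juxt x y))) =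
      S.q (S.c 0 a) \<otimes>\<^bsub>S.Q\<^esub> (S.q (S.c 0 b) \<otimes>\<^bsub>S.Q\<^esub> (?X \<otimes>\<^bsub>S.Q\<^esub> ?Y))"
    unfolding semilinear_smult[OF S.nu(1) a S.Om.smult_closed[OF b w]] semilinear_smult[OF S.nu(1) b w] comb_module_simps
    by simp
  have "M.nu (a \<odot>\<^bsub>M.Om\<^esub> M.w x) = M.q (M.c 0 a) \<otimes>\<^bsub>M.Q\<^esub> (\<Otimes>\<^bsub>M.Q\<^esub>i\<in>{..<m}. M.phi (Suc i) (x i))"
    unfolding semilinear_smult[OF M.nu(1) a M.w_closed[OF x]] M.nu(2)[OF M.ptens_closed[OF x]] M.nu0(2)[OF x]
      comb_module_simps ..
  moreover have "(\<Otimes>\<^bsub>M.Q\<^esub>i\<in>{..<m}. M.phi (Suc i) (x i)) \<in> carrier M.Q"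
    using M.phi_tuple[OF x] by (intro M.Q.finprod_closed) auto
  moreover have "p1 (\<Otimes>\<^bsub>M.Q\<^esub>i\<in>{..<m}. M.phi (Suc i) (x i)) = ?X"
  proof -
    have "p1 (\<Otimes>\<^bsub>M.Q\<^esub>i\<in>{..<m}. M.phi (Suc i) (x i)) = (\<Otimes>\<^bsub>S.Q\<^esub>i\<in>{..<m}. (p1 \<circ> (\<lambda>i. M.phi (Suc i) (x i))) i)"
      using M.phi_tuple[OF x] by (intro ring_hom_cring.hom_finprod[OF p1_ring_hom]) auto
    also have "\<dots> = ?X" using px M.ktuple_mem[OF x] by (intro S.Q.finprod_cong') (auto simp: p1_phi)
    finally show ?thesis .
  qed
  ultimately have r1: "p1 (M.nu (a \<odot>\<^bsub>M.Om\<^esub> M.w x)) = S.q (S.c 0 a) \<otimes>\<^bsub>S.Q\<^esub> ?X"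
    by (simp add: ring_hom_mult[OF p1(1)] M.qc_closed[OF a] p1(2) M.coord_closed[OF a] pull1(2) a)
  have "N.nu (b \<odot>\<^bsub>N.Om\<^esub> N.w y) = N.q (N.c 0 b) \<otimes>\<^bsub>N.Q\<^esub> (\<Otimes>\<^bsub>N.Q\<^esub>k\<in>{..<n}. N.phi (Suc k) (y k))"
    unfolding semilinear_smult[OF N.nu(1) b N.w_closed[OF y]] N.nu(2)[OF N.ptens_closed[OF y]] N.nu0(2)[OF y]
      comb_module_simps ..
  moreover have "(\<Otimes>\<^bsub>N.Q\<^esub>k\<in>{..<n}. N.phi (Suc k) (y k)) \<in> carrier N.Q"
    using N.phi_tuple[OF y] by (intro N.Q.finprod_closed) auto
  moreover have "p2 (\<Otimes>\<^bsub>N.Q\<^esub>k\<in>{..<n}. N.phi (Suc k) (y k)) = ?Y'"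
  proof -
    have "p2 (\<Otimes>\<^bsub>N.Q\<^esub>k\<in>{..<n}. N.phi (Suc k) (y k)) = (\<Otimes>\<^bsub>S.Q\<^esub>k\<in>{..<n}. (p2 \<circ> (\<lambda>k. N.phi (Suc k) (y k))) k)"
      using N.phi_tuple[OF y] by (intro ring_hom_cring.hom_finprod[OF p2_ring_hom]) auto
    thus ?thesis by (simp add: o_def)
  qed
  ultimately have r2: "p2 (N.nu (b \<odot>\<^bsub>N.Om\<^esub> N.w y)) = S.q (S.c m b) \<otimes>\<^bsub>S.Q\<^esub> ?Y'"
    by (simp add: ring_hom_mult[OF p2(1)] N.qc_closed[OF b] p2(2) N.coord_closed[OF b] pull2(2) b)
  \<comment> \<open>Since \<open>m\<close> is at least 1 there is a factor with index
    \<open>m\<close>, the last one. It absorbs by \<open>phi_delta\<close>, and so does its product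
    with the others.\<close>
  have abs: "absorbs ?X"
  proof -
    obtain l where l: "m = Suc l" using m by (cases m) auto
    have xl: "x l \<in> carrier K" using M.ktuple_mem[OF x, of l] l by simp
    have mm: "m \<le> m + n" by simp
    have "absorbs (S.phi m (x l))"
      unfolding absorbs_def using S.phi_closed[OF m mm xl] S.phi_delta[OF m mm xl] by simp
    moreover have "?X = S.phi m (x l) \<otimes>\<^bsub>S.Q\<^esub> (\<Otimes>\<^bsub>S.Q\<^esub>i\<in>{..<m} - {l}. S.phi (Suc i) (x i))"
      using S.Q.finprod_remove[of "{..<m}" l "\<lambda>i. S.phi (Suc i) (x i)"] px l by simp
    moreover have "(\<Otimes>\<^bsub>S.Q\<^esub>i\<in>{..<m} - {l}. S.phi (Suc i) (x i)) \<in> carrier S.Q"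
      using px by (intro S.Q.finprod_closed) auto
    ultimately show ?thesis using absorbs_mult by simp
  qed
  \<comment> \<open>The factors are ordered so that the absorbing product stands directly before
    what is to be rewritten, both for the pulled back factors and for the coefficient at
    x_m.\<close>
  have "(S.q (S.c 0 a) \<otimes>\<^bsub>S.Q\<^esub> ?X) \<otimes>\<^bsub>S.Q\<^esub> (S.q (S.c m b) \<otimes>\<^bsub>S.Q\<^esub> ?Y') =
      S.q (S.c 0 a) \<otimes>\<^bsub>S.Q\<^esub> ((?X \<otimes>\<^bsub>S.Q\<^esub> ?Y') \<otimes>\<^bsub>S.Q\<^esub> S.q (S.c m b))"
    using X Y' ca cb by (simp add: S.Q.m_ac)
  also have "?X \<otimes>\<^bsub>S.Q\<^esub> ?Y' = ?X \<otimes>\<^bsub>S.Q\<^esub> ?Y" by (rule absorbs_p2_finprod[OF abs y subset_refl])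
  also have "(?X \<otimes>\<^bsub>S.Q\<^esub> ?Y) \<otimes>\<^bsub>S.Q\<^esub> S.q (S.c m b) = (?X \<otimes>\<^bsub>S.Q\<^esub> ?Y) \<otimes>\<^bsub>S.Q\<^esub> S.q (S.c 0 b)"
    by (rule absorbs_coord[OF absorbs_mult[OF abs Y] b])
  finally show ?thesis unfolding lhs r1 r2 using X Y ca cb by (simp add: S.Q.m_ac)
qed

section \<open>The exterior product on representatives and its independence of them\<close>

abbreviation "ext u v \<equiv> lin_ext B S.Om (\<lambda>b. b) (\<lambda>x. lin_ext B S.Om (\<lambda>b. b) (\<lambda>y. S.w (juxt x y)) v) u"
abbreviation "Mcls u \<equiv> M.cls (tensor_rel B K m +>\<^bsub>tensor_free B K m\<^esub> u)"
abbreviation "Ncls v \<equiv> N.cls (tensor_rel B K n +>\<^bsub>tensor_free B K n\<^esub> v)"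

lemma cls_semilinear:
  assumes "submodule N' B (tensor_power B K k)"
  shows "semilinear B (free_module B ({..<k} \<rightarrow>\<^sub>E carrier K)) (quot_module (tensor_power B K k) N') (\<lambda>b. b)
    (\<lambda>u. N' +>\<^bsub>tensor_power B K k\<^esub> (tensor_rel B K k +>\<^bsub>tensor_free B K k\<^esub> u))"
proof -
  have 1: "semilinear B (tensor_free B K k) (tensor_power B K k) (\<lambda>b. b) (\<lambda>u. tensor_rel B K k +>\<^bsub>tensor_free B K k\<^esub> u)"
    unfolding tensor_power_def
    by (rule quot_module_semilinear[OF module_tensor_free[OF is_cring] submodule_tensor_rel[OF module_kaehler]])
  have 2: "semilinear B (tensor_power B K k) (quot_module (tensor_power B K k) N') (\<lambda>b. b) (\<lambda>u. N' +>\<^bsub>tensor_power B K k\<^esub> u)"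
    by (rule quot_module_semilinear[OF module_tensor_power[OF module_kaehler] assms])
  show ?thesis using semilinear_comp[OF 1 2] by (simp add: semilinear_tensor_free)
qed

text \<open>Both sides are additive and homogeneous in each of the two representatives, which
  reduces the identity to single tuples. As its right side depends only on the classes of
  \<open>u\<close> and \<open>v\<close>, it also prepares the proof that the exterior product is
  well defined.\<close>

lemma ext_star:
  assumes u: "u \<in> carrier (free_module B M.ktuples)" and v: "v \<in> carrier (free_module B N.ktuples)"
  shows "ext u v \<in> carrier S.Om" and "S.nu (ext u v) = p1 (M.nu (Mcls u)) \<otimes>\<^bsub>S.Q\<^esub> p2 (N.nu (Ncls v))"
proof -
  have w: "S.w (juxt x y) \<in> carrier S.Om" if "x \<in> M.ktuples" "y \<in> N.ktuples" for x y
    by (rule S.w_closed[OF juxt_tuple[OF that]])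
  have li: "semilinear B (free_module B N.ktuples) S.Om (\<lambda>b. b) (lin_ext B S.Om (\<lambda>b. b) (\<lambda>y. S.w (juxt x y)))"
    if "x \<in> M.ktuples" for x
    by (rule lin_ext_semilinear(1)[OF is_cring S.Om.module_axioms S.id_hom w[OF that]])
  have di: "lin_ext B S.Om (\<lambda>b. b) (\<lambda>y. S.w (juxt x y)) (delta B y) = S.w (juxt x y)"
    if "x \<in> M.ktuples" "y \<in> N.ktuples" for x y
    by (rule lin_ext_semilinear(2)[OF is_cring S.Om.module_axioms S.id_hom w[OF that(1)] that(2)])
  have lo: "semilinear B (free_module B M.ktuples) S.Om (\<lambda>b. b) (\<lambda>u. ext u v)"
    if "v \<in> carrier (free_module B N.ktuples)" for v
    by (rule lin_ext_semilinear(1)[OF is_cring S.Om.module_axioms S.id_hom semilinear_closed[OF li that]])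
  have dd: "ext (delta B x) v = lin_ext B S.Om (\<lambda>b. b) (\<lambda>y. S.w (juxt x y)) v"
    if "x \<in> M.ktuples" "v \<in> carrier (free_module B N.ktuples)" for x v
    by (rule lin_ext_semilinear(2)[where v = "\<lambda>x. lin_ext B S.Om (\<lambda>b. b) (\<lambda>y. S.w (juxt x y)) v",
        OF is_cring S.Om.module_axioms S.id_hom semilinear_closed[OF li that(2)] that(1)])
  show "ext u v \<in> carrier S.Om" by (rule semilinear_closed[OF lo[OF v] u])
  note mc = cls_semilinear[OF M.N_sub] and nc = cls_semilinear[OF N.N_sub]
  let ?FM = "free_module B M.ktuples" and ?FN = "free_module B N.ktuples"
  interpret FM: Module.module B ?FM by (rule module_free_module)
  interpret FN: Module.module B ?FN by (rule module_free_module)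
  have ml: "M.nu (Mcls (f \<oplus>\<^bsub>?FM\<^esub> g)) = M.nu (Mcls f) \<oplus>\<^bsub>M.Q\<^esub> M.nu (Mcls g)"
    if "f \<in> carrier ?FM" "g \<in> carrier ?FM" for f g
    unfolding semilinear_add[OF mc that]
      semilinear_add[OF M.nu(1) semilinear_closed[OF mc that(1)] semilinear_closed[OF mc that(2)]] comb_module_simps ..
  have nl: "N.nu (Ncls (f \<oplus>\<^bsub>?FN\<^esub> g)) = N.nu (Ncls f) \<oplus>\<^bsub>N.Q\<^esub> N.nu (Ncls g)"
    if "f \<in> carrier ?FN" "g \<in> carrier ?FN" for f g
    unfolding semilinear_add[OF nc that]
      semilinear_add[OF N.nu(1) semilinear_closed[OF nc that(1)] semilinear_closed[OF nc that(2)]] comb_module_simps ..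
  have mq: "M.nu (Mcls f) \<in> carrier M.Q" if "f \<in> carrier ?FM" for f
    using semilinear_closed[OF M.nu(1) semilinear_closed[OF mc that]] by (simp add: comb_module_simps)
  have nq: "N.nu (Ncls f) \<in> carrier N.Q" if "f \<in> carrier ?FN" for f
    using semilinear_closed[OF N.nu(1) semilinear_closed[OF nc that]] by (simp add: comb_module_simps)
  have mz: "M.nu (Mcls \<zero>\<^bsub>?FM\<^esub>) = \<zero>\<^bsub>M.Q\<^esub>"
    unfolding semilinear_zero[OF FM.module_axioms M.Om.module_axioms mc]
      semilinear_zero[OF M.Om.module_axioms M.module_comb M.nu(1)] comb_module_simps ..
  have nz: "N.nu (Ncls \<zero>\<^bsub>?FN\<^esub>) = \<zero>\<^bsub>N.Q\<^esub>"
    unfolding semilinear_zero[OF FN.module_axioms N.Om.module_axioms nc]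
      semilinear_zero[OF N.Om.module_axioms N.module_comb N.nu(1)] comb_module_simps ..
  have sz: "S.nu \<zero>\<^bsub>S.Om\<^esub> = \<zero>\<^bsub>S.Q\<^esub>"
    unfolding semilinear_zero[OF S.Om.module_axioms S.module_comb S.nu(1)] comb_module_simps ..
  have sa: "S.nu (s \<oplus>\<^bsub>S.Om\<^esub> t) = S.nu s \<oplus>\<^bsub>S.Q\<^esub> S.nu t" if "s \<in> carrier S.Om" "t \<in> carrier S.Om" for s t
    unfolding semilinear_add[OF S.nu(1) that] comb_module_simps ..
  note p1c = ring_hom_closed[OF p1(1) mq] and p2c = ring_hom_closed[OF p2(1) nq]
  show "S.nu (ext u v) = p1 (M.nu (Mcls u)) \<otimes>\<^bsub>S.Q\<^esub> p2 (N.nu (Ncls v))"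
    using u
  proof (induction rule: free_module_induct)
    case zero
    show ?case
      unfolding semilinear_zero[OF FM.module_axioms S.Om.module_axioms lo[OF v]] sz mz
        ring_hom_cring.hom_zero[OF p1_ring_hom] using p2c[OF v] by simp
  next
    case (add f g)
    show ?case
      unfolding semilinear_add[OF lo[OF v] add(1,2)]
        sa[OF semilinear_closed[OF lo[OF v] add(1)] semilinear_closed[OF lo[OF v] add(2)]] ml[OF add(1,2)]
        ring_hom_add[OF p1(1) mq[OF add(1)] mq[OF add(2)]] add(3,4)
      using p1c[OF add(1)] p1c[OF add(2)] p2c[OF v] by (simp add: S.Q.l_distr)
  next
    case (gen a x)
    note x = gen(2) and dx = delta_closed[OF gen(2)]
    note adx = FM.smult_closed[OF gen(1) dx]
    have e: "ext (a \<odot>\<^bsub>?FM\<^esub> delta B x) v = a \<odot>\<^bsub>S.Om\<^esub> lin_ext B S.Om (\<lambda>b. b) (\<lambda>y. S.w (juxt x y)) v"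
      if "v \<in> carrier ?FN" for v
      unfolding semilinear_smult[OF lo[OF that] gen(1) dx] dd[OF x that] ..
    have mx: "Mcls (a \<odot>\<^bsub>?FM\<^esub> delta B x) = a \<odot>\<^bsub>M.Om\<^esub> M.w x"
      unfolding semilinear_smult[OF mc gen(1) dx] pure_tensor_def ..
    show ?case using v
    proof (induction rule: free_module_induct)
      case zero
      show ?case
        unfolding e[OF FN.zero_closed] semilinear_zero[OF FN.module_axioms S.Om.module_axioms li[OF x]]
          nz ring_hom_cring.hom_zero[OF p2_ring_hom] S.Om.smult_r_null[OF gen(1)] sz using p1c[OF adx] by simp
    next
      case (add f g)
      have l: "a \<odot>\<^bsub>S.Om\<^esub> lin_ext B S.Om (\<lambda>b. b) (\<lambda>y. S.w (juxt x y)) f \<in> carrier S.Om"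
        if "f \<in> carrier ?FN" for f
        by (rule S.Om.smult_closed[OF gen(1) semilinear_closed[OF li[OF x] that]])
      show ?case
        unfolding e[OF FN.add.m_closed[OF add(1,2)]] semilinear_add[OF li[OF x] add(1,2)]
          S.Om.smult_r_distr[OF gen(1) semilinear_closed[OF li[OF x] add(1)] semilinear_closed[OF li[OF x] add(2)]]
          sa[OF l[OF add(1)] l[OF add(2)]] nl[OF add(1,2)] ring_hom_add[OF p2(1) nq[OF add(1)] nq[OF add(2)]]
        using add(3,4)[unfolded e[OF add(1)] e[OF add(2)]] p1c[OF adx] p2c[OF add(1)] p2c[OF add(2)]
        by (simp add: S.Q.r_distr)
    next
      case (gen b y)
      note dy = delta_closed[OF gen(2)]
      have ny: "Ncls (b \<odot>\<^bsub>?FN\<^esub> delta B y) = b \<odot>\<^bsub>N.Om\<^esub> N.w y"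
        unfolding semilinear_smult[OF nc gen(1) dy] pure_tensor_def ..
      show ?case
        unfolding e[OF FN.smult_closed[OF gen(1) dy]] semilinear_smult[OF li[OF x] gen(1) dy] di[OF x gen(2)] mx ny
        by (rule star_generators[OF x gen(2) \<open>a \<in> carrier B\<close> gen(1)])
    qed
  qed
qed

lemma quot_module_Union:
  assumes M': "Module.module C M'" and N': "submodule N' C M'" and X: "X \<in> carrier (quot_module M' N')"
  shows "x \<in> X \<longleftrightarrow> x \<in> carrier M' \<and> N' +>\<^bsub>M'\<^esub> x = X"
proof -
  interpret abelian_subgroup N' M' by (rule submodule_abelian_subgroup[OF M' N'])
  obtain y where y: "y \<in> carrier M'" "X = N' +>\<^bsub>M'\<^esub> y" using X by (auto simp: quot_module_carrier)
  show ?thesis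
    using a_repr_independence'[of x y] a_elemrcos_carrier[of y x] a_rcos_self[of x] y by auto
qed

text \<open>A form is a set of tensors and a tensor is a set of functions on tuples. So the union of
  a form collects its representatives in the free module, the set over which the definition of
  \<open>ext_prod\<close> ranges.\<close>

lemma reps:
  assumes N': "submodule N' B (tensor_power B K k)" and X: "X \<in> carrier (quot_module (tensor_power B K k) N')"
  shows "u \<in> \<Union>X \<longleftrightarrow> u \<in> carrier (free_module B ({..<k} \<rightarrow>\<^sub>E carrier K)) \<and>
      N' +>\<^bsub>tensor_power B K k\<^esub> (tensor_rel B K k +>\<^bsub>tensor_free B K k\<^esub> u) = X"
    and "\<Union>X \<noteq> {}"
proof -
  note F = module_tensor_free[OF is_cring, of K k] and P = module_tensor_power[OF module_kaehler, of k]
    and rel = submodule_tensor_rel[OF module_kaehler, of k]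
  have 1: "t \<in> X \<longleftrightarrow> t \<in> carrier (tensor_power B K k) \<and> N' +>\<^bsub>tensor_power B K k\<^esub> t = X" for t
    by (rule quot_module_Union[OF P N' X])
  have 2: "u \<in> t \<longleftrightarrow> u \<in> carrier (tensor_free B K k) \<and> tensor_rel B K k +>\<^bsub>tensor_free B K k\<^esub> u = t"
    if "t \<in> carrier (tensor_power B K k)" for t u
    using quot_module_Union[OF F rel] that unfolding tensor_power_def by blast
  have 3: "tensor_rel B K k +>\<^bsub>tensor_free B K k\<^esub> u \<in> carrier (tensor_power B K k)"
    if "u \<in> carrier (tensor_free B K k)" for u
    using that by (auto simp: tensor_power_def quot_module_carrier)
  show "u \<in> \<Union>X \<longleftrightarrow> u \<in> carrier (free_module B ({..<k} \<rightarrow>\<^sub>E carrier K)) \<and>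
      N' +>\<^bsub>tensor_power B K k\<^esub> (tensor_rel B K k +>\<^bsub>tensor_free B K k\<^esub> u) = X"
    using 1 2 3 by (auto simp: tensor_free_simps(1)[symmetric])
  obtain t where t: "t \<in> carrier (tensor_power B K k)" "X = N' +>\<^bsub>tensor_power B K k\<^esub> t"
    using X by (auto simp: quot_module_carrier)
  moreover obtain u where "u \<in> carrier (tensor_free B K k)" "t = tensor_rel B K k +>\<^bsub>tensor_free B K k\<^esub> u"
    using t(1) by (auto simp: tensor_power_def quot_module_carrier)
  ultimately show "\<Union>X \<noteq> {}" using 1 2 by blast
qed

text \<open>All choices of representatives give values with the same image under
  \<open>S.nu\<close>, which is injective. So the values agree, the image in the definition of
  \<open>ext_prod\<close> is a singleton, and its element has the claimed image: well-definedness of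
  the exterior product is drawn from the isomorphism.\<close>

theorem nu_ext_prod:
  assumes \<omega>: "\<omega> \<in> carrier (omega_strong m R B)" and \<eta>: "\<eta> \<in> carrier (omega_strong n R B)"
  shows "S.nu (ext_prod R B m n \<omega> \<eta>) = star_prod R B m n (M.nu \<omega>) (N.nu \<eta>)"
proof -
  note mr = reps[OF M.N_sub \<omega>[unfolded omega_strong_def]] and nr = reps[OF N.N_sub \<eta>[unfolded omega_strong_def]]
  let ?E = "\<lambda>(u, v). ext u v"
  have E: "ext u v \<in> carrier S.Om \<and> S.nu (ext u v) = p1 (M.nu \<omega>) \<otimes>\<^bsub>S.Q\<^esub> p2 (N.nu \<eta>)"
    if "u \<in> \<Union>\<omega>" "v \<in> \<Union>\<eta>" for u v
    using ext_star[of u v] mr(1)[of u] nr(1)[of v] that by simp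
  obtain u v where uv: "u \<in> \<Union>\<omega>" "v \<in> \<Union>\<eta>" using mr(2) nr(2) by auto
  have inj: "inj_on S.nu (carrier S.Om)"
    using S.nu_iso by (auto simp: module_iso_def bij_betw_def)
  have eq: "ext u' v' = ext u v" if "u' \<in> \<Union>\<omega>" "v' \<in> \<Union>\<eta>" for u' v'
    using inj_onD[OF inj] E[OF that] E[OF uv] by simp
  have "?E ` (\<Union>\<omega> \<times> \<Union>\<eta>) = {ext u v}"
  proof (intro equalityI subsetI)
    fix z assume "z \<in> ?E ` (\<Union>\<omega> \<times> \<Union>\<eta>)"
    then obtain p where p: "p \<in> \<Union>\<omega> \<times> \<Union>\<eta>" "z = ?E p" by (rule imageE)
    obtain u' v' where p': "p = (u', v')" by (cases p)
    have "u' \<in> \<Union>\<omega>" "v' \<in> \<Union>\<eta>" using p(1) unfolding p' by (simp_all only: mem_Sigma_iff)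
    from eq[OF this] show "z \<in> {ext u v}" unfolding p(2) p' by simp
  qed (use uv in \<open>auto intro!: image_eqI[of _ _ "(u, v)"]\<close>)
  hence "ext_prod R B m n \<omega> \<eta> = ext u v"
    unfolding ext_prod_def omega_strong_def wedge_strong_def by simp
  thus ?thesis using E[OF uv] unfolding star_prod_def p1_def p2_def by simp
qed

end

section \<open>Sheaves of forms\<close>

lemma hom_algebra_simps:
  "carrier (hom_algebra \<phi> B) = carrier B" "mult (hom_algebra \<phi> B) = mult B" "one (hom_algebra \<phi> B) = one B"
  "zero (hom_algebra \<phi> B) = zero B" "add (hom_algebra \<phi> B) = add B"
  "r \<odot>\<^bsub>hom_algebra \<phi> B\<^esub> b = \<phi> r \<otimes>\<^bsub>B\<^esub> b"
  by (simp_all add: hom_algebra_def ring.defs module.defs)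

lemma comm_algebra_hom_algebra:
  assumes "cring R" "cring B" "\<phi> \<in> ring_hom R B" shows "comm_algebra R (hom_algebra \<phi> B)"
proof -
  interpret B: cring B by fact
  note h = ring_hom_closed[OF assms(3)] ring_hom_add[OF assms(3)] ring_hom_mult[OF assms(3)] ring_hom_one[OF assms(3)]
  have c: "cring (hom_algebra \<phi> B)"
  proof (rule cringI)
    show "abelian_group (hom_algebra \<phi> B)"
      by (rule abelian_groupI) (auto simp: hom_algebra_simps B.a_ac intro: B.l_neg)
    show "comm_monoid (hom_algebra \<phi> B)"
      by (rule comm_monoidI) (auto simp: hom_algebra_simps B.m_ac)
  qed (simp add: hom_algebra_simps B.l_distr)
  show ?thesis unfolding comm_algebra_def
    by (rule algebraI[OF assms(1) c]) (auto simp: hom_algebra_simps h B.l_distr B.r_distr B.m_assoc)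
qed

lemma ring_hom_hom_algebra: "ring_hom (hom_algebra \<phi> B) (hom_algebra \<psi> B') = ring_hom B B'"
  by (simp add: ring_hom_def hom_algebra_simps)

section \<open>Ringed spaces over the base and their affine pairs\<close>

lemma ringed_spaceD:
  assumes "is_ringed_space X"
  shows "openin (pts X) U \<Longrightarrow> cring (sec X U)"
    and "openin (pts X) U \<Longrightarrow> openin (pts X) V \<Longrightarrow> V \<subseteq> U \<Longrightarrow> res X U V \<in> ring_hom (sec X U) (sec X V)"
    and "openin (pts X) U \<Longrightarrow> s \<in> carrier (sec X U) \<Longrightarrow> res X U U s = s"
    and "openin (pts X) U \<Longrightarrow> openin (pts X) V \<Longrightarrow> openin (pts X) W \<Longrightarrow> V \<subseteq> U \<Longrightarrow> W \<subseteq> V \<Longrightarrow>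
      s \<in> carrier (sec X U) \<Longrightarrow> res X V W (res X U V s) = res X U W s"
  using assms unfolding is_ringed_space_def by simp_all

lemma ringed_mapD:
  assumes "ringed_map X Y f"
  shows "continuous_map (pts X) (pts Y) (base f)"
    and "openin (pts Y) W \<Longrightarrow> comor f W \<in> ring_hom (sec Y W) (sec X (preim X f W))"
    and "openin (pts Y) W \<Longrightarrow> openin (pts Y) W' \<Longrightarrow> W' \<subseteq> W \<Longrightarrow> s \<in> carrier (sec Y W) \<Longrightarrow>
      res X (preim X f W) (preim X f W') (comor f W s) = comor f W' (res Y W W' s)"
    and "openin (pts Y) W \<Longrightarrow> openin (pts X) (preim X f W)"
  using assms unfolding ringed_map_def preim_def by (blast intro: openin_continuous_map_preimage)+

lemma subset_preim: "openin (pts X) V \<Longrightarrow> base f ` V \<subseteq> W \<Longrightarrow> V \<subseteq> preim X f W"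
  using openin_subset by (fastforce simp: preim_def)

lemma preim_mono: "W' \<subseteq> W \<Longrightarrow> preim X f W' \<subseteq> preim X f W"
  by (auto simp: preim_def)

lemma ring_map_on_hom:
  assumes X: "is_ringed_space X" and f: "ringed_map X Y f"
    and V: "openin (pts X) V" and W: "openin (pts Y) W" and VW: "base f ` V \<subseteq> W"
  shows "ring_map_on X f V W \<in> ring_hom (sec Y W) (sec X V)"
  using ring_hom_trans[OF ringed_mapD(2)[OF f W] ringed_spaceD(2)[OF X ringed_mapD(4)[OF f W] V subset_preim[OF V VW]]]
  by (simp add: ring_map_on_def[abs_def] o_def)

lemma preim_comp_map:
  assumes "ringed_map U X g" shows "preim U (comp_map X g f) W = preim U g (preim X f W)"
  using continuous_map_image_subset_topspace[OF ringed_mapD(1)[OF assms]] by (auto simp: preim_def comp_map_def)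

lemma ringed_map_comp:
  assumes g: "ringed_map U X g" and f: "ringed_map X S f" shows "ringed_map U S (comp_map X g f)"
proof -
  note p = preim_comp_map[OF g, of f]
  have c: "continuous_map (pts U) (pts S) (base (comp_map X g f))"
    using continuous_map_compose[OF ringed_mapD(1)[OF g] ringed_mapD(1)[OF f]] by (simp add: comp_map_def o_def)
  have h: "comor (comp_map X g f) W \<in> ring_hom (sec S W) (sec U (preim U (comp_map X g f) W))"
    if W: "openin (pts S) W" for W
    using ring_hom_trans[OF ringed_mapD(2)[OF f W] ringed_mapD(2)[OF g ringed_mapD(4)[OF f W]]]
    unfolding p by (simp add: comp_map_def o_def)
  have r: "res U (preim U (comp_map X g f) W) (preim U (comp_map X g f) W') (comor (comp_map X g f) W s) =
      comor (comp_map X g f) W' (res S W W' s)"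
    if W: "openin (pts S) W" "openin (pts S) W'" "W' \<subseteq> W" and s: "s \<in> carrier (sec S W)" for W W' s
    unfolding p using ringed_mapD(3)[OF g ringed_mapD(4)[OF f W(1)] ringed_mapD(4)[OF f W(2)] preim_mono[OF W(3)]
        ring_hom_closed[OF ringed_mapD(2)[OF f W(1)] s]] ringed_mapD(3)[OF f W s]
    by (simp add: comp_map_def)
  show ?thesis unfolding ringed_map_def using c h r by blast
qed

lemma aff_pairsD:
  assumes "(V, W) \<in> aff_pairs S U f"
  shows "openin (pts U) V" "openin (pts S) W" "base f ` V \<subseteq> W"
  using assms by (auto simp: aff_pairs_def affine_open_def)

lemma pair_alg_carrier: "carrier (pair_alg U f V W) = carrier (sec U V)"
  by (simp add: pair_alg_def hom_algebra_simps)

locale over_base =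
  fixes S :: "('q, 's) ringed_space" and U :: "('p, 'r) ringed_space" and f :: "('p, 'q, 'r, 's) space_map"
  assumes base: "is_ringed_space S" and space: "is_ringed_space U" and map: "ringed_map U S f"
begin

lemma comm_algebra_pair:
  assumes "(V, W) \<in> aff_pairs S U f" shows "comm_algebra (sec S W) (pair_alg U f V W)"
  unfolding pair_alg_def using aff_pairsD[OF assms]
  by (intro comm_algebra_hom_algebra ringed_spaceD(1)[OF base] ringed_spaceD(1)[OF space] ring_map_on_hom[OF space map])

lemma res_closed:
  assumes "(V, W) \<in> aff_pairs S U f" "a \<in> carrier (sec U (topspace (pts U)))"
  shows "res U (topspace (pts U)) V a \<in> carrier (pair_alg U f V W)"
  unfolding pair_alg_carrier using aff_pairsD(1)[OF assms(1)]
  by (intro ring_hom_closed[OF ringed_spaceD(2)[OF space] assms(2)]) (auto simp: openin_subset)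

text \<open>The square commutes because both ways around equal the restriction to \<open>V'\<close>
  of the section \<open>comor f' W r\<close>. Compatibility of \<open>h\<close> with the maps to
  \<open>S\<close> is phrased on points of the space and on sections over open sets, which is where
  \<open>same_map\<close> controls it.\<close>

lemma algebra_map_pair:
  assumes U': "over_base S U' f'" and h: "ringed_map U' U h"
    and b: "\<And>x. x \<in> topspace (pts U') \<Longrightarrow> base f' x = base f (base h x)"
    and c: "\<And>W s. openin (pts S) W \<Longrightarrow> s \<in> carrier (sec S W) \<Longrightarrow> comor f' W s = comor h (preim U f W) (comor f W s)"
    and VW: "(V, W) \<in> aff_pairs S U f" and VW': "(V', W') \<in> aff_pairs S U' f'"
    and V: "base h ` V' \<subseteq> V" and W: "W' \<subseteq> W"
  shows "algebra_map (sec S W) (sec S W') (pair_alg U f V W) (pair_alg U' f' V' W') (res S W W') (ring_map_on U' h V' V)"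
proof -
  interpret U': over_base S U' f' by fact
  note o = aff_pairsD[OF VW] and o' = aff_pairsD[OF VW']
  interpret A: comm_algebra "sec S W" "pair_alg U f V W" by (rule comm_algebra_pair[OF VW])
  interpret A': comm_algebra "sec S W'" "pair_alg U' f' V' W'" by (rule U'.comm_algebra_pair[OF VW'])
  have a: "res S W W' \<in> ring_hom (sec S W) (sec S W')" by (rule ringed_spaceD(2)[OF base o(2) o'(2) W])
  have be: "ring_map_on U' h V' V \<in> ring_hom (sec U V) (sec U' V')" by (rule ring_map_on_hom[OF U'.space h o'(1) o(1) V])
  have pre: "preim U' f' W = preim U' h (preim U f W)"
    using b continuous_map_image_subset_topspace[OF ringed_mapD(1)[OF h]] by (auto simp: preim_def)
  have sq: "ring_map_on U' h V' V (ring_map_on U f V W r) = ring_map_on U' f' V' W' (res S W W' r)"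
    if r: "r \<in> carrier (sec S W)" for r
  proof -
    let ?P = "preim U f W"
    have P: "openin (pts U) ?P" by (rule ringed_mapD(4)[OF map o(2)])
    have VP: "V \<subseteq> ?P" by (rule subset_preim[OF o(1,3)])
    have fr: "comor f W r \<in> carrier (sec U ?P)" by (rule ring_hom_closed[OF ringed_mapD(2)[OF map o(2)] r])
    have hP: "openin (pts U') (preim U' h ?P)" "openin (pts U') (preim U' h V)"
      by (rule ringed_mapD(4)[OF h] P o(1))+
    have hfr: "comor h ?P (comor f W r) \<in> carrier (sec U' (preim U' h ?P))"
      by (rule ring_hom_closed[OF ringed_mapD(2)[OF h P] fr])
    have "ring_map_on U' h V' V (ring_map_on U f V W r) =
        res U' (preim U' h V) V' (res U' (preim U' h ?P) (preim U' h V) (comor h ?P (comor f W r)))"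
      unfolding ring_map_on_def ringed_mapD(3)[OF h P o(1) VP fr] ..
    also have "\<dots> = res U' (preim U' h ?P) V' (comor h ?P (comor f W r))"
      by (rule ringed_spaceD(4)[OF U'.space hP o'(1) preim_mono[OF VP] subset_preim[OF o'(1) V] hfr])
    also have "\<dots> = res U' (preim U' f' W) V' (comor f' W r)"
      unfolding pre c[OF o(2) r] ..
    also have "\<dots> = res U' (preim U' f' W') V' (res U' (preim U' f' W) (preim U' f' W') (comor f' W r))"
      by (rule ringed_spaceD(4)[OF U'.space ringed_mapD(4)[OF U'.map o(2)] ringed_mapD(4)[OF U'.map o'(2)] o'(1)
          preim_mono[OF W] subset_preim[OF o'(1,3)] ring_hom_closed[OF ringed_mapD(2)[OF U'.map o(2)] r], symmetric])
    also have "\<dots> = ring_map_on U' f' V' W' (res S W W' r)"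
      unfolding ring_map_on_def ringed_mapD(3)[OF U'.map o(2) o'(2) W r] ..
    finally show ?thesis .
  qed
  have one: "ring_map_on U' h V' V (r \<odot>\<^bsub>pair_alg U f V W\<^esub> \<one>\<^bsub>pair_alg U f V W\<^esub>) =
      res S W W' r \<odot>\<^bsub>pair_alg U' f' V' W'\<^esub> \<one>\<^bsub>pair_alg U' f' V' W'\<^esub>" if r: "r \<in> carrier (sec S W)" for r
  proof -
    interpret B: cring "sec U V" by (rule ringed_spaceD(1)[OF space o(1)])
    interpret B': cring "sec U' V'" by (rule ringed_spaceD(1)[OF U'.space o'(1)])
    have "ring_map_on U f V W r \<in> carrier (sec U V)"
      by (rule ring_hom_closed[OF ring_map_on_hom[OF space map o(1-3)] r])
    moreover have "ring_map_on U' f' V' W' (res S W W' r) \<in> carrier (sec U' V')"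
      by (rule ring_hom_closed[OF ring_map_on_hom[OF U'.space U'.map o'(1-3)] ring_hom_closed[OF a r]])
    ultimately show ?thesis using sq[OF r] by (simp add: pair_alg_def hom_algebra_simps)
  qed
  show ?thesis
  proof (intro algebra_map.intro algebra_map_axioms.intro A.comm_algebra_axioms A'.comm_algebra_axioms a one)
    show "ring_map_on U' h V' V \<in> ring_hom (pair_alg U f V W) (pair_alg U' f' V' W')"
      unfolding pair_alg_def ring_hom_hom_algebra by (rule be)
  qed
qed

lemma id_ringed_map: "ringed_map U U id_map"
proof -
  have p: "preim U id_map W = W" if "openin (pts U) W" for W
    using openin_subset[OF that] by (auto simp: preim_def id_map_def)
  show ?thesis unfolding ringed_map_def
    by (auto simp: p[unfolded id_map_def] id_map_def intro: ring_hom_memI)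
qed

lemma algebra_map_restrict:
  assumes VW: "(V, W) \<in> aff_pairs S U f" and VW': "(V', W') \<in> aff_pairs S U f"
    and V: "base (id_map :: ('p, 'p, 'r, 'r) space_map) ` V' \<subseteq> V" and W: "W' \<subseteq> W"
  shows "algebra_map (sec S W) (sec S W') (pair_alg U f V W) (pair_alg U f V' W') (res S W W') (ring_map_on U id_map V' V)"
proof (rule algebra_map_pair[OF over_base_axioms id_ringed_map _ _ VW VW' V W])
  show "base f x = base f (base id_map x)" for x by (simp add: id_map_def)
  show "comor f W s = comor id_map (preim U f W) (comor f W s)" for W s by (simp add: id_map_def)
qed

end

lemma forms_on_simps:
  "s \<in> carrier (forms_on M tr S U f) \<longleftrightarrow>
     s \<in> (\<Pi>\<^sub>E (V, W)\<in>aff_pairs S U f. carrier (M (sec S W) (pair_alg U f V W))) \<and> is_pullback tr S U f U f id_map s s"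
  "add (forms_on M tr S U f) s t = (\<lambda>(V, W)\<in>aff_pairs S U f. s (V, W) \<oplus>\<^bsub>M (sec S W) (pair_alg U f V W)\<^esub> t (V, W))"
  "a \<odot>\<^bsub>forms_on M tr S U f\<^esub> s = (\<lambda>(V, W)\<in>aff_pairs S U f.
     res U (topspace (pts U)) V a \<odot>\<^bsub>M (sec S W) (pair_alg U f V W)\<^esub> s (V, W))"
  by (simp_all add: forms_on_def)

lemma forms_on_value:
  assumes "s \<in> carrier (forms_on M tr S U f)" "(V, W) \<in> aff_pairs S U f"
  shows "s (V, W) \<in> carrier (M (sec S W) (pair_alg U f V W))"
  using assms PiE_mem[of s "aff_pairs S U f" _ "(V, W)"] by (fastforce simp: forms_on_simps)

lemma on_pairs_value: "(V, W) \<in> aff_pairs S U f \<Longrightarrow> on_pairs S U f op s (V, W) = op (sec S W) (pair_alg U f V W) (s (V, W))"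
  by (simp add: on_pairs_def)

lemma on_pairs_eqI:
  assumes "\<And>V W. (V, W) \<in> aff_pairs S U f \<Longrightarrow>
      op (sec S W) (pair_alg U f V W) (s (V, W)) = op' (sec S W) (pair_alg U f V W) (t (V, W))"
  shows "on_pairs S U f op s = on_pairs S U f op' t"
  unfolding on_pairs_def by (rule restrict_ext) (use assms in auto)

text \<open>An isomorphism between two constructions on algebras that commutes with their transition
  maps. The statements about sheaves are derived from it once and applied to weak and to strong
  forms.\<close>

locale natural_iso =
  fixes M :: "('s, 'c, 'm) construction" and tr :: "('s, 'c, 'm) transition"
    and M' :: "('s, 'c, 'k) construction" and tr' :: "('s, 'c, 'k) transition"
    and \<nu> :: "'s ring \<Rightarrow> ('s, 'c) module \<Rightarrow> 'm \<Rightarrow> 'k"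
  assumes iso: "\<And>R B. comm_algebra R B \<Longrightarrow> \<nu> R B \<in> module_iso B (M R B) (M' R B)"
    and closed: "\<And>R R' B B' \<alpha> \<beta> v. algebra_map R R' B B' \<alpha> \<beta> \<Longrightarrow> v \<in> carrier (M R B) \<Longrightarrow>
      tr R B R' B' \<alpha> \<beta> v \<in> carrier (M R' B')"
    and natural: "\<And>R R' B B' \<alpha> \<beta> v. algebra_map R R' B B' \<alpha> \<beta> \<Longrightarrow> v \<in> carrier (M R B) \<Longrightarrow>
      tr' R B R' B' \<alpha> \<beta> (\<nu> R B v) = \<nu> R' B' (tr R B R' B' \<alpha> \<beta> v)"
begin

lemma iso_closed: "comm_algebra R B \<Longrightarrow> v \<in> carrier (M R B) \<Longrightarrow> \<nu> R B v \<in> carrier (M' R B)"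
  using iso[of R B] by (auto simp: module_iso_def bij_betw_def)

lemma iso_inj: "comm_algebra R B \<Longrightarrow> inj_on (\<nu> R B) (carrier (M R B))"
  using iso[of R B] by (auto simp: module_iso_def bij_betw_def)

lemma iso_surj:
  assumes "comm_algebra R B" and v: "v \<in> carrier (M' R B)"
  shows "\<exists>u. u \<in> carrier (M R B) \<and> \<nu> R B u = v"
proof -
  have "\<nu> R B ` carrier (M R B) = carrier (M' R B)"
    using iso[OF assms(1)] by (auto simp: module_iso_def bij_betw_def)
  thus ?thesis using v by (metis imageE)
qed

text \<open>An equivalence and not just an implication: the maps on affine pieces are injective, so
  compatibility of the image family reflects back to the original one. Surjectivity on compatible
  families rests on this direction.\<close>

lemma on_pairs_pullback:
  assumes U: "over_base S U f" and U': "over_base S U' f'"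
    and am: "\<And>V W V' W'. (V, W) \<in> aff_pairs S U f \<Longrightarrow> (V', W') \<in> aff_pairs S U' f' \<Longrightarrow> base h ` V' \<subseteq> V \<Longrightarrow> W' \<subseteq> W \<Longrightarrow>
      algebra_map (sec S W) (sec S W') (pair_alg U f V W) (pair_alg U' f' V' W') (res S W W') (ring_map_on U' h V' V)"
    and s: "\<And>V W. (V, W) \<in> aff_pairs S U f \<Longrightarrow> s (V, W) \<in> carrier (M (sec S W) (pair_alg U f V W))"
    and s': "\<And>V W. (V, W) \<in> aff_pairs S U' f' \<Longrightarrow> s' (V, W) \<in> carrier (M (sec S W) (pair_alg U' f' V W))"
  shows "is_pullback tr' S U f U' f' h (on_pairs S U f \<nu> s) (on_pairs S U' f' \<nu> s') \<longleftrightarrow>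
    is_pullback tr S U f U' f' h s s'"
proof -
  interpret U: over_base S U f by fact
  interpret U': over_base S U' f' by fact
  have "on_pairs S U' f' \<nu> s' (V', W') = tr' (sec S W) (pair_alg U f V W) (sec S W') (pair_alg U' f' V' W')
          (res S W W') (ring_map_on U' h V' V) (on_pairs S U f \<nu> s (V, W)) \<longleftrightarrow>
      s' (V', W') = tr (sec S W) (pair_alg U f V W) (sec S W') (pair_alg U' f' V' W')
          (res S W W') (ring_map_on U' h V' V) (s (V, W))"
    if p: "(V, W) \<in> aff_pairs S U f" "(V', W') \<in> aff_pairs S U' f'" "base h ` V' \<subseteq> V" "W' \<subseteq> W" for V W V' W'
    unfolding on_pairs_value[OF p(1)] on_pairs_value[OF p(2)] natural[OF am[OF p] s[OF p(1)]]
    using inj_on_eq_iff[OF iso_inj[OF U'.comm_algebra_pair[OF p(2)]] s'[OF p(2)] closed[OF am[OF p] s[OF p(1)]]] .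
  thus ?thesis unfolding is_pullback_def by fast
qed

lemma on_pairs_iso:
  assumes U: "over_base S U f"
  shows "on_pairs S U f \<nu> \<in> module_iso (sec U (topspace (pts U))) (forms_on M tr S U f) (forms_on M' tr' S U f)"
proof -
  interpret U: over_base S U f by fact
  have pb: "is_pullback tr' S U f U f id_map (on_pairs S U f \<nu> s) (on_pairs S U f \<nu> s) \<longleftrightarrow>
      is_pullback tr S U f U f id_map s s"
    if "\<And>V W. (V, W) \<in> aff_pairs S U f \<Longrightarrow> s (V, W) \<in> carrier (M (sec S W) (pair_alg U f V W))" for s
    by (rule on_pairs_pullback[OF U U], rule U.algebra_map_restrict, assumption+, rule that, assumption, rule that, assumption)
  have cl: "on_pairs S U f \<nu> s \<in> carrier (forms_on M' tr' S U f)" if s: "s \<in> carrier (forms_on M tr S U f)" for s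
  proof -
    have "on_pairs S U f \<nu> s \<in> (\<Pi>\<^sub>E (V, W)\<in>aff_pairs S U f. carrier (M' (sec S W) (pair_alg U f V W)))"
      unfolding on_pairs_def using iso_closed[OF U.comm_algebra_pair forms_on_value[OF s]] by auto
    moreover have "is_pullback tr' S U f U f id_map (on_pairs S U f \<nu> s) (on_pairs S U f \<nu> s)"
      by (subst pb) (use forms_on_value[OF s] s in \<open>simp_all add: forms_on_simps(1)\<close>)
    ultimately show ?thesis by (simp add: forms_on_simps)
  qed
  have inj: "inj_on (on_pairs S U f \<nu>) (carrier (forms_on M tr S U f))"
  proof (rule inj_onI)
    fix s t assume s: "s \<in> carrier (forms_on M tr S U f)" and t: "t \<in> carrier (forms_on M tr S U f)"
      and eq: "on_pairs S U f \<nu> s = on_pairs S U f \<nu> t"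
    have "s (V, W) = t (V, W)" if p: "(V, W) \<in> aff_pairs S U f" for V W
      using fun_cong[OF eq, of "(V, W)"] inj_onD[OF iso_inj[OF U.comm_algebra_pair[OF p]] _ forms_on_value[OF s p] forms_on_value[OF t p]]
      unfolding on_pairs_value[OF p] by blast
    moreover have "s \<in> extensional (aff_pairs S U f)" "t \<in> extensional (aff_pairs S U f)"
      using s t by (auto simp: forms_on_simps PiE_iff)
    ultimately show "s = t" by (auto intro!: extensionalityI[of s _ t])
  qed
  have surj: "\<exists>s\<in>carrier (forms_on M tr S U f). on_pairs S U f \<nu> s = t" if t: "t \<in> carrier (forms_on M' tr' S U f)" for t
  proof -
    \<comment> \<open>Preimages are chosen on each pair separately. That they fit together follows
      afterwards from \<open>pb\<close>.\<close>
    define u where "u = (\<lambda>(V, W). SOME u. u \<in> carrier (M (sec S W) (pair_alg U f V W)) \<and>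
        \<nu> (sec S W) (pair_alg U f V W) u = t (V, W))"
    have u: "u (V, W) \<in> carrier (M (sec S W) (pair_alg U f V W))"
        "\<nu> (sec S W) (pair_alg U f V W) (u (V, W)) = t (V, W)" if p: "(V, W) \<in> aff_pairs S U f" for V W
      using someI_ex[OF iso_surj[OF U.comm_algebra_pair[OF p] forms_on_value[OF t p]]] unfolding u_def by auto
    let ?s = "restrict u (aff_pairs S U f)"
    have sv: "?s (V, W) \<in> carrier (M (sec S W) (pair_alg U f V W))" if "(V, W) \<in> aff_pairs S U f" for V W
      using u(1)[OF that] that by simp
    have "on_pairs S U f \<nu> ?s = t"
    proof (rule extensionalityI)
      show "on_pairs S U f \<nu> ?s \<in> extensional (aff_pairs S U f)" by (simp add: on_pairs_def)
      show "t \<in> extensional (aff_pairs S U f)" using t by (auto simp: forms_on_simps PiE_iff)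
      show "on_pairs S U f \<nu> ?s p = t p" if "p \<in> aff_pairs S U f" for p
        using that u(2) by (cases p) (simp add: on_pairs_value)
    qed
    note e = this
    have "is_pullback tr S U f U f id_map ?s ?s \<longleftrightarrow> is_pullback tr' S U f U f id_map (on_pairs S U f \<nu> ?s) (on_pairs S U f \<nu> ?s)"
      by (rule pb[OF sv, symmetric]) assumption
    hence "is_pullback tr S U f U f id_map ?s ?s" using t unfolding e forms_on_simps(1) by (simp only: )
    moreover have "?s \<in> (\<Pi>\<^sub>E (V, W)\<in>aff_pairs S U f. carrier (M (sec S W) (pair_alg U f V W)))"
      using u(1) by auto
    ultimately have "?s \<in> carrier (forms_on M tr S U f)" unfolding forms_on_simps(1) by (rule conjI[rotated])
    thus ?thesis by (rule bexI[where P = "\<lambda>s. on_pairs S U f \<nu> s = t", OF e])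
  qed
  have add: "on_pairs S U f \<nu> (s \<oplus>\<^bsub>forms_on M tr S U f\<^esub> t) =
      on_pairs S U f \<nu> s \<oplus>\<^bsub>forms_on M' tr' S U f\<^esub> on_pairs S U f \<nu> t"
    if s: "s \<in> carrier (forms_on M tr S U f)" and t: "t \<in> carrier (forms_on M tr S U f)" for s t
    unfolding forms_on_simps on_pairs_def
    using iso[OF U.comm_algebra_pair] forms_on_value[OF s] forms_on_value[OF t]
    by (intro restrict_ext) (auto simp: module_iso_def)
  have smult: "on_pairs S U f \<nu> (a \<odot>\<^bsub>forms_on M tr S U f\<^esub> s) = a \<odot>\<^bsub>forms_on M' tr' S U f\<^esub> on_pairs S U f \<nu> s"
    if a: "a \<in> carrier (sec U (topspace (pts U)))" and s: "s \<in> carrier (forms_on M tr S U f)" for a s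
    unfolding forms_on_simps on_pairs_def
    using iso[OF U.comm_algebra_pair] forms_on_value[OF s] U.res_closed[OF _ a]
    by (intro restrict_ext) (auto simp: module_iso_def)
  show ?thesis unfolding module_iso_def bij_betw_def
    using cl inj surj add smult by auto
qed

lemma sheaf_iso:
  assumes S: "is_ringed_space S" and f: "ringed_map X S f"
  shows "sheaf_iso S X f M tr M' tr' (\<lambda>p. on_pairs S (fst p) (comp_map X (snd p) f) \<nu>)"
proof -
  have et: "over_base S U (comp_map X g f)" "ringed_map U X g" if "etale U X g" for U :: "('u, 'c) ringed_space" and g
    using that ringed_map_comp[OF _ f] S
    by (auto simp: etale_def scheme_map_def scheme_def over_base_def)
  show ?thesis unfolding sheaf_iso_def fst_conv snd_conv
  proof (intro conjI allI impI ballI)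
    fix U :: "('u, 'c) ringed_space" and g assume "etale U X g"
    thus "on_pairs S U (comp_map X g f) \<nu> \<in> module_iso (sec U (topspace (pts U)))
        (forms_on M tr S U (comp_map X g f)) (forms_on M' tr' S U (comp_map X g f))"
      by (intro on_pairs_iso et)
  next
    fix U U' :: "('u, 'c) ringed_space" and g g' h s s'
    assume e: "etale U X g \<and> etale U' X g' \<and> scheme_map U' U h \<and> same_map U' X (comp_map U h g) g'"
      and s: "s \<in> carrier (forms_on M tr S U (comp_map X g f))"
      and s': "s' \<in> carrier (forms_on M tr S U' (comp_map X g' f))"
      and pb: "is_pullback tr S U (comp_map X g f) U' (comp_map X g' f) h s s'"
    interpret U: over_base S U "comp_map X g f" using e et by blast
    interpret U': over_base S U' "comp_map X g' f" using e et by blast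
    have h: "ringed_map U' U h" using e by (simp add: scheme_map_def)
    have g: "ringed_map U X g" using e et by blast
    \<comment> \<open>Both structure maps to \<open>S\<close> factor through \<open>X\<close>, where
      the triangle of the site commutes.\<close>
    have b: "base (comp_map X g' f) x = base (comp_map X g f) (base h x)" if "x \<in> topspace (pts U')" for x
      using e that by (auto simp: same_map_def comp_map_def)
    have c: "comor (comp_map X g' f) W r = comor h (preim U (comp_map X g f) W) (comor (comp_map X g f) W r)"
      if W: "openin (pts S) W" and r: "r \<in> carrier (sec S W)" for W r
    proof -
      have "comor (comp_map U h g) (preim X f W) (comor f W r) = comor g' (preim X f W) (comor f W r)"
        using e ringed_mapD(4)[OF f W] ring_hom_closed[OF ringed_mapD(2)[OF f W] r] by (auto simp: same_map_def)
      thus ?thesis unfolding preim_comp_map[OF g] by (simp add: comp_map_def)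
    qed
    show "is_pullback tr' S U (comp_map X g f) U' (comp_map X g' f) h
        (on_pairs S U (comp_map X g f) \<nu> s) (on_pairs S U' (comp_map X g' f) \<nu> s')"
      using on_pairs_pullback[OF U.over_base_axioms U'.over_base_axioms
          U.algebra_map_pair[OF U'.over_base_axioms h b c] forms_on_value[OF s] forms_on_value[OF s']] pb by blast
  qed
qed

end

text \<open>For given \<open>R\<close>, \<open>B\<close> and \<open>n\<close> the map is determined
  by the ideal alone; the relations between forms enter only through the fact that it descends to
  their quotient.\<close>

definition nu_weak where "nu_weak n R B = form_iso.nu R B n (J_weak n R B)"
definition nu_strong where "nu_strong n R B = form_iso.nu R B n (J_strong n R B)"

lemma natural_iso_weak:
  assumes n: "1 \<le> n"
  shows "natural_iso (omega_weak n) (omega_weak_map n) (psi_weak n) (psi_weak_map n) (nu_weak n)"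
proof
  fix R :: "'a ring" and B :: "('a, 'b) module" assume "comm_algebra R B"
  then interpret A: comm_algebra R B .
  show "nu_weak n R B \<in> module_iso B (omega_weak n R B) (psi_weak n R B)"
    unfolding nu_weak_def omega_weak_def psi_eq
    by (rule form_iso.nu_iso[OF power_algebra.weak_form_iso[OF A.power_algebra n]])
next
  fix R R' :: "'a ring" and B B' :: "('a, 'b) module" and \<alpha> \<beta> v
  assume "algebra_map R R' B B' \<alpha> \<beta>" and v: "v \<in> carrier (omega_weak n R B)"
  then interpret A: algebra_map R R' B B' \<alpha> \<beta> by simp
  note * = A.form_iso_natural[OF power_algebra.weak_form_iso[OF A.A_power n] power_algebra.weak_form_iso[OF A.A'_power n]
      A.tm_rels(1) A.fm_ideals(1) v[unfolded omega_weak_def]]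
  show "omega_weak_map n R B R' B' \<alpha> \<beta> v \<in> carrier (omega_weak n R' B')"
    unfolding omega_weak_map_def omega_weak_def by (rule *(1))
  show "psi_weak_map n R B R' B' \<alpha> \<beta> (nu_weak n R B v) = nu_weak n R' B' (omega_weak_map n R B R' B' \<alpha> \<beta> v)"
    unfolding psi_weak_map_def omega_weak_map_def nu_weak_def by (rule *(2))
qed

lemma natural_iso_strong:
  assumes n: "1 \<le> n"
  shows "natural_iso (omega_strong n) (omega_strong_map n) (psi_strong n) (psi_strong_map n) (nu_strong n)"
proof
  fix R :: "'a ring" and B :: "('a, 'b) module" assume "comm_algebra R B"
  then interpret A: comm_algebra R B .
  show "nu_strong n R B \<in> module_iso B (omega_strong n R B) (psi_strong n R B)"
    unfolding nu_strong_def omega_strong_def psi_eq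
    by (rule form_iso.nu_iso[OF power_algebra.strong_form_iso[OF A.power_algebra n]])
next
  fix R R' :: "'a ring" and B B' :: "('a, 'b) module" and \<alpha> \<beta> v
  assume "algebra_map R R' B B' \<alpha> \<beta>" and v: "v \<in> carrier (omega_strong n R B)"
  then interpret A: algebra_map R R' B B' \<alpha> \<beta> by simp
  note * = A.form_iso_natural[OF power_algebra.strong_form_iso[OF A.A_power n] power_algebra.strong_form_iso[OF A.A'_power n]
      A.tm_rels(2) A.fm_ideals(2) v[unfolded omega_strong_def]]
  show "omega_strong_map n R B R' B' \<alpha> \<beta> v \<in> carrier (omega_strong n R' B')"
    unfolding omega_strong_map_def omega_strong_def by (rule *(1))
  show "psi_strong_map n R B R' B' \<alpha> \<beta> (nu_strong n R B v) = nu_strong n R' B' (omega_strong_map n R B R' B' \<alpha> \<beta> v)"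
    unfolding psi_strong_map_def omega_strong_map_def nu_strong_def by (rule *(2))
qed

lemma (in comm_algebra) nu_wedge:
  assumes n: "1 \<le> n" and b: "\<And>i. i \<in> {1..n} \<Longrightarrow> b i \<in> carrier B"
  shows "nu_weak n R B (d_wedge_weak n R B b) = diff_prod_weak n R B b"
    and "nu_strong n R B (d_wedge_strong n R B b) = diff_prod_strong n R B b"
  unfolding nu_weak_def nu_strong_def d_wedge_weak_def d_wedge_strong_def wedge_weak_def wedge_strong_def
    diff_prod_weak_def diff_prod_strong_def
  by (rule form_iso.nu_diff_prod[OF power_algebra.weak_form_iso[OF power_algebra n] b]
      form_iso.nu_diff_prod[OF power_algebra.strong_form_iso[OF power_algebra n] b]; assumption)+

lemma (in comm_algebra) nu_proj:
  assumes n: "1 \<le> n" and v: "v \<in> carrier (omega_weak n R B)"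
  shows "nu_strong n R B (omega_proj n R B v) = psi_proj n R B (nu_weak n R B v)"
  unfolding nu_weak_def nu_strong_def omega_proj_def psi_proj_def
  by (rule power_algebra.form_iso_proj[OF power_algebra power_algebra.weak_form_iso[OF power_algebra n]
        power_algebra.strong_form_iso[OF power_algebra n] power_algebra.weak_le_strong[OF power_algebra]
        power_algebra.Jw_le_Js[OF power_algebra] v[unfolded omega_weak_def], symmetric])

lemma (in comm_algebra) nu_star:
  assumes "1 \<le> m" "1 \<le> n" "\<omega> \<in> carrier (omega_strong m R B)" "\<eta> \<in> carrier (omega_strong n R B)"
  shows "nu_strong (m + n) R B (ext_prod R B m n \<omega> \<eta>) =
    star_prod R B m n (nu_strong m R B \<omega>) (nu_strong n R B \<eta>)"
proof -
  interpret comb_product R B m n using assms(1,2) by unfold_locales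
  show ?thesis unfolding nu_strong_def by (rule nu_ext_prod[OF assms(3,4)])
qed

text \<open>The sheaf maps apply the isomorphisms of algebra on every affine pair. That the strong
  one is induced by the weak one is expressed by commutation with the projections
  \<open>omega_proj\<close> and \<open>psi_proj\<close>.\<close>

theorem theorem1p16:
  fixes S :: "('q, 's) ringed_space" and X :: "('x, 'b) ringed_space"
    and f :: "('x, 'q, 'b, 's) space_map"
  assumes "scheme S" and "scheme X" and "scheme_map X S f" and "separated X S f"
  shows "\<exists>\<nu>w \<nu> :: nat \<Rightarrow> ('u, 'x, 'c, 'b) site_obj \<Rightarrow>
            ('u set \<times> 'q set \<Rightarrow> 'c form_elt) \<Rightarrow> 'u set \<times> 'q set \<Rightarrow> ('s, 'c) comb_elt.
    (\<forall>n\<ge>1.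
       sheaf_iso S X f (omega_weak n) (omega_weak_map n) (psi_weak n) (psi_weak_map n) (\<nu>w n) \<and>
       sheaf_iso S X f (omega_strong n) (omega_strong_map n) (psi_strong n) (psi_strong_map n) (\<nu> n) \<and>
       (\<forall>U g. etale U X g \<longrightarrow>
          (\<forall>b. (\<forall>i\<in>{1..n}. b i \<in> carrier (sec U (topspace (pts U)))) \<longrightarrow>
             (let f' = comp_map X g f; b' = local_funs S U f' b in
                \<nu>w n (U, g) (on_pairs S U f' (d_wedge_weak n) b') = on_pairs S U f' (diff_prod_weak n) b' \<and>
                \<nu> n (U, g) (on_pairs S U f' (d_wedge_strong n) b') = on_pairs S U f' (diff_prod_strong n) b')) \<and>
          (\<forall>s\<in>carrier (forms_on (omega_weak n) (omega_weak_map n) S U (comp_map X g f)).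
             \<nu> n (U, g) (on_pairs S U (comp_map X g f) (omega_proj n) s) =
             on_pairs S U (comp_map X g f) (psi_proj n) (\<nu>w n (U, g) s)))) \<and>
    (\<forall>m\<ge>1. \<forall>n\<ge>1. \<forall>U g. etale U X g \<longrightarrow>
       (\<forall>s\<in>carrier (forms_on (omega_strong m) (omega_strong_map m) S U (comp_map X g f)).
        \<forall>t\<in>carrier (forms_on (omega_strong n) (omega_strong_map n) S U (comp_map X g f)).
          \<nu> (m + n) (U, g) (on_pairs2 S U (comp_map X g f) (\<lambda>R B. ext_prod R B m n) s t) =
          on_pairs2 S U (comp_map X g f) (\<lambda>R B. star_prod R B m n) (\<nu> m (U, g) s) (\<nu> n (U, g) t)))"
proof -
  have S: "is_ringed_space S" and f: "ringed_map X S f" using assms by (auto simp: scheme_def scheme_map_def)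
  have et: "over_base S U (comp_map X g f)" if "etale U X g" for U :: "('u, 'c) ringed_space" and g
    using that ringed_map_comp[OF _ f] S by (auto simp: etale_def scheme_map_def scheme_def over_base_def)
  define w ::
      "nat \<Rightarrow> ('u, 'x, 'c, 'b) site_obj \<Rightarrow> ('u set \<times> 'q set \<Rightarrow> 'c form_elt) \<Rightarrow> 'u set \<times> 'q set \<Rightarrow> ('s, 'c) comb_elt"
    where "w = (\<lambda>n p. on_pairs S (fst p) (comp_map X (snd p) f) (nu_weak n))"
  define \<nu> ::
      "nat \<Rightarrow> ('u, 'x, 'c, 'b) site_obj \<Rightarrow> ('u set \<times> 'q set \<Rightarrow> 'c form_elt) \<Rightarrow> 'u set \<times> 'q set \<Rightarrow> ('s, 'c) comb_elt"
    where "\<nu> = (\<lambda>n p. on_pairs S (fst p) (comp_map X (snd p) f) (nu_strong n))"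
  show ?thesis
  proof (rule exI[of _ w], rule exI[of _ \<nu>], intro conjI allI impI ballI)
    fix n :: nat assume n: "1 \<le> n"
    show "sheaf_iso S X f (omega_weak n) (omega_weak_map n) (psi_weak n) (psi_weak_map n) (w n)" unfolding w_def
      by (rule natural_iso.sheaf_iso[OF natural_iso_weak[OF n] S f])
    show "sheaf_iso S X f (omega_strong n) (omega_strong_map n) (psi_strong n) (psi_strong_map n) (\<nu> n)" unfolding \<nu>_def
      by (rule natural_iso.sheaf_iso[OF natural_iso_strong[OF n] S f])
    fix U :: "('u, 'c) ringed_space" and g assume e: "etale U X g"
    let ?f = "comp_map X g f"
    interpret over_base S U ?f by (rule et[OF e])
    {
      fix b assume b: "\<forall>i\<in>{1..n}. b i \<in> carrier (sec U (topspace (pts U)))"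
      let ?b = "local_funs S U ?f b"
      have bc: "?b (V, W) i \<in> carrier (pair_alg U ?f V W)" if "(V, W) \<in> aff_pairs S U ?f" "i \<in> {1..n}" for V W i
        using res_closed[OF that(1)] b that by (simp add: local_funs_def)
      have "w n (U, g) (on_pairs S U ?f (d_wedge_weak n) ?b) = on_pairs S U ?f (diff_prod_weak n) ?b"
        unfolding w_def \<nu>_def fst_conv snd_conv
        by (rule on_pairs_eqI, simp only: on_pairs_value, rule comm_algebra.nu_wedge(1)[OF comm_algebra_pair n],
          assumption, rule bc)
      moreover have "\<nu> n (U, g) (on_pairs S U ?f (d_wedge_strong n) ?b) = on_pairs S U ?f (diff_prod_strong n) ?b"
        unfolding w_def \<nu>_def fst_conv snd_conv
        by (rule on_pairs_eqI, simp only: on_pairs_value, rule comm_algebra.nu_wedge(2)[OF comm_algebra_pair n],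
          assumption, rule bc)
      ultimately show "let f' = ?f; b' = local_funs S U f' b in
          w n (U, g) (on_pairs S U f' (d_wedge_weak n) b') = on_pairs S U f' (diff_prod_weak n) b' \<and>
          \<nu> n (U, g) (on_pairs S U f' (d_wedge_strong n) b') = on_pairs S U f' (diff_prod_strong n) b'"
        by (simp add: Let_def)
    }
    fix s assume s: "s \<in> carrier (forms_on (omega_weak n) (omega_weak_map n) S U ?f)"
    show "\<nu> n (U, g) (on_pairs S U ?f (omega_proj n) s) = on_pairs S U ?f (psi_proj n) (w n (U, g) s)"
      unfolding w_def \<nu>_def fst_conv snd_conv
      by (rule on_pairs_eqI)
        (simp add: on_pairs_value comm_algebra.nu_proj[OF comm_algebra_pair n forms_on_value[OF s]])
  next
    fix m n :: nat and U :: "('u, 'c) ringed_space" and g s t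
    assume mn: "1 \<le> m" "1 \<le> n" and e: "etale U X g"
    let ?f = "comp_map X g f"
    assume s: "s \<in> carrier (forms_on (omega_strong m) (omega_strong_map m) S U ?f)"
      and t: "t \<in> carrier (forms_on (omega_strong n) (omega_strong_map n) S U ?f)"
    interpret over_base S U ?f by (rule et[OF e])
    show "\<nu> (m + n) (U, g) (on_pairs2 S U ?f (\<lambda>R B. ext_prod R B m n) s t) =
        on_pairs2 S U ?f (\<lambda>R B. star_prod R B m n) (\<nu> m (U, g) s) (\<nu> n (U, g) t)"
      unfolding w_def \<nu>_def fst_conv snd_conv on_pairs2_def on_pairs_def
      by (rule restrict_ext)
        (auto simp: comm_algebra.nu_star[OF comm_algebra_pair mn forms_on_value[OF s] forms_on_value[OF t]])
  qed
qed

end
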